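(* (i) There is a universal constant $C_1<\infty$ such that, for every $\kappa>1$, $d\ge1$, $U\in\mathcal U_\kappa^d$, writing $Q=Q_{h,\gamma}^U$ for the OBABO kernel with $h=\frac1{4\sqrt\kappa}$ and $\gamma=4\sqrt\kappa$, the kernel $Q$ has a unique invariant law $\pi$ and, for every initial state $z\in\mathbb R^d\times\mathbb R^d$ and every $\varepsilon\in(0,1)$, $$t_{\mathrm{mix}}(z,\varepsilon;Q,\pi)\le C_1\kappa\log\!\left(\frac{C_1\kappa\,(1+W_2(\delta_z,\pi))}{\varepsilon}\right).$$ (ii) Let $(K,L,d)\mapsto(h_{K,L,d},\gamma_{K,L,d})$ be any numerically stable fixed-parameter OBABO tuning rule, and write $h_\kappa=h_{1,\kappa,2}$, $\gamma_\kappa=\gamma_{1,\kappa,2}$. Let $C,c>0$ and $a,b\ge0$ be constants, let $\tau:(1,\infty)\to(0,\infty)$ satisfy $\tau(\kappa)=o(\kappa)$ as $\kappa\to\infty$, and let $\kappa_0>1$. Then there exist $\kappa\ge\kappa_0$ and $U\in\mathcal U_\kappa^2$ such that $Q_{h_\kappa,\gamma_\kappa}^U$ has a unique invariant law $\pi$, and there are $z\in\mathbb R^4$ and $n\in\mathbb N$ for which $$\bigl\|\delta_z(Q_{h_\kappa,\gamma_\kappa}^U)^n-\pi\bigr\|_{\mathrm{TV}}>C\kappa^a\bigl(1+W_2(\delta_z,\pi)\bigr)^b\exp\!\left(-\frac{cn}{\tau(\kappa)}\right).$$ In particular, the assertion that the reverse inequality ($\le$) holds for all $\kappa\ge\kappa_0$,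 all $U\in\mathcal U_\kappa^2$ for which $Q^U_{h_\kappa,\gamma_\kappa}$ has a unique invariant law $\pi$, all $z\in\mathbb R^4$ and all $n\in\mathbb N$ fails with $\tau(\kappa)=\kappa^\alpha$ for any $\alpha<1$.
   Context: OBABO chain. For a differentiable $U:\mathbb R^d\to\mathbb R$ and $h,\gamma>0$, put $r=e^{-\gamma h/2}$, $\beta=r^2=e^{-\gamma h}$, $\sigma=(1-\beta)^{1/2}$. One OBABO step maps $(x,v)\in\mathbb R^d\times\mathbb R^d$ to $(x^+,v^+)$ by $v^{(a)}=rv+\sigma\xi^{(1)}$, $v^{(b)}=v^{(a)}-\frac h2\nabla U(x)$, $x^+=x+hv^{(b)}$, $v^{(c)}=v^{(b)}-\frac h2\nabla U(x^+)$, $v^+=rv^{(c)}+\sigma\xi^{(2)}$, where $\xi^{(1)},\xi^{(2)}$ are independent $\mathcal N(0,\mathrm{Id}_d)$. Iterating with i.i.d. copies of $(\xi^{(1)},\xi^{(2)})$ defines a Markov chain with transition kernel $Q_{h,\gamma}^U$. $\mathcal U_\kappa^d=\{U\in C^\infty(\mathbb R^d): \mathrm{Id}_d\preceq\nabla^2U(x)\preceq\kappa\,\mathrm{Id}_d\text{ for every }x\}$. A fixed-parameter tuning rule assigns to each triple $(K,L,d)$ with $0<K<L$ and integer $d\ge1$ a pair $(h_{K,L,d},\gamma_{K,L,d})\in(0,\infty)^2$. It is numerically stable (for OBABO) if $0<h_{K,L,d}<2/\sqrt L$ for every $0<K<L$ and $d\ge1$. $\mathbb N=\{0,1,2,\dots\}$.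 $\|\nu-\widetilde\nu\|_{\mathrm{TV}}=\sup_A|\nu(A)-\widetilde\nu(A)|$; $W_2$ is the Euclidean $2$-Wasserstein distance; $\delta_z$ is the Dirac mass at $z$. $t_{\mathrm{mix}}(z,\varepsilon;Q,\pi)=\inf\{n\ge0:\|\delta_zQ^n-\pi\|_{\mathrm{TV}}\le\varepsilon\}$, with $\inf\varnothing=\infty$. *)

theory Defs
  imports "HOL-Probability.Probability"
begin

text \<open>
  The dimension d is quantified inside the statement (the constant in its first part does not
  depend on d), so it cannot be a type. A point of R^d is a function on the indices
  0, ..., d - 1, extended by \<^const>\<open>undefined\<close>, i.e. an element of the space of
  the product measurable space over \<open>{..<d}\<close>. A function on R^d is represented by a
  total function on \<^typ>\<open>nat \<Rightarrow> real\<close>, of which only the values on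
  \<open>vecs d\<close> matter.
\<close>

type_synonym point = "nat \<Rightarrow> real"
type_synonym phase = "point \<times> point"

definition vecs :: "nat \<Rightarrow> point set" where
  "vecs d = {..<d} \<rightarrow>\<^sub>E UNIV"

definition partial :: "nat \<Rightarrow> (point \<Rightarrow> real) \<Rightarrow> point \<Rightarrow> real" where
  "partial i f x = deriv (\<lambda>t. f (x(i := t))) (x i)"

text \<open>Continuity refers to the product topology on functions, which on \<open>vecs d\<close>
  is the usual topology of R^d.\<close>

primrec C_k :: "nat \<Rightarrow> nat \<Rightarrow> (point \<Rightarrow> real) \<Rightarrow> bool" where
  "C_k d 0 f = continuous_on (vecs d) f"
| "C_k d (Suc k) f =
    (continuous_on (vecs d) f \<and>
     (\<forall>i<d. (\<forall>x\<in>vecs d. (\<lambda>t. f (x(i := t))) differentiable at (x i)) \<and> C_k d k (partial i f)))"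

definition smooth :: "nat \<Rightarrow> (point \<Rightarrow> real) \<Rightarrow> bool" where
  "smooth d f \<longleftrightarrow> (\<forall>k. C_k d k f)"

definition grad :: "nat \<Rightarrow> (point \<Rightarrow> real) \<Rightarrow> point \<Rightarrow> point" where
  "grad d U x = (\<lambda>i\<in>{..<d}. partial i U x)"

definition hessian :: "(point \<Rightarrow> real) \<Rightarrow> point \<Rightarrow> nat \<Rightarrow> nat \<Rightarrow> real" where
  "hessian U x i j = partial i (partial j U) x"

definition scalar_mat :: "real \<Rightarrow> nat \<Rightarrow> nat \<Rightarrow> real" where
  "scalar_mat c i j = (if i = j then c else 0)"

definition loewner_le :: "nat \<Rightarrow> (nat \<Rightarrow> nat \<Rightarrow> real) \<Rightarrow> (nat \<Rightarrow> nat \<Rightarrow> real) \<Rightarrow> bool" where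
  "loewner_le d A B \<longleftrightarrow> (\<forall>w. 0 \<le> (\<Sum>i<d. \<Sum>j<d. w i * (B i j - A i j) * w j))"

definition potentials :: "nat \<Rightarrow> real \<Rightarrow> (point \<Rightarrow> real) set" where
  "potentials d \<kappa> = {U. smooth d U \<and>
     (\<forall>x\<in>vecs d. loewner_le d (scalar_mat 1) (hessian U x) \<and>
                  loewner_le d (hessian U x) (scalar_mat \<kappa>))}"

definition phase_space :: "nat \<Rightarrow> phase measure" where
  "phase_space d = PiM {..<d} (\<lambda>_. borel) \<Otimes>\<^sub>M PiM {..<d} (\<lambda>_. borel)"

definition std_gauss :: "nat \<Rightarrow> point measure" where
  "std_gauss d = PiM {..<d} (\<lambda>_. std_normal_distribution)"

definition obabo_step ::
  "nat \<Rightarrow> (point \<Rightarrow> real) \<Rightarrow> real \<Rightarrow> real \<Rightarrow> point \<Rightarrow> point \<Rightarrow> phase \<Rightarrow> phase" where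
  "obabo_step d U h \<gamma> \<xi>1 \<xi>2 = (\<lambda>(x, v).
     let r = exp (- \<gamma> * h / 2);
         \<beta> = r\<^sup>2;
         \<sigma> = sqrt (1 - \<beta>);
         va = (\<lambda>i\<in>{..<d}. r * v i + \<sigma> * \<xi>1 i);
         vb = (\<lambda>i\<in>{..<d}. va i - h / 2 * grad d U x i);
         x' = (\<lambda>i\<in>{..<d}. x i + h * vb i);
         vc = (\<lambda>i\<in>{..<d}. vb i - h / 2 * grad d U x' i);
         v' = (\<lambda>i\<in>{..<d}. r * vc i + \<sigma> * \<xi>2 i)
     in (x', v'))"

definition obabo ::
  "nat \<Rightarrow> (point \<Rightarrow> real) \<Rightarrow> real \<Rightarrow> real \<Rightarrow> phase \<Rightarrow> phase measure" where
  "obabo d U h \<gamma> z =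
     distr (std_gauss d \<Otimes>\<^sub>M std_gauss d) (phase_space d)
       (\<lambda>(\<xi>1, \<xi>2). obabo_step d U h \<gamma> \<xi>1 \<xi>2 z)"

primrec kernel_pow :: "nat \<Rightarrow> (phase \<Rightarrow> phase measure) \<Rightarrow> nat \<Rightarrow> phase \<Rightarrow> phase measure" where
  "kernel_pow d Q 0 z = return (phase_space d) z"
| "kernel_pow d Q (Suc n) z = kernel_pow d Q n z \<bind> Q"

definition invariant_law :: "nat \<Rightarrow> (phase \<Rightarrow> phase measure) \<Rightarrow> phase measure \<Rightarrow> bool" where
  "invariant_law d Q \<pi> \<longleftrightarrow>
     prob_space \<pi> \<and> sets \<pi> = sets (phase_space d) \<and> \<pi> \<bind> Q = \<pi>"

definition unique_invariant_law :: "nat \<Rightarrow> (phase \<Rightarrow> phase measure) \<Rightarrow> phase measure \<Rightarrow> bool" where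
  "unique_invariant_law d Q \<pi> \<longleftrightarrow>
     invariant_law d Q \<pi> \<and> (\<forall>\<pi>'. invariant_law d Q \<pi>' \<longrightarrow> \<pi>' = \<pi>)"

definition tv_dist :: "nat \<Rightarrow> phase measure \<Rightarrow> phase measure \<Rightarrow> real" where
  "tv_dist d \<mu> \<nu> = (SUP A\<in>sets (phase_space d). \<bar>measure \<mu> A - measure \<nu> A\<bar>)"

definition couplings :: "nat \<Rightarrow> phase measure \<Rightarrow> phase measure \<Rightarrow> (phase \<times> phase) measure set" where
  "couplings d \<mu> \<nu> =
     {\<Gamma>. prob_space \<Gamma> \<and> sets \<Gamma> = sets (phase_space d \<Otimes>\<^sub>M phase_space d) \<and>
          distr \<Gamma> (phase_space d) fst = \<mu> \<and> distr \<Gamma> (phase_space d) snd = \<nu>}"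

definition sq_dist :: "nat \<Rightarrow> phase \<Rightarrow> phase \<Rightarrow> real" where
  "sq_dist d z w = (\<Sum>i<d. (fst z i - fst w i)\<^sup>2) + (\<Sum>i<d. (snd z i - snd w i)\<^sup>2)"

definition W2 :: "nat \<Rightarrow> phase measure \<Rightarrow> phase measure \<Rightarrow> ennreal" where
  "W2 d \<mu> \<nu> =
     (let cost = (INF \<Gamma>\<in>couplings d \<mu> \<nu>. \<integral>\<^sup>+p. ennreal (sq_dist d (fst p) (snd p)) \<partial>\<Gamma>)
      in if cost = \<infinity> then \<infinity> else ennreal (sqrt (enn2real cost)))"

abbreviation dirac :: "nat \<Rightarrow> phase \<Rightarrow> phase measure" where
  "dirac d z \<equiv> return (phase_space d) z"

definition t_mix ::
  "nat \<Rightarrow> phase \<Rightarrow> real \<Rightarrow> (phase \<Rightarrow> phase measure) \<Rightarrow> phase measure \<Rightarrow> enat" where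
  "t_mix d z \<epsilon> Q \<pi> = Inf {enat n |n. tv_dist d (kernel_pow d Q n z) \<pi> \<le> \<epsilon>}"

text \<open>A rule maps K, L, d to the pair (h, gamma); its values outside
  \<open>0 < K < L\<close>, \<open>d \<ge> 1\<close> are irrelevant.\<close>

type_synonym tuning = "real \<Rightarrow> real \<Rightarrow> nat \<Rightarrow> real \<times> real"

definition tuning_rule :: "tuning \<Rightarrow> bool" where
  "tuning_rule \<rho> \<longleftrightarrow>
     (\<forall>K L d. 0 < K \<and> K < L \<and> 1 \<le> d \<longrightarrow> 0 < fst (\<rho> K L d) \<and> 0 < snd (\<rho> K L d))"

definition numerically_stable :: "tuning \<Rightarrow> bool" where
  "numerically_stable \<rho> \<longleftrightarrow>
     (\<forall>K L d. 0 < K \<and> K < L \<and> 1 \<le> d \<longrightarrow> 0 < fst (\<rho> K L d) \<and> fst (\<rho> K L d) < 2 / sqrt L)"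

definition tuned_obabo :: "tuning \<Rightarrow> real \<Rightarrow> (point \<Rightarrow> real) \<Rightarrow> phase \<Rightarrow> phase measure" where
  "tuned_obabo \<rho> \<kappa> U = obabo 2 U (fst (\<rho> 1 \<kappa> 2)) (snd (\<rho> 1 \<kappa> 2))"

text \<open>
  The profile is real-valued: finiteness of the Wasserstein distance is stated separately wherever
  it is used.
\<close>

definition decay_profile ::
  "real \<Rightarrow> real \<Rightarrow> real \<Rightarrow> real \<Rightarrow> (real \<Rightarrow> real) \<Rightarrow> real \<Rightarrow> phase \<Rightarrow> phase measure \<Rightarrow> nat \<Rightarrow> real" where
  "decay_profile C c a b \<tau> \<kappa> z \<pi> n =
     C * \<kappa> powr a * (1 + enn2real (W2 2 (dirac 2 z) \<pi>)) powr b * exp (- (c * real n / \<tau> \<kappa>))"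

end

theory Submission
  imports Defs
begin

text \<open>
  The displacement \<open>p = r h v - (h\<^sup>2 / 2) \<nabla>U(x)\<close> turns an OBABO step into
  \<open>x' = x + p + noise\<close>, \<open>p' = \<beta> (x' - x) - \<alpha> \<nabla>U(x') + noise\<close> with \<open>\<alpha> = (1 + \<beta>) h\<^sup>2 / 2\<close>, a noisy heavy-ball iteration. Both parts
  of the theorem are statements about this iteration; the noise turns contraction into convergence in total
  variation, and separation of trajectories into its failure.

  Upper bound. For \<open>h = 1 / (4 sqrt \<kappa>)\<close> and \<open>\<gamma> h = 1\<close> the friction is constant and \<open>\<alpha>\<close> is of order
  \<open>1 / \<kappa>\<close>. Under the same noise, the quadratic distance \<open>\<Phi>\<close>, which treats \<open>x + p / (1 - \<beta>)\<close> as a gradient descent and \<open>p\<close> as a fast variable,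
  contracts by the factor \<open>1 - 1 / (32 \<kappa>)\<close> (\<open>\<Phi>_contraction\<close>). Translating the Gaussian noise of one step bounds the total variation distance
  by a multiple of \<open>sqrt (\<kappa> \<Phi>)\<close> (\<open>one_step_lipschitz\<close>). Applied to the functions \<open>z \<mapsto> P k z A\<close>, the contraction
  of Lipschitz constants iterates without any coupling (\<open>kernel_pow_contraction\<close>), and the invariant law is the setwise limit of
  \<open>P n z\<close> (\<open>unique_invariant_law_of_contraction\<close>).

  Lower bound. Write \<open>N\<close> for a large absolute constant. If \<open>1 - \<beta>\<close> is at most of order \<open>N / \<kappa>\<close>, or if \<open>\<alpha> \<kappa> \<le> N (1 - \<beta>)\<close>,
  then the heavy ball with the potential \<open>\<bar>x\<bar>\<^sup>2 / 2\<close> decays no faster than \<open>(1 - O(1 / \<kappa>)) ^ n\<close> (\<open>slow_linear_trajectories\<close>).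
  Otherwise, stability \<open>h\<^sup>2 \<kappa> < 4\<close> leaves enough room for a smooth potential with second derivative in \<open>[1, \<kappa>]\<close>
  for which the heavy ball has a periodic orbit (\<open>cycle_exists\<close>). The force deviates from the linear one by a bounded staircase, constant near the orbit; hence
  the orbit inherits the stability of the linear recursion, and a rescaled orbit is not left before time \<open>n\<close> if the scale is of order \<open>n\<close>,
  because the noise accumulates only a variance \<open>O(n)\<close>. The bounded staircase does not destroy the drift condition either, so Harris' theorem provides
  the unique invariant law. In both cases there are two starting points whose laws at time \<open>n\<close> have most of their mass on disjoint sets;
  one of them is at distance at least \<open>1 / 4\<close> from \<open>\<pi>\<close> (\<open>slow_mixing_of_separated_trajectories\<close>). As \<open>W2\<close> to \<open>\<pi>\<close> is at most
  \<open>O(n exp (O(n / \<kappa>)))\<close> there, a profile with rate \<open>c / \<tau>(\<kappa>)\<close> and \<open>\<tau>(\<kappa>) = o(\<kappa>)\<close> is eventually violated.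

  Contraction, Harris' theorem and Doob's inequality are all used in the dual form, as inequalities for \<open>z \<mapsto> P n z A\<close> that
  are propagated backwards in time, so that no path space, coupling of trajectories or martingale has to be constructed.
\<close>

section \<open>Harris theorem in dual form\<close>

text \<open>Layer-cake: up to an error \<open>1 / N\<close>, \<open>\<phi>\<close> is the mean of the indicators of its \<open>N\<close>
  superlevel sets, so the difference of the integrals is a mean of differences of probabilities.
  Using that \<open>\<phi>\<close> has oscillation 1, rather than supremum norm 1, saves the factor 2.\<close>

lemma integral_diff_le_setwise:
  assumes "prob_space \<mu>" "prob_space \<nu>" and sets: "sets \<nu> = sets \<mu>"
    and meas: "\<phi> \<in> borel_measurable \<mu>"
    and range: "\<And>x. x \<in> space \<mu> \<Longrightarrow> 0 \<le> \<phi> x \<and> \<phi> x \<le> (1::real)"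
    and close: "\<And>A. A \<in> sets \<mu> \<Longrightarrow> \<bar>measure \<mu> A - measure \<nu> A\<bar> \<le> \<epsilon>"
  shows "\<bar>(\<integral>x. \<phi> x \<partial>\<mu>) - (\<integral>x. \<phi> x \<partial>\<nu>)\<bar> \<le> \<epsilon>"
proof -
  have sp: "space \<nu> = space \<mu>" using sets by (rule sets_eq_imp_space_eq)
  define A where "A N k = {x \<in> space \<mu>. real k / real N \<le> \<phi> x}" for N k :: nat
  have A[measurable]: "A N k \<in> sets \<mu>" for N k
    using meas unfolding A_def by measurable
  define s where "s N x = (\<Sum>k=1..N. indicator (A N k) x) / real N" for N :: nat and x
  have s_approx: "s N x \<le> \<phi> x \<and> \<phi> x \<le> s N x + 1 / N" if "N > 0" "x \<in> space \<mu>" for N x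
  proof -
    define m where "m = nat \<lfloor>N * \<phi> x\<rfloor>"
    have nn: "0 \<le> N * \<phi> x" "N * \<phi> x \<le> N"
      using range[OF that(2)] by (auto simp: mult_left_le)
    have m: "real m \<le> N * \<phi> x" "N * \<phi> x < m + 1"
      unfolding m_def using nn(1) by linarith+
    have "m \<le> N" using m nn by linarith
    have "(\<Sum>k=1..N. indicator (A N k) x) = (\<Sum>k=1..N. if k \<in> {1..m} then 1 else (0::real))"
    proof (rule sum.cong)
      fix k assume k: "k \<in> {1..N}"
      have "real k / real N \<le> \<phi> x \<longleftrightarrow> real k \<le> N * \<phi> x"
        using that(1) by (simp add: field_simps)
      also have "\<dots> \<longleftrightarrow> k \<le> m" using m by linarith
      finally show "indicator (A N k) x = (if k \<in> {1..m} then 1 else (0::real))"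
        using k that(2) by (auto simp: A_def indicator_def)
    qed simp
    also have "\<dots> = card ({1..N} \<inter> {1..m})"
      by (simp add: sum.If_cases del: atLeastAtMost_iff)
    also have "{1..N} \<inter> {1..m} = {1..m}" using \<open>m \<le> N\<close> by auto
    also have "real (card {1..m}) = m" by simp
    finally have "s N x = m / N" by (simp add: s_def)
    then have "real N * s N x \<le> real N * \<phi> x" "real N * \<phi> x \<le> real N * (s N x + 1 / N)"
      using m that(1) by (simp_all add: distrib_left)
    then show ?thesis using that(1) by (simp only: mult_le_cancel_left_pos of_nat_0_less_iff)
  qed
  have meas': "\<phi> \<in> borel_measurable \<nu>"
    using meas by (simp add: measurable_cong_sets[OF sets refl])
  have sm: "\<bar>(\<integral>x. \<phi> x \<partial>\<mu>') - (\<Sum>k=1..N. measure \<mu>' (A N k)) / N\<bar> \<le> 1 / N"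
    if "N > 0" "prob_space \<mu>'" "sets \<mu>' = sets \<mu>" "\<phi> \<in> borel_measurable \<mu>'" for N \<mu>'
  proof -
    interpret prob_space \<mu>' by fact
    have sp': "space \<mu>' = space \<mu>" using that(3) by (rule sets_eq_imp_space_eq)
    have A'[measurable]: "A N k \<in> sets \<mu>'" for k using A that(3) by simp
    have isn: "integrable \<mu>' (s N)" unfolding s_def
      by (intro integrable_divide_zero Bochner_Integration.integrable_sum)
         (auto intro!: integrable_real_indicator simp: emeasure_eq_measure)
    have ip: "integrable \<mu>' \<phi>"
      by (rule integrable_const_bound[of _ 1]) (use range that(4) sp' in auto)
    have "(\<integral>x. s N x \<partial>\<mu>') = (\<Sum>k=1..N. measure \<mu>' (A N k)) / N"
      unfolding s_def by (subst integral_divide_zero, subst Bochner_Integration.integral_sum)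
        (auto intro!: integrable_real_indicator simp: emeasure_eq_measure)
    moreover have "(\<integral>x. s N x \<partial>\<mu>') \<le> (\<integral>x. \<phi> x \<partial>\<mu>')"
      using s_approx[OF that(1)] sp' by (intro integral_mono isn ip) auto
    moreover have "(\<integral>x. \<phi> x \<partial>\<mu>') \<le> (\<integral>x. s N x + 1 / N \<partial>\<mu>')"
      using s_approx[OF that(1)] sp' by (intro integral_mono isn ip) (auto intro: isn)
    moreover have "(\<integral>x. s N x + 1 / N \<partial>\<mu>') = (\<integral>x. s N x \<partial>\<mu>') + 1 / N"
      using isn by (simp add: prob_space)
    ultimately show ?thesis by linarith
  qed
  have main: "\<bar>(\<integral>x. \<phi> x \<partial>\<mu>) - (\<integral>x. \<phi> x \<partial>\<nu>)\<bar> \<le> \<epsilon> + 2 / N" if "N > 0" for N :: nat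
  proof -
    have "\<bar>(\<Sum>k=1..N. measure \<mu> (A N k)) / N - (\<Sum>k=1..N. measure \<nu> (A N k)) / N\<bar>
       = \<bar>\<Sum>k=1..N. measure \<mu> (A N k) - measure \<nu> (A N k)\<bar> / N"
      by (simp add: sum_subtractf diff_divide_distrib[symmetric] abs_divide)
    also have "\<dots> \<le> (\<Sum>k=1..N. \<epsilon>) / N"
      by (intro divide_right_mono order_trans[OF sum_abs] sum_mono close) auto
    also have "\<dots> = \<epsilon>" using that by simp
    finally show ?thesis
      using sm[OF that assms(1) refl meas] sm[OF that assms(2) sets meas'] by linarith
  qed
  show ?thesis
  proof (rule LIMSEQ_le_const)
    show "(\<lambda>N. \<epsilon> + 2 / real N) \<longlonglongrightarrow> \<epsilon>"
      using tendsto_add[OF tendsto_const lim_const_over_n[of 2], of \<epsilon>] by simp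
  qed (use main in \<open>auto intro!: exI[of _ 1]\<close>)
qed

lemma integral_real_le_nn_integral:
  assumes "(\<integral>\<^sup>+x. ennreal (V x) \<partial>\<mu>) \<le> ennreal a" and [measurable]: "V \<in> borel_measurable \<mu>"
    and "\<And>x. x \<in> space \<mu> \<Longrightarrow> 0 \<le> V x" "0 \<le> a"
  shows "integrable \<mu> V \<and> (\<integral>x. V x \<partial>\<mu>) \<le> a"
proof
  have fin: "(\<integral>\<^sup>+x. ennreal (V x) \<partial>\<mu>) < \<infinity>"
    using assms(1) by (simp add: order_le_less_trans)
  show i: "integrable \<mu> V"
    by (rule integrableI_nonneg) (use assms fin in auto)
  have "ennreal (\<integral>x. V x \<partial>\<mu>) = (\<integral>\<^sup>+x. ennreal (V x) \<partial>\<mu>)"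
    by (rule nn_integral_eq_integral[symmetric]) (use i assms in auto)
  then have "ennreal (\<integral>x. V x \<partial>\<mu>) \<le> ennreal a" using assms(1) by simp
  then show "(\<integral>x. V x \<partial>\<mu>) \<le> a" using assms(4) by (simp add: ennreal_le_iff)
qed

text \<open>The form in which a weighted seminorm is used: truncate \<open>\<phi>\<close> to \<open>[-1/2, 1/2]\<close>. The truncated
  part has oscillation at most 1 and sees only the setwise distance, the rest is at most \<open>V\<close>.\<close>

lemma integral_diff_le_weighted:
  assumes "prob_space \<mu>" "prob_space \<nu>" and sets: "sets \<nu> = sets \<mu>"
    and meas[measurable]: "\<phi> \<in> borel_measurable \<mu>" and V[measurable]: "V \<in> borel_measurable \<mu>"
    and Vpos: "\<And>x. x \<in> space \<mu> \<Longrightarrow> 0 \<le> V x"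
    and bound: "\<And>x. x \<in> space \<mu> \<Longrightarrow> \<bar>\<phi> x\<bar> \<le> 1/2 + V x"
    and Vi: "(\<integral>\<^sup>+x. ennreal (V x) \<partial>\<mu>) \<le> ennreal a" "(\<integral>\<^sup>+x. ennreal (V x) \<partial>\<nu>) \<le> ennreal b"
    and ab: "0 \<le> a" "0 \<le> b"
    and close: "\<And>A. A \<in> sets \<mu> \<Longrightarrow> \<bar>measure \<mu> A - measure \<nu> A\<bar> \<le> \<epsilon>"
  shows "\<bar>(\<integral>x. \<phi> x \<partial>\<mu>) - (\<integral>x. \<phi> x \<partial>\<nu>)\<bar> \<le> \<epsilon> + a + b"
proof -
  have sp: "space \<nu> = space \<mu>" using sets by (rule sets_eq_imp_space_eq)
  define c where "c x = max (-(1/2)) (min (1/2) (\<phi> x))" for x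
  have c[measurable]: "c \<in> borel_measurable \<mu>" unfolding c_def by measurable
  have c\<nu>: "c \<in> borel_measurable \<nu>" "V \<in> borel_measurable \<nu>" "\<phi> \<in> borel_measurable \<nu>"
    using c V meas by (simp_all add: measurable_cong_sets[OF sets refl])
  have cV: "\<bar>\<phi> x - c x\<bar> \<le> V x" "\<bar>c x\<bar> \<le> 1/2" if "x \<in> space \<mu>" for x
    using bound[OF that] Vpos[OF that] by (auto simp: c_def)
  have *: "integrable \<mu>' c \<and> \<bar>(\<integral>x. \<phi> x \<partial>\<mu>') - (\<integral>x. c x \<partial>\<mu>')\<bar> \<le> r"
    if "prob_space \<mu>'" "space \<mu>' = space \<mu>" "c \<in> borel_measurable \<mu>'" "V \<in> borel_measurable \<mu>'"
      "\<phi> \<in> borel_measurable \<mu>'" "(\<integral>\<^sup>+x. ennreal (V x) \<partial>\<mu>') \<le> ennreal r" "0 \<le> r" for \<mu>' r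
  proof -
    note [measurable] = that(3-5)
    interpret prob_space \<mu>' by fact
    have V: "integrable \<mu>' V" "(\<integral>x. V x \<partial>\<mu>') \<le> r"
      using integral_real_le_nn_integral[OF that(6,4)] Vpos that by auto
    have ic: "integrable \<mu>' c"
      by (rule integrable_const_bound[of _ "1/2"]) (use cV that in auto)
    have id: "integrable \<mu>' (\<lambda>x. \<phi> x - c x)"
    proof (rule Bochner_Integration.integrable_bound[OF V(1)])
      show "AE x in \<mu>'. norm (\<phi> x - c x) \<le> norm (V x)"
        using cV Vpos that(2) by (intro AE_I2) fastforce
    qed measurable
    have "integrable \<mu>' \<phi>" using Bochner_Integration.integrable_add[OF id ic] by simp
    then have "(\<integral>x. \<phi> x \<partial>\<mu>') - (\<integral>x. c x \<partial>\<mu>') = (\<integral>x. \<phi> x - c x \<partial>\<mu>')" using ic by simp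
    also have "\<bar>\<dots>\<bar> \<le> (\<integral>x. \<bar>\<phi> x - c x\<bar> \<partial>\<mu>')" by (rule integral_abs_bound)
    also have "\<dots> \<le> (\<integral>x. V x \<partial>\<mu>')" using cV that by (intro integral_mono integrable_abs id V) auto
    finally show ?thesis using ic V by auto
  qed
  note 1 = *[OF assms(1) refl c V meas Vi(1) ab(1)] and 2 = *[OF assms(2) sp c\<nu> Vi(2) ab(2)]
  have "\<bar>(\<integral>x. c x + 1/2 \<partial>\<mu>) - (\<integral>x. c x + 1/2 \<partial>\<nu>)\<bar> \<le> \<epsilon>"
    by (rule integral_diff_le_setwise[OF assms(1,2) sets _ _ close]) (auto simp: c_def)
  moreover have "(\<integral>x. c x + 1/2 \<partial>\<mu>) = (\<integral>x. c x \<partial>\<mu>) + 1/2" "(\<integral>x. c x + 1/2 \<partial>\<nu>) = (\<integral>x. c x \<partial>\<nu>) + 1/2"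
    using 1 2 assms(1,2) by (simp_all add: prob_space.prob_space prob_space.finite_measure finite_measure.integrable_const)
  ultimately show ?thesis using 1 2 by linarith
qed

locale phase_kernel =
  fixes d :: nat and Q :: "phase \<Rightarrow> phase measure"
  assumes kernel[measurable]: "Q \<in> phase_space d \<rightarrow>\<^sub>M prob_algebra (phase_space d)"
begin

abbreviation "M \<equiv> phase_space d"
abbreviation "P \<equiv> kernel_pow d Q"

lemma space_M_nonempty: "space M \<noteq> {}"
  by (simp add: phase_space_def space_pair_measure space_PiM PiE_eq_empty_iff)

lemma measurable_kernel_pow[measurable]: "P n \<in> M \<rightarrow>\<^sub>M prob_algebra M"
proof (induction n)
  case 0
  have "P 0 = return M" by (simp add: fun_eq_iff)
  then show ?case by simp
next
  case (Suc n)
  have "P (Suc n) = (\<lambda>z. P n z \<bind> Q)" by (simp add: fun_eq_iff)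
  then show ?case using measurable_bind_prob_space[OF Suc kernel] by simp
qed

lemma prob_kernel: "z \<in> space M \<Longrightarrow> prob_space (Q z)" "z \<in> space M \<Longrightarrow> sets (Q z) = sets M"
  using measurable_space[OF kernel] by (auto simp: space_prob_algebra)

lemma space_kernel: "z \<in> space M \<Longrightarrow> space (Q z) = space M"
  using prob_kernel(2) sets_eq_imp_space_eq by blast

lemma prob_kernel_pow: "z \<in> space M \<Longrightarrow> prob_space (P n z)" "z \<in> space M \<Longrightarrow> sets (P n z) = sets M"
  using measurable_space[OF measurable_kernel_pow] by (auto simp: space_prob_algebra)

lemma space_kernel_pow: "z \<in> space M \<Longrightarrow> space (P n z) = space M"
  using prob_kernel_pow(2) sets_eq_imp_space_eq by blast

lemma kernel_pow_Suc_left: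
  assumes "z \<in> space M" shows "P (Suc n) z = Q z \<bind> P n"
proof (induction n)
  case 0
  have "return M z \<bind> Q = Q z"
    by (rule bind_return[OF measurable_prob_algebraD[OF kernel] assms])
  moreover have "Q z \<bind> P 0 = Q z \<bind> return M" by (simp add: fun_eq_iff cong: bind_cong)
  moreover have "Q z \<bind> return M = Q z"
    by (rule bind_return'') (use prob_kernel assms in auto)
  ultimately show ?case by simp
next
  case (Suc n)
  have "P (Suc (Suc n)) z = (Q z \<bind> P n) \<bind> Q" using Suc by simp
  also have "\<dots> = Q z \<bind> (\<lambda>x. P n x \<bind> Q)"
  proof (rule bind_assoc[where N=M and R=M])
    show "P n \<in> Q z \<rightarrow>\<^sub>M subprob_algebra M"
      using measurable_prob_algebraD[OF measurable_kernel_pow] prob_kernel(2)[OF assms]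
      by (simp cong: measurable_cong_sets)
  qed (rule measurable_prob_algebraD[OF kernel])
  finally show ?case by simp
qed

lemma measure_bind_kernel:
  assumes "prob_space \<mu>" "sets \<mu> = sets M" "R \<in> M \<rightarrow>\<^sub>M prob_algebra M" "A \<in> sets M"
  shows "measure (\<mu> \<bind> R) A = (\<integral>z. measure (R z) A \<partial>\<mu>)"
proof -
  interpret prob_space \<mu> by fact
  show ?thesis
    by (rule measure_bind[where N=M])
       (use measurable_prob_algebraD[OF assms(3)] assms in \<open>auto cong: measurable_cong_sets\<close>)
qed

lemma measurable_measure_kernel_pow[measurable]:
  "A \<in> sets M \<Longrightarrow> (\<lambda>z. measure (P n z) A) \<in> borel_measurable M"
  using measurable_compose[OF measurable_kernel_pow measurable_measure_prob_algebra] by blast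

lemma measure_kernel_pow_Suc:
  assumes "z \<in> space M" "A \<in> sets M"
  shows "measure (P (Suc n) z) A = (\<integral>w. measure (P n w) A \<partial>Q z)"
  unfolding kernel_pow_Suc_left[OF assms(1)]
  by (rule measure_bind_kernel) (use assms prob_kernel in auto)

lemma invariant_kernel_pow:
  assumes "invariant_law d Q \<pi>"
  shows "\<pi> \<bind> P n = \<pi>"
proof (induction n)
  case 0
  have "\<pi> \<bind> P 0 = \<pi> \<bind> return M" by (simp add: fun_eq_iff cong: bind_cong)
  then show ?case using bind_return''[of \<pi> M] assms by (simp add: invariant_law_def)
next
  case (Suc n)
  have [measurable_cong]: "sets \<pi> = sets M" using assms by (simp add: invariant_law_def)
  have "P (Suc n) = (\<lambda>x. P n x \<bind> Q)" by (simp add: fun_eq_iff)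
  then have "\<pi> \<bind> P (Suc n) = \<pi> \<bind> (\<lambda>x. P n x \<bind> Q)" by (simp only:)
  also have "\<dots> = (\<pi> \<bind> P n) \<bind> Q"
    by (rule bind_assoc[symmetric, where N=M and R=M])
       (use measurable_prob_algebraD[OF measurable_kernel_pow] measurable_prob_algebraD[OF kernel]
         in \<open>auto cong: measurable_cong_sets\<close>)
  finally show ?case using Suc assms by (simp only: invariant_law_def)
qed

lemma measure_kernel_pow_01: "z \<in> space M \<Longrightarrow> 0 \<le> measure (P n z) A \<and> measure (P n z) A \<le> 1"
  using prob_space.prob_le_1[OF prob_kernel_pow(1)] by auto

text \<open>Contraction for a cost \<open>D\<close>, stated for test functions instead of couplings: if integration
  against \<open>Q\<close> multiplies the \<open>D\<close>-Lipschitz constant of \<open>[0,1]\<close>-valued functions by \<open>\<rho>\<close>, then any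
  Lipschitz bound reached after \<open>m\<close> steps (by smoothing, if \<open>D\<close> is a distance;
  trivially at \<open>m = 0\<close>, if \<open>1 \<le> D\<close>) decays geometrically from then on.
  The functions \<open>z \<mapsto> P k z A\<close> are the test functions, so no coupling has to be constructed.\<close>

lemma kernel_pow_contraction:
  assumes step: "\<And>\<phi> L. \<phi> \<in> borel_measurable M \<Longrightarrow> (\<And>x. x \<in> space M \<Longrightarrow> 0 \<le> \<phi> x \<and> \<phi> x \<le> (1::real)) \<Longrightarrow> 0 < L \<Longrightarrow>
      (\<And>x y. x \<in> space M \<Longrightarrow> y \<in> space M \<Longrightarrow> \<bar>\<phi> x - \<phi> y\<bar> \<le> L * D x y) \<Longrightarrow>
      (\<And>x y. x \<in> space M \<Longrightarrow> y \<in> space M \<Longrightarrow> \<bar>(\<integral>w. \<phi> w \<partial>Q x) - (\<integral>w. \<phi> w \<partial>Q y)\<bar> \<le> L * \<rho> * D x y)"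
    and start: "\<And>x y. x \<in> space M \<Longrightarrow> y \<in> space M \<Longrightarrow>
      \<bar>measure (P m x) A - measure (P m y) A\<bar> \<le> L * D x y"
    and A: "A \<in> sets M" and pos: "0 < L" "0 < \<rho>"
    and xy: "x \<in> space M" "y \<in> space M"
  shows "\<bar>measure (P (n + m) x) A - measure (P (n + m) y) A\<bar> \<le> L * \<rho> ^ n * D x y"
  using xy
proof (induction n arbitrary: x y)
  case 0
  then show ?case using start by simp
next
  case (Suc n)
  have "\<bar>(\<integral>w. measure (P (n+m) w) A \<partial>Q x) - (\<integral>w. measure (P (n+m) w) A \<partial>Q y)\<bar> \<le> (L * \<rho>^n) * \<rho> * D x y"
    by (rule step) (use Suc A pos measure_kernel_pow_01 in auto)
  then show ?case
    using Suc.prems by (simp del: kernel_pow.simps add: measure_kernel_pow_Suc A mult_ac)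
qed

lemma drift_iterate:
  assumes V[measurable]: "V \<in> borel_measurable M" and Vpos: "\<And>z. z \<in> space M \<Longrightarrow> 0 \<le> V z"
    and drift: "\<And>z. z \<in> space M \<Longrightarrow> (\<integral>\<^sup>+w. ennreal (V w) \<partial>Q z) \<le> ennreal (\<gamma> * V z + K)"
    and \<gamma>: "0 \<le> \<gamma>" "\<gamma> < 1" "0 \<le> K" and z: "z \<in> space M"
  shows "(\<integral>\<^sup>+w. ennreal (V w) \<partial>P n z) \<le> ennreal (V z + K / (1 - \<gamma>))"
proof (induction n)
  case 0
  then show ?case using \<gamma> Vpos z by (simp add: nn_integral_return)
next
  case (Suc n)
  note [measurable_cong] = prob_kernel_pow(2)[OF z]
  have "(\<integral>\<^sup>+w. ennreal (V w) \<partial>P (Suc n) z) = (\<integral>\<^sup>+x. (\<integral>\<^sup>+w. ennreal (V w) \<partial>Q x) \<partial>P n z)"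
    unfolding kernel_pow.simps
    by (rule nn_integral_bind[where B=M])
       (use measurable_prob_algebraD[OF kernel] in \<open>auto cong: measurable_cong_sets\<close>)
  also have "\<dots> \<le> (\<integral>\<^sup>+x. ennreal (\<gamma> * V x + K) \<partial>P n z)"
    by (intro nn_integral_mono drift) (use space_kernel_pow z in auto)
  also have "\<dots> = (\<integral>\<^sup>+x. ennreal \<gamma> * ennreal (V x) + ennreal K \<partial>P n z)"
    by (intro nn_integral_cong)
       (use \<gamma> Vpos space_kernel_pow z in \<open>auto simp: ennreal_mult[symmetric] ennreal_plus[symmetric] simp del: ennreal_plus\<close>)
  also have "\<dots> = ennreal \<gamma> * (\<integral>\<^sup>+x. ennreal (V x) \<partial>P n z) + ennreal K"
    using prob_space.emeasure_space_1[OF prob_kernel_pow(1)[OF z]]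
    by (subst nn_integral_add) (auto simp: nn_integral_cmult)
  also have "\<dots> \<le> ennreal \<gamma> * ennreal (V z + K / (1 - \<gamma>)) + ennreal K"
    by (intro add_mono mult_left_mono Suc.IH) auto
  also have "\<dots> = ennreal (\<gamma> * (V z + K / (1 - \<gamma>)) + K)"
    using \<gamma> Vpos[OF z] by (simp add: ennreal_mult[symmetric] ennreal_plus[symmetric] del: ennreal_plus)
  also have "\<gamma> * (V z + K / (1 - \<gamma>)) + K \<le> V z + K / (1 - \<gamma>)"
  proof -
    have "\<gamma> * (K / (1 - \<gamma>)) + K = K / (1 - \<gamma>)" using \<gamma> by (simp add: field_simps)
    moreover have "\<gamma> * V z \<le> V z" using \<gamma> Vpos[OF z] by (simp add: mult_left_le_one_le)
    ultimately show ?thesis by (simp add: distrib_left)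
  qed
  finally show ?case by (simp add: ennreal_leI)
qed

text \<open>Existence without compactness or completeness of a metric space: by the contraction, the
  probabilities \<open>P n z0 A\<close> form a Cauchy sequence with rate \<open>\<rho> ^ n\<close> that is uniform in \<open>A\<close>. The
  uniformity turns the limit \<open>L\<close> into a measure, because continuity at the empty set can be checked
  at a large fixed \<open>n\<close>. The moment bound follows by truncating \<open>V\<close>, as every truncation is a
  bounded test function.\<close>

theorem unique_invariant_law_of_contraction:
  assumes V[measurable]: "V \<in> borel_measurable M" and Vpos: "\<And>z. z \<in> space M \<Longrightarrow> 0 \<le> V z"
    and drift: "\<And>z. z \<in> space M \<Longrightarrow> (\<integral>\<^sup>+w. ennreal (V w) \<partial>Q z) \<le> ennreal (\<gamma> * V z + K)"
    and \<gamma>: "0 \<le> \<gamma>" "\<gamma> < 1" "0 \<le> K" and \<rho>: "0 \<le> \<rho>" "\<rho> < 1" "0 \<le> D"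
    and contr: "\<And>n x y A. x \<in> space M \<Longrightarrow> y \<in> space M \<Longrightarrow> A \<in> sets M \<Longrightarrow>
      \<bar>measure (P n x) A - measure (P n y) A\<bar> \<le> D * \<rho> ^ n * (1 + V x + V y)"
    and z0: "z0 \<in> space M"
  obtains \<pi> where "unique_invariant_law d Q \<pi>"
    "(\<integral>\<^sup>+w. ennreal (V w) \<partial>\<pi>) \<le> ennreal (V z0 + K / (1 - \<gamma>))"
proof -
  define p where "p n A = measure (P n z0) A" for n A
  define C1 where "C1 = D * (1 + V z0 + (\<gamma> * V z0 + K))"
  define C2 where "C2 = C1 / (1 - \<rho>)"
  note prob = prob_kernel[OF z0]
  interpret Q0: prob_space "Q z0" using prob by simp
  note [measurable_cong] = prob(2)
  have V0: "integrable (Q z0) V \<and> (\<integral>x. V x \<partial>Q z0) \<le> \<gamma> * V z0 + K"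
    by (rule integral_real_le_nn_integral[OF drift[OF z0]])
       (use Vpos \<gamma> z0 space_kernel in auto)
  have step: "\<bar>p (Suc n) A - p n A\<bar> \<le> C1 * \<rho>^n" if A: "A \<in> sets M" for n A
  proof -
    have i: "integrable (Q z0) (\<lambda>w. measure (P n w) A)"
      by (rule Q0.integrable_const_bound[of _ 1])
         (use measure_kernel_pow_01 space_kernel[OF z0] A in \<open>auto intro!: AE_I2\<close>)
    have "p (Suc n) A - p n A = (\<integral>w. measure (P n w) A - measure (P n z0) A \<partial>Q z0)"
      unfolding p_def measure_kernel_pow_Suc[OF z0 A] using i by (simp add: Q0.prob_space)
    also have "\<bar>\<dots>\<bar> \<le> (\<integral>w. \<bar>measure (P n w) A - measure (P n z0) A\<bar> \<partial>Q z0)"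
      by (rule integral_abs_bound)
    also have "\<dots> \<le> (\<integral>w. D * \<rho>^n * (1 + V w + V z0) \<partial>Q z0)"
      using contr A z0 space_kernel V0 i by (intro integral_mono integrable_abs) auto
    also have "\<dots> = D * \<rho>^n * (1 + (\<integral>w. V w \<partial>Q z0) + V z0)"
      using V0 by (simp add: Q0.prob_space)
    also have "\<dots> \<le> D * \<rho>^n * (1 + (\<gamma> * V z0 + K) + V z0)"
      using V0 \<rho> by (intro mult_left_mono) auto
    finally show ?thesis by (simp add: C1_def mult_ac add_ac)
  qed
  have C1: "0 \<le> C1" using \<rho> \<gamma> Vpos[OF z0] by (simp add: C1_def)
  then have C2: "0 \<le> C2" using \<rho> by (simp add: C2_def)
  have C12: "C2 * \<rho>^n - C2 * \<rho>^Suc n = C1 * \<rho>^n" for n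
  proof -
    have "C2 * (1 - \<rho>) = C1" using \<rho> by (simp add: C2_def)
    moreover have "C2 * \<rho>^n - C2 * \<rho>^Suc n = C2 * (1 - \<rho>) * \<rho>^n" by (simp add: algebra_simps)
    ultimately show ?thesis by simp
  qed
  have \<rho>0: "(\<lambda>n. c * \<rho>^n) \<longlonglongrightarrow> 0" for c
    using tendsto_mult_right_zero[OF LIMSEQ_power_zero[of \<rho>]] \<rho> by auto
  have ex: "\<exists>L. \<forall>n. \<bar>p n A - L\<bar> \<le> C2 * \<rho>^n" if A: "A \<in> sets M" for A
  proof -
    have dec: "decseq (\<lambda>n. p n A + C2 * \<rho>^n)"
      using step[OF A] C12 by (intro decseq_SucI) (smt (verit))
    have inc: "incseq (\<lambda>n. p n A - C2 * \<rho>^n)"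
      using step[OF A] C12 by (intro incseq_SucI) (smt (verit))
    have "\<bar>p n A\<bar> \<le> 1" for n using measure_kernel_pow_01[OF z0] by (simp add: p_def)
    moreover have "\<bar>C2 * \<rho>^n\<bar> \<le> C2" for n
      using C2 \<rho> by (simp add: abs_mult power_le_one mult_left_le)
    ultimately have "- (1 + C2) \<le> p n A + C2 * \<rho>^n" for n by (smt (verit))
    then obtain L where L: "(\<lambda>n. p n A + C2 * \<rho>^n) \<longlonglongrightarrow> L" "\<And>n. L \<le> p n A + C2 * \<rho>^n"
      using decseq_convergent[OF dec] by metis
    have "(\<lambda>n. p n A + C2 * \<rho>^n - 2 * C2 * \<rho>^n) \<longlonglongrightarrow> L - 0"
      by (intro tendsto_diff L \<rho>0)
    then have "(\<lambda>n. p n A - C2 * \<rho>^n) \<longlonglongrightarrow> L" by (simp add: algebra_simps)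
    then have "p n A - C2 * \<rho>^n \<le> L" for n using incseq_le[OF inc] by blast
    with L(2) show ?thesis by (intro exI[of _ L]) (smt (verit))
  qed
  then obtain L where L: "\<And>A n. A \<in> sets M \<Longrightarrow> \<bar>p n A - L A\<bar> \<le> C2 * \<rho>^n"
    by metis
  have lim: "(\<lambda>n. p n A) \<longlonglongrightarrow> L A" if "A \<in> sets M" for A
  proof -
    have "(\<lambda>n. p n A - L A) \<longlonglongrightarrow> 0"
      by (rule Lim_null_comparison[OF _ \<rho>0[of C2]]) (use L[OF that] in auto)
    then show ?thesis by (simp add: LIM_zero_iff)
  qed
  have L01: "0 \<le> L A" "L A \<le> 1" if "A \<in> sets M" for A
    using LIMSEQ_le_const[OF lim[OF that]] LIMSEQ_le_const2[OF lim[OF that]] measure_kernel_pow_01[OF z0]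
    unfolding p_def by blast+
  define \<pi> where "\<pi> = measure_of (space M) (sets M) (\<lambda>A. ennreal (L A))"
  have add: "L (A \<union> B) = L A + L B" if "A \<in> sets M" "B \<in> sets M" "A \<inter> B = {}" for A B
  proof -
    have "p n (A \<union> B) = p n A + p n B" for n
    proof -
      interpret prob_space "P n z0" using prob_kernel_pow[OF z0] by simp
      show ?thesis unfolding p_def using that prob_kernel_pow(2)[OF z0] by (intro finite_measure_Union) auto
    qed
    then have "(\<lambda>n. p n A + p n B) \<longlonglongrightarrow> L (A \<union> B)" using lim[of "A \<union> B"] that by simp
    then show ?thesis using tendsto_add[OF lim lim] that LIMSEQ_unique by blast
  qed
  have "L {} = 0" using add[of "{}" "{}"] by simp
  have ca: "countably_additive (sets M) (\<lambda>A. ennreal (L A))"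
  proof (rule sets.empty_continuous_imp_countably_additive)
    show "positive (sets M) (\<lambda>A. ennreal (L A))" using \<open>L {} = 0\<close> by (simp add: positive_def)
    show "additive (sets M) (\<lambda>A. ennreal (L A))"
      unfolding additive_def using add L01 by simp
    fix F :: "nat \<Rightarrow> phase set" assume F: "range F \<subseteq> sets M" "decseq F" "(\<Inter>i. F i) = {}"
    have "(\<lambda>i. L (F i)) \<longlonglongrightarrow> 0"
    proof (rule LIMSEQ_I)
      fix r :: real assume r: "0 < r"
      obtain n where n: "C2 * \<rho>^n < r/2"
        using order_tendstoD(2)[OF \<rho>0[of C2], of "r/2"] r unfolding eventually_sequentially by auto
      interpret prob_space "P n z0" using prob_kernel_pow[OF z0] by simp
      have "(\<lambda>i. p n (F i)) \<longlonglongrightarrow> measure (P n z0) (\<Inter>i. F i)"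
        unfolding p_def by (rule finite_Lim_measure_decseq) (use F prob_kernel_pow(2)[OF z0] in auto)
      then have "(\<lambda>i. p n (F i)) \<longlonglongrightarrow> 0" using F by simp
      then obtain i0 where "\<And>i. i \<ge> i0 \<Longrightarrow> \<bar>p n (F i)\<bar> < r/2"
        using LIMSEQ_D[of "\<lambda>i. p n (F i)" 0 "r/2"] r by auto
      moreover have "\<bar>p n (F i) - L (F i)\<bar> \<le> C2 * \<rho>^n" for i using L F by auto
      ultimately have "\<bar>L (F i)\<bar> < r" if "i \<ge> i0" for i
        using n that by (smt (verit) field_sum_of_halves)
      then show "\<exists>no. \<forall>i\<ge>no. norm (L (F i) - 0) < r" by auto
    qed
    then show "(\<lambda>i. ennreal (L (F i))) \<longlonglongrightarrow> 0"
      using tendsto_ennrealI by fastforce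
  qed auto
  have s\<pi>[measurable_cong]: "sets \<pi> = sets M" by (simp add: \<pi>_def sets.sigma_sets_eq sets.space_closed)
  then have sp\<pi>: "space \<pi> = space M" by (rule sets_eq_imp_space_eq)
  have e\<pi>: "emeasure \<pi> A = ennreal (L A)" if "A \<in> sets M" for A
    unfolding \<pi>_def
    by (rule emeasure_measure_of_sigma[OF sets.sigma_algebra_axioms _ ca that])
       (simp add: positive_def \<open>L {} = 0\<close>)
  have m\<pi>: "measure \<pi> A = L A" if "A \<in> sets M" for A
    using e\<pi>[OF that] L01[OF that] by (simp add: measure_def)
  have "p n (space M) = 1" for n
    unfolding p_def using prob_space.prob_space[OF prob_kernel_pow(1)[OF z0]] by (simp add: space_kernel_pow[OF z0])
  then have "L (space M) = 1" using lim[of "space M"] LIMSEQ_unique[OF _ tendsto_const] by auto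
  then have pr: "prob_space \<pi>" by (intro prob_spaceI) (simp add: sp\<pi> e\<pi>)
  interpret \<pi>: prob_space \<pi> by fact
  have close: "\<bar>(\<integral>w. f w \<partial>\<pi>) - (\<integral>w. f w \<partial>P n z0)\<bar> \<le> C2 * \<rho>^n"
    if "f \<in> borel_measurable M" "\<And>x. x \<in> space M \<Longrightarrow> 0 \<le> f x \<and> f x \<le> 1" for f n
  proof (rule integral_diff_le_setwise)
    show "\<bar>measure \<pi> A - measure (P n z0) A\<bar> \<le> C2 * \<rho>^n" if "A \<in> sets \<pi>" for A
      using L[of A n] m\<pi>[of A] that by (simp add: s\<pi> p_def abs_minus_commute)
  qed (use pr prob_kernel_pow[OF z0] that s\<pi> sp\<pi> in \<open>auto cong: measurable_cong_sets\<close>)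
  have inv: "measure (\<pi> \<bind> Q) A = L A" if A: "A \<in> sets M" for A
  proof -
    have m: "(\<lambda>w. measure (Q w) A) \<in> borel_measurable M"
      using measurable_compose[OF kernel measurable_measure_prob_algebra[OF A]] by simp
    have r: "0 \<le> measure (Q w) A \<and> measure (Q w) A \<le> 1" if "w \<in> space M" for w
      using prob_space.prob_le_1[OF prob_kernel(1)[OF that]] by auto
    have eq: "p (Suc n) A = (\<integral>w. measure (Q w) A \<partial>P n z0)" for n
      unfolding p_def kernel_pow.simps by (rule measure_bind_kernel) (use prob_kernel_pow[OF z0] A in auto)
    have "\<bar>measure (\<pi> \<bind> Q) A - p (Suc n) A\<bar> \<le> C2 * \<rho>^n" for n
      unfolding eq measure_bind_kernel[OF pr s\<pi> kernel A] by (rule close[OF m r])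
    then have "(\<lambda>n. p (Suc n) A - measure (\<pi> \<bind> Q) A) \<longlonglongrightarrow> 0"
      by (intro Lim_null_comparison[OF _ \<rho>0[of C2]]) (auto simp: abs_minus_commute)
    then have "(\<lambda>n. p (Suc n) A) \<longlonglongrightarrow> measure (\<pi> \<bind> Q) A" by (simp add: LIM_zero_iff)
    then show ?thesis using LIMSEQ_Suc[OF lim[OF A]] LIMSEQ_unique by blast
  qed
  have in_pa: "\<mu> \<in> space (prob_algebra M)" if "prob_space \<mu>" "sets \<mu> = sets M" for \<mu>
    using that by (simp add: space_prob_algebra)
  have invariant: "\<pi> \<bind> Q = \<pi>"
  proof (rule measure_eqI)
    have *: "prob_space (\<pi> \<bind> Q)" "sets (\<pi> \<bind> Q) = sets M"
      using prob_space_bind'[OF in_pa[OF pr s\<pi>] kernel] sets_bind'[OF in_pa[OF pr s\<pi>] kernel] by auto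
    show "sets (\<pi> \<bind> Q) = sets \<pi>" using * s\<pi> by simp
    interpret b: prob_space "\<pi> \<bind> Q" using * by simp
    fix A assume "A \<in> sets (\<pi> \<bind> Q)"
    then show "emeasure (\<pi> \<bind> Q) A = emeasure \<pi> A"
      using * by (simp add: b.emeasure_eq_measure inv e\<pi>)
  qed
  have unique: "\<pi>' = \<pi>" if "invariant_law d Q \<pi>'" for \<pi>'
  proof -
    have pr': "prob_space \<pi>'" and s'[measurable_cong]: "sets \<pi>' = sets M" and i': "\<pi>' \<bind> Q = \<pi>'"
      using that by (auto simp: invariant_law_def)
    interpret p': prob_space \<pi>' by fact
    have sp': "space \<pi>' = space M" using s' by (rule sets_eq_imp_space_eq)
    note it = invariant_kernel_pow[OF that]
    have "measure \<pi>' A = L A" if A: "A \<in> sets M" for A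
    proof -
      have "(\<lambda>n. \<integral>w. measure (P n w) A \<partial>\<pi>') \<longlonglongrightarrow> (\<integral>w. L A \<partial>\<pi>')"
      proof (rule integral_dominated_convergence[where w="\<lambda>_. 1"])
        show "AE x in \<pi>'. (\<lambda>n. measure (P n x) A) \<longlonglongrightarrow> L A"
        proof (rule AE_I2)
          fix x assume "x \<in> space \<pi>'"
          then have x: "x \<in> space M" using sp' by simp
          have "(\<lambda>n. measure (P n x) A - p n A) \<longlonglongrightarrow> 0"
            by (rule Lim_null_comparison[OF _ \<rho>0[of "D * (1 + V x + V z0)"]])
               (use contr[OF x z0 A] in \<open>auto simp: p_def mult_ac\<close>)
          from tendsto_add[OF this lim[OF A]] show "(\<lambda>n. measure (P n x) A) \<longlonglongrightarrow> L A" by simp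
        qed
        show "AE x in \<pi>'. norm (measure (P n x) A) \<le> 1" for n
          using measure_kernel_pow_01 sp' by (intro AE_I2) auto
      qed (use A in auto)
      moreover have "(\<integral>w. measure (P n w) A \<partial>\<pi>') = measure \<pi>' A" for n
        using measure_bind_kernel[OF pr' s' measurable_kernel_pow A, of n] it by simp
      ultimately have "(\<lambda>n::nat. measure \<pi>' A) \<longlonglongrightarrow> L A" by (simp add: p'.prob_space)
      then show ?thesis using LIMSEQ_unique[OF tendsto_const] by blast
    qed
    then show "\<pi>' = \<pi>"
      using m\<pi> by (intro measure_eqI) (auto simp: s' s\<pi> p'.emeasure_eq_measure \<pi>.emeasure_eq_measure)
  qed
  have "unique_invariant_law d Q \<pi>"
  proof -
    have "invariant_law d Q \<pi>" using pr s\<pi> invariant by (simp add: invariant_law_def)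
    then show ?thesis unfolding unique_invariant_law_def using unique by blast
  qed
  moreover have "(\<integral>\<^sup>+w. ennreal (V w) \<partial>\<pi>) \<le> ennreal (V z0 + K / (1 - \<gamma>))"
  proof -
    define S where "S = V z0 + K / (1 - \<gamma>)"
    have S: "0 \<le> S" using Vpos[OF z0] \<gamma> by (simp add: S_def)
    have trunc: "(\<integral>\<^sup>+w. ennreal (min (V w) (Suc m)) \<partial>\<pi>) \<le> ennreal S" for m
    proof -
      have i: "integrable \<mu> (\<lambda>w. min (V w) (Suc m))" if "prob_space \<mu>" "sets \<mu> = sets M" for \<mu>
      proof -
        interpret prob_space \<mu> by fact
        note [measurable_cong] = that(2)
        show ?thesis
          by (rule integrable_const_bound[of _ "Suc m"])
             (use Vpos sets_eq_imp_space_eq[OF that(2)] in \<open>auto intro!: AE_I2\<close>)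
      qed
      have b: "(\<integral>w. min (V w) (Suc m) \<partial>\<pi>) \<le> S + (Suc m) * (C2 * \<rho>^n)" for n
      proof -
        note [measurable_cong] = prob_kernel_pow(2)[OF z0]
        have "\<bar>(\<integral>w. min (V w) (Suc m) / Suc m \<partial>\<pi>) - (\<integral>w. min (V w) (Suc m) / Suc m \<partial>P n z0)\<bar> \<le> C2 * \<rho>^n"
          by (rule close) (use Vpos in \<open>auto simp: divide_simps\<close>)
        then have "((\<integral>w. min (V w) (Suc m) \<partial>\<pi>) - (\<integral>w. min (V w) (Suc m) \<partial>P n z0)) / real (Suc m) \<le> C2 * \<rho>^n"
          by (simp add: diff_divide_distrib del: of_nat_Suc)
        then have "(\<integral>w. min (V w) (Suc m) \<partial>\<pi>) \<le> (\<integral>w. min (V w) (Suc m) \<partial>P n z0) + (Suc m) * (C2 * \<rho>^n)"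
          by (simp add: pos_divide_le_eq mult.commute del: of_nat_Suc)
        moreover have "integrable (P n z0) V \<and> (\<integral>w. V w \<partial>P n z0) \<le> S"
          by (rule integral_real_le_nn_integral)
             (use drift_iterate[OF V Vpos drift \<gamma> z0] S space_kernel_pow[OF z0] Vpos in \<open>auto simp: S_def\<close>)
        moreover from this have "(\<integral>w. min (V w) (Suc m) \<partial>P n z0) \<le> (\<integral>w. V w \<partial>P n z0)"
          by (intro integral_mono i prob_kernel_pow z0) auto
        ultimately show ?thesis by linarith
      qed
      have "(\<lambda>n. S + (Suc m * C2) * \<rho>^n) \<longlonglongrightarrow> S + 0" by (intro tendsto_intros \<rho>0)
      then have "(\<integral>w. min (V w) (Suc m) \<partial>\<pi>) \<le> S"
        using b by (intro LIMSEQ_le_const[of "\<lambda>n. S + (Suc m * C2) * \<rho>^n"]) (auto simp: mult_ac)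
      moreover have "(\<integral>\<^sup>+w. ennreal (min (V w) (Suc m)) \<partial>\<pi>) = ennreal (\<integral>w. min (V w) (Suc m) \<partial>\<pi>)"
        by (rule nn_integral_eq_integral[OF i[OF pr s\<pi>]]) (use Vpos sp\<pi> in auto)
      ultimately show ?thesis by (simp add: ennreal_leI)
    qed
    have "(\<integral>\<^sup>+w. ennreal (V w) \<partial>\<pi>) = (\<integral>\<^sup>+w. (SUP m. ennreal (min (V w) (Suc m))) \<partial>\<pi>)"
    proof (rule nn_integral_cong)
      fix w
      show "ennreal (V w) = (SUP m. ennreal (min (V w) (Suc m)))"
      proof (rule antisym)
        obtain m :: nat where "V w \<le> m" using real_arch_simple by blast
        then have "ennreal (V w) = ennreal (min (V w) (Suc m))" by simp
        then show "ennreal (V w) \<le> (SUP m. ennreal (min (V w) (Suc m)))" by (metis SUP_upper UNIV_I)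
      qed (auto intro!: SUP_least ennreal_leI)
    qed
    also have "\<dots> = (SUP m. (\<integral>\<^sup>+w. ennreal (min (V w) (Suc m)) \<partial>\<pi>))"
      by (rule nn_integral_monotone_convergence_SUP) (auto simp: incseq_def le_fun_def intro!: ennreal_leI)
    also have "\<dots> \<le> ennreal S" by (rule SUP_least) (rule trunc)
    finally show ?thesis by (simp add: S_def)
  qed
  ultimately show ?thesis by (rule that)
qed

text \<open>The functions with oscillation \<open>\<bar>\<phi> x - \<phi> y\<bar> \<le> L * (1 + \<theta> * V x + \<theta> * V y)\<close> are, up to an
  additive constant, those bounded by \<open>L * (1/2 + \<theta> * V)\<close>. The constant is \<open>c\<close> in the proof, and
  with it the bound is the weighted one.\<close>

lemma harris_step:
  assumes V[measurable]: "V \<in> borel_measurable M" and Vpos: "\<And>z. z \<in> space M \<Longrightarrow> 0 \<le> V z"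
    and drift: "\<And>z. z \<in> space M \<Longrightarrow> (\<integral>\<^sup>+w. ennreal (V w) \<partial>Q z) \<le> ennreal (\<gamma> * V z + K)"
    and \<gamma>: "0 \<le> \<gamma>" "0 \<le> K" and \<theta>: "0 \<le> \<theta>" and L: "0 < L"
    and \<phi>[measurable]: "\<phi> \<in> borel_measurable M" and \<phi>01: "\<And>x. x \<in> space M \<Longrightarrow> 0 \<le> \<phi> x \<and> \<phi> x \<le> (1::real)"
    and osc: "\<And>x y. x \<in> space M \<Longrightarrow> y \<in> space M \<Longrightarrow> \<bar>\<phi> x - \<phi> y\<bar> \<le> L * (1 + \<theta> * V x + \<theta> * V y)"
    and xy: "x \<in> space M" "y \<in> space M"
    and overlap: "\<And>A. A \<in> sets M \<Longrightarrow> \<bar>measure (Q x) A - measure (Q y) A\<bar> \<le> \<epsilon>"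
  shows "\<bar>(\<integral>w. \<phi> w \<partial>Q x) - (\<integral>w. \<phi> w \<partial>Q y)\<bar> \<le> L * (\<epsilon> + \<theta> * (\<gamma> * V x + K) + \<theta> * (\<gamma> * V y + K))"
proof -
  define lo where "lo x = \<phi> x / L - (1/2 + \<theta> * V x)" for x
  define c where "c = (SUP x\<in>space M. lo x)"
  have lo: "lo x \<le> \<phi> y / L + (1/2 + \<theta> * V y)" if "x \<in> space M" "y \<in> space M" for x y
  proof -
    have "(\<phi> x - \<phi> y) / L \<le> (L * (1 + \<theta> * V x + \<theta> * V y)) / L"
      using osc[OF that] L by (intro divide_right_mono) auto
    then show ?thesis using L by (simp add: lo_def diff_divide_distrib)
  qed
  have "bdd_above (lo ` space M)"
    using lo xy by (intro bdd_aboveI2[of _ _ "\<phi> x / L + (1/2 + \<theta> * V x)"]) auto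
  then have c1: "lo x \<le> c" if "x \<in> space M" for x using that unfolding c_def by (rule cSUP_upper2) auto
  have c2: "c \<le> \<phi> y / L + (1/2 + \<theta> * V y)" if "y \<in> space M" for y
    unfolding c_def using space_M_nonempty lo that by (intro cSUP_least) auto
  have bd: "\<bar>\<phi> z / L - c\<bar> \<le> 1/2 + \<theta> * V z" if "z \<in> space M" for z
    using c1[OF that] c2[OF that] by (simp add: lo_def abs_le_iff)
  have Vi: "(\<integral>\<^sup>+w. ennreal (\<theta> * V w) \<partial>Q z) \<le> ennreal (\<theta> * (\<gamma> * V z + K))" if "z \<in> space M" for z
  proof -
    note [measurable_cong] = prob_kernel(2)[OF that]
    have "(\<integral>\<^sup>+w. ennreal (\<theta> * V w) \<partial>Q z) = ennreal \<theta> * (\<integral>\<^sup>+w. ennreal (V w) \<partial>Q z)"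
      using \<theta> Vpos space_kernel[OF that] by (subst nn_integral_cmult[symmetric]) (auto simp: ennreal_mult intro!: nn_integral_cong)
    also have "\<dots> \<le> ennreal \<theta> * ennreal (\<gamma> * V z + K)" by (intro mult_left_mono drift that) auto
    finally show ?thesis using \<theta> \<gamma> Vpos[OF that] by (simp add: ennreal_mult)
  qed
  have "\<bar>(\<integral>w. \<phi> w / L - c \<partial>Q x) - (\<integral>w. \<phi> w / L - c \<partial>Q y)\<bar> \<le> \<epsilon> + \<theta> * (\<gamma> * V x + K) + \<theta> * (\<gamma> * V y + K)"
  proof (rule integral_diff_le_weighted[where V="\<lambda>z. \<theta> * V z"])
    note [measurable_cong] = prob_kernel(2)[OF xy(1)]
    show "(\<lambda>w. \<phi> w / L - c) \<in> borel_measurable (Q x)" "(\<lambda>z. \<theta> * V z) \<in> borel_measurable (Q x)" by measurable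
  qed (use prob_kernel xy space_kernel bd \<theta> Vpos Vi \<gamma> overlap in auto)
  moreover have "(\<integral>w. \<phi> w / L - c \<partial>Q z) = (\<integral>w. \<phi> w \<partial>Q z) / L - c" if "z \<in> space M" for z
  proof -
    interpret prob_space "Q z" using prob_kernel that by simp
    note [measurable_cong] = prob_kernel(2)[OF that]
    have "integrable (Q z) \<phi>"
      by (rule integrable_const_bound[of _ 1]) (use \<phi>01 space_kernel[OF that] in \<open>auto intro!: AE_I2\<close>)
    then show ?thesis by (simp add: prob_space)
  qed
  ultimately have "\<bar>(\<integral>w. \<phi> w \<partial>Q x) / L - (\<integral>w. \<phi> w \<partial>Q y) / L\<bar> \<le> \<epsilon> + \<theta> * (\<gamma> * V x + K) + \<theta> * (\<gamma> * V y + K)"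
    using xy by simp
  then have "\<bar>(\<integral>w. \<phi> w \<partial>Q x) - (\<integral>w. \<phi> w \<partial>Q y)\<bar> / L \<le> \<epsilon> + \<theta> * (\<gamma> * V x + K) + \<theta> * (\<gamma> * V y + K)"
    using L by (simp add: diff_divide_distrib[symmetric] abs_divide)
  then show ?thesis using L by (simp add: field_simps)
qed

text \<open>The Hairer-Mattingly argument for the cost \<open>D x y = 1 + \<theta> * V x + \<theta> * V y\<close>: where \<open>V x + V y\<close>
  is large, the drift condition contracts \<open>D\<close>; on the sublevel set \<open>V x + V y \<le> R\<close> the overlap
  lowers the term 1. With \<open>2 * \<theta> * K = \<delta> / 2\<close> the drift spends only half of what the overlap gains.\<close>

theorem harris:
  assumes V: "V \<in> borel_measurable M" and Vpos: "\<And>z. z \<in> space M \<Longrightarrow> 0 \<le> V z"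
    and drift: "\<And>z. z \<in> space M \<Longrightarrow> (\<integral>\<^sup>+w. ennreal (V w) \<partial>Q z) \<le> ennreal (\<gamma> * V z + K)"
    and \<gamma>: "0 \<le> \<gamma>" "\<gamma> < 1" "0 < K"
    and overlap: "\<And>R. \<exists>\<delta>>0. \<forall>x\<in>space M. \<forall>y\<in>space M. V x + V y \<le> R \<longrightarrow>
      (\<forall>A\<in>sets M. \<bar>measure (Q x) A - measure (Q y) A\<bar> \<le> 1 - \<delta>)"
    and z0: "z0 \<in> space M"
  obtains \<pi> where "unique_invariant_law d Q \<pi>"
    "(\<integral>\<^sup>+w. ennreal (V w) \<partial>\<pi>) \<le> ennreal (V z0 + K / (1 - \<gamma>))"
proof -
  define R where "R = 4 * K / (1 - \<gamma>)"
  have R: "0 < R" "2 * K = (1 - \<gamma>) / 2 * R" using \<gamma> by (auto simp: R_def)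
  obtain \<delta> where \<delta>: "0 < \<delta>" and ov: "\<And>x y A. x \<in> space M \<Longrightarrow> y \<in> space M \<Longrightarrow> V x + V y \<le> R \<Longrightarrow> A \<in> sets M \<Longrightarrow>
      \<bar>measure (Q x) A - measure (Q y) A\<bar> \<le> 1 - \<delta>"
    using overlap[of R] by blast
  define \<theta> where "\<theta> = \<delta> / (4 * K)"
  have \<theta>: "0 < \<theta>" "2 * \<theta> * K = \<delta> / 2" using \<delta> \<gamma> by (auto simp: \<theta>_def)
  define \<rho>1 where "\<rho>1 = (1 + (1 + \<gamma>) / 2 * (\<theta> * R)) / (1 + \<theta> * R)"
  define \<rho> where "\<rho> = max \<rho>1 (max (1 - \<delta> / 2) ((1 + \<gamma>) / 2))"
  have tR: "0 < \<theta> * R" using \<theta> R by simp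
  have "(1 + \<gamma>) / 2 * (\<theta> * R) < 1 * (\<theta> * R)" using tR \<gamma> by (intro mult_strict_right_mono) auto
  then have "\<rho>1 < 1" using tR by (simp add: \<rho>1_def divide_simps)
  then have \<rho>: "0 < \<rho>" "\<rho> < 1" using \<gamma> \<delta> by (auto simp: \<rho>_def less_max_iff_disj)
  define D where "D x y = 1 + \<theta> * V x + \<theta> * V y" for x y
  have contr: "\<bar>(\<integral>w. \<phi> w \<partial>Q x) - (\<integral>w. \<phi> w \<partial>Q y)\<bar> \<le> L * \<rho> * D x y"
    if "\<phi> \<in> borel_measurable M" "\<And>x. x \<in> space M \<Longrightarrow> 0 \<le> \<phi> x \<and> \<phi> x \<le> (1::real)" "0 < L"
      "\<And>x y. x \<in> space M \<Longrightarrow> y \<in> space M \<Longrightarrow> \<bar>\<phi> x - \<phi> y\<bar> \<le> L * D x y" "x \<in> space M" "y \<in> space M" for \<phi> L x y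
  proof -
    define S where "S = V x + V y"
    have S0: "0 \<le> S" using Vpos that by (simp add: S_def)
    define \<epsilon> where "\<epsilon> = (if S \<le> R then 1 - \<delta> else 1)"
    have *: "\<bar>measure (Q x) A - measure (Q y) A\<bar> \<le> \<epsilon>" if A: "A \<in> sets M" for A
    proof (cases "S \<le> R")
      case True
      then show ?thesis using ov[OF \<open>x \<in> space M\<close> \<open>y \<in> space M\<close> _ A] by (simp add: \<epsilon>_def S_def)
    next
      case False
      interpret x: prob_space "Q x" using prob_kernel \<open>x \<in> space M\<close> by simp
      interpret y: prob_space "Q y" using prob_kernel \<open>y \<in> space M\<close> by simp
      have "\<bar>measure (Q x) A - measure (Q y) A\<bar> \<le> 1"
        using x.prob_le_1[of A] y.prob_le_1[of A] measure_nonneg[of "Q x" A] measure_nonneg[of "Q y" A] by linarith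
      then show ?thesis using False by (simp add: \<epsilon>_def)
    qed
    have "\<bar>(\<integral>w. \<phi> w \<partial>Q x) - (\<integral>w. \<phi> w \<partial>Q y)\<bar> \<le> L * (\<epsilon> + \<theta> * (\<gamma> * V x + K) + \<theta> * (\<gamma> * V y + K))"
      by (rule harris_step[OF V Vpos drift _ _ _ \<open>0 < L\<close>]) (use that \<gamma> \<theta> * in \<open>auto simp: D_def\<close>)
    also have "\<epsilon> + \<theta> * (\<gamma> * V x + K) + \<theta> * (\<gamma> * V y + K) = \<epsilon> + \<gamma> * (\<theta> * S) + 2 * \<theta> * K"
      by (simp add: S_def algebra_simps)
    also have "\<epsilon> + \<gamma> * (\<theta> * S) + 2 * \<theta> * K \<le> \<rho> * (1 + \<theta> * S)"
    proof (cases "S \<le> R")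
      case True
      have "\<gamma> * (\<theta> * S) \<le> \<rho> * (\<theta> * S)"
        using \<gamma> S0 \<theta> by (intro mult_right_mono) (auto simp: \<rho>_def le_max_iff_disj)
      moreover have "1 - \<delta> / 2 \<le> \<rho>" by (simp add: \<rho>_def)
      moreover have "\<epsilon> = 1 - \<delta>" using True by (simp add: \<epsilon>_def)
      ultimately show ?thesis using \<theta> unfolding distrib_left by linarith
    next
      case False
      have "2 * \<theta> * K = \<theta> * (2 * K)" by simp
      also have "\<dots> = (1 - \<gamma>) / 2 * (\<theta> * R)" unfolding R(2) by simp
      also have "\<dots> \<le> (1 - \<gamma>) / 2 * (\<theta> * S)"
        using False \<theta> \<gamma> by (intro mult_left_mono) auto
      finally have "1 + \<gamma> * (\<theta> * S) + 2 * \<theta> * K \<le> 1 + (1 + \<gamma>) / 2 * (\<theta> * S)"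
        by (simp add: field_simps)
      also have "\<dots> = 1 + (1 + \<gamma>) / 2 * (\<theta> * R) + (1 + \<gamma>) / 2 * (\<theta> * S - \<theta> * R)" by (simp add: field_simps)
      also have "\<dots> = \<rho>1 * (1 + \<theta> * R) + (1 + \<gamma>) / 2 * (\<theta> * S - \<theta> * R)"
        using tR by (simp add: \<rho>1_def)
      also have "\<dots> \<le> \<rho> * (1 + \<theta> * R) + \<rho> * (\<theta> * S - \<theta> * R)"
      proof (intro add_mono mult_right_mono)
        show "\<rho>1 \<le> \<rho>" "(1 + \<gamma>) / 2 \<le> \<rho>" by (simp_all add: \<rho>_def le_max_iff_disj)
      qed (use tR False \<theta> in auto)
      finally show ?thesis using False by (simp add: \<epsilon>_def algebra_simps)
    qed
    finally show ?thesis using that(3) by (simp add: D_def S_def mult.assoc distrib_left add.assoc)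
  qed
  have it: "\<bar>measure (P n x) A - measure (P n y) A\<bar> \<le> 1 * \<rho>^n * D x y"
    if "x \<in> space M" "y \<in> space M" "A \<in> sets M" for n x y A
  proof -
    have "\<bar>measure (P (n+0) x) A - measure (P (n+0) y) A\<bar> \<le> 1 * \<rho>^n * D x y"
    proof (rule kernel_pow_contraction[OF contr])
      fix x y assume xy: "x \<in> space M" "y \<in> space M"
      have "1 \<le> D x y" using Vpos xy \<theta> by (simp add: D_def)
      then show "\<bar>measure (P 0 x) A - measure (P 0 y) A\<bar> \<le> 1 * D x y"
        using measure_kernel_pow_01[OF xy(1), of 0 A] measure_kernel_pow_01[OF xy(2), of 0 A] by linarith
    qed (use that \<rho> in auto)
    then show ?thesis by simp
  qed
  show ?thesis
  proof (rule unique_invariant_law_of_contraction[OF V Vpos drift, where D="max 1 \<theta>" and \<rho>=\<rho>])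
    fix n x y A assume *: "x \<in> space M" "y \<in> space M" "A \<in> sets M"
    have "\<theta> * V x \<le> max 1 \<theta> * V x" "\<theta> * V y \<le> max 1 \<theta> * V y"
      by (intro mult_right_mono Vpos * max.cobounded2)+
    then have "D x y \<le> max 1 \<theta> * (1 + V x + V y)" unfolding D_def distrib_left by linarith
    then have "\<rho>^n * D x y \<le> \<rho>^n * (max 1 \<theta> * (1 + V x + V y))" using \<rho> by (intro mult_left_mono) auto
    then show "\<bar>measure (P n x) A - measure (P n y) A\<bar> \<le> max 1 \<theta> * \<rho>^n * (1 + V x + V y)"
      using it[OF *, of n] by (simp add: mult_ac)
  qed (use \<gamma> \<rho> z0 that in auto)
qed

end

section \<open>Translating the Gaussian noise\<close>

definition shift :: "nat \<Rightarrow> point \<Rightarrow> point \<Rightarrow> point" where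
  "shift d a \<xi> = (\<lambda>i\<in>{..<d}. \<xi> i + a i)"

lemma prob_std_normal: "prob_space std_normal_distribution"
  by (rule prob_space_normal_density) simp

lemma prob_std_gauss: "prob_space (std_gauss d)"
  unfolding std_gauss_def by (rule prob_space_PiM) (rule prob_std_normal)

lemma sets_std_gauss[measurable_cong]: "sets (std_gauss d) = sets (PiM {..<d} (\<lambda>_. borel))"
  unfolding std_gauss_def by (rule sets_PiM_cong) auto

lemma space_std_gauss: "space (std_gauss d) = vecs d"
  unfolding vecs_def std_gauss_def by (simp add: space_PiM)

lemma distr_std_normal_plus:
  "distr std_normal_distribution borel (\<lambda>x. x + a) =
   density std_normal_distribution (\<lambda>x. ennreal (exp (a * x - a\<^sup>2 / 2)))"
proof (rule measure_eqI)
  fix A assume "A \<in> sets (distr std_normal_distribution borel (\<lambda>x. x + a))"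
  then have [measurable]: "A \<in> sets borel" by simp
  have "emeasure (distr std_normal_distribution borel (\<lambda>x. x + a)) A
      = (\<integral>\<^sup>+y. indicator A y \<partial>distr std_normal_distribution borel (\<lambda>x. x + a))"
    by simp
  also have "\<dots> = (\<integral>\<^sup>+x. ennreal (std_normal_density x) * indicator A (x + a) \<partial>lborel)"
    by (subst nn_integral_distr) (auto simp: nn_integral_density)
  also have "\<dots> = (\<integral>\<^sup>+x. ennreal (std_normal_density x) * indicator A (x + a) \<partial>distr lborel borel ((+) (-a)))"
    by (subst lborel_distr_plus) simp
  also have "\<dots> = (\<integral>\<^sup>+y. ennreal (std_normal_density (y - a)) * indicator A y \<partial>lborel)"
    by (subst nn_integral_distr) (auto simp: add_ac)
  also have "\<dots> = (\<integral>\<^sup>+y. ennreal (std_normal_density y) * (ennreal (exp (a * y - a\<^sup>2 / 2)) * indicator A y) \<partial>lborel)"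
  proof (rule nn_integral_cong)
    fix y
    have "- (y - a)\<^sup>2 / 2 = - y\<^sup>2 / 2 + (a * y - a\<^sup>2 / 2)"
      by (simp add: power2_eq_square field_simps)
    then have "std_normal_density (y - a) = std_normal_density y * exp (a * y - a\<^sup>2 / 2)"
      by (simp add: std_normal_density_def exp_add[symmetric])
    then show "ennreal (std_normal_density (y - a)) * indicator A y
      = ennreal (std_normal_density y) * (ennreal (exp (a * y - a\<^sup>2 / 2)) * indicator A y)"
      by (simp add: ennreal_mult mult.assoc)
  qed
  also have "\<dots> = emeasure (density std_normal_distribution (\<lambda>x. ennreal (exp (a * x - a\<^sup>2 / 2)))) A"
    by (simp add: emeasure_density nn_integral_density)
  finally show "emeasure (distr std_normal_distribution borel (\<lambda>x. x + a)) A = \<dots>" .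
qed simp

lemma prob_std_normal_plus: "prob_space (distr std_normal_distribution borel (\<lambda>x. x + a))"
  by (rule prob_space.prob_space_distr[OF prob_std_normal]) simp

lemma nn_integral_exp_std_normal:
  "(\<integral>\<^sup>+x. ennreal (exp (a * x - a\<^sup>2 / 2)) \<partial>std_normal_distribution) = 1"
proof -
  have "emeasure (density std_normal_distribution (\<lambda>x. ennreal (exp (a * x - a\<^sup>2 / 2)))) UNIV = 1"
    using prob_space.emeasure_space_1[OF prob_std_normal_plus[of a]] by (simp add: distr_std_normal_plus)
  then show ?thesis by (simp add: emeasure_density)
qed

lemma measurable_shift[measurable]: "shift d a \<in> std_gauss d \<rightarrow>\<^sub>M std_gauss d"
proof -
  have "shift d a \<in> PiM {..<d} (\<lambda>_. borel) \<rightarrow>\<^sub>M PiM {..<d} (\<lambda>_. borel)"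
    unfolding shift_def by measurable
  then show ?thesis by (simp cong: measurable_cong_sets add: sets_std_gauss)
qed

text \<open>The square root of the Cameron-Martin density of the translate by \<open>a\<close>. Its integral is the
  Hellinger affinity of the two Gaussians.\<close>

definition tilt :: "nat \<Rightarrow> point \<Rightarrow> point \<Rightarrow> real" where
  "tilt d a \<xi> = (\<Prod>i<d. exp (a i * \<xi> i / 2 - (a i)\<^sup>2 / 4))"

lemma measurable_tilt[measurable]: "tilt d a \<in> borel_measurable (std_gauss d)"
proof -
  have "tilt d a \<in> borel_measurable (PiM {..<d} (\<lambda>_. borel))"
    unfolding tilt_def by measurable
  then show ?thesis by (simp cong: measurable_cong_sets add: sets_std_gauss)
qed

lemma tilt_pos: "0 < tilt d a \<xi>" by (simp add: tilt_def prod_pos)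

lemma tilt_sq: "(tilt d a \<xi>)\<^sup>2 = (\<Prod>i<d. exp (a i * \<xi> i - (a i)\<^sup>2 / 2))"
  unfolding tilt_def power2_eq_square prod.distrib[symmetric]
  by (intro prod.cong refl) (simp add: exp_add[symmetric] power2_eq_square field_simps)

lemma distr_std_gauss_shift:
  "distr (std_gauss d) (std_gauss d) (shift d a) = density (std_gauss d) (\<lambda>\<xi>. ennreal ((tilt d a \<xi>)\<^sup>2))"
proof -
  define N where "N i = distr std_normal_distribution borel (\<lambda>x. x + a i)" for i
  have prN: "prob_space (N i)" for i unfolding N_def by (rule prob_std_normal_plus)
  interpret N: product_prob_space N by (rule product_prob_spaceI) (rule prN)
  interpret G: product_prob_space "\<lambda>_::nat. std_normal_distribution"
    by (rule product_prob_spaceI) (rule prob_std_normal)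
  have setsN: "sets (PiM {..<d} N) = sets (PiM {..<d} (\<lambda>_. borel))"
    by (rule sets_PiM_cong) (auto simp: N_def)
  have 1: "distr (std_gauss d) (std_gauss d) (shift d a) = PiM {..<d} N"
  proof (rule N.PiM_eqI)
    show "sets (distr (std_gauss d) (std_gauss d) (shift d a)) = PiM {..<d} N"
      by (simp add: setsN sets_std_gauss)
    fix A assume A: "\<And>i. i \<in> {..<d} \<Longrightarrow> A i \<in> sets (N i)"
    then have A'[measurable]: "A i \<in> sets borel" if "i < d" for i using that by (simp add: N_def)
    have PA: "Pi\<^sub>E {..<d} A \<in> sets (std_gauss d)"
      unfolding sets_std_gauss by (rule sets_PiM_I_finite) (use A' in auto)
    have "shift d a -` Pi\<^sub>E {..<d} A \<inter> space (std_gauss d) = Pi\<^sub>E {..<d} (\<lambda>i. {x. x + a i \<in> A i})"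
      by (auto simp: shift_def space_std_gauss vecs_def PiE_def Pi_def)
    then have "emeasure (distr (std_gauss d) (std_gauss d) (shift d a)) (Pi\<^sub>E {..<d} A)
      = emeasure (std_gauss d) (Pi\<^sub>E {..<d} (\<lambda>i. {x. x + a i \<in> A i}))"
      using PA by (subst emeasure_distr) auto
    also have "\<dots> = (\<Prod>i<d. emeasure std_normal_distribution {x. x + a i \<in> A i})"
      unfolding std_gauss_def by (subst G.emeasure_PiM) auto
    also have "\<dots> = (\<Prod>i<d. emeasure (N i) (A i))"
      by (intro prod.cong refl, subst N_def, subst emeasure_distr) (auto simp: vimage_def)
    finally show "emeasure (distr (std_gauss d) (std_gauss d) (shift d a)) (Pi\<^sub>E {..<d} A) = (\<Prod>i<d. emeasure (N i) (A i))" .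
  qed simp
  have 2: "density (std_gauss d) (\<lambda>\<xi>. ennreal ((tilt d a \<xi>)\<^sup>2)) = PiM {..<d} N"
  proof (rule N.PiM_eqI)
    show "sets (density (std_gauss d) (\<lambda>\<xi>. ennreal ((tilt d a \<xi>)\<^sup>2))) = PiM {..<d} N"
      by (simp add: setsN sets_std_gauss)
    fix A assume A: "\<And>i. i \<in> {..<d} \<Longrightarrow> A i \<in> sets (N i)"
    then have A'[measurable]: "A i \<in> sets borel" if "i < d" for i using that by (simp add: N_def)
    have PA[measurable]: "Pi\<^sub>E {..<d} A \<in> sets (std_gauss d)"
      unfolding sets_std_gauss by (rule sets_PiM_I_finite) (use A' in auto)
    have "emeasure (density (std_gauss d) (\<lambda>\<xi>. ennreal ((tilt d a \<xi>)\<^sup>2))) (Pi\<^sub>E {..<d} A)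
      = (\<integral>\<^sup>+\<xi>. ennreal ((tilt d a \<xi>)\<^sup>2) * indicator (Pi\<^sub>E {..<d} A) \<xi> \<partial>std_gauss d)"
      by (subst emeasure_density) auto
    also have "\<dots> = (\<integral>\<^sup>+\<xi>. (\<Prod>i<d. ennreal (exp (a i * \<xi> i - (a i)\<^sup>2 / 2)) * indicator (A i) (\<xi> i)) \<partial>std_gauss d)"
    proof (rule nn_integral_cong)
      fix \<xi> assume "\<xi> \<in> space (std_gauss d)"
      then have "indicator (Pi\<^sub>E {..<d} A) \<xi> = (\<Prod>i<d. indicator (A i) (\<xi> i) :: ennreal)"
        by (auto simp: indicator_def space_std_gauss vecs_def PiE_def Pi_def prod_zero_iff)
      then show "ennreal ((tilt d a \<xi>)\<^sup>2) * indicator (Pi\<^sub>E {..<d} A) \<xi> =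
        (\<Prod>i<d. ennreal (exp (a i * \<xi> i - (a i)\<^sup>2 / 2)) * indicator (A i) (\<xi> i))"
        by (simp add: tilt_sq prod.distrib prod_ennreal)
    qed
    also have "\<dots> = (\<Prod>i<d. \<integral>\<^sup>+x. ennreal (exp (a i * x - (a i)\<^sup>2 / 2)) * indicator (A i) x \<partial>std_normal_distribution)"
      unfolding std_gauss_def by (rule G.product_nn_integral_prod) auto
    also have "\<dots> = (\<Prod>i<d. emeasure (N i) (A i))"
      by (intro prod.cong refl) (auto simp: N_def distr_std_normal_plus emeasure_density)
    finally show "emeasure (density (std_gauss d) (\<lambda>\<xi>. ennreal ((tilt d a \<xi>)\<^sup>2))) (Pi\<^sub>E {..<d} A) = (\<Prod>i<d. emeasure (N i) (A i))" .
  qed simp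
  show ?thesis using 1 2 by simp
qed

lemma nn_integral_tilt:
  "(\<integral>\<^sup>+\<xi>. ennreal (tilt d a \<xi>) \<partial>std_gauss d) = ennreal (exp (- (\<Sum>i<d. (a i)\<^sup>2) / 8))"
proof -
  interpret G: product_prob_space "\<lambda>_::nat. std_normal_distribution"
    by (rule product_prob_spaceI) (rule prob_std_normal)
  have "(\<integral>\<^sup>+\<xi>. ennreal (tilt d a \<xi>) \<partial>std_gauss d)
      = (\<integral>\<^sup>+\<xi>. (\<Prod>i<d. ennreal (exp (a i * \<xi> i / 2 - (a i)\<^sup>2 / 4))) \<partial>std_gauss d)"
    by (simp add: tilt_def prod_ennreal)
  also have "\<dots> = (\<Prod>i<d. \<integral>\<^sup>+x. ennreal (exp (a i * x / 2 - (a i)\<^sup>2 / 4)) \<partial>std_normal_distribution)"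
    unfolding std_gauss_def by (rule G.product_nn_integral_prod) auto
  also have "\<dots> = (\<Prod>i<d. ennreal (exp (- (a i)\<^sup>2 / 8)))"
  proof (rule prod.cong)
    fix i
    have "exp (a i * x / 2 - (a i)\<^sup>2 / 4) = exp (- (a i)\<^sup>2 / 8) * exp ((a i / 2) * x - (a i / 2)\<^sup>2 / 2)" for x
      unfolding exp_add[symmetric] by (simp add: power2_eq_square field_simps)
    then have "(\<integral>\<^sup>+x. ennreal (exp (a i * x / 2 - (a i)\<^sup>2 / 4)) \<partial>std_normal_distribution)
       = (\<integral>\<^sup>+x. ennreal (exp (- (a i)\<^sup>2 / 8)) * ennreal (exp ((a i / 2) * x - (a i / 2)\<^sup>2 / 2)) \<partial>std_normal_distribution)"
      by (simp add: ennreal_mult)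
    also have "\<dots> = ennreal (exp (- (a i)\<^sup>2 / 8)) * (\<integral>\<^sup>+x. ennreal (exp ((a i / 2) * x - (a i / 2)\<^sup>2 / 2)) \<partial>std_normal_distribution)"
      by (rule nn_integral_cmult) simp
    finally show "(\<integral>\<^sup>+x. ennreal (exp (a i * x / 2 - (a i)\<^sup>2 / 4)) \<partial>std_normal_distribution) = ennreal (exp (- (a i)\<^sup>2 / 8))"
      by (simp only: nn_integral_exp_std_normal mult_1_right)
  qed simp
  also have "\<dots> = ennreal (exp (- (\<Sum>i<d. (a i)\<^sup>2) / 8))"
    by (simp add: prod_ennreal exp_sum[symmetric] sum_negf[symmetric] sum_divide_distrib)
  finally show ?thesis .
qed

lemma integral_le_sqrt:
  assumes "prob_space P" and [measurable]: "H \<in> borel_measurable P" "A \<in> sets P" and "\<And>x. 0 \<le> H x"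
    and H2: "integrable P (\<lambda>x. (H x)\<^sup>2)"
  shows "(\<integral>x. H x * indicator A x \<partial>P) \<le> sqrt (measure P A * (\<integral>x. (H x)\<^sup>2 * indicator A x \<partial>P))"
proof -
  interpret prob_space P by fact
  define q where "q = (\<integral>x. (H x)\<^sup>2 * indicator A x \<partial>P)"
  define I where "I = (\<integral>\<^sup>+x. ennreal (H x * indicator A x) \<partial>P)"
  have q0: "0 \<le> q" unfolding q_def by (intro Bochner_Integration.integral_nonneg) auto
  have "I\<^sup>2 = (\<integral>\<^sup>+x. ennreal (H x * indicator A x) * indicator A x \<partial>P)\<^sup>2"
    unfolding I_def by (intro arg_cong[where f="\<lambda>x. x\<^sup>2"] nn_integral_cong) (auto simp: indicator_def)
  also have "\<dots> \<le> (\<integral>\<^sup>+x. (ennreal (H x * indicator A x))\<^sup>2 \<partial>P) * (\<integral>\<^sup>+x. (indicator A x)\<^sup>2 \<partial>P)"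
    by (rule Cauchy_Schwarz_nn_integral) measurable
  also have "(\<integral>\<^sup>+x. (ennreal (H x * indicator A x))\<^sup>2 \<partial>P) = (\<integral>\<^sup>+x. ennreal ((H x)\<^sup>2 * indicator A x) \<partial>P)"
    by (intro nn_integral_cong) (auto simp: indicator_def ennreal_power assms(4))
  also have "\<dots> = ennreal q"
    unfolding q_def by (intro nn_integral_eq_integral integrable_real_mult_indicator H2) auto
  also have "(\<integral>\<^sup>+x. (indicator A x)\<^sup>2 \<partial>P) = (\<integral>\<^sup>+x. indicator A x \<partial>P)"
    by (intro nn_integral_cong) (auto simp: indicator_def)
  also have "\<dots> = ennreal (measure P A)" by (simp add: emeasure_eq_measure)
  finally have le: "I\<^sup>2 \<le> ennreal (measure P A * q)" by (simp add: ennreal_mult q0 mult.commute)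
  then have "I \<noteq> \<top>" by (auto simp: power2_eq_square top_unique)
  then obtain s where s: "I = ennreal s" "0 \<le> s" by (cases I) auto
  then have "s\<^sup>2 \<le> measure P A * q" using le q0 by (simp add: ennreal_power ennreal_le_iff)
  moreover have "(\<integral>x. H x * indicator A x \<partial>P) = s"
    using s assms(4) integral_eq_nn_integral[of "\<lambda>x. H x * indicator A x" P] by (simp add: I_def)
  ultimately show ?thesis by (simp add: q_def real_le_rsqrt)
qed

text \<open>The total variation distance of \<open>P\<close> and \<open>H\<^sup>2 P\<close> is at most \<open>sqrt (1 - e\<^sup>2)\<close> with \<open>e\<close> their affinity.
  Cauchy-Schwarz on \<open>A\<close> and on its complement reduces this to two Bernoulli laws. Unlike a bound
  from relative entropy by Pinsker, it stays below 1 for arbitrarily distant Gaussians, which the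
  overlap condition of Harris' theorem needs.\<close>

lemma density_affinity_bound:
  assumes "prob_space P" "prob_space (density P (\<lambda>x. ennreal ((H x)\<^sup>2)))"
    and [measurable]: "H \<in> borel_measurable P" "A \<in> sets P" and Hpos: "\<And>x. 0 \<le> H x"
    and e: "(\<integral>\<^sup>+x. ennreal (H x) \<partial>P) = ennreal e" "0 \<le> e"
  shows "\<bar>measure P A - measure (density P (\<lambda>x. ennreal ((H x)\<^sup>2))) A\<bar> \<le> sqrt (1 - e\<^sup>2)"
proof -
  define R where "R = density P (\<lambda>x. ennreal ((H x)\<^sup>2))"
  interpret P: prob_space P by fact
  interpret R: prob_space R unfolding R_def by fact
  have one: "(\<integral>\<^sup>+x. ennreal ((H x)\<^sup>2) \<partial>P) = 1"
    using R.emeasure_space_1 by (simp add: R_def emeasure_density cong: nn_integral_cong)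
  have H2: "integrable P (\<lambda>x. (H x)\<^sup>2)" by (rule integrableI_nonneg) (auto simp: one)
  have iH: "integrable P H" by (rule integrableI_nonneg) (use Hpos e in auto)
  have He: "(\<integral>x. H x \<partial>P) = e" using integral_eq_nn_integral[of H P] e Hpos by simp
  have RB: "measure R B = (\<integral>x. (H x)\<^sup>2 * indicator B x \<partial>P)" if [measurable]: "B \<in> sets P" for B
  proof -
    have "emeasure R B = (\<integral>\<^sup>+x. ennreal ((H x)\<^sup>2 * indicator B x) \<partial>P)"
      unfolding R_def by (subst emeasure_density) (auto intro!: nn_integral_cong simp: indicator_def)
    then have "measure R B = enn2real (\<integral>\<^sup>+x. ennreal ((H x)\<^sup>2 * indicator B x) \<partial>P)" by (simp add: measure_def)
    also have "\<dots> = (\<integral>x. (H x)\<^sup>2 * indicator B x \<partial>P)" by (rule integral_eq_nn_integral[symmetric]) auto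
    finally show ?thesis .
  qed
  define p q where "p = measure P A" and "q = measure R A"
  have pc: "measure P (space P - A) = 1 - p" unfolding p_def by (rule P.prob_compl) simp
  have "measure R (space R - A) = 1 - q" unfolding q_def by (rule R.prob_compl) (simp add: R_def)
  then have qc: "measure R (space P - A) = 1 - q" by (simp add: R_def)
  have "e = (\<integral>x. H x * indicator A x + H x * indicator (space P - A) x \<partial>P)"
    unfolding He[symmetric] by (rule Bochner_Integration.integral_cong) (auto simp: indicator_def)
  also have "\<dots> = (\<integral>x. H x * indicator A x \<partial>P) + (\<integral>x. H x * indicator (space P - A) x \<partial>P)"
    by (intro Bochner_Integration.integral_add integrable_real_mult_indicator iH) auto
  also have "\<dots> \<le> sqrt (p * q) + sqrt ((1 - p) * (1 - q))"
    using integral_le_sqrt[OF assms(1) _ _ Hpos H2, of A] integral_le_sqrt[OF assms(1) _ _ Hpos H2, of "space P - A"]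
    by (simp add: RB[symmetric] pc qc p_def q_def)
  finally have "e\<^sup>2 \<le> (sqrt (p * q) + sqrt ((1 - p) * (1 - q)))\<^sup>2" using e(2) by (rule power_mono)
  also have "\<dots> \<le> 1 - (p - q)\<^sup>2"
  proof -
    have r: "0 \<le> p" "p \<le> 1" "0 \<le> q" "q \<le> 1" unfolding p_def q_def by auto
    define u v where "u = sqrt (p * (1 - p))" and "v = sqrt (q * (1 - q))"
    have u2: "u\<^sup>2 = p * (1 - p)" and v2: "v\<^sup>2 = q * (1 - q)" using r by (simp_all add: u_def v_def)
    have uv: "sqrt (p * q) * sqrt ((1 - p) * (1 - q)) = u * v"
      unfolding u_def v_def real_sqrt_mult[symmetric] by (simp add: mult_ac)
    have "(sqrt (p * q) + sqrt ((1 - p) * (1 - q)))\<^sup>2 = p * q + (1 - p) * (1 - q) + 2 * (u * v)"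
      unfolding power2_sum using r uv by simp
    moreover have "2 * (u * v) \<le> p * (1 - p) + q * (1 - q)"
      using zero_le_power2[of "u - v"] u2 v2 by (simp add: power2_diff)
    ultimately show ?thesis by (simp add: power2_eq_square algebra_simps)
  qed
  finally have "(p - q)\<^sup>2 \<le> 1 - e\<^sup>2" by simp
  then have "sqrt ((p - q)\<^sup>2) \<le> sqrt (1 - e\<^sup>2)" by (rule real_sqrt_le_mono)
  then show ?thesis by (simp add: p_def q_def R_def)
qed

text \<open>The smoothing effect of the noise: if the images of two states under a step coincide after a translation
  \<open>(a, b)\<close> of the noise, their transition laws are this close.\<close>

lemma gauss_pair_shift_bound:
  assumes f[measurable]: "f \<in> std_gauss d \<Otimes>\<^sub>M std_gauss d \<rightarrow>\<^sub>M N" and A[measurable]: "A \<in> sets N"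
  shows "\<bar>measure (distr (std_gauss d \<Otimes>\<^sub>M std_gauss d) N f) A
        - measure (distr (std_gauss d \<Otimes>\<^sub>M std_gauss d) N (\<lambda>(\<xi>, \<eta>). f (shift d a \<xi>, shift d b \<eta>))) A\<bar>
      \<le> sqrt (1 - exp (- ((\<Sum>i<d. (a i)\<^sup>2) + (\<Sum>i<d. (b i)\<^sup>2)) / 4))"
proof -
  define G where "G = std_gauss d"
  define H where "H = (\<lambda>(\<xi>, \<eta>). tilt d a \<xi> * tilt d b \<eta>)"
  define S where "S = (\<lambda>(\<xi>, \<eta>). (shift d a \<xi>, shift d b \<eta>))"
  have [measurable]: "tilt d c \<in> borel_measurable G" "shift d c \<in> G \<rightarrow>\<^sub>M G" for c unfolding G_def by measurable
  have fG[measurable]: "f \<in> G \<Otimes>\<^sub>M G \<rightarrow>\<^sub>M N" using f by (simp add: G_def)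
  have S[measurable]: "S \<in> G \<Otimes>\<^sub>M G \<rightarrow>\<^sub>M G \<Otimes>\<^sub>M G" unfolding S_def by measurable
  have Hm[measurable]: "H \<in> borel_measurable (G \<Otimes>\<^sub>M G)" unfolding H_def by measurable
  interpret G: prob_space G unfolding G_def by (rule prob_std_gauss)
  have prs: "prob_space (distr G G (shift d c))" for c by (rule G.prob_space_distr) simp
  have sf: "sigma_finite_measure (distr G G (shift d c))" for c
    using prs[of c] by (simp add: prob_space_imp_sigma_finite)
  have SD: "distr G G (shift d c) = density G (\<lambda>\<xi>. ennreal ((tilt d c \<xi>)\<^sup>2))" for c
    unfolding G_def by (rule distr_std_gauss_shift)
  have "distr (G \<Otimes>\<^sub>M G) (G \<Otimes>\<^sub>M G) S = distr G G (shift d a) \<Otimes>\<^sub>M distr G G (shift d b)"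
    unfolding S_def by (rule pair_measure_distr[symmetric]) (auto intro: sf)
  also have "\<dots> = density (G \<Otimes>\<^sub>M G) (\<lambda>(\<xi>, \<eta>). ennreal ((tilt d a \<xi>)\<^sup>2) * ennreal ((tilt d b \<eta>)\<^sup>2))"
    unfolding SD by (rule pair_measure_density) (auto simp: SD[symmetric] sf G.sigma_finite_measure_axioms)
  also have "\<dots> = density (G \<Otimes>\<^sub>M G) (\<lambda>x. ennreal ((H x)\<^sup>2))"
    by (rule arg_cong[where f="density _"]) (auto simp: H_def fun_eq_iff ennreal_mult power_mult_distrib)
  finally have D: "distr (G \<Otimes>\<^sub>M G) (G \<Otimes>\<^sub>M G) S = density (G \<Otimes>\<^sub>M G) (\<lambda>x. ennreal ((H x)\<^sup>2))" .
  define B where "B = f -` A \<inter> space (G \<Otimes>\<^sub>M G)"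
  have B[measurable]: "B \<in> sets (G \<Otimes>\<^sub>M G)" unfolding B_def by measurable
  interpret GG: pair_prob_space G G ..
  have pr: "prob_space (G \<Otimes>\<^sub>M G)" by (rule GG.prob_space_axioms)
  have 1: "measure (distr (G \<Otimes>\<^sub>M G) N f) A = measure (G \<Otimes>\<^sub>M G) B"
    unfolding B_def by (rule measure_distr) auto
  have "distr (G \<Otimes>\<^sub>M G) N (f \<circ> S) = distr (distr (G \<Otimes>\<^sub>M G) (G \<Otimes>\<^sub>M G) S) N f"
    by (rule distr_distr[symmetric]) auto
  then have 2: "measure (distr (G \<Otimes>\<^sub>M G) N (f \<circ> S)) A = measure (density (G \<Otimes>\<^sub>M G) (\<lambda>x. ennreal ((H x)\<^sup>2))) B"
    unfolding D by (simp add: measure_distr B_def)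
  have e: "(\<integral>\<^sup>+x. ennreal (H x) \<partial>(G \<Otimes>\<^sub>M G)) = ennreal (exp (- ((\<Sum>i<d. (a i)\<^sup>2) + (\<Sum>i<d. (b i)\<^sup>2)) / 8))"
  proof -
    have "(\<integral>\<^sup>+x. ennreal (H x) \<partial>(G \<Otimes>\<^sub>M G)) = (\<integral>\<^sup>+\<xi>. \<integral>\<^sup>+\<eta>. ennreal (tilt d a \<xi>) * ennreal (tilt d b \<eta>) \<partial>G \<partial>G)"
      by (subst G.nn_integral_fst[symmetric])
         (auto simp: H_def ennreal_mult less_imp_le[OF tilt_pos] intro!: nn_integral_cong)
    also have "\<dots> = (\<integral>\<^sup>+\<xi>. ennreal (tilt d a \<xi>) \<partial>G) * (\<integral>\<^sup>+\<eta>. ennreal (tilt d b \<eta>) \<partial>G)"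
      by (simp add: nn_integral_cmult nn_integral_multc)
    also have "\<dots> = ennreal (exp (- ((\<Sum>i<d. (a i)\<^sup>2) + (\<Sum>i<d. (b i)\<^sup>2)) / 8))"
      unfolding G_def nn_integral_tilt
      by (simp add: ennreal_mult[symmetric] exp_add[symmetric] add_divide_distrib)
    finally show ?thesis .
  qed
  have prD: "prob_space (density (G \<Otimes>\<^sub>M G) (\<lambda>x. ennreal ((H x)\<^sup>2)))"
    unfolding D[symmetric] by (rule GG.prob_space_distr) simp
  have "\<bar>measure (G \<Otimes>\<^sub>M G) B - measure (density (G \<Otimes>\<^sub>M G) (\<lambda>x. ennreal ((H x)\<^sup>2))) B\<bar>
     \<le> sqrt (1 - (exp (- ((\<Sum>i<d. (a i)\<^sup>2) + (\<Sum>i<d. (b i)\<^sup>2)) / 8))\<^sup>2)"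
    by (rule density_affinity_bound[OF pr prD _ _ _ e])
       (auto simp: H_def less_imp_le[OF tilt_pos])
  also have "(exp (- ((\<Sum>i<d. (a i)\<^sup>2) + (\<Sum>i<d. (b i)\<^sup>2)) / 8))\<^sup>2 = exp (- ((\<Sum>i<d. (a i)\<^sup>2) + (\<Sum>i<d. (b i)\<^sup>2)) / 4)"
    by (simp add: power2_eq_square exp_add[symmetric])
  finally have "\<bar>measure (distr (G \<Otimes>\<^sub>M G) N f) A - measure (distr (G \<Otimes>\<^sub>M G) N (f \<circ> S)) A\<bar>
     \<le> sqrt (1 - exp (- ((\<Sum>i<d. (a i)\<^sup>2) + (\<Sum>i<d. (b i)\<^sup>2)) / 4))" unfolding 1 2 .
  moreover have "f \<circ> S = (\<lambda>(\<xi>, \<eta>). f (shift d a \<xi>, shift d b \<eta>))" by (auto simp: S_def)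
  ultimately show ?thesis by (simp add: G_def)
qed

lemma gauss_second_moment:
  assumes "i < d"
  shows "(\<integral>\<^sup>+\<xi>. ennreal ((\<xi> i)\<^sup>2) \<partial>std_gauss d) = 1"
proof -
  have "(\<integral>\<^sup>+\<xi>. ennreal ((\<xi> i)\<^sup>2) \<partial>std_gauss d) = (\<integral>\<^sup>+x. ennreal (x\<^sup>2) \<partial>distr (std_gauss d) std_normal_distribution (\<lambda>\<xi>. \<xi> i))"
    by (subst nn_integral_distr) (use assms in \<open>auto simp: std_gauss_def\<close>)
  also have "distr (std_gauss d) std_normal_distribution (\<lambda>\<xi>. \<xi> i) = std_normal_distribution"
    unfolding std_gauss_def by (rule distr_PiM_component) (use assms prob_std_normal in auto)
  also have "(\<integral>\<^sup>+x. ennreal (x\<^sup>2) \<partial>std_normal_distribution) = (\<integral>\<^sup>+x. ennreal (std_normal_density x * x\<^sup>2) \<partial>lborel)"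
    by (subst nn_integral_density) (auto simp: ennreal_mult)
  also have "\<dots> = ennreal (\<integral>x. std_normal_density x * x\<^sup>2 \<partial>lborel)"
    by (rule nn_integral_eq_integral) (auto intro: integrable_std_normal_moment)
  also have "(\<integral>x. std_normal_density x * x\<^sup>2 \<partial>lborel) = 1"
    using integral_std_normal_moment_even[of 1] by (simp add: fact_2)
  finally show ?thesis by simp
qed

section \<open>The chain in heavy-ball form\<close>

lemma space_phase: "space (phase_space d) = vecs d \<times> vecs d"
  by (simp add: phase_space_def space_pair_measure space_PiM vecs_def)

text \<open>Continuity on \<open>vecs d\<close> refers to the product topology over all of \<open>nat\<close>, the measurable space to
  the coordinates below \<open>d\<close> only; the remaining coordinates are constant on \<open>vecs d\<close>.\<close>

lemma borel_measurable_vecs: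
  assumes "continuous_on (vecs d) f"
  shows "f \<in> borel_measurable (PiM {..<d} (\<lambda>_. borel :: real measure))"
proof -
  have id: "(\<lambda>x. x) \<in> PiM {..<d} (\<lambda>_. borel :: real measure) \<rightarrow>\<^sub>M borel"
  proof (rule measurable_coordinatewise_then_product)
    fix i
    show "(\<lambda>x. x i) \<in> borel_measurable (PiM {..<d} (\<lambda>_. borel :: real measure))"
    proof (cases "i < d")
      case True
      then show ?thesis by (intro measurable_component_singleton) simp
    next
      case False
      then have "(\<lambda>x. x i) \<in> borel_measurable (PiM {..<d} (\<lambda>_. borel :: real measure)) \<longleftrightarrow>
        (\<lambda>x::point. undefined :: real) \<in> borel_measurable (PiM {..<d} (\<lambda>_. borel :: real measure))"
        by (intro measurable_cong) (auto simp: space_PiM PiE_def extensional_def)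
      then show ?thesis by simp
    qed
  qed
  have "(\<lambda>x. x) \<in> PiM {..<d} (\<lambda>_. borel :: real measure) \<rightarrow>\<^sub>M restrict_space borel (vecs d)"
    by (rule measurable_restrict_space2[OF _ id]) (simp add: space_PiM vecs_def)
  from measurable_compose[OF this borel_measurable_continuous_on_restrict[OF assms]] show ?thesis .
qed

locale obabo_chain =
  fixes d :: nat and U :: "point \<Rightarrow> real" and h \<gamma> :: real
  assumes h: "0 < h" and \<gamma>: "0 < \<gamma>"
    and cont_partial: "\<And>i. i < d \<Longrightarrow> continuous_on (vecs d) (partial i U)"
begin

definition "r = exp (- \<gamma> * h / 2)"
definition "\<beta> = r\<^sup>2"
definition "\<sigma> = sqrt (1 - \<beta>)"
definition "\<alpha> = (1 + \<beta>) * h\<^sup>2 / 2"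
abbreviation "g \<equiv> grad d U"
abbreviation "GG \<equiv> std_gauss d \<Otimes>\<^sub>M std_gauss d"

text \<open>The deterministic displacement of the position in the next step. In the coordinates position and
  \<open>mom\<close>, a step is a heavy-ball iteration with momentum factor \<open>\<beta>\<close> and step size \<open>\<alpha>\<close> driven by the gradient at
  the new position only (\<open>step_pos\<close>, \<open>step_mom\<close>).\<close>

definition mom :: "phase \<Rightarrow> point" where
  "mom z i = r * h * snd z i - h\<^sup>2 / 2 * g (fst z) i"

definition step :: "point \<Rightarrow> point \<Rightarrow> phase \<Rightarrow> phase" where
  "step = obabo_step d U h \<gamma>"

lemma r_pos: "0 < r" "r < 1" using h \<gamma> by (auto simp: r_def)
lemma \<beta>_pos: "0 < \<beta>" "\<beta> < 1" using r_pos by (auto simp: \<beta>_def power_less_one_iff)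
lemma \<sigma>_pos: "0 < \<sigma>" "\<sigma>\<^sup>2 = 1 - \<beta>" using \<beta>_pos by (auto simp: \<sigma>_def)
lemma \<alpha>_pos: "0 < \<alpha>" using \<beta>_pos h by (simp add: \<alpha>_def)

lemma fst_step:
  "fst (step \<xi> \<eta> z) = (\<lambda>i\<in>{..<d}. fst z i + mom z i + h * \<sigma> * \<xi> i)"
  by (cases z) (auto simp: step_def obabo_step_def Let_def mom_def fun_eq_iff r_def \<sigma>_def \<beta>_def
      power2_eq_square algebra_simps)

lemma snd_step:
  "snd (step \<xi> \<eta> z) = (\<lambda>i\<in>{..<d}. r * ((fst (step \<xi> \<eta> z) i - fst z i) / h - h / 2 * g (fst (step \<xi> \<eta> z)) i) + \<sigma> * \<eta> i)"
proof -
  have "snd (step \<xi> \<eta> z) = (\<lambda>i\<in>{..<d}. r * ((r * snd z i + \<sigma> * \<xi> i - h / 2 * g (fst z) i) - h / 2 * g (fst (step \<xi> \<eta> z)) i) + \<sigma> * \<eta> i)"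
  proof -
    define va where "va = (\<lambda>i\<in>{..<d}. r * snd z i + \<sigma> * \<xi> i)"
    define vb where "vb = (\<lambda>i\<in>{..<d}. va i - h / 2 * g (fst z) i)"
    define x' where "x' = (\<lambda>i\<in>{..<d}. fst z i + h * vb i)"
    define vc where "vc = (\<lambda>i\<in>{..<d}. vb i - h / 2 * g x' i)"
    have "step \<xi> \<eta> z = (x', \<lambda>i\<in>{..<d}. r * vc i + \<sigma> * \<eta> i)"
      unfolding vc_def x'_def vb_def va_def
      by (cases z) (simp only: step_def obabo_step_def Let_def prod.case fst_conv snd_conv r_def \<sigma>_def \<beta>_def)
    then show ?thesis by (auto simp: vc_def vb_def va_def fun_eq_iff)
  qed
  also have "\<dots> = (\<lambda>i\<in>{..<d}. r * ((fst (step \<xi> \<eta> z) i - fst z i) / h - h / 2 * g (fst (step \<xi> \<eta> z)) i) + \<sigma> * \<eta> i)"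
  proof (rule restrict_ext)
    fix i assume "i \<in> {..<d}"
    then have "(fst (step \<xi> \<eta> z) i - fst z i) / h = r * snd z i + \<sigma> * \<xi> i - h / 2 * g (fst z) i"
      using h by (simp add: fst_step mom_def power2_eq_square field_simps)
    then show "r * ((r * snd z i + \<sigma> * \<xi> i - h / 2 * g (fst z) i) - h / 2 * g (fst (step \<xi> \<eta> z)) i) + \<sigma> * \<eta> i
      = r * ((fst (step \<xi> \<eta> z) i - fst z i) / h - h / 2 * g (fst (step \<xi> \<eta> z)) i) + \<sigma> * \<eta> i" by simp
  qed
  finally show ?thesis .
qed

lemma step_pos: "i < d \<Longrightarrow> fst (step \<xi> \<eta> z) i = fst z i + mom z i + h * \<sigma> * \<xi> i"
  by (simp add: fst_step)

lemma step_mom: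
  assumes "i < d"
  shows "mom (step \<xi> \<eta> z) i = \<beta> * (mom z i + h * \<sigma> * \<xi> i) - \<alpha> * g (fst (step \<xi> \<eta> z)) i + r * h * \<sigma> * \<eta> i"
proof -
  have "mom (step \<xi> \<eta> z) i = r * h * (r * ((fst (step \<xi> \<eta> z) i - fst z i) / h - h / 2 * g (fst (step \<xi> \<eta> z)) i) + \<sigma> * \<eta> i)
     - h\<^sup>2 / 2 * g (fst (step \<xi> \<eta> z)) i"
    using assms by (subst mom_def, subst snd_step) simp
  also have "\<dots> = \<beta> * (fst (step \<xi> \<eta> z) i - fst z i) - \<alpha> * g (fst (step \<xi> \<eta> z)) i + r * h * \<sigma> * \<eta> i"
    using h by (simp add: \<beta>_def \<alpha>_def power2_eq_square field_simps)
  finally show ?thesis by (simp add: step_pos assms)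
qed

lemma step_vecs: "step \<xi> \<eta> z \<in> space (phase_space d)"
proof -
  have "fst (step \<xi> \<eta> z) \<in> vecs d" "snd (step \<xi> \<eta> z) \<in> vecs d"
    by (subst fst_step snd_step, simp add: vecs_def)+
  then show ?thesis by (simp add: space_phase mem_Times_iff)
qed

lemma measurable_grad[measurable]: "g \<in> PiM {..<d} (\<lambda>_. borel) \<rightarrow>\<^sub>M PiM {..<d} (\<lambda>_. borel)"
  unfolding grad_def using borel_measurable_vecs[OF cont_partial] by (intro measurable_restrict) auto

lemma measurable_component_std_gauss[measurable]:
  "i < d \<Longrightarrow> (\<lambda>\<xi>. \<xi> i) \<in> borel_measurable (std_gauss d)"
proof -
  assume "i < d"
  then have "(\<lambda>\<xi>. \<xi> i) \<in> borel_measurable (PiM {..<d} (\<lambda>_. borel :: real measure))"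
    by (intro measurable_component_singleton) simp
  then show ?thesis by (simp cong: measurable_cong_sets add: sets_std_gauss)
qed

lemma measurable_fst_phase[measurable]: "i < d \<Longrightarrow> (\<lambda>z. fst z i) \<in> borel_measurable (phase_space d)"
  unfolding phase_space_def by measurable

lemma measurable_snd_phase[measurable]: "i < d \<Longrightarrow> (\<lambda>z. snd z i) \<in> borel_measurable (phase_space d)"
  unfolding phase_space_def by measurable

lemma measurable_mom[measurable]: "i < d \<Longrightarrow> (\<lambda>z. mom z i) \<in> borel_measurable (phase_space d)"
proof -
  assume [measurable]: "i < d"
  have "(\<lambda>z. g (fst z) i) \<in> borel_measurable (phase_space d)"
    unfolding phase_space_def by measurable
  then show ?thesis unfolding mom_def by measurable
qed

lemma measurable_step[measurable]:
  "(\<lambda>(z, \<xi>, \<eta>). step \<xi> \<eta> z) \<in> phase_space d \<Otimes>\<^sub>M GG \<rightarrow>\<^sub>M phase_space d"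
proof -
  let ?P = "PiM {..<d} (\<lambda>_. borel :: real measure)"
  let ?N = "phase_space d \<Otimes>\<^sub>M GG"
  have 1[measurable]: "(\<lambda>u. fst (step (fst (snd u)) (snd (snd u)) (fst u))) \<in> ?N \<rightarrow>\<^sub>M ?P"
    unfolding fst_step by (rule measurable_restrict) measurable
  have [measurable]: "(\<lambda>u. g (fst (step (fst (snd u)) (snd (snd u)) (fst u)))) \<in> ?N \<rightarrow>\<^sub>M ?P"
    by measurable
  have 2[measurable]: "(\<lambda>u. snd (step (fst (snd u)) (snd (snd u)) (fst u))) \<in> ?N \<rightarrow>\<^sub>M ?P"
    by (subst snd_step, rule measurable_restrict) measurable
  have "(\<lambda>u. step (fst (snd u)) (snd (snd u)) (fst u)) = (\<lambda>u. (fst (step (fst (snd u)) (snd (snd u)) (fst u)), snd (step (fst (snd u)) (snd (snd u)) (fst u))))"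
    by simp
  also have "\<dots> \<in> ?N \<rightarrow>\<^sub>M phase_space d" unfolding phase_space_def[of d]
    using 1 2 unfolding phase_space_def by (rule measurable_Pair)
  finally show ?thesis by (simp add: case_prod_unfold)
qed

lemma measurable_step_noise[measurable]:
  "z \<in> space (phase_space d) \<Longrightarrow> (\<lambda>(\<xi>, \<eta>). step \<xi> \<eta> z) \<in> GG \<rightarrow>\<^sub>M phase_space d"
  using measurable_compose[OF measurable_Pair1' measurable_step] by (simp add: case_prod_unfold)

abbreviation "Q \<equiv> obabo d U h \<gamma>"

lemma obabo_eq: "Q z = distr GG (phase_space d) (\<lambda>(\<xi>, \<eta>). step \<xi> \<eta> z)"
  by (simp add: obabo_def step_def)

lemma prob_GG: "prob_space GG"
  by (intro prob_space_pair prob_std_gauss)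

lemma kernel_obabo: "Q \<in> phase_space d \<rightarrow>\<^sub>M prob_algebra (phase_space d)"
proof -
  have "(\<lambda>z. distr GG (phase_space d) ((\<lambda>z (\<xi>, \<eta>). step \<xi> \<eta> z) z)) \<in> phase_space d \<rightarrow>\<^sub>M prob_algebra (phase_space d)"
  proof (rule measurable_distr_prob_space2)
    show "(\<lambda>_. GG) \<in> phase_space d \<rightarrow>\<^sub>M prob_algebra GG"
      by (rule measurable_const) (simp add: space_prob_algebra prob_GG)
    show "(\<lambda>(z, u). case u of (\<xi>, \<eta>) \<Rightarrow> step \<xi> \<eta> z) \<in> phase_space d \<Otimes>\<^sub>M GG \<rightarrow>\<^sub>M phase_space d"
      using measurable_step by simp
  qed
  also have "(\<lambda>z. distr GG (phase_space d) ((\<lambda>z (\<xi>, \<eta>). step \<xi> \<eta> z) z)) = Q"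
    by (simp add: fun_eq_iff obabo_eq)
  finally show ?thesis .
qed

sublocale phase_kernel d Q by unfold_locales (rule kernel_obabo)

lemma nn_integral_obabo:
  assumes "z \<in> space M" "f \<in> borel_measurable M"
  shows "(\<integral>\<^sup>+w. f w \<partial>Q z) = (\<integral>\<^sup>+(\<xi>, \<eta>). f (step \<xi> \<eta> z) \<partial>GG)"
  unfolding obabo_eq using assms by (subst nn_integral_distr) (auto simp: case_prod_unfold)

lemma integral_obabo:
  fixes f :: "phase \<Rightarrow> real"
  assumes "z \<in> space M" "f \<in> borel_measurable M"
  shows "(\<integral>w. f w \<partial>Q z) = (\<integral>u. f (step (fst u) (snd u) z) \<partial>GG)"
  unfolding obabo_eq using assms by (subst integral_distr) (auto simp: case_prod_unfold)

text \<open>The squared length of the noise translation that makes the images of \<open>z\<close> and \<open>w\<close> coincide: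
  the first noise must absorb the difference of the next mean positions. The position reached is then
  the same, so only the difference of the displacements, through the two old positions, is left for
  the second noise.\<close>

definition gap :: "phase \<Rightarrow> phase \<Rightarrow> real" where
  "gap z w = (\<Sum>i<d. ((fst z i + mom z i - (fst w i + mom w i)) / (h * \<sigma>))\<^sup>2)
           + (\<Sum>i<d. (r * (fst z i - fst w i) / (h * \<sigma>))\<^sup>2)"

lemma obabo_overlap:
  assumes z: "z \<in> space M" and w: "w \<in> space M" and A: "A \<in> sets M"
  shows "\<bar>measure (Q z) A - measure (Q w) A\<bar> \<le> sqrt (1 - exp (- gap z w / 4))"
proof -
  define a where "a i = (fst w i + mom w i - (fst z i + mom z i)) / (h * \<sigma>)" for i
  define b where "b i = r * (fst z i - fst w i) / (h * \<sigma>)" for i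
  have eq: "step (shift d a \<xi>) (shift d b \<eta>) z = step \<xi> \<eta> w" for \<xi> \<eta>
  proof -
    have 1: "fst (step (shift d a \<xi>) (shift d b \<eta>) z) = fst (step \<xi> \<eta> w)"
      unfolding fst_step by (rule restrict_ext) (use h \<sigma>_pos in \<open>simp add: shift_def a_def field_simps\<close>)
    moreover have "snd (step (shift d a \<xi>) (shift d b \<eta>) z) = snd (step \<xi> \<eta> w)"
      unfolding snd_step[of _ _ z] snd_step[of _ _ w] 1
      by (rule restrict_ext) (use h \<sigma>_pos in \<open>simp add: shift_def b_def field_simps\<close>)
    ultimately show ?thesis by (rule prod_eqI)
  qed
  have Qw: "Q w = distr GG M (\<lambda>(\<xi>, \<eta>). (\<lambda>(\<xi>, \<eta>). step \<xi> \<eta> z) (shift d a \<xi>, shift d b \<eta>))"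
    by (simp add: obabo_eq eq)
  have "(\<Sum>i<d. (a i)\<^sup>2) + (\<Sum>i<d. (b i)\<^sup>2) = gap z w"
    unfolding gap_def a_def b_def by (simp add: power_divide power2_commute)
  then show ?thesis
    using gauss_pair_shift_bound[OF measurable_step_noise[OF z] A, of a b]
    unfolding Qw obabo_eq[of z] by (simp only:)
qed

lemma nn_integral_noise:
  "(\<integral>\<^sup>+u. ennreal ((\<Sum>i<d. (fst u i)\<^sup>2) + (\<Sum>i<d. (snd u i)\<^sup>2)) \<partial>GG) = ennreal (2 * real d)"
proof -
  interpret G: prob_space "std_gauss d" by (rule prob_std_gauss)
  interpret PP: pair_prob_space "std_gauss d" "std_gauss d" ..
  have "(\<integral>\<^sup>+u. ennreal ((\<Sum>i<d. (fst u i)\<^sup>2) + (\<Sum>i<d. (snd u i)\<^sup>2)) \<partial>GG)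
     = (\<integral>\<^sup>+u. (\<Sum>i<d. ennreal ((fst u i)\<^sup>2)) + (\<Sum>i<d. ennreal ((snd u i)\<^sup>2)) \<partial>GG)"
    by (intro nn_integral_cong) (simp add: sum_ennreal sum_nonneg)
  also have "\<dots> = (\<Sum>i<d. \<integral>\<^sup>+u. ennreal ((fst u i)\<^sup>2) \<partial>GG) + (\<Sum>i<d. \<integral>\<^sup>+u. ennreal ((snd u i)\<^sup>2) \<partial>GG)"
    by (subst nn_integral_add) (auto simp: nn_integral_sum simp del: sum_ennreal)
  also have "\<dots> = (\<Sum>i<d. 1) + (\<Sum>i<d. 1)"
  proof (intro arg_cong2[where f="(+)"] sum.cong refl)
    fix i assume i: "i \<in> {..<d}"
    have "(\<integral>\<^sup>+u. ennreal ((fst u i)\<^sup>2) \<partial>GG) = (\<integral>\<^sup>+\<xi>. \<integral>\<^sup>+\<eta>. ennreal ((\<xi> i)\<^sup>2) \<partial>std_gauss d \<partial>std_gauss d)"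
      by (subst G.nn_integral_fst[symmetric]) (use i in auto)
    then show "(\<integral>\<^sup>+u. ennreal ((fst u i)\<^sup>2) \<partial>GG) = 1"
      using i by (simp add: G.emeasure_space_1 gauss_second_moment)
    have "(\<integral>\<^sup>+u. ennreal ((snd u i)\<^sup>2) \<partial>GG) = (\<integral>\<^sup>+\<xi>. \<integral>\<^sup>+\<eta>. ennreal ((\<eta> i)\<^sup>2) \<partial>std_gauss d \<partial>std_gauss d)"
      by (subst G.nn_integral_fst[symmetric]) (use i in auto)
    then show "(\<integral>\<^sup>+u. ennreal ((snd u i)\<^sup>2) \<partial>GG) = 1"
      using i by (simp add: G.emeasure_space_1 gauss_second_moment)
  qed
  also have "\<dots> = ennreal (2 * real d)" by (simp add: ennreal_of_nat_eq_real_of_nat flip: ennreal_plus)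
  finally show ?thesis .
qed

text \<open>Drift conditions are checked for every realization of the noise; the expectation of its squared
  norm is \<open>2 * d\<close>.\<close>

lemma drift_of_pathwise:
  assumes z: "z \<in> space M" and V[measurable]: "V \<in> borel_measurable M"
    and le: "\<And>\<xi> \<eta>. V (step \<xi> \<eta> z) \<le> a + c * ((\<Sum>i<d. (\<xi> i)\<^sup>2) + (\<Sum>i<d. (\<eta> i)\<^sup>2))" and ac: "0 \<le> a" "0 \<le> c"
  shows "(\<integral>\<^sup>+w. ennreal (V w) \<partial>Q z) \<le> ennreal (a + 2 * c * real d)"
proof -
  interpret GG: prob_space GG by (rule prob_GG)
  have "(\<integral>\<^sup>+w. ennreal (V w) \<partial>Q z) \<le>
    (\<integral>\<^sup>+u. ennreal a + ennreal c * ennreal ((\<Sum>i<d. (fst u i)\<^sup>2) + (\<Sum>i<d. (snd u i)\<^sup>2)) \<partial>GG)"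
    by (subst nn_integral_obabo[OF z])
       (use ac le in \<open>auto intro!: nn_integral_mono ennreal_leI simp: case_prod_unfold ennreal_mult[symmetric]
          ennreal_plus[symmetric] sum_nonneg simp del: ennreal_plus\<close>)
  also have "\<dots> = ennreal a + ennreal c * ennreal (2 * real d)"
    by (subst nn_integral_add) (auto simp: nn_integral_cmult nn_integral_noise GG.emeasure_space_1)
  also have "\<dots> = ennreal (a + 2 * c * real d)"
    using ac by (simp add: ennreal_mult[symmetric] ennreal_plus[symmetric] mult_ac del: ennreal_plus)
  finally show ?thesis .
qed

end

section \<open>Strongly convex potentials with Lipschitz gradient\<close>

definition dot :: "nat \<Rightarrow> point \<Rightarrow> point \<Rightarrow> real" where
  "dot d a b = (\<Sum>i<d. a i * b i)"

definition line :: "nat \<Rightarrow> point \<Rightarrow> point \<Rightarrow> real \<Rightarrow> point" where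
  "line d x e t = (\<lambda>i\<in>{..<d}. x i + t * e i)"

lemma line_vecs[simp]: "line d x e t \<in> vecs d" by (simp add: line_def vecs_def)

lemma line_line: "line d (line d x e t) e s = line d x e (t + s)"
  by (auto simp: line_def fun_eq_iff algebra_simps)

lemma tendsto_fun_iff:
  fixes f :: "'b \<Rightarrow> 'i \<Rightarrow> real"
  shows "(f \<longlongrightarrow> l) F \<longleftrightarrow> (\<forall>i. ((\<lambda>c. f c i) \<longlongrightarrow> l i) F)"
  using limitin_componentwise[of "\<lambda>_::'i. euclidean::real topology" UNIV f l F]
  by (simp add: euclidean_product_topology)

text \<open>Continuous partial derivatives give directional derivatives, for functions on coordinate vectors:
  move one coordinate at a time, and apply the mean value theorem to each of the \<open>d\<close> moves.\<close>

lemma C1_has_derivative_along_line_0: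
  assumes diff: "\<And>i x. i < d \<Longrightarrow> x \<in> vecs d \<Longrightarrow> (\<lambda>t. f (x(i := t))) differentiable at (x i)"
    and cont: "\<And>i. i < d \<Longrightarrow> continuous_on (vecs d) (partial i f)" and x: "x \<in> vecs d"
  shows "((\<lambda>t. f (line d x e t)) has_real_derivative (\<Sum>i<d. e i * partial i f x)) (at 0)"
proof -
  define z where "z k s = (\<lambda>i\<in>{..<d}. if i < k then x i + s * e i else x i)" for k :: nat and s
  have z0: "z 0 s = x" for s using x by (auto simp: z_def vecs_def fun_eq_iff PiE_def extensional_def)
  have zd: "z d s = line d x e s" for s by (auto simp: z_def line_def)
  have zv: "z k s \<in> vecs d" for k s by (simp add: z_def vecs_def)
  have ex: "\<exists>p. p \<in> vecs d \<and> (\<forall>i. \<bar>p i - x i\<bar> \<le> \<bar>s\<bar> * \<bar>e i\<bar>) \<and> f (z (Suc k) s) - f (z k s) = s * (e k * partial k f p)"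
    if k: "k < d" for k s
  proof -
    define G where "G t = f ((z k s)(k := t))" for t
    have up: "(z k s)(k := t) \<in> vecs d" for t
      using zv[of k s] k by (auto simp: vecs_def PiE_def extensional_def)
    have der: "(G has_real_derivative partial k f ((z k s)(k := t))) (at t)" for t
    proof -
      have "(\<lambda>u. f (((z k s)(k := t))(k := u))) differentiable at (((z k s)(k := t)) k)"
        by (rule diff[OF k up])
      then have "G differentiable at t" by (simp add: G_def[abs_def])
      then have "(G has_real_derivative deriv G t) (at t)"
        by (metis real_differentiable_def DERIV_imp_deriv)
      then show ?thesis by (simp add: partial_def G_def[abs_def])
    qed
    have zx: "z k s k = x k" using k by (simp add: z_def)
    have G1: "G (x k + s * e k) = f (z (Suc k) s)"
    proof -
      have "(z k s)(k := x k + s * e k) = z (Suc k) s"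
        using k by (auto simp: z_def fun_eq_iff less_Suc_eq)
      then show ?thesis by (simp add: G_def)
    qed
    have G0: "G (x k) = f (z k s)" using zx unfolding G_def by (metis fun_upd_triv)
    have "\<exists>t. \<bar>t - x k\<bar> \<le> \<bar>s * e k\<bar> \<and> G (x k + s * e k) - G (x k) = s * e k * partial k f ((z k s)(k := t))"
    proof -
      consider "s * e k = 0" | "s * e k > 0" | "s * e k < 0" by linarith
      then show ?thesis
      proof cases
        case 1 then show ?thesis by (intro exI[of _ "x k"]) auto
      next
        case 2
        obtain t where "x k < t" "t < x k + s * e k"
          "G (x k + s * e k) - G (x k) = (x k + s * e k - x k) * partial k f ((z k s)(k := t))"
          using MVT2[of "x k" "x k + s * e k" G "\<lambda>t. partial k f ((z k s)(k := t))"] 2 der by auto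
        then show ?thesis by (intro exI[of _ t]) auto
      next
        case 3
        obtain t where "x k + s * e k < t" "t < x k"
          "G (x k) - G (x k + s * e k) = (x k - (x k + s * e k)) * partial k f ((z k s)(k := t))"
          using MVT2[of "x k + s * e k" "x k" G "\<lambda>t. partial k f ((z k s)(k := t))"] 3 der by auto
        then show ?thesis by (intro exI[of _ t]) auto
      qed
    qed
    then obtain t where t: "\<bar>t - x k\<bar> \<le> \<bar>s * e k\<bar>" "f (z (Suc k) s) - f (z k s) = s * e k * partial k f ((z k s)(k := t))"
      using G0 G1 by auto
    have "\<bar>((z k s)(k := t)) i - x i\<bar> \<le> \<bar>s\<bar> * \<bar>e i\<bar>" for i
      using t(1) x by (auto simp: z_def abs_mult vecs_def PiE_def extensional_def)
    then show ?thesis using up t(2) by (intro exI[of _ "(z k s)(k := t)"]) (simp add: mult.assoc)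
  qed
  then obtain p where p: "\<And>k s. k < d \<Longrightarrow> p k s \<in> vecs d" "\<And>k s i. k < d \<Longrightarrow> \<bar>p k s i - x i\<bar> \<le> \<bar>s\<bar> * \<bar>e i\<bar>"
      "\<And>k s. k < d \<Longrightarrow> f (z (Suc k) s) - f (z k s) = s * (e k * partial k f (p k s))"
    by metis
  have lim: "((\<lambda>s. partial k f (p k s)) \<longlongrightarrow> partial k f x) (at 0)" if k: "k < d" for k
  proof (rule continuous_on_tendsto_compose[OF cont[OF k] _ x])
    show "(p k \<longlongrightarrow> x) (at 0)"
      unfolding tendsto_fun_iff
    proof
      fix i
      have "((\<lambda>s::real. \<bar>s\<bar> * \<bar>e i\<bar>) \<longlongrightarrow> \<bar>0\<bar> * \<bar>e i\<bar>) (at 0)" by (intro tendsto_intros)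
      then have *: "((\<lambda>s::real. \<bar>s\<bar> * \<bar>e i\<bar>) \<longlongrightarrow> 0) (at 0)" by simp
      have "\<forall>\<^sub>F s in at 0. norm (p k s i - x i) \<le> \<bar>s\<bar> * \<bar>e i\<bar>"
        unfolding real_norm_def by (intro always_eventually allI p(2)[OF k])
      from Lim_null_comparison[OF this *] have "((\<lambda>s. p k s i - x i) \<longlongrightarrow> 0) (at 0)" .
      then show "((\<lambda>s. p k s i) \<longlongrightarrow> x i) (at 0)" by (simp add: LIM_zero_iff)
    qed
    show "\<forall>\<^sub>F s in at 0. p k s \<in> vecs d" using p(1)[OF k] by simp
  qed
  have quot: "(f (line d x e s) - f (line d x e 0)) / s = (\<Sum>k<d. e k * partial k f (p k s))" if "s \<noteq> 0" for s
  proof -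
    have "f (line d x e s) - f x = (\<Sum>k<d. f (z (Suc k) s) - f (z k s))"
      unfolding sum_lessThan_telescope[of "\<lambda>k. f (z k s)" d] z0 zd ..
    also have "\<dots> = s * (\<Sum>k<d. e k * partial k f (p k s))"
      unfolding sum_distrib_left by (intro sum.cong refl p(3)) auto
    finally have "f (line d x e s) - f x = s * (\<Sum>k<d. e k * partial k f (p k s))" .
    moreover have "line d x e 0 = x"
      using x by (auto simp: line_def vecs_def fun_eq_iff PiE_def extensional_def)
    ultimately show ?thesis using that by simp
  qed
  have "((\<lambda>s. \<Sum>k<d. e k * partial k f (p k s)) \<longlongrightarrow> (\<Sum>k<d. e k * partial k f x)) (at 0)"
    by (intro tendsto_intros lim) auto
  then have "((\<lambda>s. (f (line d x e s) - f (line d x e 0)) / s) \<longlongrightarrow> (\<Sum>k<d. e k * partial k f x)) (at 0)"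
    by (rule Lim_transform_eventually) (auto simp: eventually_at_filter quot)
  then show ?thesis by (simp add: has_field_derivative_iff)
qed

lemma C1_has_derivative_along_line:
  assumes C1: "C_k d (Suc 0) f"
  shows "((\<lambda>t. f (line d x e t)) has_real_derivative (\<Sum>i<d. e i * partial i f (line d x e t))) (at t)"
proof -
  have "((\<lambda>s. f (line d (line d x e t) e s)) has_real_derivative (\<Sum>i<d. e i * partial i f (line d x e t))) (at 0)"
    by (rule C1_has_derivative_along_line_0) (use C1 in \<open>simp_all del: fun_upd_apply\<close>)
  then have "((\<lambda>s. f (line d x e (t + s))) has_real_derivative (\<Sum>i<d. e i * partial i f (line d x e t))) (at 0)"
    by (simp add: line_line)
  then show ?thesis
    by (simp add: DERIV_shift[of "\<lambda>s. f (line d x e s)" _ 0 t, symmetric, simplified] add.commute)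
qed

lemma potential_C_k: "U \<in> potentials d \<kappa> \<Longrightarrow> C_k d k U"
  by (simp add: potentials_def smooth_def)

lemma potential_continuous_partial:
  assumes "U \<in> potentials d \<kappa>" "i < d" shows "continuous_on (vecs d) (partial i U)"
proof -
  have "C_k d (Suc (Suc 0)) U" by (rule potential_C_k[OF assms(1)])
  then show ?thesis using assms(2) by auto
qed

lemma sum_scalar_mat: "(\<Sum>i<d. \<Sum>j<d. w i * scalar_mat c i j * w j) = c * (\<Sum>i<d. (w i)\<^sup>2)"
proof -
  have "(\<Sum>i<d. \<Sum>j<d. w i * scalar_mat c i j * w j) = (\<Sum>i<d. \<Sum>j<d. if i = j then c * (w i)\<^sup>2 else 0)"
    by (intro sum.cong refl) (auto simp: scalar_mat_def power2_eq_square)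
  then show ?thesis by (simp add: sum_distrib_left)
qed

lemma potential_second_order:
  assumes U: "U \<in> potentials d \<kappa>" and x: "x \<in> vecs d" and y: "y \<in> vecs d"
  defines "e \<equiv> \<lambda>i. y i - x i"
  shows "U x + dot d (grad d U x) e + 1/2 * dot d e e \<le> U y"
    and "U y \<le> U x + dot d (grad d U x) e + \<kappa>/2 * dot d e e"
proof -
  define \<phi> where "\<phi> t = U (line d x e t)" for t
  define \<phi>1 where "\<phi>1 t = (\<Sum>i<d. e i * partial i U (line d x e t))" for t
  define \<phi>2 where "\<phi>2 t = (\<Sum>i<d. e i * (\<Sum>j<d. e j * partial j (partial i U) (line d x e t)))" for t
  have C2: "C_k d (Suc (Suc 0)) U" by (rule potential_C_k[OF U])
  have d1: "(\<phi> has_real_derivative \<phi>1 t) (at t)" for t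
    unfolding \<phi>_def \<phi>1_def by (rule C1_has_derivative_along_line) (use C2 in auto)
  have d2: "(\<phi>1 has_real_derivative \<phi>2 t) (at t)" for t
    unfolding \<phi>1_def[abs_def] \<phi>2_def
    by (intro DERIV_sum DERIV_cmult C1_has_derivative_along_line) (use C2 in auto)
  have bounds: "dot d e e \<le> \<phi>2 t \<and> \<phi>2 t \<le> \<kappa> * dot d e e" for t
  proof -
    define p where "p = line d x e t"
    have "\<phi>2 t = (\<Sum>i<d. \<Sum>j<d. e i * (e j * partial j (partial i U) p))"
      by (simp add: \<phi>2_def p_def sum_distrib_left)
    also have "\<dots> = (\<Sum>j<d. \<Sum>i<d. e j * hessian U p j i * e i)"
      by (subst sum.swap) (simp add: hessian_def mult_ac)
    finally have H: "\<phi>2 t = (\<Sum>i<d. \<Sum>j<d. e i * hessian U p i j * e j)" .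
    have l: "loewner_le d (scalar_mat 1) (hessian U p)" "loewner_le d (hessian U p) (scalar_mat \<kappa>)"
      using U by (auto simp: potentials_def p_def)
    have "0 \<le> (\<Sum>i<d. \<Sum>j<d. e i * (hessian U p i j - scalar_mat 1 i j) * e j)"
      "0 \<le> (\<Sum>i<d. \<Sum>j<d. e i * (scalar_mat \<kappa> i j - hessian U p i j) * e j)"
      using l by (auto simp: loewner_le_def)
    then show ?thesis
      unfolding H dot_def using sum_scalar_mat[where w=e and d=d]
      by (simp add: left_diff_distrib right_diff_distrib sum_subtractf power2_eq_square)
  qed
  have "\<exists>t>0. t < 1 \<and> \<phi> 1 = (\<Sum>m<2. (if m = 0 then \<phi> else if m = 1 then \<phi>1 else \<phi>2) 0 / fact m * (1 - 0) ^ m)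
      + (if 2 = (0::nat) then \<phi> else if 2 = (1::nat) then \<phi>1 else \<phi>2) t / fact 2 * (1 - 0) ^ 2"
    by (rule Taylor_up[of 2 "\<lambda>m::nat. if m = 0 then \<phi> else if m = 1 then \<phi>1 else \<phi>2" \<phi> 0 1 0])
       (use d1 d2 in \<open>auto simp: less_Suc_eq numeral_2_eq_2\<close>)
  then obtain t where "\<phi> 1 = \<phi> 0 + \<phi>1 0 + \<phi>2 t / 2"
    by (auto simp: numeral_2_eq_2)
  moreover have "line d x e 0 = x" "line d x e 1 = y"
    using x y by (auto simp: line_def e_def vecs_def fun_eq_iff PiE_def extensional_def)
  ultimately have "U y = U x + dot d (grad d U x) e + \<phi>2 t / 2"
    by (simp add: \<phi>_def \<phi>1_def dot_def grad_def mult.commute)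
  then show "U x + dot d (grad d U x) e + 1/2 * dot d e e \<le> U y"
    and "U y \<le> U x + dot d (grad d U x) e + \<kappa>/2 * dot d e e"
    using bounds[of t] by auto
qed

lemma dot_commute: "dot d a b = dot d b a" by (simp add: dot_def mult.commute)
lemma dot_nonneg: "0 \<le> dot d a a" by (simp add: dot_def sum_nonneg)
lemma dot_diff_left: "dot d (\<lambda>i. a i - b i) c = dot d a c - dot d b c"
  by (simp add: dot_def left_diff_distrib sum_subtractf)
lemma dot_diff_right: "dot d c (\<lambda>i. a i - b i) = dot d c a - dot d c b"
  by (simp add: dot_def right_diff_distrib sum_subtractf)

lemma gradient_strongly_monotone:
  assumes U: "U \<in> potentials d \<kappa>" and x: "x \<in> vecs d" and y: "y \<in> vecs d"
  shows "dot d (\<lambda>i. y i - x i) (\<lambda>i. y i - x i) \<le> dot d (\<lambda>i. grad d U y i - grad d U x i) (\<lambda>i. y i - x i)"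
proof -
  define S where "S = dot d (\<lambda>i. y i - x i) (\<lambda>i. y i - x i)"
  have "dot d (\<lambda>i. x i - y i) (\<lambda>i. x i - y i) = S"
    by (simp add: dot_def S_def algebra_simps)
  then have "U x + dot d (grad d U x) (\<lambda>i. y i - x i) + S / 2 \<le> U y" "U y + dot d (grad d U y) (\<lambda>i. x i - y i) + S / 2 \<le> U x"
    using potential_second_order(1)[OF U x y] potential_second_order(1)[OF U y x] by (simp_all add: S_def)
  moreover have "dot d (grad d U y) (\<lambda>i. x i - y i) = - dot d (grad d U y) (\<lambda>i. y i - x i)"
    by (simp add: dot_diff_right)
  ultimately have "S \<le> dot d (\<lambda>i. grad d U y i - grad d U x i) (\<lambda>i. y i - x i)"
    unfolding dot_diff_left by linarith
  then show ?thesis by (simp add: S_def)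
qed

text \<open>Compare \<open>y\<close> with the point that a gradient step of length \<open>1 / \<kappa>\<close> reaches from it, for the potential
  tilted to have its minimum at \<open>x\<close>.\<close>

lemma gradient_gap:
  assumes U: "U \<in> potentials d \<kappa>" and x: "x \<in> vecs d" and y: "y \<in> vecs d" and \<kappa>: "0 < \<kappa>"
  defines "G \<equiv> \<lambda>i. grad d U y i - grad d U x i"
  shows "U x + dot d (grad d U x) (\<lambda>i. y i - x i) + dot d G G / (2 * \<kappa>) \<le> U y"
proof -
  define w where "w = line d y G (- 1 / \<kappa>)"
  have w: "w \<in> vecs d" by (simp add: w_def)
  have wy: "dot d a (\<lambda>i. w i - y i) = - (1 / \<kappa>) * dot d a G" for a
    by (simp add: dot_def w_def line_def sum_distrib_left sum_negf[symmetric] algebra_simps)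
  have wx: "dot d a (\<lambda>i. w i - x i) = dot d a (\<lambda>i. y i - x i) - (1 / \<kappa>) * dot d a G" for a
    using wy[of a] by (simp add: dot_diff_right)
  have ww: "dot d (\<lambda>i. w i - y i) (\<lambda>i. w i - y i) = dot d G G / \<kappa>\<^sup>2"
    by (subst wy, subst dot_commute, subst wy) (simp add: power2_eq_square)
  have 1: "U x + dot d (grad d U x) (\<lambda>i. w i - x i) \<le> U w"
    using potential_second_order(1)[OF U x w] dot_nonneg[of d "\<lambda>i. w i - x i"] by linarith
  have 2: "U w \<le> U y + dot d (grad d U y) (\<lambda>i. w i - y i) + \<kappa> / 2 * dot d (\<lambda>i. w i - y i) (\<lambda>i. w i - y i)"
    by (rule potential_second_order(2)[OF U y w])
  have GG: "dot d G G = dot d (grad d U y) G - dot d (grad d U x) G"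
    by (simp add: G_def dot_diff_left)
  have "U x + dot d (grad d U x) (\<lambda>i. y i - x i) + (1 / \<kappa>) * dot d G G \<le> U y + \<kappa> / 2 * (dot d G G / \<kappa>\<^sup>2)"
    using 1[unfolded wx] 2[unfolded ww, unfolded wy] GG by (simp add: right_diff_distrib diff_divide_distrib)
  moreover have "\<kappa> / 2 * (dot d G G / \<kappa>\<^sup>2) = dot d G G / (2 * \<kappa>)" using \<kappa> by (simp add: power2_eq_square)
  moreover have "(1 / \<kappa>) * dot d G G = 2 * (dot d G G / (2 * \<kappa>))" by simp
  ultimately show ?thesis by linarith
qed

lemma gradient_cocoercive:
  assumes U: "U \<in> potentials d \<kappa>" and x: "x \<in> vecs d" and y: "y \<in> vecs d" and \<kappa>: "0 < \<kappa>"
  defines "G \<equiv> \<lambda>i. grad d U y i - grad d U x i"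
  shows "dot d G G \<le> \<kappa> * dot d G (\<lambda>i. y i - x i)"
proof -
  define S where "S = dot d G G / (2 * \<kappa>)"
  have "dot d (\<lambda>i. grad d U x i - grad d U y i) (\<lambda>i. grad d U x i - grad d U y i) = dot d G G"
    by (simp add: dot_def G_def algebra_simps)
  then have "U x + dot d (grad d U x) (\<lambda>i. y i - x i) + S \<le> U y" "U y + dot d (grad d U y) (\<lambda>i. x i - y i) + S \<le> U x"
    using gradient_gap[OF U x y \<kappa>] gradient_gap[OF U y x \<kappa>] by (simp_all add: G_def S_def)
  moreover have "dot d (grad d U y) (\<lambda>i. x i - y i) = - dot d (grad d U y) (\<lambda>i. y i - x i)"
    by (simp add: dot_diff_right)
  ultimately have "2 * S \<le> dot d G (\<lambda>i. y i - x i)"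
    unfolding G_def dot_diff_left by linarith
  then have "2 * (dot d G G / (2 * \<kappa>)) \<le> dot d G (\<lambda>i. y i - x i)" by (simp add: S_def)
  then show ?thesis using \<kappa> by (simp add: field_simps)
qed

section \<open>Distances of laws\<close>

lemma tv_dist_leI:
  assumes "\<And>A. A \<in> sets (phase_space d) \<Longrightarrow> \<bar>measure \<mu> A - measure \<nu> A\<bar> \<le> \<epsilon>"
  shows "tv_dist d \<mu> \<nu> \<le> \<epsilon>"
  unfolding tv_dist_def by (rule cSUP_least) (use assms in auto)

lemma measurable_sq_dist[measurable]:
  "(\<lambda>p. sq_dist d (fst p) (snd p)) \<in> borel_measurable (phase_space d \<Otimes>\<^sub>M phase_space d)"
  unfolding sq_dist_def phase_space_def by measurable

lemma sq_dist_nonneg: "0 \<le> sq_dist d z w"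
  by (simp add: sq_dist_def sum_nonneg)

lemma square_sum_le:
  fixes u v :: real
  assumes "0 < \<theta>" shows "(u + v)\<^sup>2 \<le> (1 + \<theta>) * u\<^sup>2 + (1 + 1 / \<theta>) * v\<^sup>2"
proof -
  have "0 \<le> (\<theta> * u - v)\<^sup>2 / \<theta>" using assms by simp
  also have "\<dots> = \<theta> * u\<^sup>2 + v\<^sup>2 / \<theta> - 2 * u * v" using assms by (simp add: power2_eq_square field_simps)
  finally show ?thesis by (simp add: power2_eq_square algebra_simps)
qed

lemma square_sum_le2: "(u + v)\<^sup>2 \<le> 2 * u\<^sup>2 + 2 * v\<^sup>2" for u v :: real
  using square_sum_le[of 1 u v] by simp

lemma sum_sq_triangle:
  "(\<Sum>i\<in>I. (a i - c i :: real)\<^sup>2) \<le> 2 * (\<Sum>i\<in>I. (a i - b i)\<^sup>2) + 2 * (\<Sum>i\<in>I. (b i - c i)\<^sup>2)"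
proof -
  have "(a i - c i)\<^sup>2 \<le> 2 * (a i - b i)\<^sup>2 + 2 * (b i - c i)\<^sup>2" for i
    using zero_le_power2[of "(a i - b i) - (b i - c i)"] by (simp add: power2_eq_square algebra_simps)
  then show ?thesis unfolding sum_distrib_left sum.distrib[symmetric] by (intro sum_mono)
qed

lemma sum_sq_add:
  fixes a b :: "'a \<Rightarrow> real"
  shows "(\<Sum>i\<in>I. (a i + c * b i)\<^sup>2) = (\<Sum>i\<in>I. (a i)\<^sup>2) + 2 * c * (\<Sum>i\<in>I. a i * b i) + c\<^sup>2 * (\<Sum>i\<in>I. (b i)\<^sup>2)"
proof -
  have "(a i + c * b i)\<^sup>2 = (a i)\<^sup>2 + 2 * c * (a i * b i) + c\<^sup>2 * (b i)\<^sup>2" for i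
    by (simp add: power2_eq_square algebra_simps)
  then show ?thesis by (simp add: sum.distrib sum_distrib_left)
qed

lemma sum_sq_add_le:
  fixes a b :: "'a \<Rightarrow> real"
  shows "(\<Sum>i\<in>I. (a i + c * b i)\<^sup>2) \<le> 2 * (\<Sum>i\<in>I. (a i)\<^sup>2) + 2 * c\<^sup>2 * (\<Sum>i\<in>I. (b i)\<^sup>2)"
proof -
  have "(a i + c * b i)\<^sup>2 \<le> 2 * (a i)\<^sup>2 + 2 * c\<^sup>2 * (b i)\<^sup>2" for i
    using zero_le_power2[of "a i - c * b i"] by (simp add: power2_eq_square algebra_simps)
  then show ?thesis unfolding sum_distrib_left sum.distrib[symmetric] by (intro sum_mono)
qed

lemma sq_dist_triangle: "sq_dist d z w \<le> 2 * sq_dist d z u + 2 * sq_dist d w u"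
  using sum_sq_triangle[of "fst z" "fst w" "{..<d}" "fst u"] sum_sq_triangle[of "snd z" "snd w" "{..<d}" "snd u"]
  by (simp add: sq_dist_def power2_commute[of "fst u _"] power2_commute[of "snd u _"])

text \<open>A coupling with a Dirac mass has no freedom: every coupling has the same cost, and the product
  is one.\<close>

lemma W2_dirac:
  assumes pr: "prob_space \<pi>" and s[measurable_cong]: "sets \<pi> = sets (phase_space d)" and z: "z \<in> space (phase_space d)"
  defines "I \<equiv> (\<integral>\<^sup>+w. ennreal (sq_dist d z w) \<partial>\<pi>)"
  shows "W2 d (dirac d z) \<pi> = (if I = \<infinity> then \<infinity> else ennreal (sqrt (enn2real I)))"
proof -
  define M where "M = phase_space d"
  have s': "sets \<pi> = sets M" using s by (simp add: M_def)
  have cost: "(\<integral>\<^sup>+p. ennreal (sq_dist d (fst p) (snd p)) \<partial>\<Gamma>) = I" if \<Gamma>: "\<Gamma> \<in> couplings d (dirac d z) \<pi>" for \<Gamma>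
  proof -
    have sG[measurable_cong]: "sets \<Gamma> = sets (M \<Otimes>\<^sub>M M)" and m1: "distr \<Gamma> M fst = return M z" and m2: "distr \<Gamma> M snd = \<pi>"
      using \<Gamma> by (auto simp: couplings_def M_def)
    have [measurable]: "z \<in> space M" using z by (simp add: M_def)
    have [measurable]: "(\<lambda>p. sq_dist d (fst p) (snd p)) \<in> borel_measurable (M \<Otimes>\<^sub>M M)" unfolding M_def by measurable
    have mz: "sq_dist d z \<in> borel_measurable M"
    proof -
      have "(\<lambda>w. sq_dist d (fst (z, w)) (snd (z, w))) \<in> borel_measurable M" by measurable
      then show ?thesis by simp
    qed
    have f0: "(\<integral>\<^sup>+x. ennreal (sq_dist d z x) \<partial>distr \<Gamma> M fst) = 0"
    proof -
      have "sq_dist d z z = 0" by (simp add: sq_dist_def)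
      then show ?thesis unfolding m1 using mz by (subst nn_integral_return) (auto simp: M_def z)
    qed
    have "(\<integral>\<^sup>+p. ennreal (sq_dist d z (fst p)) \<partial>\<Gamma>) = 0"
      using f0 mz by (subst (asm) nn_integral_distr) auto
    then have "AE p in \<Gamma>. ennreal (sq_dist d z (fst p)) = 0"
      using mz by (subst (asm) nn_integral_0_iff_AE) auto
    then have "AE p in \<Gamma>. sq_dist d (fst p) (snd p) = sq_dist d z (snd p)"
    proof eventually_elim
      case (elim p)
      then have "sq_dist d z (fst p) = 0" using sq_dist_nonneg[of d z "fst p"] by simp
      then have "(\<Sum>i<d. (fst z i - fst (fst p) i)\<^sup>2) = 0" "(\<Sum>i<d. (snd z i - snd (fst p) i)\<^sup>2) = 0"
        unfolding sq_dist_def by (smt (verit) sum_nonneg zero_le_power2)+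
      then have "\<forall>i<d. fst z i = fst (fst p) i" "\<forall>i<d. snd z i = snd (fst p) i"
        by (auto simp: sum_nonneg_eq_0_iff)
      then show ?case by (simp add: sq_dist_def)
    qed
    then have "(\<integral>\<^sup>+p. ennreal (sq_dist d (fst p) (snd p)) \<partial>\<Gamma>) = (\<integral>\<^sup>+p. ennreal (sq_dist d z (snd p)) \<partial>\<Gamma>)"
      by (intro nn_integral_cong_AE) auto
    also have "\<dots> = (\<integral>\<^sup>+w. ennreal (sq_dist d z w) \<partial>distr \<Gamma> M snd)"
      using mz by (subst nn_integral_distr) auto
    finally show ?thesis by (simp add: m2 I_def)
  qed
  have "return M z \<Otimes>\<^sub>M \<pi> \<in> couplings d (dirac d z) \<pi>"
  proof -
    interpret p: prob_space \<pi> by fact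
    interpret r: prob_space "return M z" by (rule prob_space_return) (simp add: M_def z)
    interpret pair_prob_space "return M z" \<pi> ..
    have 1: "distr (return M z \<Otimes>\<^sub>M \<pi>) M fst = return M z"
    proof -
      have "distr (return M z \<Otimes>\<^sub>M \<pi>) M fst = distr (return M z \<Otimes>\<^sub>M \<pi>) (return M z) fst"
        by (rule distr_cong) auto
      also have "\<dots> = return M z" by (rule p.distr_pair_fst)
      finally show ?thesis .
    qed
    have 2: "distr (return M z \<Otimes>\<^sub>M \<pi>) M snd = \<pi>"
    proof (rule measure_eqI)
      fix A assume "A \<in> sets (distr (return M z \<Otimes>\<^sub>M \<pi>) M snd)"
      then have A: "A \<in> sets M" by simp
      have [measurable_cong]: "sets (return M z \<Otimes>\<^sub>M \<pi>) = sets (M \<Otimes>\<^sub>M M)"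
        by (rule sets_pair_measure_cong) (simp_all add: s')
      have "snd -` A \<inter> space (return M z \<Otimes>\<^sub>M \<pi>) = space (return M z) \<times> A"
        using sets.sets_into_space[of A \<pi>] A s' by (auto simp: space_pair_measure)
      then have "emeasure (distr (return M z \<Otimes>\<^sub>M \<pi>) M snd) A = emeasure (return M z \<Otimes>\<^sub>M \<pi>) (space (return M z) \<times> A)"
        using A by (subst emeasure_distr) auto
      also have "\<dots> = emeasure (return M z) (space (return M z)) * emeasure \<pi> A"
        by (rule p.emeasure_pair_measure_Times) (use A s' in auto)
      finally show "emeasure (distr (return M z \<Otimes>\<^sub>M \<pi>) M snd) A = emeasure \<pi> A"
        using r.emeasure_space_1 by simp
    qed (simp add: s')
    have "sets (return M z \<Otimes>\<^sub>M \<pi>) = sets (M \<Otimes>\<^sub>M M)"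
      by (rule sets_pair_measure_cong) (simp_all add: s')
    then show ?thesis using 1 2 prob_space_axioms by (simp add: couplings_def M_def)
  qed
  then have "(INF \<Gamma>\<in>couplings d (dirac d z) \<pi>. \<integral>\<^sup>+p. ennreal (sq_dist d (fst p) (snd p)) \<partial>\<Gamma>) = I"
    using cost by (auto intro!: antisym INF_lower2 INF_greatest)
  then show ?thesis by (simp add: W2_def Let_def)
qed

lemma W2_dirac_le:
  assumes pr: "prob_space \<pi>" and s: "sets \<pi> = sets (phase_space d)" and z: "z \<in> space (phase_space d)"
    and le: "(\<integral>\<^sup>+w. ennreal (sq_dist d z w) \<partial>\<pi>) \<le> ennreal B" and B: "0 \<le> B"
  shows "W2 d (dirac d z) \<pi> < \<infinity>" and "enn2real (W2 d (dirac d z) \<pi>) \<le> sqrt B"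
    and "(\<integral>\<^sup>+w. ennreal (sq_dist d z w) \<partial>\<pi>) = ennreal ((enn2real (W2 d (dirac d z) \<pi>))\<^sup>2)"
proof -
  define I where "I = (\<integral>\<^sup>+w. ennreal (sq_dist d z w) \<partial>\<pi>)"
  have fin: "I < \<infinity>" using le by (simp add: I_def order_le_less_trans)
  then have W: "W2 d (dirac d z) \<pi> = ennreal (sqrt (enn2real I))"
    using W2_dirac[OF pr s z] by (auto simp: I_def)
  then show "W2 d (dirac d z) \<pi> < \<infinity>" by simp
  obtain i where i: "I = ennreal i" "0 \<le> i" using fin by (cases I) auto
  then have "i \<le> B" using le B by (simp add: I_def[symmetric] ennreal_le_iff)
  then show "enn2real (W2 d (dirac d z) \<pi>) \<le> sqrt B" using W i by simp
  show "(\<integral>\<^sup>+w. ennreal (sq_dist d z w) \<partial>\<pi>) = ennreal ((enn2real (W2 d (dirac d z) \<pi>))\<^sup>2)"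
    using W i by (simp add: I_def[symmetric])
qed

section \<open>Contraction of the tuned chain\<close>

lemma exp_minus_one_bounds: "1/3 \<le> exp (-1::real)" "exp (-1::real) \<le> 1/2"
proof -
  have "exp (1::real) \<ge> 2" using exp_ge_add_one_self[of 1] by simp
  then show "exp (-1::real) \<le> 1/2" by (simp add: exp_minus field_simps)
  show "1/3 \<le> exp (-1::real)" using exp_le by (simp add: exp_minus field_simps)
qed

text \<open>The contraction estimate after all sums over coordinates have been named. For two trajectories
  driven by the same noise, \<open>ee\<close>, \<open>F\<close>, \<open>GG\<close> are the squared norms of the differences \<open>e\<close> of the new positions,
  \<open>f\<close> of the displacements and \<open>G\<close> of the new gradients; \<open>ef\<close>, \<open>fG\<close>, \<open>S\<close> are inner products. The slow
  direction \<open>e + b f\<close> makes a gradient step of length \<open>\<alpha>'\<close>, which gains \<open>2 \<alpha>' S\<close>, of order \<open>S / \<kappa>\<close>, while \<open>F\<close>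
  is multiplied by \<open>\<beta>\<^sup>2\<close>. The hypothesis on \<open>fG\<close> is the square of \<open>G + 3 \<kappa> f\<close>: the weight 3 balances the cross term
  between these two gains.\<close>

lemma heavy_ball_contraction_scalar:
  fixes \<beta> \<kappa> ee ef F fG GG S :: real
  defines "b \<equiv> \<beta> / (1 - \<beta>)" and "\<alpha> \<equiv> (1 + \<beta>) / (32 * \<kappa>)" and "\<alpha>' \<equiv> (1 + \<beta>) / (32 * \<kappa>) / (1 - \<beta>)"
  assumes \<beta>: "1/3 \<le> \<beta>" "\<beta> \<le> 1/2" and \<kappa>: "1 \<le> \<kappa>"
    and GG: "GG \<le> \<kappa> * S" "0 \<le> GG" and ee: "ee \<le> S" and F: "0 \<le> F"
    and fG: "0 \<le> 9 * \<kappa>\<^sup>2 * F + 6 * \<kappa> * fG + GG" and ef: "0 \<le> ee - 2 * b * ef + b\<^sup>2 * F"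
  shows "(ee + 2 * b * ef + b\<^sup>2 * F) - 2 * \<alpha>' * (S + b * fG) + \<alpha>'\<^sup>2 * GG + (\<beta>\<^sup>2 * F - 2 * \<alpha> * \<beta> * fG + \<alpha>\<^sup>2 * GG)
    \<le> (1 - 1 / (32 * \<kappa>)) * ((ee + 2 * b * ef + b\<^sup>2 * F) + F)"
proof -
  \<comment> \<open>All terms are compared with \<open>F\<close> and with \<open>s\<close>, of which the gradient step gains \<open>s / 8\<close>.\<close>
  define s where "s = S / \<kappa>"
  define YY where "YY = ee + 2 * b * ef + b\<^sup>2 * F"
  have b: "0 \<le> b" "b \<le> 1" using \<beta> by (auto simp: b_def field_simps)
  have \<alpha>: "0 \<le> \<alpha>" "\<alpha> \<le> 3 / 64 / \<kappa>" using \<beta> \<kappa> by (auto simp: \<alpha>_def field_simps)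
  have \<alpha>': "1 / 16 / \<kappa> \<le> \<alpha>'" "\<alpha>' \<le> 3 / 32 / \<kappa>"
  proof -
    define q where "q = (1 + \<beta>) / (1 - \<beta>)"
    have q: "2 \<le> q" "q \<le> 3" using \<beta> by (auto simp: q_def field_simps)
    have "\<alpha>' = q / (32 * \<kappa>)" by (simp add: \<alpha>'_def q_def)
    moreover have "2 / (32 * \<kappa>) \<le> q / (32 * \<kappa>)" "q / (32 * \<kappa>) \<le> 3 / (32 * \<kappa>)"
      by (rule divide_right_mono, use q \<kappa> in simp, use \<kappa> in simp)+
    moreover have "2 / (32 * \<kappa>) = 1 / 16 / \<kappa>" "3 / (32 * \<kappa>) = 3 / 32 / \<kappa>" by simp_all
    ultimately show "1 / 16 / \<kappa> \<le> \<alpha>'" "\<alpha>' \<le> 3 / 32 / \<kappa>" by linarith+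
  qed
  have S0: "0 \<le> S" using GG \<kappa> by (smt (verit) mult_nonneg_nonpos zero_le_mult_iff)
  then have s0: "0 \<le> s" using \<kappa> by (simp add: s_def)
  have Sk: "S = \<kappa> * s" using \<kappa> by (simp add: s_def)
  have fG': "- (2 * fG) \<le> 3 * \<kappa> * F + S / 3"
  proof -
    have "0 \<le> 3 * \<kappa> * (3 * \<kappa> * F + 2 * fG + S / 3)"
      using fG GG(1) by (simp add: power2_eq_square algebra_simps)
    then have "0 \<le> 3 * \<kappa> * F + 2 * fG + S / 3" using \<kappa> by (simp add: zero_le_mult_iff)
    then show ?thesis by simp
  qed
  define m where "m = \<alpha>' * b + \<alpha> * \<beta>"
  have m: "0 \<le> m" "m \<le> 15 / 128 / \<kappa>"
  proof -
    have "0 \<le> \<alpha>'" using \<alpha>' \<kappa> by (smt (verit) divide_nonneg_pos)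
    then show "0 \<le> m" using \<alpha> b \<beta> by (simp add: m_def)
    have "\<alpha>' * b \<le> 3 / 32 / \<kappa> * 1" using \<alpha>' b \<kappa> by (intro mult_mono) auto
    moreover have "\<alpha> * \<beta> \<le> 3 / 64 / \<kappa> * (1/2)" using \<alpha> \<beta> \<kappa> by (intro mult_mono) auto
    ultimately show "m \<le> 15 / 128 / \<kappa>" by (simp add: m_def field_simps)
  qed
  have 1: "m * (- (2 * fG)) \<le> 15 / 128 * (3 * F + s / 3)"
  proof -
    have "m * (- (2 * fG)) \<le> m * (3 * \<kappa> * F + S / 3)" using fG' m by (intro mult_left_mono) auto
    also have "\<dots> \<le> 15 / 128 / \<kappa> * (3 * \<kappa> * F + S / 3)" using m F S0 \<kappa> by (intro mult_right_mono) auto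
    also have "\<dots> = 15 / 128 * (3 * F + s / 3)" using \<kappa> by (simp add: s_def field_simps)
    finally show ?thesis .
  qed
  have 2: "\<alpha>'\<^sup>2 * GG + \<alpha>\<^sup>2 * GG \<le> 45 / 4096 * s"
  proof -
    have "0 \<le> \<alpha>'" using \<alpha>' \<kappa> by (smt (verit) divide_nonneg_pos)
    then have "\<alpha>'\<^sup>2 \<le> (3 / 32 / \<kappa>)\<^sup>2" "\<alpha>\<^sup>2 \<le> (3 / 64 / \<kappa>)\<^sup>2" using \<alpha> \<alpha>' by (auto intro!: power_mono)
    then have "\<alpha>'\<^sup>2 + \<alpha>\<^sup>2 \<le> 45 / 4096 / \<kappa>\<^sup>2" by (simp add: power_divide)
    then have "(\<alpha>'\<^sup>2 + \<alpha>\<^sup>2) * GG \<le> 45 / 4096 / \<kappa>\<^sup>2 * (\<kappa> * S)" using GG by (intro mult_mono) auto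
    also have "\<dots> = 45 / 4096 * s" using \<kappa> by (simp add: s_def power2_eq_square)
    finally show ?thesis by (simp add: algebra_simps)
  qed
  have 3: "2 * \<alpha>' * S \<ge> 1 / 8 * s"
  proof -
    have "1 / 16 / \<kappa> * S \<le> \<alpha>' * S" using \<alpha>' S0 by (intro mult_right_mono) auto
    then show ?thesis by (simp add: s_def)
  qed
  have 4: "\<beta>\<^sup>2 * F \<le> 1 / 4 * F"
  proof -
    have "\<beta>\<^sup>2 \<le> (1/2)\<^sup>2" using \<beta> by (intro power_mono) auto
    then show ?thesis using F by (intro mult_right_mono) (auto simp: power2_eq_square)
  qed
  have 5: "YY \<le> 2 * S + 2 * F"
  proof -
    have "b\<^sup>2 * F \<le> 1 * F" using b F by (intro mult_right_mono) (auto simp: power_le_one)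
    then show ?thesis using ef ee by (simp add: YY_def)
  qed
  have 6: "YY / (32 * \<kappa>) \<le> s / 16 + F / 16"
  proof -
    have "YY / (32 * \<kappa>) \<le> (2 * S + 2 * F) / (32 * \<kappa>)" using 5 \<kappa> by (intro divide_right_mono) auto
    also have "\<dots> = s / 16 + F / (16 * \<kappa>)" using \<kappa> by (simp add: s_def field_simps)
    also have "F / (16 * \<kappa>) \<le> F / 16" using F \<kappa> by (intro divide_left_mono) auto
    finally show ?thesis by simp
  qed
  have 7: "F / (32 * \<kappa>) \<le> F / 32" using F \<kappa> by (intro divide_left_mono) auto
  have "YY - 2 * \<alpha>' * (S + b * fG) + \<alpha>'\<^sup>2 * GG + (\<beta>\<^sup>2 * F - 2 * \<alpha> * \<beta> * fG + \<alpha>\<^sup>2 * GG)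
     = YY - 2 * \<alpha>' * S + (\<alpha>'\<^sup>2 * GG + \<alpha>\<^sup>2 * GG) + \<beta>\<^sup>2 * F + m * (- (2 * fG))"
    by (simp add: m_def algebra_simps)
  also have "\<dots> \<le> YY - 1 / 8 * s + 45 / 4096 * s + 1 / 4 * F + 15 / 128 * (3 * F + s / 3)"
    using 1 2 3 4 by linarith
  also have "\<dots> \<le> YY + F - YY / (32 * \<kappa>) - F / (32 * \<kappa>)"
  proof -
    define u v where "u = YY / (32 * \<kappa>)" and "v = F / (32 * \<kappa>)"
    have "u \<le> s / 16 + F / 16" "v \<le> F / 32" using 6 7 by (simp_all add: u_def v_def)
    then show ?thesis unfolding u_def[symmetric] v_def[symmetric] using F s0 by (simp add: field_simps)
  qed
  also have "\<dots> = (1 - 1 / (32 * \<kappa>)) * (YY + F)" by (simp add: algebra_simps add_divide_distrib)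
  finally show ?thesis by (simp only: YY_def)
qed

lemma obabo_chain_potential:
  "0 < h \<Longrightarrow> 0 < \<gamma> \<Longrightarrow> U \<in> potentials d \<kappa> \<Longrightarrow> obabo_chain d U h \<gamma>"
  by unfold_locales (auto intro: potential_continuous_partial)

locale tuned_chain = obabo_chain +
  fixes \<kappa> :: real
  assumes \<kappa>: "1 < \<kappa>" and U: "U \<in> potentials d \<kappa>"
    and h_eq: "h = 1 / (4 * sqrt \<kappa>)" and \<gamma>_eq: "\<gamma> = 4 * sqrt \<kappa>"
begin

lemma h_sq: "h\<^sup>2 = 1 / (16 * \<kappa>)" "h \<le> 1"
proof -
  show "h\<^sup>2 = 1 / (16 * \<kappa>)" using \<kappa> by (simp add: h_eq power_divide power_mult_distrib)
  have "1 \<le> sqrt \<kappa>" using \<kappa> by simp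
  then have "1 \<le> 4 * sqrt \<kappa>" by linarith
  then show "h \<le> 1" unfolding h_eq by (subst divide_le_eq_1_pos) (use \<kappa> in auto)
qed

lemma \<beta>_eq: "\<beta> = exp (-1)"
proof -
  have "- \<gamma> * h / 2 = - 1 / 2" using \<kappa> by (simp add: h_eq \<gamma>_eq)
  then have "r = exp (- 1 / 2)" by (simp only: r_def)
  then show ?thesis by (simp add: \<beta>_def power2_eq_square exp_add[symmetric])
qed

lemma \<beta>_bounds: "1/3 \<le> \<beta>" "\<beta> \<le> 1/2"
  using exp_minus_one_bounds by (simp_all add: \<beta>_eq)

lemma over_one_minus_\<beta>: "x / (1 - \<beta>) = x + \<beta> / (1 - \<beta>) * x"
  using \<beta>_bounds by (simp add: field_simps)

lemma \<alpha>_eq: "\<alpha> = (1 + \<beta>) / (32 * \<kappa>)"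
  unfolding \<alpha>_def h_sq by simp

text \<open>Since \<open>mom\<close> is about \<open>\<beta>\<close> times the last increment of the position, position plus \<open>mom / (1 - \<beta>)\<close>
  is where the particle would come to rest without force and noise. Each step moves this point by one
  step of gradient descent, with step size of order \<open>1 / \<kappa>\<close>, whereas \<open>mom\<close> itself is contracted
  by the constant \<open>\<beta>\<close>.\<close>

definition \<Phi> :: "phase \<Rightarrow> phase \<Rightarrow> real" where
  "\<Phi> z w = (\<Sum>i<d. (fst z i - fst w i + (mom z i - mom w i) / (1 - \<beta>))\<^sup>2) + (\<Sum>i<d. (mom z i - mom w i)\<^sup>2)"

lemma \<Phi>_nonneg: "0 \<le> \<Phi> z w" by (simp add: \<Phi>_def sum_nonneg)

lemma \<Phi>_triangle:
  assumes "0 < t" shows "\<Phi> z w \<le> (1 + t) * \<Phi> z u + (1 + 1 / t) * \<Phi> u w"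
proof -
  have **: "(\<Sum>i<d. (a i + b i)\<^sup>2) \<le> (1 + t) * (\<Sum>i<d. (a i)\<^sup>2) + (1 + 1 / t) * (\<Sum>i<d. (b i)\<^sup>2)" for a b :: "nat \<Rightarrow> real"
    unfolding sum_distrib_left sum.distrib[symmetric] by (intro sum_mono square_sum_le assms)
  have 1: "(\<Sum>i<d. (fst z i - fst w i + (mom z i - mom w i) / (1 - \<beta>))\<^sup>2) \<le>
     (1 + t) * (\<Sum>i<d. (fst z i - fst u i + (mom z i - mom u i) / (1 - \<beta>))\<^sup>2)
     + (1 + 1 / t) * (\<Sum>i<d. (fst u i - fst w i + (mom u i - mom w i) / (1 - \<beta>))\<^sup>2)"
    using **[of "\<lambda>i. fst z i - fst u i + (mom z i - mom u i) / (1 - \<beta>)" "\<lambda>i. fst u i - fst w i + (mom u i - mom w i) / (1 - \<beta>)"]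
    by (simp add: algebra_simps diff_divide_distrib)
  have 2: "(\<Sum>i<d. (mom z i - mom w i)\<^sup>2) \<le> (1 + t) * (\<Sum>i<d. (mom z i - mom u i)\<^sup>2) + (1 + 1 / t) * (\<Sum>i<d. (mom u i - mom w i)\<^sup>2)"
    using **[of "\<lambda>i. mom z i - mom u i" "\<lambda>i. mom u i - mom w i"] by simp
  show ?thesis using 1 2 by (simp add: \<Phi>_def distrib_left)
qed

lemma grad_gap:
  assumes x: "x \<in> vecs d" and y: "y \<in> vecs d"
  shows "(\<Sum>i<d. (g x i - g y i)\<^sup>2) \<le> \<kappa> * (\<Sum>i<d. (g x i - g y i) * (x i - y i))"
    and "(\<Sum>i<d. (x i - y i)\<^sup>2) \<le> (\<Sum>i<d. (g x i - g y i) * (x i - y i))"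
    and "(\<Sum>i<d. (g x i - g y i)\<^sup>2) \<le> \<kappa>\<^sup>2 * (\<Sum>i<d. (x i - y i)\<^sup>2)"
proof -
  show 1: "(\<Sum>i<d. (g x i - g y i)\<^sup>2) \<le> \<kappa> * (\<Sum>i<d. (g x i - g y i) * (x i - y i))"
    using gradient_cocoercive[OF U y x] \<kappa> by (simp add: dot_def power2_eq_square)
  show "(\<Sum>i<d. (x i - y i)\<^sup>2) \<le> (\<Sum>i<d. (g x i - g y i) * (x i - y i))"
    using gradient_strongly_monotone[OF U y x] by (simp add: dot_def power2_eq_square)
  have "2 * (g x i - g y i) * (\<kappa> * (x i - y i)) \<le> (g x i - g y i)\<^sup>2 + \<kappa>\<^sup>2 * (x i - y i)\<^sup>2" for i
    using zero_le_power2[of "(g x i - g y i) - \<kappa> * (x i - y i)"] by (simp add: power2_diff power_mult_distrib)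
  then have "(\<Sum>i<d. 2 * (g x i - g y i) * (\<kappa> * (x i - y i))) \<le> (\<Sum>i<d. (g x i - g y i)\<^sup>2 + \<kappa>\<^sup>2 * (x i - y i)\<^sup>2)"
    by (rule sum_mono)
  moreover have "(\<Sum>i<d. 2 * (g x i - g y i) * (\<kappa> * (x i - y i))) = 2 * (\<kappa> * (\<Sum>i<d. (g x i - g y i) * (x i - y i)))"
    unfolding sum_distrib_left by (intro sum.cong) (auto simp: algebra_simps)
  ultimately have "2 * (\<kappa> * (\<Sum>i<d. (g x i - g y i) * (x i - y i))) \<le> (\<Sum>i<d. (g x i - g y i)\<^sup>2) + \<kappa>\<^sup>2 * (\<Sum>i<d. (x i - y i)\<^sup>2)"
    by (simp add: sum_distrib_left sum.distrib)
  then show "(\<Sum>i<d. (g x i - g y i)\<^sup>2) \<le> \<kappa>\<^sup>2 * (\<Sum>i<d. (x i - y i)\<^sup>2)" using 1 by linarith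
qed

lemma \<Phi>_contraction: "\<Phi> (step \<xi> \<eta> z) (step \<xi> \<eta> w) \<le> (1 - 1 / (32 * \<kappa>)) * \<Phi> z w"
proof -
  define b where "b = \<beta> / (1 - \<beta>)"
  define \<alpha>' where "\<alpha>' = \<alpha> / (1 - \<beta>)"
  have \<beta>1: "1 - \<beta> \<noteq> 0" using \<beta>_bounds by simp
  define z' w' where "z' = step \<xi> \<eta> z" and "w' = step \<xi> \<eta> w"
  have v: "fst z' \<in> vecs d" "fst w' \<in> vecs d"
    using step_vecs[of \<xi> \<eta> z] step_vecs[of \<xi> \<eta> w] by (auto simp: space_phase z'_def w'_def mem_Times_iff)
  define e f G where "e i = fst z' i - fst w' i" and "f i = mom z i - mom w i" and "G i = g (fst z') i - g (fst w') i" for i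
  have ei: "e i = fst z i - fst w i + f i" if "i < d" for i
    using that by (simp add: e_def f_def z'_def w'_def step_pos)
  have fi: "mom z' i - mom w' i = \<beta> * f i - \<alpha> * G i" if "i < d" for i
    unfolding z'_def w'_def step_mom[OF that] f_def G_def by (simp add: algebra_simps)
  have Y: "fst z i - fst w i + (mom z i - mom w i) / (1 - \<beta>) = e i + b * f i" if "i < d" for i
    using ei[OF that] over_one_minus_\<beta>[of "f i"] by (simp add: b_def f_def)
  have Y': "fst z' i - fst w' i + (mom z' i - mom w' i) / (1 - \<beta>) = e i + b * f i - \<alpha>' * G i" if "i < d" for i
  proof -
    have "fst z' i - fst w' i + (mom z' i - mom w' i) / (1 - \<beta>) = e i + (\<beta> * f i - \<alpha> * G i) / (1 - \<beta>)"
      unfolding fi[OF that] e_def ..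
    then show ?thesis by (simp add: b_def \<alpha>'_def diff_divide_distrib)
  qed
  define ee ef F fG GG S where "ee = (\<Sum>i<d. (e i)\<^sup>2)" and "ef = (\<Sum>i<d. e i * f i)" and "F = (\<Sum>i<d. (f i)\<^sup>2)"
    and "fG = (\<Sum>i<d. f i * G i)" and "GG = (\<Sum>i<d. (G i)\<^sup>2)" and "S = (\<Sum>i<d. G i * e i)"
  note defs = ee_def ef_def F_def fG_def GG_def S_def
  have \<Phi>z: "\<Phi> z w = (ee + 2 * b * ef + b\<^sup>2 * F) + F"
  proof -
    have "\<Phi> z w = (\<Sum>i<d. (e i + b * f i)\<^sup>2) + F"
      unfolding \<Phi>_def F_def f_def[symmetric] using Y f_def by (intro arg_cong2[where f="(+)"] sum.cong) auto
    then show ?thesis unfolding sum_sq_add by (simp add: defs)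
  qed
  have YG: "(\<Sum>i<d. (e i + b * f i) * G i) = S + b * fG"
    unfolding defs by (simp add: sum.distrib sum_distrib_left algebra_simps)
  have \<Phi>z': "\<Phi> z' w' = (ee + 2 * b * ef + b\<^sup>2 * F) - 2 * \<alpha>' * (S + b * fG) + \<alpha>'\<^sup>2 * GG + (\<beta>\<^sup>2 * F - 2 * \<alpha> * \<beta> * fG + \<alpha>\<^sup>2 * GG)"
  proof -
    have "\<Phi> z' w' = (\<Sum>i<d. (e i + b * f i + (- \<alpha>') * G i)\<^sup>2) + (\<Sum>i<d. (\<beta> * f i + (- \<alpha>) * G i)\<^sup>2)"
      unfolding \<Phi>_def using Y' fi by (intro arg_cong2[where f="(+)"] sum.cong) auto
    also have "(\<Sum>i<d. (\<beta> * f i + (- \<alpha>) * G i)\<^sup>2) = \<beta>\<^sup>2 * F - 2 * \<alpha> * \<beta> * fG + \<alpha>\<^sup>2 * GG"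
    proof -
      have "(\<Sum>i<d. (\<beta> * f i)\<^sup>2) = \<beta>\<^sup>2 * F" "(\<Sum>i<d. \<beta> * f i * G i) = \<beta> * fG"
        by (simp_all add: defs power_mult_distrib sum_distrib_left mult.assoc)
      then show ?thesis unfolding sum_sq_add by (simp add: GG_def)
    qed
    also have "(\<Sum>i<d. (e i + b * f i + (- \<alpha>') * G i)\<^sup>2) = (ee + 2 * b * ef + b\<^sup>2 * F) - 2 * \<alpha>' * (S + b * fG) + \<alpha>'\<^sup>2 * GG"
      unfolding sum_sq_add[of "\<lambda>i. e i + b * f i"] YG unfolding sum_sq_add by (simp add: defs)
    finally show ?thesis .
  qed
  have GS: "GG \<le> \<kappa> * S" "ee \<le> S" using grad_gap(1,2)[OF v] by (simp_all add: GG_def S_def G_def e_def ee_def)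
  have F0: "0 \<le> F" "0 \<le> GG" by (simp_all add: F_def GG_def sum_nonneg)
  have fG1: "0 \<le> 9 * \<kappa>\<^sup>2 * F + 6 * \<kappa> * fG + GG"
  proof -
    have "0 \<le> (\<Sum>i<d. (G i + (3 * \<kappa>) * f i)\<^sup>2)" by (rule sum_nonneg) simp
    also have "\<dots> = 9 * \<kappa>\<^sup>2 * F + 6 * \<kappa> * fG + GG"
      unfolding sum_sq_add by (simp add: defs power_mult_distrib mult.commute)
    finally show ?thesis .
  qed
  have ef1: "0 \<le> ee - 2 * b * ef + b\<^sup>2 * F"
  proof -
    have "0 \<le> (\<Sum>i<d. (e i + (- b) * f i)\<^sup>2)" by (rule sum_nonneg) simp
    also have "\<dots> = ee - 2 * b * ef + b\<^sup>2 * F"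
      unfolding sum_sq_add by (simp add: defs)
    finally show ?thesis .
  qed
  show ?thesis
    unfolding z'_def[symmetric] w'_def[symmetric] \<Phi>z \<Phi>z' b_def \<alpha>'_def \<alpha>_eq
    by (rule heavy_ball_contraction_scalar) (use \<beta>_bounds \<kappa> GS F0 fG1 ef1 in \<open>auto simp: b_def\<close>)
qed

lemma \<Phi>_parts:
  shows "(\<Sum>i<d. (fst z i - fst w i)\<^sup>2) \<le> 8 * \<Phi> z w"
    and "(\<Sum>i<d. (fst z i + mom z i - (fst w i + mom w i))\<^sup>2) \<le> 2 * \<Phi> z w"
    and "(\<Sum>i<d. (mom z i - mom w i)\<^sup>2) \<le> \<Phi> z w"
proof -
  define Y f where "Y i = fst z i - fst w i + (mom z i - mom w i) / (1 - \<beta>)" and "f i = mom z i - mom w i" for i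
  have \<Phi>: "\<Phi> z w = (\<Sum>i<d. (Y i)\<^sup>2) + (\<Sum>i<d. (f i)\<^sup>2)" by (simp add: \<Phi>_def Y_def f_def)
  have ab: "1 / (1 - \<beta>) \<le> 2" "0 \<le> 1 / (1 - \<beta>)" "\<bar>\<beta> / (1 - \<beta>)\<bar> \<le> 1" using \<beta>_bounds by (auto simp: field_simps)
  have sq: "(a - c * b)\<^sup>2 \<le> 2 * a\<^sup>2 + 2 * m\<^sup>2 * b\<^sup>2" if "\<bar>c\<bar> \<le> m" for a b c m :: real
  proof -
    have "(a - c * b)\<^sup>2 \<le> 2 * a\<^sup>2 + 2 * (c * b)\<^sup>2"
      using zero_le_power2[of "a + c * b"] by (simp add: power2_eq_square algebra_simps)
    also have "(c * b)\<^sup>2 \<le> m\<^sup>2 * b\<^sup>2"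
      unfolding power_mult_distrib using that by (intro mult_right_mono) (auto simp: abs_le_square_iff[symmetric])
    finally show ?thesis by simp
  qed
  have "(\<Sum>i<d. (fst z i - fst w i)\<^sup>2) = (\<Sum>i<d. (Y i - (1 / (1 - \<beta>)) * f i)\<^sup>2)"
    by (intro sum.cong) (auto simp: Y_def f_def)
  also have "\<dots> \<le> (\<Sum>i<d. 2 * (Y i)\<^sup>2 + 2 * 2\<^sup>2 * (f i)\<^sup>2)" using ab by (intro sum_mono sq) auto
  also have "\<dots> \<le> 8 * \<Phi> z w" by (simp add: \<Phi> sum.distrib sum_distrib_left[symmetric] sum_nonneg)
  finally show "(\<Sum>i<d. (fst z i - fst w i)\<^sup>2) \<le> 8 * \<Phi> z w" .
  have "(\<Sum>i<d. (fst z i + mom z i - (fst w i + mom w i))\<^sup>2) = (\<Sum>i<d. (Y i - (\<beta> / (1 - \<beta>)) * f i)\<^sup>2)"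
  proof (intro sum.cong refl)
    fix i
    have "Y i - (\<beta> / (1 - \<beta>)) * f i = fst z i + mom z i - (fst w i + mom w i)"
      using over_one_minus_\<beta>[of "f i"] by (simp add: Y_def f_def)
    then show "(fst z i + mom z i - (fst w i + mom w i))\<^sup>2 = (Y i - (\<beta> / (1 - \<beta>)) * f i)\<^sup>2" by simp
  qed
  also have "\<dots> \<le> (\<Sum>i<d. 2 * (Y i)\<^sup>2 + 2 * 1\<^sup>2 * (f i)\<^sup>2)" using ab by (intro sum_mono sq) auto
  also have "\<dots> = 2 * \<Phi> z w" by (simp add: \<Phi> sum.distrib sum_distrib_left)
  finally show "(\<Sum>i<d. (fst z i + mom z i - (fst w i + mom w i))\<^sup>2) \<le> 2 * \<Phi> z w" .
  show "(\<Sum>i<d. (mom z i - mom w i)\<^sup>2) \<le> \<Phi> z w" by (simp add: \<Phi> f_def[symmetric] sum_nonneg)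
qed

text \<open>A single step maps the quadratic \<open>\<Phi>\<close> to total variation: \<open>gap\<close> is at most a multiple of \<open>\<kappa> * \<Phi>\<close>, because
  the noise in the position has variance of order \<open>h\<^sup>2\<close>, that is, \<open>1 / \<kappa>\<close>.\<close>

lemma one_step_lipschitz:
  assumes "z \<in> space M" "w \<in> space M" "A \<in> sets M"
  shows "\<bar>measure (Q z) A - measure (Q w) A\<bar> \<le> 9 * sqrt \<kappa> * sqrt (\<Phi> z w)"
proof -
  have "gap z w = ((\<Sum>i<d. (fst z i + mom z i - (fst w i + mom w i))\<^sup>2) + \<beta> * (\<Sum>i<d. (fst z i - fst w i)\<^sup>2)) / (h\<^sup>2 * \<sigma>\<^sup>2)"
  proof -
    have "(\<Sum>i<d. ((fst z i + mom z i - (fst w i + mom w i)) / (h * \<sigma>))\<^sup>2) = (\<Sum>i<d. (fst z i + mom z i - (fst w i + mom w i))\<^sup>2) / (h\<^sup>2 * \<sigma>\<^sup>2)"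
      unfolding power_divide power_mult_distrib sum_divide_distrib ..
    moreover have "(\<Sum>i<d. (r * (fst z i - fst w i) / (h * \<sigma>))\<^sup>2) = \<beta> * (\<Sum>i<d. (fst z i - fst w i)\<^sup>2) / (h\<^sup>2 * \<sigma>\<^sup>2)"
      unfolding power_divide power_mult_distrib sum_divide_distrib sum_distrib_left \<beta>_def ..
    ultimately show ?thesis by (simp add: gap_def add_divide_distrib)
  qed
  also have "\<dots> \<le> (2 * \<Phi> z w + 1 * (8 * \<Phi> z w)) / (h\<^sup>2 * \<sigma>\<^sup>2)"
    using \<Phi>_parts(1,2)[of z w] \<beta>_bounds \<Phi>_nonneg[of z w]
    by (intro divide_right_mono add_mono mult_mono) (auto simp: sum_nonneg)
  also have "\<dots> = 160 * \<kappa> * \<Phi> z w / (1 - \<beta>)" using \<kappa> unfolding h_sq \<sigma>_pos by simp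
  also have "\<dots> \<le> 160 * \<kappa> * \<Phi> z w / (1/2)"
    using \<beta>_bounds \<kappa> \<Phi>_nonneg[of z w] by (intro divide_left_mono) auto
  finally have gap: "gap z w \<le> 320 * \<kappa> * \<Phi> z w" by simp
  have "1 - exp (- gap z w / 4) \<le> gap z w / 4" using exp_ge_add_one_self[of "- gap z w / 4"] by simp
  also have "\<dots> \<le> 81 * (\<kappa> * \<Phi> z w)"
  proof -
    have "0 \<le> \<kappa> * \<Phi> z w" using \<kappa> \<Phi>_nonneg[of z w] by simp
    then show ?thesis using gap by linarith
  qed
  finally have "sqrt (1 - exp (- gap z w / 4)) \<le> sqrt (9\<^sup>2 * (\<kappa> * \<Phi> z w))"
    by (intro real_sqrt_le_mono) simp
  also have "\<dots> = 9 * sqrt \<kappa> * sqrt (\<Phi> z w)" by (simp only: real_sqrt_mult real_sqrt_abs)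
  finally show ?thesis using obabo_overlap[OF assms] by linarith
qed

definition \<rho> :: real where "\<rho> = sqrt (1 - 1 / (32 * \<kappa>))"

lemma \<rho>_bounds: "0 < \<rho>" "\<rho> < 1" "\<rho> \<le> exp (- 1 / (64 * \<kappa>))"
proof -
  have 1: "0 < 1 - 1 / (32 * \<kappa>)" using \<kappa> by (simp add: field_simps)
  then show "0 < \<rho>" by (simp add: \<rho>_def)
  show "\<rho> < 1" using \<kappa> by (simp add: \<rho>_def)
  have "1 - 1 / (32 * \<kappa>) \<le> exp (- 1 / (32 * \<kappa>))" using exp_ge_add_one_self[of "- 1 / (32 * \<kappa>)"] by simp
  also have "\<dots> = (exp (- 1 / (64 * \<kappa>)))\<^sup>2" by (simp add: power2_eq_square exp_add[symmetric])
  finally show "\<rho> \<le> exp (- 1 / (64 * \<kappa>))" unfolding \<rho>_def by (intro real_le_lsqrt) auto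
qed

lemma tv_contraction:
  assumes "z \<in> space M" "w \<in> space M" "A \<in> sets M"
  shows "\<bar>measure (P (Suc n) z) A - measure (P (Suc n) w) A\<bar> \<le> 9 * sqrt \<kappa> * \<rho> ^ n * sqrt (\<Phi> z w)"
proof -
  have "\<bar>measure (P (n + 1) z) A - measure (P (n + 1) w) A\<bar> \<le> (9 * sqrt \<kappa>) * \<rho> ^ n * sqrt (\<Phi> z w)"
  proof (rule kernel_pow_contraction[where D="\<lambda>z w. sqrt (\<Phi> z w)"])
    fix \<phi> :: "phase \<Rightarrow> real" and L x y
    assume \<phi>[measurable]: "\<phi> \<in> borel_measurable M" and \<phi>01: "\<And>x. x \<in> space M \<Longrightarrow> 0 \<le> \<phi> x \<and> \<phi> x \<le> 1" and L: "0 < L"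
      and lip: "\<And>x y. x \<in> space M \<Longrightarrow> y \<in> space M \<Longrightarrow> \<bar>\<phi> x - \<phi> y\<bar> \<le> L * sqrt (\<Phi> x y)"
      and x: "x \<in> space M" and y: "y \<in> space M"
    interpret GG: prob_space GG by (rule prob_GG)
    have i: "integrable GG (\<lambda>u. \<phi> (step (fst u) (snd u) x))" if "x \<in> space M" for x
    proof (rule GG.integrable_const_bound[of _ 1])
      show "AE u in GG. norm (\<phi> (step (fst u) (snd u) x)) \<le> 1" using \<phi>01[OF step_vecs] by (intro AE_I2) auto
      show "(\<lambda>u. \<phi> (step (fst u) (snd u) x)) \<in> borel_measurable GG"
        using measurable_compose[OF measurable_step_noise[OF that] \<phi>] by (simp add: case_prod_unfold)
    qed
    have eq: "(\<integral>w. \<phi> w \<partial>Q x) - (\<integral>w. \<phi> w \<partial>Q y) = (\<integral>u. \<phi> (step (fst u) (snd u) x) - \<phi> (step (fst u) (snd u) y) \<partial>GG)"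
      unfolding integral_obabo[OF x \<phi>] integral_obabo[OF y \<phi>] using i x y by simp
    have "\<bar>(\<integral>w. \<phi> w \<partial>Q x) - (\<integral>w. \<phi> w \<partial>Q y)\<bar> \<le> (\<integral>u. \<bar>\<phi> (step (fst u) (snd u) x) - \<phi> (step (fst u) (snd u) y)\<bar> \<partial>GG)"
      unfolding eq by (rule integral_abs_bound)
    also have "\<dots> \<le> (\<integral>u. L * \<rho> * sqrt (\<Phi> x y) \<partial>GG)"
    proof (rule integral_mono)
      show "integrable GG (\<lambda>u. \<bar>\<phi> (step (fst u) (snd u) x) - \<phi> (step (fst u) (snd u) y)\<bar>)"
        by (rule integrable_abs[OF Bochner_Integration.integrable_diff[OF i[OF x] i[OF y]]])
      show "integrable GG (\<lambda>u. L * \<rho> * sqrt (\<Phi> x y))" by simp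
      fix u
      have "\<bar>\<phi> (step (fst u) (snd u) x) - \<phi> (step (fst u) (snd u) y)\<bar> \<le> L * sqrt (\<Phi> (step (fst u) (snd u) x) (step (fst u) (snd u) y))"
        by (intro lip step_vecs)
      also have "\<dots> \<le> L * sqrt ((1 - 1 / (32 * \<kappa>)) * \<Phi> x y)"
        using L by (intro mult_left_mono real_sqrt_le_mono \<Phi>_contraction) auto
      finally show "\<bar>\<phi> (step (fst u) (snd u) x) - \<phi> (step (fst u) (snd u) y)\<bar> \<le> L * \<rho> * sqrt (\<Phi> x y)"
        by (simp only: real_sqrt_mult \<rho>_def mult.assoc)
    qed
    also have "\<dots> = L * \<rho> * sqrt (\<Phi> x y)" by (simp add: GG.prob_space)
    finally show "\<bar>(\<integral>w. \<phi> w \<partial>Q x) - (\<integral>w. \<phi> w \<partial>Q y)\<bar> \<le> L * \<rho> * sqrt (\<Phi> x y)" .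
  next
    fix x y assume xy: "x \<in> space M" "y \<in> space M"
    have "P 1 z = Q z" if "z \<in> space M" for z
      using bind_return[OF measurable_prob_algebraD[OF kernel_obabo] that] by simp
    then show "\<bar>measure (P 1 x) A - measure (P 1 y) A\<bar> \<le> 9 * sqrt \<kappa> * sqrt (\<Phi> x y)"
      using one_step_lipschitz[OF xy assms(3)] xy by simp
  qed (use assms \<kappa> \<rho>_bounds in auto)
  then show ?thesis by simp
qed

lemma \<Phi>_le_sq_dist:
  assumes "z \<in> space M" "w \<in> space M" shows "\<Phi> z w \<le> 3 * sq_dist d z w"
proof -
  define X V where "X = (\<Sum>i<d. (fst z i - fst w i)\<^sup>2)" and "V = (\<Sum>i<d. (snd z i - snd w i)\<^sup>2)"
  define F where "F = (\<Sum>i<d. (mom z i - mom w i)\<^sup>2)"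
  have X0: "0 \<le> X" "0 \<le> V" "0 \<le> F" by (simp_all add: X_def V_def F_def sum_nonneg)
  have v: "fst z \<in> vecs d" "fst w \<in> vecs d" using assms by (auto simp: space_phase)
  have "F = (\<Sum>i<d. (r * h * (snd z i - snd w i) + (- (h\<^sup>2 / 2)) * (g (fst z) i - g (fst w) i))\<^sup>2)"
    unfolding F_def by (intro sum.cong refl) (simp add: mom_def algebra_simps)
  also have "\<dots> \<le> 2 * (\<Sum>i<d. (r * h * (snd z i - snd w i))\<^sup>2) + 2 * (- (h\<^sup>2 / 2))\<^sup>2 * (\<Sum>i<d. (g (fst z) i - g (fst w) i)\<^sup>2)"
    by (rule sum_sq_add_le)
  also have "(\<Sum>i<d. (r * h * (snd z i - snd w i))\<^sup>2) = (r * h)\<^sup>2 * V"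
    by (simp add: V_def power_mult_distrib sum_distrib_left)
  also have "2 * ((r * h)\<^sup>2 * V) \<le> 1 / 8 * V"
  proof -
    have "(r * h)\<^sup>2 \<le> 1 * (1 / 16)"
      unfolding power_mult_distrib h_sq using r_pos \<kappa> by (intro mult_mono) (auto simp: power_le_one field_simps)
    then have "(r * h)\<^sup>2 * V \<le> 1 / 16 * V" using X0 by (intro mult_right_mono) auto
    then show ?thesis by simp
  qed
  also have "2 * (- (h\<^sup>2 / 2))\<^sup>2 * (\<Sum>i<d. (g (fst z) i - g (fst w) i)\<^sup>2) \<le> 2 * (- (h\<^sup>2 / 2))\<^sup>2 * (\<kappa>\<^sup>2 * X)"
    unfolding X_def by (intro mult_left_mono grad_gap(3) v) auto
  also have "\<dots> = X / 512" using \<kappa> unfolding h_sq by (simp add: power2_eq_square)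
  finally have F: "F \<le> 1 / 8 * V + X / 512" by simp
  have "\<Phi> z w = (\<Sum>i<d. (fst z i - fst w i + (1 / (1 - \<beta>)) * (mom z i - mom w i))\<^sup>2) + F"
    by (simp add: \<Phi>_def F_def)
  also have "\<dots> \<le> 2 * X + 2 * (1 / (1 - \<beta>))\<^sup>2 * F + F"
    unfolding X_def F_def by (intro add_right_mono sum_sq_add_le)
  also have "(1 / (1 - \<beta>))\<^sup>2 \<le> 2\<^sup>2" using \<beta>_bounds by (intro power_mono) (auto simp: field_simps)
  finally have "\<Phi> z w \<le> 2 * X + 9 * F" using X0 by (simp add: mult_right_mono)
  also have "\<dots> \<le> 3 * (X + V)" using F X0 by (simp add: field_simps)
  finally show ?thesis by (simp add: sq_dist_def X_def V_def)
qed

lemma sq_dist_le_\<Phi>: "\<exists>C\<ge>0. \<forall>z\<in>space M. \<forall>w\<in>space M. sq_dist d z w \<le> C * \<Phi> z w"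
proof -
  have rh: "0 < (r * h)\<^sup>2" using r_pos h by simp
  have "sq_dist d z w \<le> (8 + (2 + 2 * (h\<^sup>2 / 2)\<^sup>2 * (\<kappa>\<^sup>2 * 8)) / (r * h)\<^sup>2) * \<Phi> z w" if zw: "z \<in> space M" "w \<in> space M" for z w
  proof -
    have v: "fst z \<in> vecs d" "fst w \<in> vecs d" using zw by (auto simp: space_phase)
    define X V F G where "X = (\<Sum>i<d. (fst z i - fst w i)\<^sup>2)" and "V = (\<Sum>i<d. (snd z i - snd w i)\<^sup>2)"
      and "F = (\<Sum>i<d. (mom z i - mom w i)\<^sup>2)" and "G = (\<Sum>i<d. (g (fst z) i - g (fst w) i)\<^sup>2)"
    have X: "X \<le> 8 * \<Phi> z w" and F: "F \<le> \<Phi> z w" unfolding X_def F_def by (rule \<Phi>_parts)+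
    have "G \<le> \<kappa>\<^sup>2 * X" unfolding G_def X_def by (rule grad_gap(3)[OF v])
    also have "\<dots> \<le> \<kappa>\<^sup>2 * (8 * \<Phi> z w)" using X by (intro mult_left_mono) auto
    finally have G: "G \<le> \<kappa>\<^sup>2 * (8 * \<Phi> z w)" .
    have "(r * h)\<^sup>2 * V = (\<Sum>i<d. ((mom z i - mom w i) + (h\<^sup>2 / 2) * (g (fst z) i - g (fst w) i))\<^sup>2)"
      unfolding V_def sum_distrib_left power_mult_distrib[symmetric]
      by (intro sum.cong refl) (simp add: mom_def algebra_simps)
    also have "\<dots> \<le> 2 * F + 2 * (h\<^sup>2 / 2)\<^sup>2 * G"
      unfolding F_def G_def by (rule sum_sq_add_le)
    also have "\<dots> \<le> 2 * \<Phi> z w + 2 * (h\<^sup>2 / 2)\<^sup>2 * (\<kappa>\<^sup>2 * (8 * \<Phi> z w))"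
      using F G by (intro add_mono mult_left_mono) auto
    also have "\<dots> = (2 + 2 * (h\<^sup>2 / 2)\<^sup>2 * (\<kappa>\<^sup>2 * 8)) * \<Phi> z w" by (simp add: algebra_simps)
    finally have "V \<le> (2 + 2 * (h\<^sup>2 / 2)\<^sup>2 * (\<kappa>\<^sup>2 * 8)) * \<Phi> z w / (r * h)\<^sup>2"
      using rh by (simp add: pos_le_divide_eq mult.commute)
    then show ?thesis using X by (simp add: sq_dist_def X_def V_def distrib_right)
  qed
  moreover have "0 \<le> 8 + (2 + 2 * (h\<^sup>2 / 2)\<^sup>2 * (\<kappa>\<^sup>2 * 8)) / (r * h)\<^sup>2" by simp
  ultimately show ?thesis by blast
qed

definition origin :: phase where
  "origin = ((\<lambda>i\<in>{..<d}. 0), (\<lambda>i\<in>{..<d}. 0))"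

lemma origin[simp]: "origin \<in> space M" by (simp add: origin_def space_phase vecs_def)

lemma \<Phi>_one_step_from_origin:
  "\<exists>C\<ge>0. \<forall>\<xi> \<eta>. \<Phi> (step \<xi> \<eta> origin) origin \<le> C * (1 + ((\<Sum>i<d. (\<xi> i)\<^sup>2) + (\<Sum>i<d. (\<eta> i)\<^sup>2)))"
proof -
  define m where "m i = mom origin i" for i
  define K where "K = (\<Sum>i<d. (m i)\<^sup>2) + (\<Sum>i<d. (g (fst origin) i)\<^sup>2)"
  have K: "0 \<le> K" "(\<Sum>i<d. (m i)\<^sup>2) \<le> K" "(\<Sum>i<d. (g (fst origin) i)\<^sup>2) \<le> K" by (simp_all add: K_def sum_nonneg)
  have two: "(\<Sum>i<d. (a i + b i)\<^sup>2) \<le> 2 * (\<Sum>i<d. (a i)\<^sup>2) + 2 * (\<Sum>i<d. (b i)\<^sup>2)" for a b :: "nat \<Rightarrow> real"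
    using sum_sq_triangle[of a "\<lambda>i. - b i" "{..<d}" "\<lambda>_. 0"] by simp
  have sc: "(\<Sum>i<d. (c * b i)\<^sup>2) = c\<^sup>2 * (\<Sum>i<d. (b i)\<^sup>2)" for c and b :: "nat \<Rightarrow> real"
    by (simp add: power_mult_distrib sum_distrib_left)
  define C1 where "C1 = 2 * K + 2 * (h * \<sigma>)\<^sup>2"
  define C2 where "C2 = 2 * K + 2 * (2 * \<beta>\<^sup>2 * C1 + 2 * (2 * \<alpha>\<^sup>2 * (2 * \<kappa>\<^sup>2 * C1 + 2 * K) + 2 * (r * h * \<sigma>)\<^sup>2))"
  have C0: "0 \<le> C1" "0 \<le> C2" using K by (simp_all add: C1_def C2_def)
  have "\<Phi> (step \<xi> \<eta> origin) origin \<le> (2 * C1 + 9 * C2) * (1 + ((\<Sum>i<d. (\<xi> i)\<^sup>2) + (\<Sum>i<d. (\<eta> i)\<^sup>2)))" for \<xi> \<eta>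
  proof -
    define N where "N = 1 + ((\<Sum>i<d. (\<xi> i)\<^sup>2) + (\<Sum>i<d. (\<eta> i)\<^sup>2))"
    have N: "1 \<le> N" "(\<Sum>i<d. (\<xi> i)\<^sup>2) \<le> N" "(\<Sum>i<d. (\<eta> i)\<^sup>2) \<le> N" by (simp_all add: N_def sum_nonneg)
    define z where "z = step \<xi> \<eta> origin"
    define X G F where "X = (\<Sum>i<d. (fst z i - fst origin i)\<^sup>2)" and "G = (\<Sum>i<d. (g (fst z) i)\<^sup>2)" and "F = (\<Sum>i<d. (mom z i - m i)\<^sup>2)"
    have zv: "fst z \<in> vecs d" "fst origin \<in> vecs d"
      using step_vecs[of \<xi> \<eta> origin] origin by (auto simp: z_def space_phase mem_Times_iff)
    have KN: "K \<le> K * N" using K N by (simp add: mult_le_cancel_left1)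
    define w where "w i = m i + h * \<sigma> * \<xi> i" for i
    have w: "(\<Sum>i<d. (w i)\<^sup>2) \<le> C1 * N"
    proof -
      have "(\<Sum>i<d. (w i)\<^sup>2) \<le> 2 * K + 2 * ((h * \<sigma>)\<^sup>2 * N)"
        unfolding w_def using two[of m "\<lambda>i. h * \<sigma> * \<xi> i"] K mult_left_mono[OF N(2) zero_le_power2[of "h * \<sigma>"]]
        unfolding sc by linarith
      then show ?thesis using KN by (simp add: C1_def algebra_simps)
    qed
    have "X = (\<Sum>i<d. (w i)\<^sup>2)" unfolding X_def by (intro sum.cong) (auto simp: z_def step_pos w_def m_def)
    then have X: "X \<le> C1 * N" using w by simp
    have "G \<le> 2 * (\<Sum>i<d. (g (fst z) i - g (fst origin) i)\<^sup>2) + 2 * K"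
      using two[of "\<lambda>i. g (fst z) i - g (fst origin) i" "g (fst origin)"] K(3) by (simp add: G_def)
    also have "\<dots> \<le> 2 * (\<kappa>\<^sup>2 * (C1 * N)) + 2 * (K * N)"
      using grad_gap(3)[OF zv] mult_left_mono[OF X, of "\<kappa>\<^sup>2"] KN by (simp add: X_def)
    finally have G: "G \<le> (2 * \<kappa>\<^sup>2 * C1 + 2 * K) * N" by (simp add: algebra_simps)
    have "F \<le> 2 * (\<Sum>i<d. (mom z i)\<^sup>2) + 2 * K"
      using two[of "mom z" "\<lambda>i. - m i"] K(2) by (simp add: F_def)
    also have "(\<Sum>i<d. (mom z i)\<^sup>2) = (\<Sum>i<d. (\<beta> * w i + ((- \<alpha>) * g (fst z) i + r * h * \<sigma> * \<eta> i))\<^sup>2)"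
    proof (intro sum.cong refl)
      fix i assume "i \<in> {..<d}"
      then have "mom z i = \<beta> * w i + ((- \<alpha>) * g (fst z) i + r * h * \<sigma> * \<eta> i)"
        unfolding z_def w_def m_def by (subst step_mom) auto
      then show "(mom z i)\<^sup>2 = (\<beta> * w i + ((- \<alpha>) * g (fst z) i + r * h * \<sigma> * \<eta> i))\<^sup>2" by (simp only:)
    qed
    also have "\<dots> \<le> 2 * (\<beta>\<^sup>2 * (\<Sum>i<d. (w i)\<^sup>2)) + 2 * (2 * ((- \<alpha>)\<^sup>2 * G) + 2 * ((r * h * \<sigma>)\<^sup>2 * (\<Sum>i<d. (\<eta> i)\<^sup>2)))"
      using two[of "\<lambda>i. \<beta> * w i" "\<lambda>i. (- \<alpha>) * g (fst z) i + r * h * \<sigma> * \<eta> i"]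
        two[of "\<lambda>i. (- \<alpha>) * g (fst z) i" "\<lambda>i. r * h * \<sigma> * \<eta> i"]
      unfolding sc G_def[symmetric] by (meson add_left_mono mult_left_mono order_trans zero_le_numeral)
    also have "\<dots> \<le> 2 * (\<beta>\<^sup>2 * (C1 * N)) + 2 * (2 * ((- \<alpha>)\<^sup>2 * ((2 * \<kappa>\<^sup>2 * C1 + 2 * K) * N)) + 2 * ((r * h * \<sigma>)\<^sup>2 * N))"
      by (intro add_mono mult_left_mono w G N) auto
    finally have "F \<le> C2 * N" using KN by (simp add: C2_def algebra_simps)
    have "\<Phi> z origin = (\<Sum>i<d. (fst z i - fst origin i + 1 / (1 - \<beta>) * (mom z i - m i))\<^sup>2) + F"
      by (simp add: \<Phi>_def F_def m_def)
    also have "\<dots> \<le> 2 * X + 2 * ((1 / (1 - \<beta>))\<^sup>2 * F) + F"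
      using two[of "\<lambda>i. fst z i - fst origin i" "\<lambda>i. 1 / (1 - \<beta>) * (mom z i - m i)"]
      unfolding sc X_def F_def by linarith
    also have "(1 / (1 - \<beta>))\<^sup>2 * F \<le> 2\<^sup>2 * F"
      using \<beta>_bounds by (intro mult_right_mono power_mono) (auto simp: field_simps F_def sum_nonneg)
    also have "2 * X + 2 * (2\<^sup>2 * F) + F \<le> (2 * C1 + 9 * C2) * N"
      using X \<open>F \<le> C2 * N\<close> by (simp add: algebra_simps)
    finally show ?thesis by (simp add: z_def N_def)
  qed
  then show ?thesis using C0 by (intro exI[of _ "2 * C1 + 9 * C2"]) auto
qed

lemma measurable_\<Phi>[measurable]: "(\<lambda>z. \<Phi> z w) \<in> borel_measurable M"
  unfolding \<Phi>_def by measurable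


text \<open>Compare with the chain started at the origin under the same noise: the distance to it contracts,
  and that chain is near the origin in mean square after one step.\<close>

lemma drift:
  obtains \<gamma>' K where "0 \<le> \<gamma>'" "\<gamma>' < 1" "0 \<le> K"
    "\<And>z. z \<in> space M \<Longrightarrow> (\<integral>\<^sup>+w. ennreal (\<Phi> w origin) \<partial>Q z) \<le> ennreal (\<gamma>' * \<Phi> z origin + K)"
proof -
  obtain C where C: "0 \<le> C" "\<And>\<xi> \<eta>. \<Phi> (step \<xi> \<eta> origin) origin \<le> C * (1 + ((\<Sum>i<d. (\<xi> i)\<^sup>2) + (\<Sum>i<d. (\<eta> i)\<^sup>2)))"
    using \<Phi>_one_step_from_origin by blast
  define t where "t = 1 / (64 * \<kappa>)"
  have t: "0 < t" "t < 1" using \<kappa> by (auto simp: t_def field_simps)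
  have t2: "1 - 1 / (32 * \<kappa>) = 1 - 2 * t" by (simp add: t_def)
  define c where "c = (1 + 1 / t) * C"
  have c: "0 \<le> c" using C t by (simp add: c_def)
  show ?thesis
  proof (rule that[of "1 - t" "c + 2 * c * real d"])
    fix z assume z: "z \<in> space M"
    have "(\<integral>\<^sup>+w. ennreal (\<Phi> w origin) \<partial>Q z) \<le> ennreal (((1 - t) * \<Phi> z origin + c) + 2 * c * real d)"
    proof (rule drift_of_pathwise[OF z measurable_\<Phi>])
      fix \<xi> \<eta> :: point
      define N where "N = (\<Sum>i<d. (\<xi> i)\<^sup>2) + (\<Sum>i<d. (\<eta> i)\<^sup>2)"
      have "\<Phi> (step \<xi> \<eta> z) origin \<le> (1 + t) * \<Phi> (step \<xi> \<eta> z) (step \<xi> \<eta> origin) + (1 + 1 / t) * \<Phi> (step \<xi> \<eta> origin) origin"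
        using t by (intro \<Phi>_triangle) auto
      also have "\<dots> \<le> (1 + t) * ((1 - 2 * t) * \<Phi> z origin) + (1 + 1 / t) * (C * (1 + N))"
        using \<Phi>_contraction[of \<xi> \<eta> z origin] C t unfolding t2 N_def by (intro add_mono mult_left_mono) auto
      also have "\<dots> = ((1 + t) * (1 - 2 * t)) * \<Phi> z origin + c * (1 + N)" by (simp add: c_def)
      also have "(1 + t) * (1 - 2 * t) * \<Phi> z origin \<le> (1 - t) * \<Phi> z origin"
        using \<Phi>_nonneg t by (intro mult_right_mono) (auto simp: algebra_simps)
      finally show "\<Phi> (step \<xi> \<eta> z) origin \<le> ((1 - t) * \<Phi> z origin + c) + c * ((\<Sum>i<d. (\<xi> i)\<^sup>2) + (\<Sum>i<d. (\<eta> i)\<^sup>2))"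
        by (simp add: N_def algebra_simps)
    qed (use c t \<Phi>_nonneg in auto)
    then show "(\<integral>\<^sup>+w. ennreal (\<Phi> w origin) \<partial>Q z) \<le> ennreal ((1 - t) * \<Phi> z origin + (c + 2 * c * real d))"
      by (simp add: add.assoc)
  qed (use t c in auto)
qed

lemma sqrt_\<Phi>_le: "sqrt (\<Phi> z w) \<le> 2 * (1 + \<Phi> z origin + \<Phi> w origin)"
proof -
  have "sqrt (\<Phi> z w) \<le> 1 + \<Phi> z w"
    by (rule real_le_lsqrt) (use \<Phi>_nonneg[of z w] in \<open>auto simp: power2_eq_square algebra_simps\<close>)
  moreover have "\<Phi> origin w = \<Phi> w origin"
    by (auto simp: \<Phi>_def power2_eq_square algebra_simps diff_divide_distrib)
  ultimately show ?thesis using \<Phi>_triangle[of 1 z w origin] by simp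
qed

lemma invariant_law_exists:
  obtains \<pi> B where "unique_invariant_law d Q \<pi>" "0 \<le> B" "(\<integral>\<^sup>+w. ennreal (\<Phi> w origin) \<partial>\<pi>) \<le> ennreal B"
proof -
  obtain \<gamma>' K where dr: "0 \<le> \<gamma>'" "\<gamma>' < 1" "0 \<le> K"
    "\<And>z. z \<in> space M \<Longrightarrow> (\<integral>\<^sup>+w. ennreal (\<Phi> w origin) \<partial>Q z) \<le> ennreal (\<gamma>' * \<Phi> z origin + K)"
    using drift by blast
  define D where "D = 1 + 18 * sqrt \<kappa> / \<rho>"
  have D0: "0 \<le> 18 * sqrt \<kappa> / \<rho>" using \<kappa> \<rho>_bounds by simp
  then have D: "1 \<le> D" "18 * sqrt \<kappa> / \<rho> \<le> D" by (simp_all add: D_def)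
  have "\<bar>measure (P n x) A - measure (P n y) A\<bar> \<le> D * \<rho> ^ n * (1 + \<Phi> x origin + \<Phi> y origin)"
    if xy: "x \<in> space M" "y \<in> space M" "A \<in> sets M" for n x y A
  proof (cases n)
    case 0
    have "\<bar>measure (P n x) A - measure (P n y) A\<bar> \<le> 1"
      using measure_kernel_pow_01[OF xy(1), of n A] measure_kernel_pow_01[OF xy(2), of n A] by linarith
    also have "1 \<le> 1 * (1 + \<Phi> x origin + \<Phi> y origin)" using \<Phi>_nonneg by (simp add: add_nonneg_nonneg)
    also have "\<dots> \<le> D * (1 + \<Phi> x origin + \<Phi> y origin)"
      using D \<Phi>_nonneg by (intro mult_right_mono) (auto simp: add_nonneg_nonneg)
    finally show ?thesis using 0 by simp
  next
    case (Suc m)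
    have "\<bar>measure (P n x) A - measure (P n y) A\<bar> \<le> 9 * sqrt \<kappa> * \<rho> ^ m * sqrt (\<Phi> x y)"
      using tv_contraction[OF xy, of m] Suc by simp
    also have "\<dots> \<le> 9 * sqrt \<kappa> * \<rho> ^ m * (2 * (1 + \<Phi> x origin + \<Phi> y origin))"
      using \<rho>_bounds \<kappa> by (intro mult_left_mono sqrt_\<Phi>_le) auto
    also have "\<dots> = 18 * sqrt \<kappa> / \<rho> * \<rho> ^ n * (1 + \<Phi> x origin + \<Phi> y origin)"
      using \<rho>_bounds Suc by simp
    also have "\<dots> \<le> D * \<rho> ^ n * (1 + \<Phi> x origin + \<Phi> y origin)"
      using D \<rho>_bounds \<Phi>_nonneg by (intro mult_right_mono) (auto simp: add_nonneg_nonneg)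
    finally show ?thesis .
  qed
  note contraction = this
  have \<rho>D: "0 \<le> \<rho>" "\<rho> < 1" "0 \<le> D" using \<rho>_bounds D by linarith+
  obtain \<pi> where "unique_invariant_law d Q \<pi>"
      "(\<integral>\<^sup>+w. ennreal (\<Phi> w origin) \<partial>\<pi>) \<le> ennreal (\<Phi> origin origin + K / (1 - \<gamma>'))"
    by (rule unique_invariant_law_of_contraction[OF measurable_\<Phi> \<Phi>_nonneg dr(4,1,2,3) \<rho>D contraction origin])
  moreover have "0 \<le> \<Phi> origin origin + K / (1 - \<gamma>')" using dr \<Phi>_nonneg by (simp add: add_nonneg_nonneg)
  ultimately show ?thesis using that by blast
qed

text \<open>Average the contraction from \<open>z\<close> against the invariant law. As \<open>\<Phi>\<close> is comparable to the squared
  distance, its square root averages to at most a multiple of \<open>W2\<close>; \<open>R = 1 + W2\<close> serves as the weight in the inequality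
  \<open>2 R sqrt \<Phi> \<le> \<Phi> + R\<^sup>2\<close>, which replaces Jensen's inequality.\<close>

lemma W2_and_distance_to_invariant_law:
  assumes \<pi>: "unique_invariant_law d Q \<pi>" and B: "0 \<le> B" "(\<integral>\<^sup>+w. ennreal (\<Phi> w origin) \<partial>\<pi>) \<le> ennreal B"
    and z: "z \<in> space M"
  shows "W2 d (dirac d z) \<pi> < \<infinity>"
    and "tv_dist d (P (Suc n) z) \<pi> \<le> 18 * sqrt \<kappa> * \<rho> ^ n * (1 + enn2real (W2 d (dirac d z) \<pi>))"
proof -
  have pr: "prob_space \<pi>" and s[measurable_cong]: "sets \<pi> = sets M" and inv: "invariant_law d Q \<pi>"
    using \<pi> by (auto simp: unique_invariant_law_def invariant_law_def)
  interpret \<pi>: prob_space \<pi> by fact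
  have sp: "space \<pi> = space M" using s by (rule sets_eq_imp_space_eq)
  obtain C where C: "0 \<le> C" "\<And>z w. z \<in> space M \<Longrightarrow> w \<in> space M \<Longrightarrow> sq_dist d z w \<le> C * \<Phi> z w"
    using sq_dist_le_\<Phi> by blast
  define S where "S = 2 * sq_dist d z origin"
  have S: "0 \<le> S" by (simp add: S_def sq_dist_nonneg)
  have "(\<integral>\<^sup>+w. ennreal (sq_dist d z w) \<partial>\<pi>) \<le> (\<integral>\<^sup>+w. ennreal S + ennreal (2 * C) * ennreal (\<Phi> w origin) \<partial>\<pi>)"
  proof (rule nn_integral_mono)
    fix w assume "w \<in> space \<pi>"
    then have "sq_dist d z w \<le> S + 2 * C * \<Phi> w origin"
      using C(2)[of w origin] sq_dist_triangle[of d z w origin] sp by (simp add: S_def)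
    then show "ennreal (sq_dist d z w) \<le> ennreal S + ennreal (2 * C) * ennreal (\<Phi> w origin)"
      using S C \<Phi>_nonneg[of w origin]
      by (simp add: ennreal_mult[symmetric] ennreal_plus[symmetric] ennreal_leI del: ennreal_plus)
  qed
  also have "\<dots> = ennreal S + ennreal (2 * C) * (\<integral>\<^sup>+w. ennreal (\<Phi> w origin) \<partial>\<pi>)"
    by (subst nn_integral_add) (auto simp: nn_integral_cmult \<pi>.emeasure_space_1)
  also have "\<dots> \<le> ennreal S + ennreal (2 * C) * ennreal B" by (intro add_left_mono mult_left_mono B) auto
  also have "\<dots> = ennreal (S + 2 * C * B)" using S C B by (simp add: ennreal_mult[symmetric] ennreal_plus[symmetric] del: ennreal_plus)
  finally have fin: "(\<integral>\<^sup>+w. ennreal (sq_dist d z w) \<partial>\<pi>) \<le> ennreal (S + 2 * C * B)" .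
  have B': "0 \<le> S + 2 * C * B" using S C B by simp
  note W = W2_dirac_le[OF pr s z fin B']
  show "W2 d (dirac d z) \<pi> < \<infinity>" by (rule W(1))
  define w2 where "w2 = enn2real (W2 d (dirac d z) \<pi>)"
  have w2: "0 \<le> w2" by (simp add: w2_def)
  have msq[measurable]: "sq_dist d z \<in> borel_measurable M"
    unfolding sq_dist_def by measurable
  have sq: "integrable \<pi> (sq_dist d z) \<and> (\<integral>w. sq_dist d z w \<partial>\<pi>) \<le> w2\<^sup>2"
    by (rule integral_real_le_nn_integral) (use W(3) in \<open>auto simp: w2_def sq_dist_nonneg\<close>)
  define R where "R = 1 + w2"
  have R: "0 < R" using w2 by (simp add: R_def)
  have bound: "sqrt (\<Phi> z w) \<le> (3 / (2 * R)) * sq_dist d z w + R / 2" if "w \<in> space M" for w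
  proof -
    have "0 \<le> (sqrt (\<Phi> z w) - R)\<^sup>2" by simp
    then have "2 * R * sqrt (\<Phi> z w) \<le> \<Phi> z w + R\<^sup>2" using \<Phi>_nonneg[of z w] by (simp add: power2_diff algebra_simps)
    also have "\<dots> \<le> 3 * sq_dist d z w + R\<^sup>2" using \<Phi>_le_sq_dist[OF z that] by simp
    finally have "sqrt (\<Phi> z w) \<le> (3 * sq_dist d z w + R\<^sup>2) / (2 * R)" using R by (simp add: pos_le_divide_eq mult.commute)
    also have "\<dots> = (3 / (2 * R)) * sq_dist d z w + R / 2" using R by (simp add: add_divide_distrib power2_eq_square)
    finally show ?thesis .
  qed
  note it = invariant_kernel_pow[OF inv]
  show "tv_dist d (P (Suc n) z) \<pi> \<le> 18 * sqrt \<kappa> * \<rho> ^ n * (1 + enn2real (W2 d (dirac d z) \<pi>))"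
  proof (rule tv_dist_leI)
    fix A assume A: "A \<in> sets M"
    define p where "p w = measure (P (Suc n) w) A" for w
    have p01: "0 \<le> p w \<and> p w \<le> 1" if "w \<in> space M" for w unfolding p_def by (rule measure_kernel_pow_01[OF that])
    have pm[measurable]: "p \<in> borel_measurable M" unfolding p_def by (rule measurable_measure_kernel_pow[OF A])
    have ip: "integrable \<pi> p"
      by (rule \<pi>.integrable_const_bound[of _ 1]) (use p01 sp in \<open>auto intro!: AE_I2\<close>)
    have "measure \<pi> A = (\<integral>w. p w \<partial>\<pi>)"
      using measure_bind_kernel[OF pr s measurable_kernel_pow A, of "Suc n"] unfolding it p_def .
    then have "p z - measure \<pi> A = (\<integral>w. p z - p w \<partial>\<pi>)" using ip by (simp add: \<pi>.prob_space)
    then have "\<bar>p z - measure \<pi> A\<bar> \<le> (\<integral>w. \<bar>p z - p w\<bar> \<partial>\<pi>)" by (simp only: integral_abs_bound)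
    also have "\<dots> \<le> (\<integral>w. 9 * sqrt \<kappa> * \<rho> ^ n * ((3 / (2 * R)) * sq_dist d z w + R / 2) \<partial>\<pi>)"
    proof (rule integral_mono)
      show "integrable \<pi> (\<lambda>w. \<bar>p z - p w\<bar>)" using ip by (intro integrable_abs) simp
      show "integrable \<pi> (\<lambda>w. 9 * sqrt \<kappa> * \<rho> ^ n * ((3 / (2 * R)) * sq_dist d z w + R / 2))"
        using sq by simp
      fix w assume "w \<in> space \<pi>"
      then have w: "w \<in> space M" using sp by simp
      have "\<bar>p z - p w\<bar> \<le> 9 * sqrt \<kappa> * \<rho> ^ n * sqrt (\<Phi> z w)" unfolding p_def by (rule tv_contraction[OF z w A])
      also have "\<dots> \<le> 9 * sqrt \<kappa> * \<rho> ^ n * ((3 / (2 * R)) * sq_dist d z w + R / 2)"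
        using \<rho>_bounds \<kappa> by (intro mult_left_mono bound w) auto
      finally show "\<bar>p z - p w\<bar> \<le> 9 * sqrt \<kappa> * \<rho> ^ n * ((3 / (2 * R)) * sq_dist d z w + R / 2)" .
    qed
    also have "\<dots> = 9 * sqrt \<kappa> * \<rho> ^ n * ((3 / (2 * R)) * (\<integral>w. sq_dist d z w \<partial>\<pi>) + R / 2)"
      using sq by (simp add: \<pi>.prob_space)
    also have "\<dots> \<le> 9 * sqrt \<kappa> * \<rho> ^ n * (2 * R)"
    proof (intro mult_left_mono)
      have "w2\<^sup>2 \<le> R\<^sup>2" using w2 by (intro power_mono) (auto simp: R_def)
      then have "(\<integral>w. sq_dist d z w \<partial>\<pi>) \<le> R\<^sup>2" using sq by linarith
      then have "(3 / (2 * R)) * (\<integral>w. sq_dist d z w \<partial>\<pi>) \<le> (3 / (2 * R)) * R\<^sup>2" using R by (intro mult_left_mono) auto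
      also have "\<dots> = 3 / 2 * R" using R by (simp add: power2_eq_square)
      finally show "(3 / (2 * R)) * (\<integral>w. sq_dist d z w \<partial>\<pi>) + R / 2 \<le> 2 * R" by simp
    qed (use \<rho>_bounds \<kappa> in auto)
    finally show "\<bar>measure (P (Suc n) z) A - measure \<pi> A\<bar> \<le> 18 * sqrt \<kappa> * \<rho> ^ n * (1 + enn2real (W2 d (dirac d z) \<pi>))"
      by (simp add: p_def R_def w2_def mult_ac)
  qed
qed

text \<open>The bound is \<open>18 sqrt \<kappa> \<rho> ^ n R\<close> after \<open>n + 1\<close> steps with \<open>\<rho> \<le> exp (- 1 / (64 \<kappa>))\<close>. Of the 66, 64 come
  from the rate, one from rounding \<open>n\<close> up and one from the additional step.\<close>

lemma mixing_time_bound: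
  assumes \<pi>: "unique_invariant_law d Q \<pi>" and B: "0 \<le> B" "(\<integral>\<^sup>+w. ennreal (\<Phi> w origin) \<partial>\<pi>) \<le> ennreal B"
    and z: "z \<in> space M" and \<epsilon>: "0 < \<epsilon>" "\<epsilon> < 1"
  shows "ereal_of_enat (t_mix d z \<epsilon> Q \<pi>) \<le> ereal (66 * \<kappa> * ln (66 * \<kappa> * (1 + enn2real (W2 d (dirac d z) \<pi>)) / \<epsilon>))"
proof -
  define R where "R = 1 + enn2real (W2 d (dirac d z) \<pi>)"
  have R: "1 \<le> R" by (simp add: R_def)
  define A where "A = 66 * \<kappa> * R / \<epsilon>"
  have k: "1 \<le> sqrt \<kappa>" "sqrt \<kappa> \<le> \<kappa>"
  proof -
    show k1: "1 \<le> sqrt \<kappa>" using \<kappa> by simp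
    have "sqrt \<kappa> * 1 \<le> sqrt \<kappa> * sqrt \<kappa>" using k1 by (intro mult_left_mono) auto
    then show "sqrt \<kappa> \<le> \<kappa>" using \<kappa> by simp
  qed
  have "66 \<le> 66 * \<kappa> * R" using \<kappa> R mult_mono[of 1 \<kappa> 1 R] by simp
  also have "\<dots> \<le> A" using \<epsilon> R \<kappa> by (simp add: A_def pos_le_divide_eq mult_left_le)
  finally have A: "66 \<le> A" .
  have "exp (1::real) \<le> A" using exp_le A by linarith
  then have L: "1 \<le> ln A" using A by (subst ln_ge_iff) auto
  define n where "n = nat \<lceil>64 * \<kappa> * ln A\<rceil>"
  have n: "64 * \<kappa> * ln A \<le> n" "n \<le> 64 * \<kappa> * ln A + 1"
    using L \<kappa> unfolding n_def by (auto simp: of_nat_ceiling)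
  have "\<rho> ^ n \<le> exp (- 1 / (64 * \<kappa>)) ^ n" using \<rho>_bounds by (intro power_mono) auto
  also have "\<dots> = exp (- (n / (64 * \<kappa>)))" by (simp add: exp_of_nat_mult[symmetric])
  also have "\<dots> \<le> exp (- ln A)" using n \<kappa> by (simp add: field_simps)
  also have "\<dots> = 1 / A" using A by (simp add: exp_minus inverse_eq_divide)
  finally have \<rho>n: "\<rho> ^ n \<le> 1 / A" .
  have "tv_dist d (P (Suc n) z) \<pi> \<le> 18 * sqrt \<kappa> * \<rho> ^ n * R"
    unfolding R_def by (rule W2_and_distance_to_invariant_law(2)[OF \<pi> B z])
  also have "\<dots> \<le> 18 * \<kappa> * (1 / A) * R"
    using \<rho>n k R \<kappa> \<rho>_bounds by (intro mult_right_mono mult_mono) auto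
  also have "\<dots> = 18 / 66 * \<epsilon>" using R \<kappa> \<epsilon> by (simp add: A_def)
  also have "\<dots> \<le> \<epsilon>" using \<epsilon> by simp
  finally have "t_mix d z \<epsilon> Q \<pi> \<le> enat (Suc n)" unfolding t_mix_def by (intro Inf_lower) auto
  then have "ereal_of_enat (t_mix d z \<epsilon> Q \<pi>) \<le> ereal_of_enat (enat (Suc n))"
    by (simp only: ereal_of_enat_le_iff)
  also have "\<dots> = ereal (real n + 1)" by simp
  also have "\<dots> \<le> ereal (66 * \<kappa> * ln A)"
  proof -
    have "1 \<le> \<kappa> * ln A" using L \<kappa> mult_mono[of 1 \<kappa> 1 "ln A"] by simp
    then show ?thesis using n by simp
  qed
  finally show ?thesis by (simp add: A_def R_def)
qed

end

text \<open>For \<open>h = 1 / (4 sqrt \<kappa>)\<close> and \<open>\<gamma> h = 1\<close> the chain is a heavy ball with constant friction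
  and step size of order \<open>1 / \<kappa>\<close>.\<close>

lemma mixing_upper_bound:
  "\<exists>C1>0. \<forall>\<kappa>>1. \<forall>d\<ge>1. \<forall>U\<in>potentials d \<kappa>.
      let Q = obabo d U (1 / (4 * sqrt \<kappa>)) (4 * sqrt \<kappa>) in
      \<exists>\<pi>. unique_invariant_law d Q \<pi> \<and>
        (\<forall>z\<in>space (phase_space d). \<forall>\<epsilon>. 0 < \<epsilon> \<and> \<epsilon> < 1 \<longrightarrow>
           W2 d (dirac d z) \<pi> < \<infinity> \<and>
           ereal_of_enat (t_mix d z \<epsilon> Q \<pi>)
             \<le> ereal (C1 * \<kappa> * ln (C1 * \<kappa> * (1 + enn2real (W2 d (dirac d z) \<pi>)) / \<epsilon>)))"
proof (intro exI[of _ 66] conjI allI impI ballI)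
  fix \<kappa> :: real and d :: nat and U assume \<kappa>: "1 < \<kappa>" and "1 \<le> d" and U: "U \<in> potentials d \<kappa>"
  interpret obabo_chain d U "1 / (4 * sqrt \<kappa>)" "4 * sqrt \<kappa>"
    using \<kappa> U by (intro obabo_chain_potential) auto
  interpret tuned_chain d U "1 / (4 * sqrt \<kappa>)" "4 * sqrt \<kappa>" \<kappa>
    using \<kappa> U by unfold_locales auto
  obtain \<pi> B where *: "unique_invariant_law d Q \<pi>" "0 \<le> B" "(\<integral>\<^sup>+w. ennreal (\<Phi> w origin) \<partial>\<pi>) \<le> ennreal B"
    by (rule invariant_law_exists)
  show "let Q = Q in \<exists>\<pi>. unique_invariant_law d Q \<pi> \<and>
        (\<forall>z\<in>space (phase_space d). \<forall>\<epsilon>. 0 < \<epsilon> \<and> \<epsilon> < 1 \<longrightarrow>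
           W2 d (dirac d z) \<pi> < \<infinity> \<and>
           ereal_of_enat (t_mix d z \<epsilon> Q \<pi>)
             \<le> ereal (66 * \<kappa> * ln (66 * \<kappa> * (1 + enn2real (W2 d (dirac d z) \<pi>)) / \<epsilon>)))"
    unfolding Let_def
    by (intro exI[of _ \<pi>] conjI ballI allI impI * W2_and_distance_to_invariant_law(1)[OF *] mixing_time_bound[OF *]) auto
qed simp

section \<open>Potentials with a staircase force\<close>

primrec times_differentiable :: "nat \<Rightarrow> (real \<Rightarrow> real) \<Rightarrow> bool" where
  "times_differentiable 0 f \<longleftrightarrow> continuous_on UNIV f"
| "times_differentiable (Suc k) f \<longleftrightarrow>
     (\<exists>f'. (\<forall>x. (f has_real_derivative f' x) (at x)) \<and> times_differentiable k f')"

lemma times_differentiable_SucI: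
  "(\<And>x. (f has_real_derivative f' x) (at x)) \<Longrightarrow> times_differentiable k f' \<Longrightarrow> times_differentiable (Suc k) f"
  by auto

lemma times_differentiable_SucD: "times_differentiable (Suc k) f \<Longrightarrow> times_differentiable k f"
proof (induction k arbitrary: f)
  case 0
  then obtain f' where "\<And>x. (f has_real_derivative f' x) (at x)" by auto
  then show ?case using DERIV_continuous_on[of UNIV f f'] by simp
next
  case (Suc k)
  then show ?case by (metis times_differentiable.simps(2))
qed

lemma times_differentiable_const: "times_differentiable k (\<lambda>_. c)"
proof (induction k arbitrary: c)
  case (Suc k)
  then show ?case by (auto intro!: exI[of _ "\<lambda>_. 0"])
qed simp

lemma times_differentiable_add:
  "times_differentiable k f \<Longrightarrow> times_differentiable k g \<Longrightarrow> times_differentiable k (\<lambda>x. f x + g x)"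
proof (induction k arbitrary: f g)
  case (Suc k)
  then obtain f' g' where "\<And>x. (f has_real_derivative f' x) (at x)" "times_differentiable k f'"
    "\<And>x. (g has_real_derivative g' x) (at x)" "times_differentiable k g'" by auto
  then show ?case using Suc.IH[of f' g'] by (auto intro!: exI[of _ "\<lambda>x. f' x + g' x"] DERIV_add)
qed (auto intro: continuous_on_add)

lemma times_differentiable_mult:
  "times_differentiable k f \<Longrightarrow> times_differentiable k g \<Longrightarrow> times_differentiable k (\<lambda>x. f x * g x)"
proof (induction k arbitrary: f g)
  case (Suc k)
  then obtain f' g' where *: "\<And>x. (f has_real_derivative f' x) (at x)" "times_differentiable k f'"
    "\<And>x. (g has_real_derivative g' x) (at x)" "times_differentiable k g'" by auto
  have "times_differentiable k (\<lambda>x. f x * g' x + f' x * g x)"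
    using Suc times_differentiable_SucD * by (intro times_differentiable_add) blast+
  then show ?case using * by (auto intro!: exI[of _ "\<lambda>x. f x * g' x + f' x * g x"] derivative_eq_intros)
qed (auto intro: continuous_on_mult)

lemma times_differentiable_sum:
  "(\<And>j. j \<in> J \<Longrightarrow> times_differentiable k (f j)) \<Longrightarrow> times_differentiable k (\<lambda>x. \<Sum>j\<in>J. f j x)"
  by (induction J rule: infinite_finite_induct) (auto intro: times_differentiable_add times_differentiable_const)

lemma times_differentiable_affine:
  "times_differentiable k f \<Longrightarrow> times_differentiable k (\<lambda>x. f (a * x + b))"
proof (induction k arbitrary: f)
  case 0
  then show ?case by (auto intro!: continuous_on_compose2[of UNIV f] continuous_intros)
next
  case (Suc k)
  then obtain f' where *: "\<And>x. (f has_real_derivative f' x) (at x)" "times_differentiable k f'" by auto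
  have "((\<lambda>x. f (a * x + b)) has_real_derivative f' (a * x + b) * a) (at x)" for x
    by (rule DERIV_chain2[OF *(1)]) (auto intro!: derivative_eq_intros)
  moreover have "times_differentiable k (\<lambda>x. f' (a * x + b) * a)"
    by (intro times_differentiable_mult times_differentiable_const Suc.IH *)
  ultimately show ?case by (rule times_differentiable_SucI)
qed

lemma times_differentiable_inverse:
  "times_differentiable k f \<Longrightarrow> (\<And>x. f x \<noteq> 0) \<Longrightarrow> times_differentiable k (\<lambda>x. inverse (f x))"
proof (induction k)
  case (Suc k)
  then obtain f' where *: "\<And>x. (f has_real_derivative f' x) (at x)" "times_differentiable k f'" by auto
  have "((\<lambda>x. inverse (f x)) has_real_derivative - 1 * (f' x * (inverse (f x) * inverse (f x)))) (at x)" for x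
    using Suc.prems(2) by (auto intro!: derivative_eq_intros * simp: )
  moreover have "times_differentiable k (\<lambda>x. - 1 * (f' x * (inverse (f x) * inverse (f x))))"
    using Suc times_differentiable_SucD by (intro times_differentiable_mult times_differentiable_const *) blast+
  ultimately show ?case by (rule times_differentiable_SucI)
qed (auto intro: continuous_intros)

text \<open>The functions \<open>p (1 / t) exp (- 1 / t)\<close> for polynomials \<open>p\<close>, extended by 0, are closed under
  differentiation, so each of them is smooth.\<close>

definition flat :: "real poly \<Rightarrow> real \<Rightarrow> real" where
  "flat p t = (if t \<le> 0 then 0 else poly p (1 / t) * exp (- (1 / t)))"

lemma poly_over_exp_tendsto_0: "((\<lambda>s::real. s ^ k * poly p s * exp (- s)) \<longlongrightarrow> 0) at_top"
proof (induction p arbitrary: k)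
  case (pCons a p)
  have "((\<lambda>s::real. a * (s ^ k / exp s) + s ^ Suc k * poly p s * exp (- s)) \<longlongrightarrow> a * 0 + 0) at_top"
    by (intro tendsto_intros tendsto_power_div_exp_0 pCons.IH)
  then show ?case by (simp add: exp_minus field_simps)
qed simp

lemma flat_has_derivative:
  "(flat p has_real_derivative flat ([:0, 0, 1:] * (p - pderiv p)) t) (at t)"
proof -
  consider "t < 0" | "t = 0" | "t > 0" by linarith
  then show ?thesis
  proof cases
    case 1
    have "((\<lambda>_. 0) has_real_derivative 0) (at t)" by simp
    then have "(flat p has_real_derivative 0) (at t)"
      by (rule has_field_derivative_transform_within_open[of _ _ _ "{..<0}"]) (use 1 in \<open>auto simp: flat_def\<close>)
    then show ?thesis using 1 by (simp add: flat_def)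
  next
    case 2
    have l: "((\<lambda>y. (flat p y - flat p 0) / (y - 0)) \<longlongrightarrow> 0) (at_left 0)"
      by (rule tendsto_eventually) (auto simp: flat_def eventually_at_filter)
    have "((\<lambda>y. (1 / y) ^ 1 * poly p (1 / y) * exp (- (1 / y))) \<longlongrightarrow> 0) (at_right (0::real))"
      using filterlim_compose[OF poly_over_exp_tendsto_0[of 1 p] filterlim_inverse_at_top_right] by (simp add: inverse_eq_divide)
    then have r: "((\<lambda>y. (flat p y - flat p 0) / (y - 0)) \<longlongrightarrow> 0) (at_right 0)"
      by (rule Lim_transform_eventually) (auto simp: flat_def eventually_at_filter)
    have "((\<lambda>y. (flat p y - flat p 0) / (y - 0)) \<longlongrightarrow> 0) (at 0)"
      using l r by (simp add: filterlim_split_at_real)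
    then have "(flat p has_real_derivative 0) (at 0)" unfolding has_field_derivative_iff .
    then show ?thesis using 2 by (simp add: flat_def)
  next
    case 3
    have "((\<lambda>t. poly p (1 / t) * exp (- (1 / t))) has_real_derivative
       (poly (pderiv p) (1 / t) * (- 1 / t\<^sup>2)) * exp (- (1 / t)) + poly p (1 / t) * (exp (- (1 / t)) * (1 / t\<^sup>2))) (at t)"
      using 3 by (auto intro!: derivative_eq_intros simp: power2_eq_square)
    then have "(flat p has_real_derivative
       (poly (pderiv p) (1 / t) * (- 1 / t\<^sup>2)) * exp (- (1 / t)) + poly p (1 / t) * (exp (- (1 / t)) * (1 / t\<^sup>2))) (at t)"
      by (rule has_field_derivative_transform_within_open[of _ _ _ "{0<..}"]) (use 3 in \<open>auto simp: flat_def\<close>)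
    moreover have "(poly (pderiv p) (1 / t) * (- 1 / t\<^sup>2)) * exp (- (1 / t)) + poly p (1 / t) * (exp (- (1 / t)) * (1 / t\<^sup>2))
       = flat ([:0, 0, 1:] * (p - pderiv p)) t"
      using 3 by (simp add: flat_def power2_eq_square field_simps)
    ultimately show ?thesis by simp
  qed
qed

lemma times_differentiable_flat: "times_differentiable k (flat p)"
proof (induction k arbitrary: p)
  case 0
  then show ?case using flat_has_derivative by (auto intro!: DERIV_continuous_on)
next
  case (Suc k)
  then show ?case using flat_has_derivative unfolding times_differentiable.simps(2) by blast
qed

text \<open>A transition from 0 to 1 on the unit interval. The bound \<open>B\<close> on its slope is an absolute constant,
  and all constants of the lower bound are multiples of it.\<close>

locale smooth_step =
  fixes G G1 :: "real \<Rightarrow> real" and B :: real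
  assumes smooth_G1: "times_differentiable k G1"
    and deriv_G: "(G has_real_derivative G1 t) (at t)"
    and G1_nonneg: "0 \<le> G1 t" and G1_le: "G1 t \<le> B" and B_ge_1: "1 \<le> B"
    and G_left: "t \<le> 0 \<Longrightarrow> G t = 0 \<and> G1 t = 0" and G_right: "1 \<le> t \<Longrightarrow> G t = 1 \<and> G1 t = 0"
    and G_range: "0 \<le> G t \<and> G t \<le> 1"

lemma smooth_step_exists: "\<exists>G G1 B. smooth_step G G1 B"
proof -
  define f f1 where "f = flat 1" and "f1 = flat [:0, 0, 1:]"
  have f: "(f has_real_derivative f1 t) (at t)" for t
    using flat_has_derivative[of 1 t] by (simp add: f_def f1_def)
  have fpos: "0 \<le> f t" "0 < t \<Longrightarrow> 0 < f t" "t \<le> 0 \<Longrightarrow> f t = 0" for t by (auto simp: f_def flat_def)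
  have f1pos: "0 \<le> f1 t" "t \<le> 0 \<Longrightarrow> f1 t = 0" for t by (auto simp: f1_def flat_def)
  define N where "N t = f t + f (1 - t)" for t
  have N: "0 < N t" for t
  proof (cases "0 < t")
    case True
    then show ?thesis using fpos(2)[of t] fpos(1)[of "1 - t"] by (simp add: N_def)
  next
    case False
    then show ?thesis using fpos(1)[of t] fpos(2)[of "1 - t"] by (simp add: N_def)
  qed
  define G G1 where "G t = f t * inverse (N t)"
    and "G1 t = (f1 t * f (1 - t) + f t * f1 (1 - t)) * (inverse (N t) * inverse (N t))" for t
  have f': "((\<lambda>t. f (1 - t)) has_real_derivative - f1 (1 - t)) (at t)" for t
  proof -
    have "((\<lambda>t. f (1 - t)) has_real_derivative f1 (1 - t) * (0 - 1)) (at t)"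
      by (rule DERIV_chain2[OF f]) (auto intro!: derivative_eq_intros)
    then show ?thesis by simp
  qed
  have G: "(G has_real_derivative G1 t) (at t)" for t
  proof -
    have "(N has_real_derivative f1 t - f1 (1 - t)) (at t)"
      unfolding N_def[abs_def] using DERIV_add[OF f[of t] f'[of t]] by simp
    then have "(G has_real_derivative f1 t * inverse (N t) + (- (inverse (N t) * (f1 t - f1 (1 - t)) * inverse (N t))) * f t) (at t)"
      unfolding G_def[abs_def] using N[of t] by (intro DERIV_mult f DERIV_inverse') auto
    moreover have "f1 t * inverse (N t) + (- (inverse (N t) * (f1 t - f1 (1 - t)) * inverse (N t))) * f t = G1 t"
    proof -
      define v where "v = inverse (N t) * inverse (N t)"
      have 1: "f1 t * inverse (N t) = f1 t * N t * v" using N[of t] by (simp add: v_def)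
      have 2: "f1 t * N t * v + (- (inverse (N t) * (f1 t - f1 (1 - t)) * inverse (N t))) * f t
         = (f1 t * (N t - f t) + f t * f1 (1 - t)) * v"
        unfolding v_def by (simp add: algebra_simps)
      have 3: "N t - f t = f (1 - t)" by (simp add: N_def)
      show ?thesis unfolding 1 unfolding 2 unfolding 3 G1_def v_def ..
    qed
    ultimately show ?thesis by simp
  qed
  have smf: "times_differentiable k f" "times_differentiable k f1" for k
    by (simp_all add: f_def f1_def times_differentiable_flat)
  have smr: "times_differentiable k (\<lambda>t. f (1 - t))" "times_differentiable k (\<lambda>t. f1 (1 - t))" for k
    using times_differentiable_affine[OF smf(1), of k "-1" 1] times_differentiable_affine[OF smf(2), of k "-1" 1] by simp_all
  have smN: "times_differentiable k (\<lambda>t. inverse (N t))" for k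
  proof (rule times_differentiable_inverse)
    show "times_differentiable k N" unfolding N_def[abs_def] by (intro times_differentiable_add smf smr)
    show "N t \<noteq> 0" for t using N[of t] by simp
  qed
  have smG: "times_differentiable k G1" for k
    unfolding G1_def[abs_def] by (intro times_differentiable_mult times_differentiable_add smf smr smN)
  have G1pos: "0 \<le> G1 t" for t using fpos f1pos N[of t] by (simp add: G1_def)
  have out: "G1 t = 0" if "t \<le> 0 \<or> 1 \<le> t" for t using that fpos f1pos by (auto simp: G1_def)
  have "continuous_on {0..1} G1" using smG[of 0] by (auto intro: continuous_on_subset)
  then obtain B where B: "\<And>t. t \<in> {0..1} \<Longrightarrow> G1 t \<le> B"
    using continuous_attains_sup[of "{0..1::real}" G1] by fastforce
  have bd: "G1 t \<le> max B 1" for t using B[of t] out[of t] by (cases "t \<in> {0..1}") (auto simp: le_max_iff_disj)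
  have G01: "0 \<le> G t \<and> G t \<le> 1" for t
  proof -
    have "f t \<le> N t" using fpos by (simp add: N_def)
    then show ?thesis using N[of t] fpos(1)[of t] by (simp add: G_def field_simps)
  qed
  have "smooth_step G G1 (max B 1)"
  proof (unfold_locales, rule smG, rule G, rule G1pos, rule bd, simp)
    show "G t = 0 \<and> G1 t = 0" if "t \<le> 0" for t using that out fpos by (simp add: G_def)
    show "G t = 1 \<and> G1 t = 0" if "1 \<le> t" for t
    proof -
      have "N t = f t" using fpos(3)[of "1 - t"] that by (simp add: N_def)
      then show ?thesis using N[of t] that out by (simp add: G_def)
    qed
  qed (rule G01)
  then show ?thesis by blast
qed

text \<open>The partial derivative is again written as a separable sum, so that \<open>C_k_separable\<close> can be proved by
  induction.\<close>

lemma partial_separable: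
  assumes "i < d" "\<And>t. (u i has_real_derivative u' t) (at t)"
  shows "partial i (\<lambda>x. \<Sum>j<d. u j (x j)) = (\<lambda>x. \<Sum>j<d. (if j = i then u' else (\<lambda>_. 0)) (x j))"
    and "(\<lambda>t. \<Sum>j<d. u j ((x(i := t)) j)) differentiable (at (x i))"
proof -
  have *: "((\<lambda>t. \<Sum>j<d. u j ((x(i := t)) j)) has_real_derivative u' s) (at s)" for x s
  proof -
    have "((\<lambda>t. \<Sum>j<d. u j ((x(i := t)) j)) has_real_derivative (\<Sum>j<d. if j = i then u' s else 0)) (at s)"
      by (intro DERIV_sum) (use assms in auto)
    then show ?thesis using assms(1) by simp
  qed
  show "partial i (\<lambda>x. \<Sum>j<d. u j (x j)) = (\<lambda>x. \<Sum>j<d. (if j = i then u' else (\<lambda>_. 0)) (x j))"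
  proof
    fix x :: point
    have "(\<Sum>j<d. (if j = i then u' else (\<lambda>_. 0)) (x j)) = (\<Sum>j<d. if j = i then u' (x i) else 0)"
      by (intro sum.cong) auto
    then show "partial i (\<lambda>x. \<Sum>j<d. u j (x j)) x = (\<Sum>j<d. (if j = i then u' else (\<lambda>_. 0)) (x j))"
      using DERIV_imp_deriv[OF *[of x "x i"]] assms(1) by (simp add: partial_def)
  qed
  show "(\<lambda>t. \<Sum>j<d. u j ((x(i := t)) j)) differentiable (at (x i))"
    using *[of x "x i"] real_differentiable_def by blast
qed

lemma C_k_separable:
  assumes "\<And>i. i < d \<Longrightarrow> times_differentiable k (u i)"
  shows "C_k d k (\<lambda>x. \<Sum>i<d. u i (x i))"
  using assms
proof (induction k arbitrary: u)
  case 0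
  have "continuous_on (vecs d) (\<lambda>x. u i (x i))" if "i < d" for i
  proof (rule continuous_on_compose2[of UNIV "u i" "vecs d" "\<lambda>x. x i"])
    show "continuous_on UNIV (u i)" using 0 that by simp
    show "continuous_on (vecs d) (\<lambda>x. x i)"
      by (rule continuous_on_subset[OF continuous_on_product_coordinates]) simp
  qed auto
  then show ?case by (auto intro!: continuous_on_sum)
next
  case (Suc k)
  have C: "C_k d k (\<lambda>x. \<Sum>i<d. u i (x i))"
    by (rule Suc.IH) (use Suc.prems times_differentiable_SucD in blast)
  then have cont: "continuous_on (vecs d) (\<lambda>x. \<Sum>i<d. u i (x i))" by (cases k) auto
  have "(\<forall>x\<in>vecs d. (\<lambda>t. \<Sum>j<d. u j ((x(i := t)) j)) differentiable (at (x i))) \<and>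
     C_k d k (partial i (\<lambda>x. \<Sum>j<d. u j (x j)))" if i: "i < d" for i
  proof -
    obtain u' where u': "\<And>t. (u i has_real_derivative u' t) (at t)" "times_differentiable k u'"
      using Suc.prems[OF i] by auto
    have "C_k d k (\<lambda>x. \<Sum>j<d. (if j = i then u' else (\<lambda>_. 0)) (x j))"
      by (rule Suc.IH) (use u' times_differentiable_const in auto)
    then show ?thesis
      unfolding partial_separable(1)[where u=u, OF i u'(1)] using partial_separable(2)[where u=u, OF i u'(1)] by blast
  qed
  then show ?case using cont by (simp only: C_k.simps) blast
qed

lemma separable_potential:
  assumes u: "\<And>i t. i < d \<Longrightarrow> (u i has_real_derivative u1 i t) (at t)"
    and u1: "\<And>i t. i < d \<Longrightarrow> (u1 i has_real_derivative u2 i t) (at t)"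
    and sm: "\<And>i k. i < d \<Longrightarrow> times_differentiable k (u2 i)"
    and bd: "\<And>i t. i < d \<Longrightarrow> 1 \<le> u2 i t \<and> u2 i t \<le> \<kappa>"
  shows "(\<lambda>x. \<Sum>i<d. u i (x i)) \<in> potentials d \<kappa>"
    and "i < d \<Longrightarrow> grad d (\<lambda>x. \<Sum>i<d. u i (x i)) x i = u1 i (x i)"
proof -
  define U where "U = (\<lambda>x :: point. \<Sum>i<d. u i (x i))"
  have single: "(\<Sum>j<d. (if j = i then f else (\<lambda>_. 0)) (x j)) = f (x i)" if "i < d" for i f and x :: point
  proof -
    have "(\<Sum>j<d. (if j = i then f else (\<lambda>_. 0)) (x j)) = (\<Sum>j<d. if j = i then f (x i) else 0)"
      by (intro sum.cong) auto
    then show ?thesis using that by simp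
  qed
  have smu: "times_differentiable k (u i)" if "i < d" for i k
  proof -
    have "times_differentiable (Suc (Suc k)) (u i)"
      by (rule times_differentiable_SucI[OF u[OF that]], rule times_differentiable_SucI[OF u1[OF that]], rule sm[OF that])
    then show ?thesis using times_differentiable_SucD by blast
  qed
  have smooth: "smooth d U" unfolding smooth_def U_def using smu by (auto intro: C_k_separable)
  have p1: "partial i U = (\<lambda>x. \<Sum>j<d. (if j = i then u1 i else (\<lambda>_. 0)) (x j))" if "i < d" for i
    unfolding U_def using that u by (intro partial_separable) auto
  show "i < d \<Longrightarrow> grad d U x i = u1 i (x i)" for i x
    by (simp add: grad_def p1 single)
  have H: "hessian U x i j = (if i = j then u2 i (x i) else 0)" if "i < d" "j < d" for x i j
  proof -
    have "partial i (\<lambda>x. \<Sum>k<d. (if k = j then u1 j else (\<lambda>_. 0)) (x k))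
       = (\<lambda>x. \<Sum>k<d. (if k = i then (if i = j then u2 i else (\<lambda>_. 0)) else (\<lambda>_. 0)) (x k))"
      using that u1 by (intro partial_separable) (auto)
    then have "hessian U x i j = (\<Sum>k<d. (if k = i then (if i = j then u2 i else (\<lambda>_. 0)) else (\<lambda>_. 0)) (x k))"
      unfolding hessian_def p1[OF that(2)] by (rule fun_cong)
    also have "\<dots> = (if i = j then u2 i else (\<lambda>_. 0)) (x i)" by (rule single[OF that(1)])
    finally show ?thesis by simp
  qed
  have sum: "(\<Sum>i<d. \<Sum>j<d. w i * (if i = j then c i else 0) * w j) = (\<Sum>i<d. c i * (w i)\<^sup>2)" for w c :: "nat \<Rightarrow> real"
  proof (intro sum.cong refl)
    fix i assume "i \<in> {..<d}"
    have "(\<Sum>j<d. w i * (if i = j then c i else 0) * w j) = (\<Sum>j<d. if j = i then c i * (w i)\<^sup>2 else 0)"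
      by (intro sum.cong) (auto simp: power2_eq_square)
    then show "(\<Sum>j<d. w i * (if i = j then c i else 0) * w j) = c i * (w i)\<^sup>2" using \<open>i \<in> {..<d}\<close> by simp
  qed
  have "loewner_le d (scalar_mat 1) (hessian U x)" for x
    unfolding loewner_le_def
  proof
    fix w :: "nat \<Rightarrow> real"
    have "(\<Sum>i<d. \<Sum>j<d. w i * (hessian U x i j - scalar_mat 1 i j) * w j)
      = (\<Sum>i<d. \<Sum>j<d. w i * (if i = j then u2 i (x i) - 1 else 0) * w j)"
      by (intro sum.cong refl) (auto simp: H scalar_mat_def)
    also have "\<dots> = (\<Sum>i<d. (u2 i (x i) - 1) * (w i)\<^sup>2)" by (rule sum)
    also have "\<dots> \<ge> 0" using bd by (intro sum_nonneg mult_nonneg_nonneg) auto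
    finally show "0 \<le> (\<Sum>i<d. \<Sum>j<d. w i * (hessian U x i j - scalar_mat 1 i j) * w j)" .
  qed
  moreover have "loewner_le d (hessian U x) (scalar_mat \<kappa>)" for x
    unfolding loewner_le_def
  proof
    fix w :: "nat \<Rightarrow> real"
    have "(\<Sum>i<d. \<Sum>j<d. w i * (scalar_mat \<kappa> i j - hessian U x i j) * w j)
      = (\<Sum>i<d. \<Sum>j<d. w i * (if i = j then \<kappa> - u2 i (x i) else 0) * w j)"
      by (intro sum.cong refl) (auto simp: H scalar_mat_def)
    also have "\<dots> = (\<Sum>i<d. (\<kappa> - u2 i (x i)) * (w i)\<^sup>2)" by (rule sum)
    also have "\<dots> \<ge> 0" using bd by (intro sum_nonneg mult_nonneg_nonneg) auto
    finally show "0 \<le> (\<Sum>i<d. \<Sum>j<d. w i * (scalar_mat \<kappa> i j - hessian U x i j) * w j)" .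
  qed
  ultimately show "U \<in> potentials d \<kappa>" using smooth by (simp add: potentials_def)
qed

lemma antiderivative_exists:
  fixes f :: "real \<Rightarrow> real"
  assumes "continuous_on UNIV f"
  obtains F where "\<And>x. (F has_real_derivative f x) (at x)"
proof -
  have "\<exists>F. \<forall>x :: real. -\<infinity> < ereal x \<longrightarrow> ereal x < \<infinity> \<longrightarrow> (F has_vector_derivative f x) (at x)"
    by (rule einterval_antiderivative) (use assms continuous_on_eq_continuous_at in auto)
  then show ?thesis using that by (auto simp: has_real_derivative_iff_has_vector_derivative)
qed

context smooth_step
begin

text \<open>Step \<open>j\<close> rises by \<open>a j\<close> over the interval \<open>[l j, l j + w j]\<close>; between the steps the function is constant.\<close>

definition stair :: "nat \<Rightarrow> (nat \<Rightarrow> real) \<Rightarrow> (nat \<Rightarrow> real) \<Rightarrow> (nat \<Rightarrow> real) \<Rightarrow> real \<Rightarrow> real" where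
  "stair m a l w t = (\<Sum>j<m. a j * G ((t - l j) / w j))"

lemma stair_bound:
  assumes "\<And>j. j < m \<Longrightarrow> 0 \<le> a j"
  shows "0 \<le> stair m a l w t \<and> stair m a l w t \<le> (\<Sum>j<m. a j)"
  unfolding stair_def using assms G_range by (auto intro!: sum_nonneg sum_mono mult_nonneg_nonneg mult_left_le)

text \<open>The force \<open>t + c + stair\<close> has slope at most \<open>\<kappa>\<close>, because at any point at most one step is active and that step
  has slope at most \<open>\<kappa> - 1\<close>.\<close>

lemma stair_potential:
  assumes a: "\<And>j. j < m \<Longrightarrow> 0 \<le> a j" and w: "\<And>j. j < m \<Longrightarrow> 0 < w j"
    and slope: "\<And>j. j < m \<Longrightarrow> B * a j \<le> (\<kappa> - 1) * w j" and \<kappa>: "1 \<le> \<kappa>"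
    and disj: "\<And>j k. j < m \<Longrightarrow> k < m \<Longrightarrow> j \<noteq> k \<Longrightarrow> l j + w j \<le> l k \<or> l k + w k \<le> l j"
  shows "\<exists>U\<in>potentials 2 \<kappa>. \<forall>x. \<forall>i<2. grad 2 U x i = x i + (if i = 0 then c + stair m a l w (x i) else 0)"
proof -
  have "continuous_on UNIV G" using DERIV_continuous_on[of UNIV G G1] deriv_G by simp
  then obtain H where H: "\<And>t. (H has_real_derivative G t) (at t)" using antiderivative_exists[of G] by blast
  define u u1 u2 :: "nat \<Rightarrow> real \<Rightarrow> real"
    where "u i t = t\<^sup>2 / 2 + (if i = 0 then c * t + (\<Sum>j<m. a j * (w j * H ((t - l j) / w j))) else 0)"
      and "u1 i t = t + (if i = 0 then c + stair m a l w t else 0)"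
      and "u2 i t = 1 + (if i = 0 then \<Sum>j<m. a j / w j * G1 (1 / w j * t + (- l j / w j)) else 0)" for i t
  have arg: "(t - l j) / w j = 1 / w j * t + (- l j / w j)" for t j by (simp add: diff_divide_distrib)
  have inner: "((\<lambda>t. (t - l j) / w j) has_real_derivative 1 / w j) (at t)" if "j < m" for t j
    using w[OF that] by (auto intro!: derivative_eq_intros)
  have d1: "(u i has_real_derivative u1 i t) (at t)" for i t
  proof -
    have "((\<lambda>t. a j * (w j * H ((t - l j) / w j))) has_real_derivative a j * G ((t - l j) / w j)) (at t)" if "j < m" for j
    proof -
      have "((\<lambda>t. a j * (w j * H ((t - l j) / w j))) has_real_derivative a j * (w j * (G ((t - l j) / w j) * (1 / w j)))) (at t)"
        by (intro DERIV_cmult DERIV_chain2[OF H inner[OF that]])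
      then show ?thesis using w[OF that] by simp
    qed
    then have S: "((\<lambda>t. \<Sum>j<m. a j * (w j * H ((t - l j) / w j))) has_real_derivative stair m a l w t) (at t)"
      unfolding stair_def by (intro DERIV_sum) auto
    have lin: "((\<lambda>t. t\<^sup>2 / 2) has_real_derivative t) (at t)" "((\<lambda>t. c * t) has_real_derivative c) (at t)"
      by (auto intro!: derivative_eq_intros)
    show ?thesis unfolding u_def[abs_def] u1_def
      using DERIV_add[OF lin(1) DERIV_add[OF lin(2) S]] lin(1) by (cases "i = 0") auto
  qed
  have d2: "(u1 i has_real_derivative u2 i t) (at t)" for i t
  proof -
    have "((\<lambda>t. stair m a l w t) has_real_derivative (\<Sum>j<m. a j * (G1 ((t - l j) / w j) * (1 / w j)))) (at t)"
      unfolding stair_def by (intro DERIV_sum DERIV_cmult DERIV_chain2[OF deriv_G inner]) auto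
    then have "((\<lambda>t. stair m a l w t) has_real_derivative (\<Sum>j<m. a j / w j * G1 (1 / w j * t + (- l j / w j)))) (at t)"
      by (simp add: arg mult_ac)
    then show ?thesis unfolding u1_def[abs_def] u2_def
      by (cases "i = 0") (auto intro!: derivative_eq_intros)
  qed
  have sm: "times_differentiable k (u2 i)" for i k
  proof (cases "i = 0")
    case True
    have "times_differentiable k (\<lambda>t. 1 + (\<Sum>j<m. a j / w j * G1 (1 / w j * t + (- l j / w j))))"
      by (intro times_differentiable_add times_differentiable_const times_differentiable_sum
          times_differentiable_mult times_differentiable_affine smooth_G1)
    then show ?thesis by (simp only: u2_def[abs_def] True simp_thms if_True)
  next
    case False
    then show ?thesis using times_differentiable_const[of k 1] by (simp add: u2_def[abs_def])
  qed
  have bd: "1 \<le> u2 i t \<and> u2 i t \<le> \<kappa>" for i t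
  proof -
    define s where "s j = a j / w j * G1 ((t - l j) / w j)" for j
    have s: "0 \<le> s j \<and> s j \<le> \<kappa> - 1" if "j < m" for j
    proof -
      have "s j \<le> a j / w j * B" unfolding s_def using a[OF that] w[OF that] G1_le by (intro mult_left_mono) auto
      also have "\<dots> \<le> \<kappa> - 1" using slope[OF that] w[OF that] by (simp add: field_simps)
      finally show ?thesis using a[OF that] w[OF that] G1_nonneg by (simp add: s_def)
    qed
    have zero: "s k = 0" if "j < m" "k < m" "j \<noteq> k" "s j \<noteq> 0" for j k
    proof -
      have "\<not> (t - l j) / w j \<le> 0" "\<not> 1 \<le> (t - l j) / w j"
        using \<open>s j \<noteq> 0\<close> G_left[of "(t - l j) / w j"] G_right[of "(t - l j) / w j"] unfolding s_def by auto
      then have "l j < t" "t < l j + w j" using w[OF that(1)] by (auto simp: field_simps)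
      then have "t \<le> l k \<or> l k + w k \<le> t" using disj[OF that(1,2,3)] by linarith
      then have "(t - l k) / w k \<le> 0 \<or> 1 \<le> (t - l k) / w k" using w[OF that(2)] by (auto simp: field_simps)
      then show ?thesis using G_left[of "(t - l k) / w k"] G_right[of "(t - l k) / w k"] unfolding s_def by auto
    qed
    have "(\<Sum>j<m. s j) \<le> \<kappa> - 1"
    proof (cases "\<exists>j<m. s j \<noteq> 0")
      case True
      then obtain j where j: "j < m" "s j \<noteq> 0" by blast
      have "(\<Sum>k<m. s k) = s j + (\<Sum>k\<in>{..<m} - {j}. s k)" using j by (subst sum.remove[of _ j]) auto
      also have "(\<Sum>k\<in>{..<m} - {j}. s k) = 0" using zero[OF j(1) _ _ j(2)] by (intro sum.neutral) auto
      finally show ?thesis using s[OF j(1)] by simp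
    qed (use \<kappa> in simp)
    moreover have "0 \<le> (\<Sum>j<m. s j)" using s by (intro sum_nonneg) auto
    moreover have "u2 i t = 1 + (if i = 0 then \<Sum>j<m. s j else 0)" unfolding u2_def s_def arg ..
    ultimately show ?thesis using \<kappa> by auto
  qed
  show ?thesis
  proof (rule bexI[OF _ separable_potential(1)[OF d1 d2 sm bd]], intro allI impI)
    fix x and i :: nat assume "i < 2"
    then show "grad 2 (\<lambda>x. \<Sum>i<2. u i (x i)) x i = x i + (if i = 0 then c + stair m a l w (x i) else 0)"
      using separable_potential(2)[OF d1 d2 sm bd] by (simp add: u1_def)
  qed
qed

end

section \<open>Trajectories followed with high probability\<close>

text \<open>The two-dimensional recursion with characteristic polynomial \<open>l\<^sup>2 - t l + \<beta>\<close>, \<open>t = 1 + \<beta> - \<alpha>\<close>, is stable exactly if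
  \<open>\<bar>t\<bar> < 1 + \<beta>\<close>. In the coordinates \<open>a = x + y\<close> and \<open>b = x\<close> (the next and the present position) it is
  \<open>(a, b) \<mapsto> (t a - \<beta> b, a)\<close>. The ansatz \<open>(a - s b)\<^sup>2 + p b\<^sup>2\<close> with \<open>s = t \<beta> / (1 + \<beta>)\<close> removes the mixed term of the
  loss, which then is \<open>e (a\<^sup>2 + b\<^sup>2)\<close>.\<close>

lemma stable_quadratic_form:
  fixes \<beta> \<alpha> :: real
  assumes \<beta>: "0 < \<beta>" "\<beta> < 1" and \<alpha>: "0 < \<alpha>" "\<alpha> < 2 * (1 + \<beta>)"
  shows "\<exists>s p \<eta> C. 0 < p \<and> 0 < \<eta> \<and> \<eta> < 1 \<and> 1 \<le> C \<and> (\<forall>x y.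
    (x + y + (\<beta> * y - \<alpha> * (x + y)) - s * (x + y))\<^sup>2 + p * (x + y)\<^sup>2
       \<le> (1 - \<eta>) * ((x + y - s * x)\<^sup>2 + p * x\<^sup>2) \<and>
    x\<^sup>2 + y\<^sup>2 \<le> C * ((x + y - s * x)\<^sup>2 + p * x\<^sup>2) \<and>
    (x + y - s * x)\<^sup>2 + p * x\<^sup>2 \<le> C * (x\<^sup>2 + y\<^sup>2))"
proof -
  define t where "t = 1 + \<beta> - \<alpha>"
  have t: "\<bar>t\<bar> < 1 + \<beta>" using \<alpha> by (auto simp: t_def)
  then have t2: "t\<^sup>2 < (1 + \<beta>)\<^sup>2" using abs_le_square_iff[of "1 + \<beta>" t] \<beta> by (metis abs_of_pos add_pos_pos linorder_not_less zero_less_one)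
  define s where "s = t * \<beta> / (1 + \<beta>)"
  define e where "e = (1 - \<beta>) / (1 + \<beta>) * ((1 + \<beta>)\<^sup>2 - t\<^sup>2) / 2"
  define p where "p = \<beta>\<^sup>2 + e - s\<^sup>2"
  have e: "0 < e" using \<beta> t2 by (simp add: e_def)
  have s2: "s\<^sup>2 \<le> \<beta>\<^sup>2"
  proof -
    have "s\<^sup>2 = \<beta>\<^sup>2 * (t\<^sup>2 / (1 + \<beta>)\<^sup>2)" by (simp add: s_def power_divide power_mult_distrib)
    also have "\<dots> \<le> \<beta>\<^sup>2 * 1" using t2 \<beta> by (intro mult_left_mono) (auto simp: divide_le_eq_1)
    finally show ?thesis by simp
  qed
  have p: "0 < p" using e s2 by (simp add: p_def)
  define q where "q a b = (a - s * b)\<^sup>2 + p * b\<^sup>2" for a b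
  have step: "q (t * a - \<beta> * b) a = q a b - e * (a\<^sup>2 + b\<^sup>2)" for a b
  proof -
    have sb: "s * (1 + \<beta>) = t * \<beta>" using \<beta> by (simp add: s_def)
    have e2: "2 * e * (1 + \<beta>) = (1 - \<beta>) * ((1 + \<beta>)\<^sup>2 - t\<^sup>2)"
    proof -
      have "2 * e = (1 - \<beta>) / (1 + \<beta>) * ((1 + \<beta>)\<^sup>2 - t\<^sup>2)"
      proof -
        have "2 * (y / 2) = y" for y :: real by simp
        then show ?thesis unfolding e_def .
      qed
      then have "2 * e * (1 + \<beta>) = (1 - \<beta>) / (1 + \<beta>) * (1 + \<beta>) * ((1 + \<beta>)\<^sup>2 - t\<^sup>2)" by (simp only: mult_ac)
      moreover have "(1 - \<beta>) / (1 + \<beta>) * (1 + \<beta>) = 1 - \<beta>" using \<beta> by simp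
      ultimately show ?thesis by (simp only:)
    qed
    have 1: "2 * e = 1 - t\<^sup>2 + 2 * s * t - \<beta>\<^sup>2"
    proof -
      have "(1 + \<beta>) * (1 - t\<^sup>2 + 2 * s * t - \<beta>\<^sup>2) = (1 + \<beta>) * (1 - t\<^sup>2 - \<beta>\<^sup>2) + 2 * t * (s * (1 + \<beta>))" by (simp add: algebra_simps)
      also have "\<dots> = (1 - \<beta>) * ((1 + \<beta>)\<^sup>2 - t\<^sup>2)" unfolding sb by (simp add: power2_eq_square algebra_simps)
      finally have "(1 + \<beta>) * (1 - t\<^sup>2 + 2 * s * t - \<beta>\<^sup>2) = (1 + \<beta>) * (2 * e)" using e2 by (simp add: mult.commute)
      then show ?thesis using \<beta> by simp
    qed
    have "q (t * a - \<beta> * b) a - (q a b - e * (a\<^sup>2 + b\<^sup>2)) = a\<^sup>2 * (t\<^sup>2 - 2 * s * t + \<beta>\<^sup>2 + 2 * e - 1) + 2 * a * b * (s * (1 + \<beta>) - t * \<beta>)"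
      unfolding q_def p_def by (simp add: power2_eq_square algebra_simps)
    then show ?thesis using 1 sb by simp
  qed
  have sq2: "(u + v)\<^sup>2 \<le> 2 * u\<^sup>2 + 2 * v\<^sup>2" for u v :: real
    using zero_le_power2[of "u - v"] by (simp add: power2_eq_square algebra_simps)
  have up: "q a b \<le> 2 * (1 + s\<^sup>2 + p) * (a\<^sup>2 + b\<^sup>2)" for a b
  proof -
    have "q a b \<le> 2 * a\<^sup>2 + 2 * s\<^sup>2 * b\<^sup>2 + p * b\<^sup>2"
      using sq2[of a "- s * b"] by (simp add: q_def power_mult_distrib)
    also have "\<dots> \<le> 2 * (1 + s\<^sup>2 + p) * (a\<^sup>2 + b\<^sup>2)"
      using p by (simp add: algebra_simps add_nonneg_nonneg)
    finally show ?thesis .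
  qed
  have lo: "a\<^sup>2 + b\<^sup>2 \<le> (2 + 3 / p) * q a b" for a b
  proof -
    have "s\<^sup>2 \<le> 1" using s2 \<beta> by (meson order_trans power_le_one less_imp_le)
    then have sb: "s\<^sup>2 * b\<^sup>2 \<le> 1 * b\<^sup>2" by (intro mult_right_mono) auto
    have "a\<^sup>2 \<le> 2 * (a - s * b)\<^sup>2 + 2 * (s * b)\<^sup>2" using sq2[of "a - s * b" "s * b"] by simp
    also have "(s * b)\<^sup>2 \<le> b\<^sup>2" using sb by (simp add: power_mult_distrib)
    finally have "a\<^sup>2 + b\<^sup>2 \<le> 2 * (a - s * b)\<^sup>2 + 3 * b\<^sup>2" by simp
    also have "\<dots> \<le> 2 * (a - s * b)\<^sup>2 + 3 * b\<^sup>2 + (2 * p * b\<^sup>2 + 3 / p * (a - s * b)\<^sup>2)" using p by simp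
    also have "\<dots> = (2 + 3 / p) * q a b" using p by (simp add: q_def field_simps)
    finally show ?thesis .
  qed
  define c2 where "c2 = 2 * (1 + s\<^sup>2 + p)"
  define \<eta> where "\<eta> = min (e / c2) (1/2)"
  have c2: "0 < c2" using p by (simp add: c2_def add_pos_nonneg)
  have \<eta>: "0 < \<eta>" "\<eta> < 1" using e c2 by (auto simp: \<eta>_def min_less_iff_disj)
  have dec: "q (t * a - \<beta> * b) a \<le> (1 - \<eta>) * q a b" for a b
  proof -
    have "\<eta> * q a b \<le> e / c2 * (c2 * (a\<^sup>2 + b\<^sup>2))"
      using up[of a b] e c2 p \<eta> by (intro mult_mono) (auto simp: \<eta>_def c2_def q_def)
    then show ?thesis using c2 by (simp add: step left_diff_distrib)
  qed
  define C where "C = 1 + 3 * (2 + 3 / p) + 3 * c2"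
  have C: "1 \<le> C" "3 * (2 + 3 / p) \<le> C" "3 * c2 \<le> C" using p c2 by (simp_all add: C_def)
  have q0: "0 \<le> q a b" for a b using p by (simp add: q_def)
  show ?thesis
  proof (rule exI[of _ s], rule exI[of _ p], rule exI[of _ \<eta>], rule exI[of _ C], intro conjI p \<eta> C(1) allI)
    fix x y
    have "q (x + y + (\<beta> * y - \<alpha> * (x + y))) (x + y) = q (t * (x + y) - \<beta> * x) (x + y)"
      by (rule arg_cong2[where f=q]) (simp_all add: t_def algebra_simps)
    then show "(x + y + (\<beta> * y - \<alpha> * (x + y)) - s * (x + y))\<^sup>2 + p * (x + y)\<^sup>2 \<le> (1 - \<eta>) * ((x + y - s * x)\<^sup>2 + p * x\<^sup>2)"
      using dec[of "x + y" x] by (simp add: q_def)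
    have "y\<^sup>2 \<le> 2 * (x + y)\<^sup>2 + 2 * x\<^sup>2" using sq2[of "x + y" "- x"] by simp
    then have "x\<^sup>2 + y\<^sup>2 \<le> 3 * ((x + y)\<^sup>2 + x\<^sup>2)"
      using zero_le_power2[of "x + y"] unfolding distrib_left by linarith
    also have "\<dots> \<le> 3 * ((2 + 3 / p) * q (x + y) x)" using lo[of "x + y" x] by (intro mult_left_mono) auto
    also have "\<dots> \<le> C * q (x + y) x" using mult_right_mono[OF C(2) q0[of "x + y" x]] by (simp only: mult.assoc)
    finally show "x\<^sup>2 + y\<^sup>2 \<le> C * ((x + y - s * x)\<^sup>2 + p * x\<^sup>2)" by (simp add: q_def)
    have "q (x + y) x \<le> c2 * ((x + y)\<^sup>2 + x\<^sup>2)" using up by (simp add: c2_def)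
    also have "\<dots> \<le> c2 * (3 * (x\<^sup>2 + y\<^sup>2))"
    proof (rule mult_left_mono)
      show "(x + y)\<^sup>2 + x\<^sup>2 \<le> 3 * (x\<^sup>2 + y\<^sup>2)" using sq2[of x y] zero_le_power2[of y] by (simp only: distrib_left)
    qed (use c2 in simp)
    also have "\<dots> \<le> C * (x\<^sup>2 + y\<^sup>2)" using mult_right_mono[OF C(3), of "x\<^sup>2 + y\<^sup>2"] by (simp add: mult_ac)
    finally show "(x + y - s * x)\<^sup>2 + p * x\<^sup>2 \<le> C * (x\<^sup>2 + y\<^sup>2)" by (simp add: q_def)
  qed
qed

context phase_kernel
begin

text \<open>Doob's maximal inequality in dual form. The drift is only assumed where \<open>V k z \<le> R\<close>, so the
  expectation of \<open>V\<close> at time \<open>n\<close> is out of control. The lower bound \<open>1 - (V k z + n K) / R\<close> is propagated backwards in time: it is at most 0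
  outside of the region, and inside it does not exceed its mean after one step.\<close>

lemma confinement:
  assumes V[measurable]: "\<And>k. V k \<in> borel_measurable M" and R: "0 < R" and K: "0 \<le> K"
    and Vpos: "\<And>k z. 0 \<le> V k z"
    and drift: "\<And>k z. z \<in> space M \<Longrightarrow> V k z \<le> R \<Longrightarrow> (\<integral>\<^sup>+w. ennreal (V (Suc k) w) \<partial>Q z) \<le> ennreal (V k z + K)"
    and z: "z \<in> space M"
  shows "1 - (V k z + n * K) / R \<le> measure (P n z) {w \<in> space M. V (k + n) w \<le> R}"
  using z
proof (induction n arbitrary: k z)
  case 0
  show ?case
  proof (cases "V k z \<le> R")
    case True
    have "measure (P 0 z) {w \<in> space M. V (k + 0) w \<le> R} = 1"
      using True 0 by (simp add: measure_return)
    then show ?thesis using Vpos[of k z] R by simp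
  next
    case False
    then have "1 - (V k z + 0 * K) / R \<le> 0" using R by simp
    also have "0 \<le> measure (P 0 z) {w \<in> space M. V (k + 0) w \<le> R}" by simp
    finally show ?thesis by simp
  qed
next
  case (Suc n)
  show ?case
  proof (cases "V k z \<le> R")
    case True
    note [measurable_cong] = prob_kernel(2)[OF Suc.prems]
    interpret prob_space "Q z" using prob_kernel Suc.prems by simp
    define A where "A = {w \<in> space M. V (Suc k + n) w \<le> R}"
    have A[measurable]: "A \<in> sets M" unfolding A_def by measurable
    have i: "integrable (Q z) (V (Suc k)) \<and> (\<integral>w. V (Suc k) w \<partial>Q z) \<le> V k z + K"
      by (rule integral_real_le_nn_integral[OF drift[OF Suc.prems True]]) (use Vpos K in auto)
    have "1 - (V k z + Suc n * K) / R = 1 - (V k z + K + n * K) / R" by (simp add: algebra_simps)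
    also have "\<dots> \<le> 1 - ((\<integral>w. V (Suc k) w \<partial>Q z) + n * K) / R"
      using i R by (intro diff_left_mono divide_right_mono) auto
    also have "\<dots> = (\<integral>w. 1 - (V (Suc k) w + n * K) / R \<partial>Q z)"
      using i by (simp add: prob_space)
    also have "\<dots> \<le> (\<integral>w. measure (P n w) A \<partial>Q z)"
    proof (rule integral_mono)
      show "integrable (Q z) (\<lambda>w. 1 - (V (Suc k) w + n * K) / R)" using i by simp
      show "integrable (Q z) (\<lambda>w. measure (P n w) A)"
        by (rule integrable_const_bound[of _ 1]) (use measure_kernel_pow_01 space_kernel[OF Suc.prems] A in \<open>auto intro!: AE_I2\<close>)
      show "1 - (V (Suc k) w + n * K) / R \<le> measure (P n w) A" if "w \<in> space (Q z)" for w
        unfolding A_def by (rule Suc.IH) (use that space_kernel[OF Suc.prems] in simp)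
    qed
    also have "\<dots> = measure (P (Suc n) z) A" by (rule measure_kernel_pow_Suc[symmetric]) (use Suc.prems in auto)
    finally show ?thesis by (simp add: A_def)
  next
    case False
    then have "R \<le> V k z + Suc n * K" using K by (simp add: add_increasing2)
    then have "1 - (V k z + Suc n * K) / R \<le> 0" using R by (simp add: le_divide_eq)
    also have "0 \<le> measure (P (Suc n) z) {w \<in> space M. V (k + Suc n) w \<le> R}" by simp
    finally show ?thesis .
  qed
qed

lemma tv_dist_ge:
  assumes "z \<in> space M" "prob_space \<pi>" "A \<in> sets M"
  shows "\<bar>measure (P n z) A - measure \<pi> A\<bar> \<le> tv_dist d (P n z) \<pi>"
  unfolding tv_dist_def
proof (rule cSUP_upper[OF assms(3)])
  interpret \<pi>: prob_space \<pi> by fact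
  have "\<bar>measure (P n z) A - measure \<pi> A\<bar> \<le> 1" for A
    using measure_kernel_pow_01[OF assms(1), of n A] \<pi>.prob_le_1[of A] measure_nonneg[of \<pi> A] by linarith
  then show "bdd_above ((\<lambda>A. \<bar>measure (P n z) A - measure \<pi> A\<bar>) ` sets M)" by (intro bdd_aboveI2[of _ _ 1])
qed

text \<open>No law is close to two laws concentrated on disjoint sets, so one of the two starting points is far
  from equilibrium, whatever the invariant law is.\<close>

lemma two_separated_laws:
  assumes "z1 \<in> space M" "z2 \<in> space M" and \<pi>: "prob_space \<pi>" "sets \<pi> = sets M"
    and A: "A1 \<in> sets M" "A2 \<in> sets M" "A1 \<inter> A2 = {}"
    and m: "3 / 4 \<le> measure (P n z1) A1" "3 / 4 \<le> measure (P n z2) A2"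
  shows "1 / 4 \<le> tv_dist d (P n z1) \<pi> \<or> 1 / 4 \<le> tv_dist d (P n z2) \<pi>"
proof -
  interpret \<pi>: prob_space \<pi> by fact
  have "measure \<pi> A1 + measure \<pi> A2 = measure \<pi> (A1 \<union> A2)"
    by (rule \<pi>.finite_measure_Union[symmetric]) (use A \<pi>(2) in auto)
  also have "\<dots> \<le> 1" by simp
  finally have "measure \<pi> A1 \<le> 1 / 2 \<or> measure \<pi> A2 \<le> 1 / 2" by linarith
  then show ?thesis
    using tv_dist_ge[OF assms(1) \<pi>(1) A(1), of n] tv_dist_ge[OF assms(2) \<pi>(1) A(2), of n] m by linarith
qed

end

text \<open>The force is the linear one plus a bounded term \<open>b\<close> in the first coordinate. The linear part is a stable recursion,
  with Lyapunov form given by \<open>s\<close>, \<open>p\<close>, \<open>\<eta>\<close>, \<open>C\<close>, and only it decides about stability: these parameters are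
  the same for all \<open>b\<close>, so \<open>b\<close> may depend on the time at which the chain is observed.\<close>

locale perturbed_chain = obabo_chain 2 U h \<gamma> for U h \<gamma> +
  fixes b :: "real \<Rightarrow> real" and Bd s p \<eta> C :: real
  assumes grad_eq: "i < 2 \<Longrightarrow> g u i = u i + (if i = 0 then b (u i) else 0)"
    and b_bound: "\<bar>b t\<bar> \<le> Bd"
    and form: "0 < p" "0 < \<eta>" "\<eta> < 1" "1 \<le> C"
    and form_step: "(x + y + (\<beta> * y - \<alpha> * (x + y)) - s * (x + y))\<^sup>2 + p * (x + y)\<^sup>2
       \<le> (1 - \<eta>) * ((x + y - s * x)\<^sup>2 + p * x\<^sup>2)"
    and form_lower: "x\<^sup>2 + y\<^sup>2 \<le> C * ((x + y - s * x)\<^sup>2 + p * x\<^sup>2)"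
    and form_upper: "(x + y - s * x)\<^sup>2 + p * x\<^sup>2 \<le> C * (x\<^sup>2 + y\<^sup>2)"
begin

definition q :: "real \<Rightarrow> real \<Rightarrow> real" where "q x y = (x + y - s * x)\<^sup>2 + p * x\<^sup>2"

lemma q_nonneg: "0 \<le> q x y" using form by (simp add: q_def)

lemma q_triangle: "0 < \<theta> \<Longrightarrow> q (x + x') (y + y') \<le> (1 + \<theta>) * q x y + (1 + 1 / \<theta>) * q x' y'"
proof -
  assume \<theta>: "0 < \<theta>"
  have "q (x + x') (y + y') = ((x + y - s * x) + (x' + y' - s * x'))\<^sup>2 + p * (x + x')\<^sup>2"
    by (simp add: q_def algebra_simps)
  also have "\<dots> \<le> ((1 + \<theta>) * (x + y - s * x)\<^sup>2 + (1 + 1 / \<theta>) * (x' + y' - s * x')\<^sup>2) + p * ((1 + \<theta>) * x\<^sup>2 + (1 + 1 / \<theta>) * x'\<^sup>2)"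
    using \<theta> form by (intro add_mono mult_left_mono square_sum_le) auto
  also have "\<dots> = (1 + \<theta>) * q x y + (1 + 1 / \<theta>) * q x' y'" by (simp add: q_def algebra_simps)
  finally show ?thesis .
qed

lemma q_minus: "q (- x) (- y) = q x y"
proof -
  have "- x + - y - s * (- x) = - (x + y - s * x)" by simp
  then show ?thesis unfolding q_def by (simp only: power2_minus)
qed

definition "noise_factor = (1 + 2 / \<eta>) * C"

lemma noise_factor_nonneg: "0 \<le> noise_factor" using form by (simp add: noise_factor_def)

lemma q_noisy_step:
  "q (x + y + n1) (\<beta> * y - \<alpha> * (x + y) + n2) \<le> (1 - \<eta> / 2) * q x y + noise_factor * (n1\<^sup>2 + n2\<^sup>2)"
proof -
  have "q (x + y + n1) (\<beta> * y - \<alpha> * (x + y) + n2) \<le> (1 + \<eta> / 2) * q (x + y) (\<beta> * y - \<alpha> * (x + y)) + (1 + 1 / (\<eta> / 2)) * q n1 n2"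
    using form by (intro q_triangle) auto
  also have "\<dots> \<le> (1 + \<eta> / 2) * ((1 - \<eta>) * q x y) + (1 + 1 / (\<eta> / 2)) * (C * (n1\<^sup>2 + n2\<^sup>2))"
    using form form_step form_upper unfolding q_def by (intro add_mono mult_left_mono) auto
  also have "(1 + \<eta> / 2) * ((1 - \<eta>) * q x y) \<le> (1 - \<eta> / 2) * q x y"
  proof -
    have "(1 + \<eta> / 2) * (1 - \<eta>) \<le> 1 - \<eta> / 2" using form by (simp add: algebra_simps)
    then show ?thesis using q_nonneg mult_right_mono by (fastforce simp: mult.assoc[symmetric])
  qed
  finally show ?thesis by (simp add: noise_factor_def mult.assoc)
qed

text \<open>The Lyapunov form of the deviation from a centre \<open>c\<close>, which consists of a position and a displacement.\<close>

definition V :: "point \<times> point \<Rightarrow> phase \<Rightarrow> real" where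
  "V c z = (\<Sum>i<2. q (fst z i - fst c i) (mom z i - snd c i))"

lemma V_nonneg: "0 \<le> V c z" by (simp add: V_def sum_nonneg q_nonneg)

lemma measurable_V[measurable]: "V c \<in> borel_measurable M"
  unfolding V_def q_def by measurable

definition "noise_scale D = (h * \<sigma>)\<^sup>2 + 4 * ((\<beta> - \<alpha>)\<^sup>2 * (h * \<sigma>)\<^sup>2 + (r * h * \<sigma>)\<^sup>2 + \<alpha>\<^sup>2 * D\<^sup>2)" for D :: real

lemma noise_scale_nonneg: "0 \<le> noise_scale D" by (simp add: noise_scale_def)

text \<open>The centre moves by the noiseless recursion with force \<open>fst c' i + \<omega> i\<close>. The bound on the deviation of the
  nonlinear forces has two uses: \<open>D = 0\<close>, \<open>\<omega> = 0\<close> gives the drift condition of the chain, \<open>D0 = 0\<close> the confinement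
  to a trajectory.\<close>

lemma V_noisy_step:
  assumes c1: "\<And>i. i < 2 \<Longrightarrow> fst c' i = fst c i + snd c i"
    and c2: "\<And>i. i < 2 \<Longrightarrow> snd c' i = \<beta> * snd c i - \<alpha> * (fst c' i + \<omega> i)"
    and dev: "\<And>i. i < 2 \<Longrightarrow> \<bar>(if i = 0 then b (fst (step \<xi> \<zeta> z) i) else 0) - \<omega> i\<bar> \<le> D * \<bar>\<xi> i\<bar> + D0"
  shows "V c' (step \<xi> \<zeta> z) \<le> (1 - \<eta> / 2) * V c z + (8 * noise_factor * \<alpha>\<^sup>2 * D0\<^sup>2 + noise_factor * noise_scale D * ((\<Sum>i<2. (\<xi> i)\<^sup>2) + (\<Sum>i<2. (\<zeta> i)\<^sup>2)))"
proof -
  have one: "q (fst (step \<xi> \<zeta> z) i - fst c' i) (mom (step \<xi> \<zeta> z) i - snd c' i)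
     \<le> (1 - \<eta> / 2) * q (fst z i - fst c i) (mom z i - snd c i) + (4 * noise_factor * \<alpha>\<^sup>2 * D0\<^sup>2 + noise_factor * noise_scale D * ((\<xi> i)\<^sup>2 + (\<zeta> i)\<^sup>2))"
    if i: "i < 2" for i
  proof -
    define \<Delta> where "\<Delta> = (if i = 0 then b (fst (step \<xi> \<zeta> z) i) else 0) - \<omega> i"
    define n1 n2 where "n1 = h * \<sigma> * \<xi> i" and "n2 = (\<beta> - \<alpha>) * (h * \<sigma> * \<xi> i) + r * h * \<sigma> * \<zeta> i - \<alpha> * \<Delta>"
    have x: "fst (step \<xi> \<zeta> z) i - fst c' i = (fst z i - fst c i) + (mom z i - snd c i) + n1"
      using i by (simp add: step_pos c1 n1_def)
    have y: "mom (step \<xi> \<zeta> z) i - snd c' i = \<beta> * (mom z i - snd c i) - \<alpha> * ((fst z i - fst c i) + (mom z i - snd c i)) + n2"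
    proof -
      have "mom (step \<xi> \<zeta> z) i = \<beta> * (mom z i + h * \<sigma> * \<xi> i) - \<alpha> * (fst (step \<xi> \<zeta> z) i + (\<Delta> + \<omega> i)) + r * h * \<sigma> * \<zeta> i"
        using i by (subst step_mom) (auto simp: grad_eq \<Delta>_def)
      moreover have "fst (step \<xi> \<zeta> z) i = fst z i + mom z i + h * \<sigma> * \<xi> i" by (rule step_pos[OF i])
      ultimately show ?thesis unfolding c2[OF i] c1[OF i] n2_def by (simp add: algebra_simps)
    qed
    have "\<Delta>\<^sup>2 \<le> (D * \<bar>\<xi> i\<bar> + D0)\<^sup>2"
      using dev[OF i] unfolding \<Delta>_def[symmetric] by (metis abs_ge_zero order_trans power2_abs power_mono)
    also have "\<dots> \<le> 2 * (D * \<bar>\<xi> i\<bar>)\<^sup>2 + 2 * D0\<^sup>2" using square_sum_le[of 1 "D * \<bar>\<xi> i\<bar>" D0] by simp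
    finally have D: "\<Delta>\<^sup>2 \<le> 2 * (D\<^sup>2 * (\<xi> i)\<^sup>2) + 2 * D0\<^sup>2" by (simp add: power_mult_distrib)
    have n2: "n2\<^sup>2 \<le> 4 * ((\<beta> - \<alpha>)\<^sup>2 * (h * \<sigma>)\<^sup>2 * (\<xi> i)\<^sup>2 + (r * h * \<sigma>)\<^sup>2 * (\<zeta> i)\<^sup>2) + 2 * (\<alpha>\<^sup>2 * \<Delta>\<^sup>2)"
    proof -
      define a c where "a = (\<beta> - \<alpha>) * (h * \<sigma> * \<xi> i)" and "c = r * h * \<sigma> * \<zeta> i"
      have 1: "n2\<^sup>2 \<le> 2 * (a + c)\<^sup>2 + 2 * (\<alpha> * \<Delta>)\<^sup>2"
        using square_sum_le2[of "a + c" "- (\<alpha> * \<Delta>)"] by (simp add: n2_def a_def c_def)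
      have "2 * (a + c)\<^sup>2 \<le> 4 * (a\<^sup>2 + c\<^sup>2)" using square_sum_le2[of a c] by simp
      then have "n2\<^sup>2 \<le> 4 * (a\<^sup>2 + c\<^sup>2) + 2 * (\<alpha> * \<Delta>)\<^sup>2"
        by (rule order_trans[OF 1 add_right_mono])
      moreover have eqs: "a\<^sup>2 = (\<beta> - \<alpha>)\<^sup>2 * (h * \<sigma>)\<^sup>2 * (\<xi> i)\<^sup>2" "c\<^sup>2 = (r * h * \<sigma>)\<^sup>2 * (\<zeta> i)\<^sup>2" "(\<alpha> * \<Delta>)\<^sup>2 = \<alpha>\<^sup>2 * \<Delta>\<^sup>2"
        unfolding a_def c_def power_mult_distrib by (simp_all add: mult_ac)
      ultimately show ?thesis by (simp only: eqs)
    qed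
    have "n1\<^sup>2 + n2\<^sup>2 \<le> (h * \<sigma>)\<^sup>2 * (\<xi> i)\<^sup>2 + 4 * ((\<beta> - \<alpha>)\<^sup>2 * (h * \<sigma>)\<^sup>2 * (\<xi> i)\<^sup>2 + (r * h * \<sigma>)\<^sup>2 * (\<zeta> i)\<^sup>2)
        + 2 * (\<alpha>\<^sup>2 * (2 * (D\<^sup>2 * (\<xi> i)\<^sup>2) + 2 * D0\<^sup>2))"
      using n2 mult_left_mono[OF D zero_le_power2[of \<alpha>]] by (simp add: n1_def power_mult_distrib)
    also have "\<dots> = noise_scale D * (\<xi> i)\<^sup>2 + 4 * (r * h * \<sigma>)\<^sup>2 * (\<zeta> i)\<^sup>2 - 4 * (r * h * \<sigma>)\<^sup>2 * (\<xi> i)\<^sup>2 + 4 * \<alpha>\<^sup>2 * D0\<^sup>2"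
      by (simp add: noise_scale_def algebra_simps)
    also have "\<dots> \<le> noise_scale D * ((\<xi> i)\<^sup>2 + (\<zeta> i)\<^sup>2) + 4 * \<alpha>\<^sup>2 * D0\<^sup>2"
    proof -
      have "4 * (r * h * \<sigma>)\<^sup>2 * (\<zeta> i)\<^sup>2 \<le> noise_scale D * (\<zeta> i)\<^sup>2" by (intro mult_right_mono) (simp_all add: noise_scale_def)
      moreover have "0 \<le> 4 * (r * h * \<sigma>)\<^sup>2 * (\<xi> i)\<^sup>2" by simp
      ultimately show ?thesis unfolding distrib_left by linarith
    qed
    finally have "n1\<^sup>2 + n2\<^sup>2 \<le> noise_scale D * ((\<xi> i)\<^sup>2 + (\<zeta> i)\<^sup>2) + 4 * \<alpha>\<^sup>2 * D0\<^sup>2" .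
    from mult_left_mono[OF this noise_factor_nonneg] q_noisy_step[of "fst z i - fst c i" "mom z i - snd c i" n1 n2]
    show ?thesis unfolding x y by (simp add: algebra_simps)
  qed
  have "V c' (step \<xi> \<zeta> z) \<le> (\<Sum>i<2. (1 - \<eta> / 2) * q (fst z i - fst c i) (mom z i - snd c i) + (4 * noise_factor * \<alpha>\<^sup>2 * D0\<^sup>2 + noise_factor * noise_scale D * ((\<xi> i)\<^sup>2 + (\<zeta> i)\<^sup>2)))"
    unfolding V_def by (intro sum_mono one) auto
  also have "\<dots> = (1 - \<eta> / 2) * V c z + (8 * noise_factor * \<alpha>\<^sup>2 * D0\<^sup>2 + noise_factor * noise_scale D * ((\<Sum>i<2. (\<xi> i)\<^sup>2) + (\<Sum>i<2. (\<zeta> i)\<^sup>2)))"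
    unfolding V_def by (simp add: sum.distrib sum_distrib_left[symmetric] distrib_left)
  finally show ?thesis .
qed

abbreviation "c0 \<equiv> ((\<lambda>_. 0, \<lambda>_. 0) :: point \<times> point)"

lemma Bd_nonneg: "0 \<le> Bd" using b_bound[of 0] by simp

lemma global_drift:
  assumes z: "z \<in> space M"
  shows "(\<integral>\<^sup>+w. ennreal (V c0 w) \<partial>Q z) \<le> ennreal ((1 - \<eta> / 2) * V c0 z + (8 * noise_factor * \<alpha>\<^sup>2 * Bd\<^sup>2 + 4 * (noise_factor * noise_scale 0)))"
proof -
  have "(\<integral>\<^sup>+w. ennreal (V c0 w) \<partial>Q z) \<le> ennreal (((1 - \<eta> / 2) * V c0 z + 8 * noise_factor * \<alpha>\<^sup>2 * Bd\<^sup>2) + 2 * (noise_factor * noise_scale 0) * real 2)"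
  proof (rule drift_of_pathwise[OF z])
    fix \<xi> \<zeta>
    show "V c0 (step \<xi> \<zeta> z) \<le> ((1 - \<eta> / 2) * V c0 z + 8 * noise_factor * \<alpha>\<^sup>2 * Bd\<^sup>2) + noise_factor * noise_scale 0 * ((\<Sum>i<2. (\<xi> i)\<^sup>2) + (\<Sum>i<2. (\<zeta> i)\<^sup>2))"
      using V_noisy_step[of c0 c0 "\<lambda>_. 0" \<xi> \<zeta> z 0 Bd] b_bound Bd_nonneg by (simp add: add_ac)
  qed (use form V_nonneg noise_factor_nonneg noise_scale_nonneg in auto)
  then show ?thesis by (simp add: add_ac)
qed

definition "dist_factor = C * (1 + ((2 + 2 * (h\<^sup>2 / 2)\<^sup>2 * 2)) / (r * h)\<^sup>2) + 2 * (h\<^sup>2 / 2)\<^sup>2 * 2 * 2 / (r * h)\<^sup>2"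

lemma dist_factor_nonneg: "0 \<le> dist_factor" using form by (simp add: dist_factor_def)

definition zero_phase :: phase where
  "zero_phase = ((\<lambda>i\<in>{..<2}. 0), (\<lambda>i\<in>{..<2}. 0))"

lemma zero_phase[simp]: "zero_phase \<in> space M" by (simp add: zero_phase_def space_phase vecs_def)

lemma sq_dist_zero_phase: "sq_dist 2 z zero_phase \<le> dist_factor * (V c0 z + Bd\<^sup>2)"
proof -
  have rh: "0 < (r * h)\<^sup>2" using r_pos h by simp
  define k where "k = (h\<^sup>2 / 2)\<^sup>2"
  have k: "0 \<le> k" by (simp add: k_def)
  have one: "(fst z i)\<^sup>2 + (snd z i)\<^sup>2 \<le> C * (1 + (2 + 2 * k * 2) / (r * h)\<^sup>2) * q (fst z i) (mom z i) + 2 * k * 2 / (r * h)\<^sup>2 * Bd\<^sup>2" if i: "i < 2" for i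
  proof -
    define \<Delta> where "\<Delta> = (if i = 0 then b (fst z i) else 0)"
    define T where "T = C * q (fst z i) (mom z i)"
    have \<Delta>: "\<Delta>\<^sup>2 \<le> Bd\<^sup>2" using b_bound[of "fst z i"] Bd_nonneg by (auto simp: \<Delta>_def abs_le_square_iff[symmetric])
    have T: "(fst z i)\<^sup>2 + (mom z i)\<^sup>2 \<le> T" unfolding T_def q_def by (rule form_lower)
    have "r * h * snd z i = mom z i + h\<^sup>2 / 2 * (fst z i + \<Delta>)" using i by (simp add: mom_def grad_eq \<Delta>_def)
    then have "(r * h)\<^sup>2 * (snd z i)\<^sup>2 = (mom z i + h\<^sup>2 / 2 * (fst z i + \<Delta>))\<^sup>2" by (simp add: power_mult_distrib[symmetric])
    also have "\<dots> \<le> 2 * (mom z i)\<^sup>2 + 2 * (k * (fst z i + \<Delta>)\<^sup>2)"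
    proof -
      have "(h\<^sup>2 / 2 * (fst z i + \<Delta>))\<^sup>2 = k * (fst z i + \<Delta>)\<^sup>2" unfolding k_def by (rule power_mult_distrib)
      then show ?thesis using square_sum_le2[of "mom z i" "h\<^sup>2 / 2 * (fst z i + \<Delta>)"] by (simp only:)
    qed
    also have "k * (fst z i + \<Delta>)\<^sup>2 \<le> k * (2 * (fst z i)\<^sup>2 + 2 * \<Delta>\<^sup>2)"
      using square_sum_le[of 1 "fst z i" \<Delta>] k by (intro mult_left_mono) auto
    also have "\<dots> \<le> k * (2 * T + 2 * Bd\<^sup>2)"
      using T \<Delta> k zero_le_power2[of "mom z i"] by (intro mult_left_mono add_mono) linarith+
    finally have "(r * h)\<^sup>2 * (snd z i)\<^sup>2 \<le> 2 * (mom z i)\<^sup>2 + 2 * (k * (2 * T + 2 * Bd\<^sup>2))" by simp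
    also have "\<dots> \<le> 2 * T + 2 * (k * (2 * T + 2 * Bd\<^sup>2))" using T zero_le_power2[of "fst z i"] by linarith
    finally have "(snd z i)\<^sup>2 \<le> (2 * T + 2 * (k * (2 * T + 2 * Bd\<^sup>2))) / (r * h)\<^sup>2"
      using rh by (simp add: pos_le_divide_eq mult.commute)
    then have "(fst z i)\<^sup>2 + (snd z i)\<^sup>2 \<le> T + (2 * T + 2 * (k * (2 * T + 2 * Bd\<^sup>2))) / (r * h)\<^sup>2"
      using T zero_le_power2[of "mom z i"] by linarith
    also have "\<dots> = C * (1 + (2 + 2 * k * 2) / (r * h)\<^sup>2) * q (fst z i) (mom z i) + 2 * k * 2 / (r * h)\<^sup>2 * Bd\<^sup>2"
      using r_pos h by (simp add: T_def field_simps)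
    finally show ?thesis .
  qed
  have "sq_dist 2 z zero_phase = (\<Sum>i<2. (fst z i)\<^sup>2 + (snd z i)\<^sup>2)"
    by (simp add: sq_dist_def zero_phase_def sum.distrib)
  also have "\<dots> \<le> (\<Sum>i<2. C * (1 + (2 + 2 * k * 2) / (r * h)\<^sup>2) * q (fst z i) (mom z i) + 2 * k * 2 / (r * h)\<^sup>2 * Bd\<^sup>2)"
    by (intro sum_mono one) simp
  also have "\<dots> = C * (1 + (2 + 2 * k * 2) / (r * h)\<^sup>2) * V c0 z + 2 * k * 2 * 2 / (r * h)\<^sup>2 * Bd\<^sup>2"
    by (simp add: V_def sum.distrib sum_distrib_left[symmetric])
  also have "\<dots> \<le> dist_factor * V c0 z + dist_factor * Bd\<^sup>2"
    using V_nonneg form k by (intro add_mono mult_right_mono) (auto simp: dist_factor_def k_def)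
  finally show ?thesis by (simp add: distrib_left)
qed

lemma overlap_on_sublevel:
  "\<exists>\<delta>>0. \<forall>x\<in>space M. \<forall>y\<in>space M. V c0 x + V c0 y \<le> R \<longrightarrow>
      (\<forall>A\<in>sets M. \<bar>measure (Q x) A - measure (Q y) A\<bar> \<le> 1 - \<delta>)"
proof -
  define k where "k = (4 + 2 * r\<^sup>2) * C / (h * \<sigma>)\<^sup>2"
  define \<delta> where "\<delta> = 1 - sqrt (1 - exp (- (k * max R 0) / 4))"
  have k: "0 \<le> k" using form by (simp add: k_def)
  have "sqrt (1 - exp (- (k * max R 0) / 4)) < sqrt 1" by (intro real_sqrt_less_mono) simp
  then have \<delta>: "0 < \<delta>" by (simp add: \<delta>_def)
  have "\<bar>measure (Q x) A - measure (Q y) A\<bar> \<le> 1 - \<delta>"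
    if xy: "x \<in> space M" "y \<in> space M" and R: "V c0 x + V c0 y \<le> R" and A: "A \<in> sets M" for x y A
  proof -
    have one: "((fst x i + mom x i - (fst y i + mom y i)) / (h * \<sigma>))\<^sup>2 + (r * (fst x i - fst y i) / (h * \<sigma>))\<^sup>2
      \<le> k * (q (fst x i) (mom x i) + q (fst y i) (mom y i))" for i
    proof -
      define X Y where "X = fst x i - fst y i" and "Y = mom x i - mom y i"
      have "((fst x i + mom x i - (fst y i + mom y i)) / (h * \<sigma>))\<^sup>2 + (r * (fst x i - fst y i) / (h * \<sigma>))\<^sup>2 = ((X + Y)\<^sup>2 + r\<^sup>2 * X\<^sup>2) / (h * \<sigma>)\<^sup>2"
        unfolding power_divide power_mult_distrib X_def Y_def by (simp add: add_divide_distrib algebra_simps)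
      also have "\<dots> \<le> ((2 + r\<^sup>2) * (X\<^sup>2 + Y\<^sup>2)) / (h * \<sigma>)\<^sup>2"
      proof (intro divide_right_mono)
        have "(X + Y)\<^sup>2 \<le> 2 * X\<^sup>2 + 2 * Y\<^sup>2" using square_sum_le[of 1 X Y] by simp
        moreover have "0 \<le> r\<^sup>2 * Y\<^sup>2" by simp
        ultimately show "(X + Y)\<^sup>2 + r\<^sup>2 * X\<^sup>2 \<le> (2 + r\<^sup>2) * (X\<^sup>2 + Y\<^sup>2)" unfolding distrib_left distrib_right by linarith
      qed simp
      also have "\<dots> \<le> ((2 + r\<^sup>2) * (C * (2 * (q (fst x i) (mom x i) + q (fst y i) (mom y i))))) / (h * \<sigma>)\<^sup>2"
      proof (intro divide_right_mono mult_left_mono)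
        have "X\<^sup>2 + Y\<^sup>2 \<le> C * q X Y" unfolding q_def by (rule form_lower)
        also have "q X Y \<le> 2 * (q (fst x i) (mom x i) + q (fst y i) (mom y i))"
          using q_triangle[of 1 "fst x i" "- fst y i" "mom x i" "- mom y i"] by (simp add: q_minus X_def Y_def)
        finally show "X\<^sup>2 + Y\<^sup>2 \<le> C * (2 * (q (fst x i) (mom x i) + q (fst y i) (mom y i)))" using form by (simp add: mult_left_mono)
      qed auto
      also have "\<dots> = k * (q (fst x i) (mom x i) + q (fst y i) (mom y i))"
        by (simp add: k_def algebra_simps add_divide_distrib)
      finally show ?thesis .
    qed
    have "gap x y \<le> (\<Sum>i<2. k * (q (fst x i) (mom x i) + q (fst y i) (mom y i)))"
      unfolding gap_def sum.distrib[symmetric] by (intro sum_mono one)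
    also have "\<dots> = k * (V c0 x + V c0 y)" by (simp add: V_def sum.distrib sum_distrib_left[symmetric])
    also have "\<dots> \<le> k * max R 0" using R k by (intro mult_left_mono) auto
    finally have "gap x y \<le> k * max R 0" .
    then have "sqrt (1 - exp (- gap x y / 4)) \<le> 1 - \<delta>"
      unfolding \<delta>_def by simp
    then show ?thesis using obabo_overlap[OF xy A] by linarith
  qed
  then show ?thesis using \<delta> by blast
qed

definition "moment_factor = C * (h\<^sup>2 / 2)\<^sup>2 + (8 * noise_factor * \<alpha>\<^sup>2 + (4 * (noise_factor * noise_scale 0) + 1)) / (\<eta> / 2)"

lemma moment_factor_nonneg: "0 \<le> moment_factor" using form noise_factor_nonneg noise_scale_nonneg[of 0] by (simp add: moment_factor_def)

lemma unique_invariant_law_exists: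
  obtains \<pi> where "unique_invariant_law 2 Q \<pi>" "(\<integral>\<^sup>+w. ennreal (V c0 w) \<partial>\<pi>) \<le> ennreal (moment_factor * (1 + Bd\<^sup>2))"
proof -
  define K where "K = 8 * noise_factor * \<alpha>\<^sup>2 * Bd\<^sup>2 + 4 * (noise_factor * noise_scale 0) + 1"
  have K: "0 < K" using noise_factor_nonneg noise_scale_nonneg[of 0] by (simp add: K_def add_nonneg_pos)
  have dr: "(\<integral>\<^sup>+w. ennreal (V c0 w) \<partial>Q z) \<le> ennreal ((1 - \<eta> / 2) * V c0 z + K)" if "z \<in> space M" for z
    by (rule order_trans[OF global_drift[OF that]]) (auto intro!: ennreal_leI simp: K_def)
  have e: "0 \<le> 1 - \<eta> / 2" "1 - \<eta> / 2 < 1" using form by auto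
  obtain \<pi> where \<pi>: "unique_invariant_law 2 Q \<pi>"
      "(\<integral>\<^sup>+w. ennreal (V c0 w) \<partial>\<pi>) \<le> ennreal (V c0 zero_phase + K / (1 - (1 - \<eta> / 2)))"
    by (rule harris[OF measurable_V V_nonneg dr e K overlap_on_sublevel zero_phase])
  have "V c0 zero_phase \<le> C * (h\<^sup>2 / 2)\<^sup>2 * Bd\<^sup>2"
  proof -
    have "mom zero_phase i = - (h\<^sup>2 / 2) * (if i = 0 then b 0 else 0)" if "i < 2" for i
      using that by (simp add: mom_def zero_phase_def grad_eq)
    then have "V c0 zero_phase = q 0 (- (h\<^sup>2 / 2) * b 0) + q 0 0"
      by (simp add: V_def zero_phase_def numeral_2_eq_2)
    also have "\<dots> \<le> C * (0\<^sup>2 + (- (h\<^sup>2 / 2) * b 0)\<^sup>2) + 0"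
      unfolding q_def by (intro add_mono form_upper) auto
    also have "\<dots> = C * (h\<^sup>2 / 2)\<^sup>2 * (b 0)\<^sup>2" unfolding power_mult_distrib power2_minus by simp
    also have "\<dots> \<le> C * (h\<^sup>2 / 2)\<^sup>2 * Bd\<^sup>2"
      using b_bound[of 0] Bd_nonneg form by (intro mult_left_mono) (auto simp: abs_le_square_iff[symmetric])
    finally show ?thesis .
  qed
  moreover have "K / (1 - (1 - \<eta> / 2)) = (8 * noise_factor * \<alpha>\<^sup>2) / (\<eta> / 2) * Bd\<^sup>2 + (4 * (noise_factor * noise_scale 0) + 1) / (\<eta> / 2)"
    by (simp add: K_def add_divide_distrib)
  moreover have "moment_factor * (1 + Bd\<^sup>2) = (C * (h\<^sup>2 / 2)\<^sup>2 * Bd\<^sup>2 + (8 * noise_factor * \<alpha>\<^sup>2) / (\<eta> / 2) * Bd\<^sup>2 + (4 * (noise_factor * noise_scale 0) + 1) / (\<eta> / 2))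
      + (C * (h\<^sup>2 / 2)\<^sup>2 + (8 * noise_factor * \<alpha>\<^sup>2) / (\<eta> / 2) + (4 * (noise_factor * noise_scale 0) + 1) / (\<eta> / 2) * Bd\<^sup>2)"
    by (simp add: moment_factor_def algebra_simps add_divide_distrib)
  moreover have "0 \<le> C * (h\<^sup>2 / 2)\<^sup>2 + (8 * noise_factor * \<alpha>\<^sup>2) / (\<eta> / 2) + (4 * (noise_factor * noise_scale 0) + 1) / (\<eta> / 2) * Bd\<^sup>2"
    using form noise_factor_nonneg noise_scale_nonneg[of 0] by (intro add_nonneg_nonneg mult_nonneg_nonneg divide_nonneg_nonneg) auto
  ultimately have "V c0 zero_phase + K / (1 - (1 - \<eta> / 2)) \<le> moment_factor * (1 + Bd\<^sup>2)" by linarith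
  then show ?thesis using \<pi> that by (meson ennreal_leI order_trans)
qed

lemma W2_bound:
  assumes \<pi>: "prob_space \<pi>" "sets \<pi> = sets M" "(\<integral>\<^sup>+w. ennreal (V c0 w) \<partial>\<pi>) \<le> ennreal (moment_factor * (1 + Bd\<^sup>2))"
    and z: "z \<in> space M"
  shows "W2 2 (dirac 2 z) \<pi> < \<infinity>"
    and "enn2real (W2 2 (dirac 2 z) \<pi>) \<le> sqrt (2 * dist_factor * (V c0 z + (2 + moment_factor) * (1 + Bd\<^sup>2)))"
proof -
  interpret \<pi>: prob_space \<pi> by fact
  note [measurable_cong] = \<pi>(2)
  have "(\<integral>\<^sup>+w. ennreal (sq_dist 2 z w) \<partial>\<pi>) \<le> (\<integral>\<^sup>+w. ennreal (2 * dist_factor) * ennreal (V c0 w) + ennreal (2 * dist_factor * (V c0 z + 2 * Bd\<^sup>2)) \<partial>\<pi>)"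
  proof (rule nn_integral_mono)
    fix w
    have "sq_dist 2 z w \<le> 2 * (dist_factor * (V c0 z + Bd\<^sup>2)) + 2 * (dist_factor * (V c0 w + Bd\<^sup>2))"
      using sq_dist_triangle[of 2 z w zero_phase] sq_dist_zero_phase[of z] sq_dist_zero_phase[of w] by linarith
    also have "\<dots> = 2 * dist_factor * V c0 w + 2 * dist_factor * (V c0 z + 2 * Bd\<^sup>2)" by (simp add: algebra_simps)
    finally show "ennreal (sq_dist 2 z w) \<le> ennreal (2 * dist_factor) * ennreal (V c0 w) + ennreal (2 * dist_factor * (V c0 z + 2 * Bd\<^sup>2))"
      using V_nonneg dist_factor_nonneg by (simp add: ennreal_mult[symmetric] ennreal_plus[symmetric] ennreal_leI del: ennreal_plus)
  qed
  also have "\<dots> = ennreal (2 * dist_factor) * (\<integral>\<^sup>+w. ennreal (V c0 w) \<partial>\<pi>) + ennreal (2 * dist_factor * (V c0 z + 2 * Bd\<^sup>2))"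
    by (subst nn_integral_add) (auto simp: nn_integral_cmult \<pi>.emeasure_space_1)
  also have "\<dots> \<le> ennreal (2 * dist_factor) * ennreal (moment_factor * (1 + Bd\<^sup>2)) + ennreal (2 * dist_factor * (V c0 z + 2 * Bd\<^sup>2))"
    by (intro add_right_mono mult_left_mono \<pi>) auto
  also have "\<dots> = ennreal (2 * dist_factor * (moment_factor * (1 + Bd\<^sup>2)) + 2 * dist_factor * (V c0 z + 2 * Bd\<^sup>2))"
    using dist_factor_nonneg moment_factor_nonneg V_nonneg by (simp add: ennreal_mult[symmetric] ennreal_plus[symmetric] del: ennreal_plus)
  also have "\<dots> \<le> ennreal (2 * dist_factor * (V c0 z + (2 + moment_factor) * (1 + Bd\<^sup>2)))"
    using dist_factor_nonneg by (intro ennreal_leI) (simp add: algebra_simps)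
  finally have le: "(\<integral>\<^sup>+w. ennreal (sq_dist 2 z w) \<partial>\<pi>) \<le> \<dots>" .
  have "0 \<le> 2 * dist_factor * (V c0 z + (2 + moment_factor) * (1 + Bd\<^sup>2))" using dist_factor_nonneg moment_factor_nonneg V_nonneg by simp
  from W2_dirac_le(1,2)[OF \<pi>(1,2) z le this]
  show "W2 2 (dirac 2 z) \<pi> < \<infinity>" "enn2real (W2 2 (dirac 2 z) \<pi>) \<le> sqrt (2 * dist_factor * (V c0 z + (2 + moment_factor) * (1 + Bd\<^sup>2)))" by auto
qed

text \<open>The centres form a noiseless trajectory. At noiseless next positions \<open>t\<close> within the region of size \<open>R\<close>, the nonlinear
  force differs from that on the trajectory by a multiple of the noise only. This holds if \<open>b\<close> is constant near
  the trajectory, since then a difference needs large noise.\<close>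

definition shadows :: "(nat \<Rightarrow> point \<times> point) \<Rightarrow> real \<Rightarrow> real \<Rightarrow> bool" where
  "shadows c R D \<longleftrightarrow> (\<forall>k. \<forall>i<2. fst (c (Suc k)) i = fst (c k) i + snd (c k) i \<and>
      snd (c (Suc k)) i = \<beta> * snd (c k) i - \<alpha> * (fst (c (Suc k)) i + (if i = 0 then b (fst (c (Suc k)) i) else 0))) \<and>
    (\<forall>k t n. (t - (fst (c k) 0 + snd (c k) 0))\<^sup>2 \<le> 2 * C * R \<longrightarrow> \<bar>b (t + h * \<sigma> * n) - b (fst (c (Suc k)) 0)\<bar> \<le> D * \<bar>n\<bar>)"

lemma trajectory_confinement:
  assumes sh: "shadows c R D" and R: "0 < R" and D: "0 \<le> D" and z: "z \<in> space M" and V0: "V (c 0) z = 0"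
  shows "1 - n * (4 * noise_factor * noise_scale D) / R \<le> measure (P n z) {w \<in> space M. V (c n) w \<le> R}"
proof -
  have "1 - (V (c 0) z + n * (4 * noise_factor * noise_scale D)) / R \<le> measure (P n z) {w \<in> space M. V (c (0 + n)) w \<le> R}"
  proof (rule confinement[OF measurable_V R _ V_nonneg _ z])
    show "0 \<le> 4 * noise_factor * noise_scale D" using noise_factor_nonneg noise_scale_nonneg by simp
    fix k z assume z: "z \<in> space M" and VR: "V (c k) z \<le> R"
    have "(\<integral>\<^sup>+w. ennreal (V (c (Suc k)) w) \<partial>Q z) \<le> ennreal (V (c k) z + 2 * (noise_factor * noise_scale D) * real 2)"
    proof (rule drift_of_pathwise[OF z])
      fix \<xi> \<zeta>
      define e f where "e = fst z 0 - fst (c k) 0" and "f = mom z 0 - snd (c k) 0"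
      have qR: "q e f \<le> R"
      proof -
        have "q e f \<le> V (c k) z" unfolding V_def e_def f_def by (simp add: numeral_2_eq_2 q_nonneg)
        then show ?thesis using VR by simp
      qed
      have "(e + f)\<^sup>2 \<le> 2 * (e\<^sup>2 + f\<^sup>2)" using square_sum_le[of 1 e f] by simp
      also have "\<dots> \<le> 2 * (C * q e f)" unfolding q_def by (intro mult_left_mono form_lower) auto
      also have "\<dots> \<le> 2 * (C * R)" using qR form by (intro mult_left_mono) auto
      finally have ef: "(fst z 0 + mom z 0 - (fst (c k) 0 + snd (c k) 0))\<^sup>2 \<le> 2 * C * R"
        by (simp add: e_def f_def algebra_simps)
      have dev: "\<bar>(if i = 0 then b (fst (step \<xi> \<zeta> z) i) else 0) - (if i = 0 then b (fst (c (Suc k)) i) else 0)\<bar> \<le> D * \<bar>\<xi> i\<bar> + 0"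
        if "i < 2" for i
      proof (cases "i = 0")
        case True
        have "\<bar>b (fst z 0 + mom z 0 + h * \<sigma> * \<xi> 0) - b (fst (c (Suc k)) 0)\<bar> \<le> D * \<bar>\<xi> 0\<bar>"
          using sh ef unfolding shadows_def by blast
        then show ?thesis using True by (simp add: step_pos)
      qed (use D in simp)
      have "V (c (Suc k)) (step \<xi> \<zeta> z) \<le> (1 - \<eta> / 2) * V (c k) z + (8 * noise_factor * \<alpha>\<^sup>2 * 0\<^sup>2 + noise_factor * noise_scale D * ((\<Sum>i<2. (\<xi> i)\<^sup>2) + (\<Sum>i<2. (\<zeta> i)\<^sup>2)))"
        by (rule V_noisy_step[OF _ _ dev]) (use sh in \<open>auto simp: shadows_def\<close>)
      also have "(1 - \<eta> / 2) * V (c k) z \<le> V (c k) z" using form V_nonneg by (simp add: mult_left_le_one_le)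
      finally show "V (c (Suc k)) (step \<xi> \<zeta> z) \<le> V (c k) z + noise_factor * noise_scale D * ((\<Sum>i<2. (\<xi> i)\<^sup>2) + (\<Sum>i<2. (\<zeta> i)\<^sup>2))" by simp
    qed (use V_nonneg noise_factor_nonneg noise_scale_nonneg in auto)
    then show "(\<integral>\<^sup>+w. ennreal (V (c (Suc k)) w) \<partial>Q z) \<le> ennreal (V (c k) z + 4 * noise_factor * noise_scale D)" by (simp add: mult_ac)
  qed
  then show ?thesis by (simp add: V0)
qed

text \<open>The inverse of the coordinates position and \<open>mom\<close>.\<close>

definition lift :: "point \<times> point \<Rightarrow> phase" where
  "lift c = ((\<lambda>i\<in>{..<2}. fst c i), (\<lambda>i\<in>{..<2}. (snd c i + h\<^sup>2 / 2 * (fst c i + (if i = 0 then b (fst c i) else 0))) / (r * h)))"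

lemma lift: "lift c \<in> space M" "i < 2 \<Longrightarrow> fst (lift c) i = fst c i" "i < 2 \<Longrightarrow> mom (lift c) i = snd c i"
  using r_pos h by (auto simp: lift_def space_phase vecs_def mom_def grad_eq)

lemma V_lift: "V c (lift c) = 0" "V c0 (lift c) = (\<Sum>i<2. q (fst c i) (snd c i))"
  by (auto simp: V_def lift q_def)

text \<open>Two trajectories that are still apart at time \<open>n\<close>, at a distance that dominates the accumulated variance of the noise,
  carry two almost disjoint laws. The bound on \<open>W2\<close> depends on the size of the starting points and on \<open>Bd\<close>.\<close>

theorem slow_mixing_of_separated_trajectories:
  assumes sh: "shadows c R D" "shadows c' R D" and R: "0 < R" and D: "0 \<le> D"
    and sep: "4 * R < (\<Sum>i<2. q (fst (c n) i - fst (c' n) i) (snd (c n) i - snd (c' n) i))"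
    and n: "n * (4 * noise_factor * noise_scale D) \<le> R / 4"
    and start: "(\<Sum>i<2. q (fst (c 0) i) (snd (c 0) i)) \<le> T" "(\<Sum>i<2. q (fst (c' 0) i) (snd (c' 0) i)) \<le> T"
  shows "\<exists>\<pi> z. unique_invariant_law 2 Q \<pi> \<and> z \<in> space M \<and> W2 2 (dirac 2 z) \<pi> < \<infinity> \<and>
      enn2real (W2 2 (dirac 2 z) \<pi>) \<le> sqrt (2 * dist_factor * (T + (2 + moment_factor) * (1 + Bd\<^sup>2))) \<and> 1 / 4 \<le> tv_dist 2 (P n z) \<pi>"
proof -
  obtain \<pi> where \<pi>: "unique_invariant_law 2 Q \<pi>" "(\<integral>\<^sup>+w. ennreal (V c0 w) \<partial>\<pi>) \<le> ennreal (moment_factor * (1 + Bd\<^sup>2))"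
    by (rule unique_invariant_law_exists)
  have pr: "prob_space \<pi>" "sets \<pi> = sets M" using \<pi>(1) by (auto simp: unique_invariant_law_def invariant_law_def)
  define A where "A c = {w \<in> space M. V (c n) w \<le> R}" for c :: "nat \<Rightarrow> point \<times> point"
  have A: "A c \<in> sets M" for c unfolding A_def by measurable
  have big: "3 / 4 \<le> measure (P n (lift (c 0))) (A c)" if "shadows c R D" for c
  proof -
    have "1 - n * (4 * noise_factor * noise_scale D) / R \<le> measure (P n (lift (c 0))) (A c)"
      unfolding A_def by (rule trajectory_confinement[OF that R D lift(1) V_lift(1)])
    moreover have "n * (4 * noise_factor * noise_scale D) / R \<le> 1 / 4" using n R by (simp add: pos_divide_le_eq)
    ultimately show ?thesis by linarith
  qed
  have disj: "A c \<inter> A c' = {}"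
  proof (rule ccontr)
    assume "A c \<inter> A c' \<noteq> {}"
    then obtain w where w: "V (c n) w \<le> R" "V (c' n) w \<le> R" by (auto simp: A_def)
    have "q (fst (c n) i - fst (c' n) i) (snd (c n) i - snd (c' n) i)
      \<le> 2 * q (fst w i - fst (c n) i) (mom w i - snd (c n) i) + 2 * q (fst w i - fst (c' n) i) (mom w i - snd (c' n) i)" for i
      using q_triangle[of 1 "- (fst w i - fst (c n) i)" "fst w i - fst (c' n) i" "- (mom w i - snd (c n) i)" "mom w i - snd (c' n) i"]
      unfolding q_minus by (simp add: algebra_simps)
    then have "(\<Sum>i<2. q (fst (c n) i - fst (c' n) i) (snd (c n) i - snd (c' n) i)) \<le>
      (\<Sum>i<2. 2 * q (fst w i - fst (c n) i) (mom w i - snd (c n) i) + 2 * q (fst w i - fst (c' n) i) (mom w i - snd (c' n) i))"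
      by (rule sum_mono)
    also have "\<dots> = 2 * V (c n) w + 2 * V (c' n) w" by (simp add: V_def sum.distrib sum_distrib_left)
    also have "\<dots> \<le> 4 * R" using w by simp
    finally show False using sep by simp
  qed
  have W: "W2 2 (dirac 2 (lift (c 0))) \<pi> < \<infinity> \<and>
      enn2real (W2 2 (dirac 2 (lift (c 0))) \<pi>) \<le> sqrt (2 * dist_factor * (T + (2 + moment_factor) * (1 + Bd\<^sup>2)))"
    if "(\<Sum>i<2. q (fst (c 0) i) (snd (c 0) i)) \<le> T" for c :: "nat \<Rightarrow> point \<times> point"
  proof
    show "W2 2 (dirac 2 (lift (c 0))) \<pi> < \<infinity>" by (rule W2_bound(1)[OF pr \<pi>(2) lift(1)])
    have "enn2real (W2 2 (dirac 2 (lift (c 0))) \<pi>) \<le> sqrt (2 * dist_factor * (V c0 (lift (c 0)) + (2 + moment_factor) * (1 + Bd\<^sup>2)))"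
      by (rule W2_bound(2)[OF pr \<pi>(2) lift(1)])
    also have "\<dots> \<le> sqrt (2 * dist_factor * (T + (2 + moment_factor) * (1 + Bd\<^sup>2)))"
      using that dist_factor_nonneg by (intro real_sqrt_le_mono mult_left_mono add_right_mono) (auto simp: V_lift)
    finally show "enn2real (W2 2 (dirac 2 (lift (c 0))) \<pi>) \<le> sqrt (2 * dist_factor * (T + (2 + moment_factor) * (1 + Bd\<^sup>2)))" .
  qed
  show ?thesis
    using two_separated_laws[OF lift(1) lift(1) pr A A disj big[OF sh(1)] big[OF sh(2)]] \<pi>(1) lift(1) W[of c, OF start(1)] W[of c', OF start(2)]
    by blast
qed

end

section \<open>A stable cycle of the heavy ball\<close>

context smooth_step
begin

text \<open>A force that takes prescribed values \<open>v j\<close> at the points \<open>p 0 > \<dots> > p m\<close> exists if its difference quotients lie between 1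
  and a fraction of \<open>\<kappa>\<close>. Everything beyond slope 1 is put into the middle half of each gap, so that the deviation
  \<open>b\<close> from the linear force is constant near the points. The factor \<open>2 * B\<close> pays for the steepest slope of a smooth step and for the
  halved width. Scaling by \<open>L\<close> changes lengths and forces but no slope.\<close>

lemma interpolating_force:
  fixes p v :: "nat \<Rightarrow> real"
  assumes dec: "\<And>j. j < m \<Longrightarrow> p (Suc j) < p j"
    and lower: "\<And>j. j < m \<Longrightarrow> p j - p (Suc j) \<le> v j - v (Suc j)"
    and upper: "\<And>j. j < m \<Longrightarrow> 2 * B * ((v j - v (Suc j)) - (p j - p (Suc j))) \<le> (\<kappa> - 1) * (p j - p (Suc j))"
    and \<kappa>: "1 \<le> \<kappa>" and \<rho>: "\<And>j. j < m \<Longrightarrow> 4 * \<rho> \<le> p j - p (Suc j)" and L: "0 < L"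
  shows "\<exists>U\<in>potentials 2 \<kappa>. \<exists>b. (\<forall>x i. i < 2 \<longrightarrow> grad 2 U x i = x i + (if i = 0 then b (x i) else 0)) \<and>
    (\<forall>t. \<bar>b t\<bar> \<le> L * (\<bar>v m - p m\<bar> + (\<Sum>j<m. (v j - v (Suc j)) - (p j - p (Suc j))))) \<and>
    (\<forall>i\<le>m. \<forall>t. \<bar>t - L * p i\<bar> \<le> L * \<rho> \<longrightarrow> b t = L * (v i - p i))"
proof -
  have anti: "p k \<le> p j" if "j \<le> k" "k \<le> m" for j k
    using that
  proof (induction rule: dec_induct)
    case (step n)
    then show ?case using dec[of n] by simp
  qed simp
  define a l w where "a j = L * ((v j - v (Suc j)) - (p j - p (Suc j)))"
    and "l j = L * (p (Suc j) + (p j - p (Suc j)) / 4)" and "w j = L * (p j - p (Suc j)) / 2" for j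
  have a0: "0 \<le> a j" if "j < m" for j using lower[OF that] L by (simp add: a_def)
  have w0: "0 < w j" if "j < m" for j using dec[OF that] L by (simp add: w_def)
  have slope: "B * a j \<le> (\<kappa> - 1) * w j" if "j < m" for j
  proof -
    have "L * (2 * B * ((v j - v (Suc j)) - (p j - p (Suc j)))) \<le> L * ((\<kappa> - 1) * (p j - p (Suc j)))"
      using upper[OF that] L by (intro mult_left_mono) auto
    moreover have "B * a j = L * (2 * B * ((v j - v (Suc j)) - (p j - p (Suc j)))) / 2"
      "(\<kappa> - 1) * w j = L * ((\<kappa> - 1) * (p j - p (Suc j))) / 2" by (simp_all add: a_def w_def)
    ultimately show ?thesis by linarith
  qed
  have lw: "l j + w j = L * (p j - (p j - p (Suc j)) / 4)" for j
    by (simp add: l_def w_def field_simps)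
  have below: "l k + w k \<le> l j" if "j < k" "k < m" for j k
  proof -
    have "p k \<le> p (Suc j)" using that by (intro anti) auto
    then have "p k - (p k - p (Suc k)) / 4 \<le> p (Suc j) + (p j - p (Suc j)) / 4"
      using dec[of k] dec[of j] that by (auto simp: field_simps)
    then show ?thesis unfolding lw unfolding l_def using L by (intro mult_left_mono) auto
  qed
  have disj: "l j + w j \<le> l k \<or> l k + w k \<le> l j" if "j < m" "k < m" "j \<noteq> k" for j k
    using below[of j k] below[of k j] that by (meson linorder_neqE_nat)
  define c where "c = L * (v m - p m)"
  have "\<exists>U\<in>potentials 2 \<kappa>. \<forall>x. \<forall>i<2. grad 2 U x i = x i + (if i = 0 then c + stair m a l w (x i) else 0)"
    by (rule stair_potential) (fact a0 w0 slope \<kappa> disj)+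
  then obtain U where U: "U \<in> potentials 2 \<kappa>"
    "\<forall>x. \<forall>i<2. grad 2 U x i = x i + (if i = 0 then c + stair m a l w (x i) else 0)"
    by (elim bexE)
  have bd: "\<bar>c + stair m a l w t\<bar> \<le> L * (\<bar>v m - p m\<bar> + (\<Sum>j<m. (v j - v (Suc j)) - (p j - p (Suc j))))" for t
  proof -
    have "\<bar>c + stair m a l w t\<bar> \<le> \<bar>c\<bar> + (\<Sum>j<m. a j)" using stair_bound[of m a l w t, OF a0] by auto
    also have "\<bar>c\<bar> = L * \<bar>v m - p m\<bar>" using L by (simp add: c_def abs_mult)
    also have "(\<Sum>j<m. a j) = L * (\<Sum>j<m. (v j - v (Suc j)) - (p j - p (Suc j)))"
      unfolding a_def sum_distrib_left ..
    finally show ?thesis by (simp only: distrib_left)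
  qed
  have val: "c + stair m a l w t = L * (v i - p i)" if i: "i \<le> m" and t: "\<bar>t - L * p i\<bar> \<le> L * \<rho>" for i t
  proof -
    have "G ((t - l j) / w j) = (if i \<le> j then 1 else 0)" if j: "j < m" for j
    proof -
      have r4: "L * \<rho> \<le> L * ((p j - p (Suc j)) / 4)" using \<rho>[OF j] L by (intro mult_left_mono) auto
      show ?thesis
      proof (cases "i \<le> j")
        case True
        have "L * p j \<le> L * p i" using anti[OF True] j L by (intro mult_left_mono) auto
        moreover have "l j + w j = L * p j - L * ((p j - p (Suc j)) / 4)" unfolding lw by (rule right_diff_distrib)
        ultimately have "l j + w j \<le> t" using t r4 by linarith
        then have "1 \<le> (t - l j) / w j" using w0[OF j] by (simp add: le_divide_eq)
        then show ?thesis using G_right True by simp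
      next
        case False
        have "L * p i \<le> L * p (Suc j)" using anti[of "Suc j" i] False i L by (intro mult_left_mono) auto
        moreover have "l j = L * p (Suc j) + L * ((p j - p (Suc j)) / 4)" unfolding l_def by (rule distrib_left)
        ultimately have "t \<le> l j" using t r4 by linarith
        then have "(t - l j) / w j \<le> 0" using w0[OF j] by (simp add: divide_le_0_iff)
        then show ?thesis using G_left False by simp
      qed
    qed
    then have "stair m a l w t = (\<Sum>j<m. if i \<le> j then a j else 0)"
      unfolding stair_def by (intro sum.cong) auto
    also have "\<dots> = (\<Sum>j\<in>{i..<m}. a j)" by (rule sum.mono_neutral_cong_right) auto
    also have "\<dots> = (\<Sum>j\<in>{i..<m}. L * (p (Suc j) - v (Suc j)) - L * (p j - v j))"
      by (intro sum.cong) (auto simp: a_def algebra_simps)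
    also have "\<dots> = L * (p m - v m) - L * (p i - v i)"
      by (rule sum_Suc_diff'[OF i])
    finally show ?thesis by (simp add: c_def algebra_simps)
  qed
  show ?thesis
  proof (rule bexI[OF _ U(1)], rule exI[of _ "\<lambda>t. c + stair m a l w t"], intro conjI)
    show "\<forall>x i. i < 2 \<longrightarrow> grad 2 U x i = x i + (if i = 0 then c + stair m a l w (x i) else 0)"
      by (intro allI impI) (rule U(2)[rule_format])
    show "\<forall>t. \<bar>c + stair m a l w t\<bar> \<le> L * (\<bar>v m - p m\<bar> + (\<Sum>j<m. (v j - v (Suc j)) - (p j - p (Suc j))))"
      by (rule allI) (rule bd)
    show "\<forall>i\<le>m. \<forall>t. \<bar>t - L * p i\<bar> \<le> L * \<rho> \<longrightarrow> c + stair m a l w t = L * (v i - p i)"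
      by (intro allI impI) (rule val)
  qed
qed

end

lemma cycle_angle_exists:
  fixes a B :: real
  assumes "0 < a" "a < 4" "1 \<le> B"
  obtains K :: nat and \<theta> where "7 \<le> K" "\<theta> = 2 * pi / K" "0 < \<theta>" "\<theta> \<le> 1" "\<theta>\<^sup>2 \<le> a / (4 * B)" "a / (16 * B) \<le> \<theta>\<^sup>2"
proof -
  define t where "t = sqrt (a / (4 * B))"
  have "a / (4 * B) < 1" using assms by (simp add: divide_less_eq)
  then have t: "0 < t" "t < 1" "t\<^sup>2 = a / (4 * B)" using assms by (auto simp: t_def)
  define K where "K = nat \<lceil>2 * pi / t\<rceil>"
  have pi3: "3 < pi" by (rule pi_gt3)
  have big: "6 < 2 * pi / t"
  proof -
    have "6 * t < 6 * 1" using t by (intro mult_strict_left_mono) auto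
    then show ?thesis using t pi3 by (simp add: less_divide_eq)
  qed
  have K: "2 * pi / t \<le> K" "K \<le> 2 * pi / t + 1" unfolding K_def using big by (auto simp: of_nat_ceiling)
  have K7: "7 \<le> K"
  proof -
    have "6 < real K" using K big by linarith
    then show ?thesis by simp
  qed
  define \<theta> where "\<theta> = 2 * pi / K"
  have Kpos: "0 < real K" using K7 by simp
  have \<theta>0: "0 < \<theta>" using Kpos by (simp add: \<theta>_def)
  have \<theta>t: "\<theta> \<le> t" using K(1) t Kpos by (simp add: \<theta>_def field_simps)
  have t\<theta>: "t \<le> 2 * \<theta>"
  proof -
    have "real K \<le> 2 * (2 * pi / t)" using K(2) big by linarith
    then have "t * K \<le> 4 * pi" using t by (simp add: field_simps)
    then show ?thesis using Kpos by (simp add: \<theta>_def field_simps)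
  qed
  have "\<theta>\<^sup>2 \<le> t\<^sup>2" using \<theta>0 \<theta>t by (intro power_mono) auto
  moreover have "t\<^sup>2 \<le> (2 * \<theta>)\<^sup>2" using t t\<theta> by (intro power_mono) auto
  then have "a / (16 * B) \<le> \<theta>\<^sup>2" using t(3) by (simp add: power_mult_distrib)
  ultimately show ?thesis using that[OF K7 \<theta>_def \<theta>0] \<theta>t t by simp
qed

lemma one_minus_cos_bounds:
  fixes \<theta> :: real
  assumes "0 < \<theta>" "\<theta> \<le> 1"
  shows "\<theta>\<^sup>2 / 8 \<le> 1 - cos \<theta>" "1 - cos \<theta> \<le> \<theta>\<^sup>2 / 2"
proof -
  have c: "1 - cos \<theta> = 2 * (sin (\<theta> / 2))\<^sup>2" using cos_double_sin[of "\<theta> / 2"] by simp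
  have s: "\<theta> / 2 / 2 \<le> sin (\<theta> / 2)"
  proof -
    have "\<exists>z. 0 < z \<and> z < \<theta> / 2 \<and> sin (\<theta> / 2) - sin 0 = (\<theta> / 2 - 0) * cos z"
      using assms by (intro MVT2) auto
    then obtain z where z: "0 < z" "z < \<theta> / 2" "sin (\<theta> / 2) = \<theta> / 2 * cos z" by auto
    have "cos (pi / 3) \<le> cos z" using z assms pi_gt3 by (intro cos_monotone_0_pi_le) auto
    then have "1 / 2 \<le> cos z" by (simp add: cos_60)
    then have "\<theta> / 2 * (1 / 2) \<le> \<theta> / 2 * cos z" using assms by (intro mult_left_mono) auto
    then show ?thesis using z(3) by simp
  qed
  have "(\<theta> / 4)\<^sup>2 \<le> (sin (\<theta> / 2))\<^sup>2" using s assms by (intro power_mono) auto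
  then show "\<theta>\<^sup>2 / 8 \<le> 1 - cos \<theta>" unfolding c by (simp add: power_divide)
  have "(sin (\<theta> / 2))\<^sup>2 \<le> (\<theta> / 2)\<^sup>2" using s assms sin_x_le_x[of "\<theta> / 2"] by (intro power_mono) auto
  then show "1 - cos \<theta> \<le> \<theta>\<^sup>2 / 2" unfolding c by (simp add: power_divide)
qed

context smooth_step
begin

text \<open>The points \<open>cos (\<phi> k)\<close> with \<open>\<phi> k = \<theta> / 4 + k \<theta>\<close> and \<open>K \<theta> = 2 \<pi>\<close> are made a periodic orbit of the heavy ball. For this the force at
  \<open>cos (\<phi> k)\<close> has to be \<open>A0 cos (\<phi> k) + B0 sin (\<phi> k)\<close>, with \<open>A0 = (1 + \<beta>) (1 - cos \<theta>) / \<alpha>\<close> and \<open>B0 = (1 - \<beta>) sin \<theta> / \<alpha>\<close>. The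
  offset \<open>\<theta> / 4\<close> makes the \<open>K\<close> positions distinct: ordered from right to left they are \<open>cos ((2 j + 1) \<theta> / 4)\<close>, alternately
  from the upper and the lower half of the circle. The difference quotients of the force are therefore
  \<open>A0 \<plusminus> B0 cot (\<theta> / 4)\<close>. The choice of \<open>\<theta>\<^sup>2\<close> of order \<open>\<alpha> \<kappa> / B\<close> makes \<open>A0\<close> a small fraction of \<open>\<kappa>\<close>, and
  the friction term, about \<open>4 (1 - \<beta>) / \<alpha>\<close>, is a smaller one by \<open>ratio\<close>.\<close>

lemma cycle_exists:
  fixes \<alpha> \<beta> \<kappa> :: real
  assumes \<beta>: "0 < \<beta>" "\<beta> < 1" and \<alpha>: "0 < \<alpha>" "\<alpha> * \<kappa> < 4" and \<kappa>: "256 * B \<le> \<kappa>"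
    and ratio: "2048 * B * (1 - \<beta>) \<le> \<alpha> * \<kappa>"
  shows "\<exists>x \<rho> D. 0 < \<rho> \<and> (\<forall>k. \<bar>x k\<bar> \<le> 1 \<and> 4 * \<rho> \<le> \<bar>x k - x (Suc k)\<bar>) \<and>
    (\<forall>L>0. \<exists>U\<in>potentials 2 \<kappa>. \<exists>b. (\<forall>u i. i < 2 \<longrightarrow> grad 2 U u i = u i + (if i = 0 then b (u i) else 0)) \<and>
      (\<forall>t. \<bar>b t\<bar> \<le> L * D) \<and>
      (\<forall>k t. \<bar>t - L * x k\<bar> \<le> L * \<rho> \<longrightarrow> b t = b (L * x k)) \<and>
      (\<forall>k. \<alpha> * (L * x (Suc k) + b (L * x (Suc k))) = L * ((1 + \<beta>) * x (Suc k) - \<beta> * x k - x (Suc (Suc k)))))"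
proof -
  have \<kappa>0: "0 < \<kappa>" "1 \<le> \<kappa>" using \<kappa> B_ge_1 by linarith+
  have "0 < \<alpha> * \<kappa>" using \<alpha> \<kappa>0 by simp
  then obtain K :: nat and \<theta> where K: "7 \<le> K" and \<theta>K: "\<theta> = 2 * pi / K" and \<theta>: "0 < \<theta>" "\<theta> \<le> 1"
    and \<theta>2: "\<theta>\<^sup>2 \<le> \<alpha> * \<kappa> / (4 * B)" "\<alpha> * \<kappa> / (16 * B) \<le> \<theta>\<^sup>2"
    using cycle_angle_exists[of "\<alpha> * \<kappa>" B] \<alpha>(2) B_ge_1 by blast
  define m where "m = K - 1"
  have K\<theta>: "K * \<theta> = 2 * pi" using K by (simp add: \<theta>K)
  define A0 B0 where "A0 = (1 + \<beta>) * (1 - cos \<theta>) / \<alpha>" and "B0 = (1 - \<beta>) * sin \<theta> / \<alpha>"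
  define \<psi> where "\<psi> j = (2 * real j + 1) * \<theta> / 4" for j
  define p v where "p j = cos (\<psi> j)" and "v j = A0 * cos (\<psi> j) + (-1) ^ j * B0 * sin (\<psi> j)" for j
  define s c where "s = sin (\<theta> / 4)" and "c = cos (\<theta> / 4)"
  have s0: "0 < s" unfolding s_def using \<theta> pi_gt3 by (intro sin_gt_zero) auto
  have c0: "0 \<le> c" "c \<le> 1" unfolding c_def using \<theta> pi_gt3 by (auto intro!: cos_ge_zero)
  \<comment> \<open>All gaps of positions and forces have the positive factor \<open>S j\<close>, which drops out of the difference quotients.\<close>
  define S where "S j = sin (real (Suc j) * \<theta> / 2)" for j
  have S0: "0 < S j" if "j < m" for j
    unfolding S_def
  proof (rule sin_gt_zero)
    have "real (Suc j) < K" using that by (simp add: m_def)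
    then have "real (Suc j) * \<theta> < K * \<theta>" using \<theta> by (intro mult_strict_right_mono) auto
    then show "real (Suc j) * \<theta> / 2 < pi" using K\<theta> by simp
  qed (use \<theta> in simp)
  have gap: "p j - p (Suc j) = 2 * S j * s" for j
  proof -
    have "p j - p (Suc j) = 2 * sin ((\<psi> j + \<psi> (Suc j)) / 2) * sin ((\<psi> (Suc j) - \<psi> j) / 2)"
      unfolding p_def by (rule cos_diff_cos)
    moreover have "(\<psi> j + \<psi> (Suc j)) / 2 = real (Suc j) * \<theta> / 2" "(\<psi> (Suc j) - \<psi> j) / 2 = \<theta> / 4"
      by (simp_all add: \<psi>_def field_simps)
    ultimately show ?thesis by (simp add: S_def s_def)
  qed
  have sinsum: "sin (\<psi> j) + sin (\<psi> (Suc j)) = 2 * S j * c" for j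
  proof -
    have "sin (\<psi> (Suc j)) + sin (\<psi> j) = 2 * sin ((\<psi> (Suc j) + \<psi> j) / 2) * cos ((\<psi> (Suc j) - \<psi> j) / 2)"
      by (rule sin_plus_sin)
    moreover have "(\<psi> (Suc j) + \<psi> j) / 2 = real (Suc j) * \<theta> / 2" "(\<psi> (Suc j) - \<psi> j) / 2 = \<theta> / 4"
      by (simp_all add: \<psi>_def field_simps)
    ultimately show ?thesis by (simp add: S_def c_def)
  qed
  have vdiff: "v j - v (Suc j) = 2 * S j * (A0 * s + (-1) ^ j * B0 * c)" for j
  proof -
    have "v j - v (Suc j) = A0 * (p j - p (Suc j)) + (-1) ^ j * B0 * (sin (\<psi> j) + sin (\<psi> (Suc j)))"
      by (simp add: v_def p_def algebra_simps)
    then show ?thesis unfolding gap sinsum by (simp add: algebra_simps)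
  qed
  have ba: "4 * (1 - \<beta>) / \<alpha> \<le> \<kappa> / (512 * B)"
    using ratio \<alpha> B_ge_1 by (simp add: field_simps)
  have B0c: "0 \<le> B0 * c" "B0 * c \<le> \<kappa> / (512 * B) * s"
  proof -
    have "sin \<theta> = 2 * (2 * s * c) * cos (\<theta> / 2)"
      using sin_double[of "\<theta> / 2"] sin_double[of "\<theta> / 4"] by (simp add: s_def c_def)
    then have e: "B0 * c = 4 * (1 - \<beta>) / \<alpha> * (s * (c * c * cos (\<theta> / 2)))" by (simp add: B0_def)
    have ch: "0 \<le> cos (\<theta> / 2)" "cos (\<theta> / 2) \<le> 1" using \<theta> pi_gt3 by (auto intro!: cos_ge_zero)
    have u: "0 \<le> 4 * (1 - \<beta>) / \<alpha>" using \<beta> \<alpha> by simp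
    show "0 \<le> B0 * c" unfolding e using u s0 c0 ch by (intro mult_nonneg_nonneg) auto
    have "c * c * cos (\<theta> / 2) \<le> 1 * 1 * 1" using c0 ch by (intro mult_mono) auto
    then have "s * (c * c * cos (\<theta> / 2)) \<le> s * 1" using s0 by (intro mult_left_mono) auto
    then have "4 * (1 - \<beta>) / \<alpha> * (s * (c * c * cos (\<theta> / 2))) \<le> \<kappa> / (512 * B) * (s * 1)"
      using u ba s0 c0 ch by (intro mult_mono) auto
    then show "B0 * c \<le> \<kappa> / (512 * B) * s" using e by simp
  qed
  have A0: "\<kappa> / (128 * B) \<le> A0" "A0 \<le> \<kappa> / (4 * B)"
  proof -
    have "\<alpha> * \<kappa> / (128 * B) \<le> \<theta>\<^sup>2 / 8" using \<theta>2(2) by simp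
    also have "\<dots> \<le> 1 - cos \<theta>" by (rule one_minus_cos_bounds(1)[OF \<theta>])
    also have "\<dots> \<le> (1 + \<beta>) * (1 - cos \<theta>)" using \<beta> by (simp add: mult_le_cancel_right1 not_less)
    finally have "\<alpha> * (\<kappa> / (128 * B)) \<le> (1 + \<beta>) * (1 - cos \<theta>)" by simp
    then show "\<kappa> / (128 * B) \<le> A0" using \<alpha> by (simp add: A0_def pos_le_divide_eq mult.commute)
    have "(1 + \<beta>) * (1 - cos \<theta>) \<le> 2 * (\<theta>\<^sup>2 / 2)"
      using \<beta> one_minus_cos_bounds(2)[OF \<theta>] by (intro mult_mono) auto
    also have "\<dots> \<le> \<alpha> * (\<kappa> / (4 * B))" using \<theta>2(1) by simp
    finally show "A0 \<le> \<kappa> / (4 * B)" using \<alpha> by (simp add: A0_def pos_divide_le_eq mult.commute)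
  qed
  have signs: "s \<le> A0 * s + (-1) ^ j * B0 * c \<and> 2 * B * (A0 * s + (-1) ^ j * B0 * c - s) \<le> (\<kappa> - 1) * s" for j :: nat
  proof -
    have sg: "- (B0 * c) \<le> (-1) ^ j * B0 * c" "(-1) ^ j * B0 * c \<le> B0 * c"
      using B0c(1) by (cases "even j"; simp)+
    define y where "y = \<kappa> / (512 * B)"
    have y: "1 / 2 \<le> y" "\<kappa> = 512 * B * y" using \<kappa> B_ge_1 by (auto simp: y_def field_simps)
    have y': "\<kappa> / (128 * B) = 4 * y" "\<kappa> / (4 * B) = 128 * y" using B_ge_1 by (simp_all add: y_def field_simps)
    have "(1 + y) * s \<le> (4 * y) * s" using y s0 by (intro mult_right_mono) auto
    also have "\<dots> \<le> A0 * s" using A0 s0 y' by (intro mult_right_mono) auto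
    finally have lo: "s + y * s \<le> A0 * s" by (simp add: distrib_right)
    have hi: "A0 * s \<le> 128 * y * s" using A0 s0 y' by (intro mult_right_mono) auto
    have ys: "B0 * c \<le> y * s" using B0c(2) by (simp add: y_def)
    have "2 * B * (A0 * s + (-1) ^ j * B0 * c - s) \<le> 2 * B * (129 * (y * s) - s)"
      using hi ys sg B_ge_1 by (intro mult_left_mono) auto
    also have "\<dots> \<le> 512 * B * y * s - 1 * s"
    proof -
      have "0 \<le> B * (y * s)" using B_ge_1 y s0 by simp
      moreover have "1 * s \<le> 2 * B * s" using B_ge_1 s0 by (intro mult_right_mono) auto
      ultimately show ?thesis by (simp add: algebra_simps)
    qed
    also have "\<dots> = (\<kappa> - 1) * s" unfolding y(2) by (simp add: left_diff_distrib)
    finally show ?thesis using lo ys sg by auto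
  qed
  define \<rho> where "\<rho> = Min ((\<lambda>j. (p j - p (Suc j)) / 4) ` {..<m})"
  have m1: "1 \<le> m" using K by (simp add: m_def)
  have dec: "p (Suc j) < p j" if "j < m" for j
  proof -
    have "0 < p j - p (Suc j)" unfolding gap using S0[OF that] s0 by simp
    then show ?thesis by simp
  qed
  have \<rho>0: "0 < \<rho>" unfolding \<rho>_def using m1 dec by (subst Min_gr_iff) (auto simp: lessThan_empty_iff)
  have \<rho>gap: "4 * \<rho> \<le> p j - p (Suc j)" if "j < m" for j
  proof -
    have "\<rho> \<le> (p j - p (Suc j)) / 4" unfolding \<rho>_def using that by (intro Min_le) auto
    then show ?thesis by simp
  qed
  have lower: "p j - p (Suc j) \<le> v j - v (Suc j)" if "j < m" for j
    unfolding gap vdiff using signs[of j] S0[OF that] by (intro mult_left_mono) auto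
  have upper: "2 * B * ((v j - v (Suc j)) - (p j - p (Suc j))) \<le> (\<kappa> - 1) * (p j - p (Suc j))" if "j < m" for j
  proof -
    have "2 * S j * (2 * B * (A0 * s + (-1) ^ j * B0 * c - s)) \<le> 2 * S j * ((\<kappa> - 1) * s)"
      using signs[of j] S0[OF that] by (intro mult_left_mono) auto
    then show ?thesis unfolding gap vdiff by (simp add: algebra_simps)
  qed
  define D where "D = \<bar>v m - p m\<bar> + (\<Sum>j<m. (v j - v (Suc j)) - (p j - p (Suc j)))"
  define \<phi> where "\<phi> k = \<theta> / 4 + real k * \<theta>" for k :: nat
  define x where "x k = cos (\<phi> k)" for k
  \<comment> \<open>The rank from right to left of the \<open>k\<close>-th point: even on the upper half of the circle, odd on the lower half.\<close>
  define idx where "idx k = (let r = k mod K in if 4 * r + 1 < 2 * K then 2 * r else 2 * K - 2 * r - 1)" for k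
  have idx_le: "idx k \<le> m" for k
    using K mod_less_divisor[of K k] by (auto simp: idx_def Let_def m_def)
  have trig: "cos (\<phi> k) = cos (\<psi> (idx k)) \<and> sin (\<phi> k) = (-1) ^ idx k * sin (\<psi> (idx k))" for k
  proof -
    define r where "r = k mod K"
    have rK: "r < K" using K by (simp add: r_def)
    have "real k = real (k div K) * K + r"
      unfolding r_def by (metis div_mult_mod_eq of_nat_add of_nat_mult)
    then have "\<phi> k = \<phi> r + real (k div K) * (K * \<theta>)" by (simp add: \<phi>_def algebra_simps)
    then have \<phi>k: "\<phi> k = \<phi> r + 2 * real (k div K) * pi" using K\<theta> by simp
    have per: "cos (\<phi> k) = cos (\<phi> r)" "sin (\<phi> k) = sin (\<phi> r)"
      unfolding \<phi>k cos_add sin_add by (simp_all only: cos_2npi sin_2npi mult_1_right mult_zero_right add_0_right diff_0_right)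
    show ?thesis
    proof (cases "4 * r + 1 < 2 * K")
      case True
      then have i: "idx k = 2 * r" by (simp add: idx_def Let_def r_def)
      have "\<psi> (idx k) = \<phi> r" by (simp add: i \<psi>_def \<phi>_def field_simps)
      then show ?thesis using per i by simp
    next
      case False
      then have i: "idx k = 2 * K - 2 * r - 1" by (simp add: idx_def Let_def r_def)
      have "real (idx k) = 2 * real K - 2 * real r - 1" using rK by (simp add: i of_nat_diff)
      then have "\<psi> (idx k) = K * \<theta> - \<phi> r"
        unfolding \<psi>_def \<phi>_def by (simp only:) (simp add: field_simps)
      then have \<psi>: "\<psi> (idx k) = 2 * pi - \<phi> r" using K\<theta> by simp
      have "odd (idx k)" using rK by (simp add: i)
      then have "(-1 :: real) ^ idx k = -1" by simp
      then show ?thesis unfolding per \<psi> by (simp add: cos_diff sin_diff)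
    qed
  qed
  have xp: "x k = p (idx k)" for k using trig by (simp add: x_def p_def)
  have vx: "v (idx k) = A0 * cos (\<phi> k) + B0 * sin (\<phi> k)" for k
    using trig[of k] by (cases "even (idx k)") (simp_all add: v_def)
  have idx_neq: "idx k \<noteq> idx (Suc k)" for k
  proof -
    define r where "r = k mod K"
    have rK: "r < K" using K by (simp add: r_def)
    define r' where "r' = Suc k mod K"
    have r': "Suc r = K \<and> r' = 0 \<or> Suc r < K \<and> r' = Suc r"
      using rK unfolding r'_def r_def by (auto simp: mod_Suc)
    have e: "idx k = (if 4 * r + 1 < 2 * K then 2 * r else 2 * K - 2 * r - 1)"
      "idx (Suc k) = (if 4 * r' + 1 < 2 * K then 2 * r' else 2 * K - 2 * r' - 1)"
      unfolding idx_def Let_def r_def r'_def by simp_all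
    from r' show ?thesis
    proof
      assume "Suc r = K \<and> r' = 0"
      then show ?thesis unfolding e using K by simp
    next
      assume "Suc r < K \<and> r' = Suc r"
      then show ?thesis unfolding e by presburger
    qed
  qed
  have anti: "p j' \<le> p j" if "j \<le> j'" "j' \<le> m" for j j'
    using that
  proof (induction rule: dec_induct)
    case (step n)
    then show ?case using dec[of n] by simp
  qed simp
  have sep: "4 * \<rho> \<le> \<bar>p i - p j\<bar>" if "i \<le> m" "j \<le> m" "i < j" for i j
    using anti[of "Suc i" j] \<rho>gap[of i] that by auto
  have sepx: "4 * \<rho> \<le> \<bar>x k - x (Suc k)\<bar>" for k
  proof (cases "idx k < idx (Suc k)")
    case True
    then show ?thesis unfolding xp by (rule sep[OF idx_le idx_le])
  next
    case False
    then have "idx (Suc k) < idx k" using idx_neq[of k] by linarith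
    from sep[OF idx_le idx_le this] show ?thesis unfolding xp by (simp only: abs_minus_commute)
  qed
  have abs_x: "\<bar>x k\<bar> \<le> 1" for k by (simp add: x_def)
  have main: "\<exists>U\<in>potentials 2 \<kappa>. \<exists>b. (\<forall>u i. i < 2 \<longrightarrow> grad 2 U u i = u i + (if i = 0 then b (u i) else 0)) \<and>
      (\<forall>t. \<bar>b t\<bar> \<le> L * D) \<and>
      (\<forall>k t. \<bar>t - L * x k\<bar> \<le> L * \<rho> \<longrightarrow> b t = b (L * x k)) \<and>
      (\<forall>k. \<alpha> * (L * x (Suc k) + b (L * x (Suc k))) = L * ((1 + \<beta>) * x (Suc k) - \<beta> * x k - x (Suc (Suc k))))"
    if L: "0 < L" for L
  proof -
    have "\<exists>U\<in>potentials 2 \<kappa>. \<exists>b. (\<forall>u i. i < 2 \<longrightarrow> grad 2 U u i = u i + (if i = 0 then b (u i) else 0)) \<and>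
      (\<forall>t. \<bar>b t\<bar> \<le> L * D) \<and> (\<forall>i\<le>m. \<forall>t. \<bar>t - L * p i\<bar> \<le> L * \<rho> \<longrightarrow> b t = L * (v i - p i))"
      unfolding D_def by (rule interpolating_force) (fact dec lower upper \<kappa>0 \<rho>gap L)+
    then obtain U b where U: "U \<in> potentials 2 \<kappa>" and b: "\<forall>u i. i < 2 \<longrightarrow> grad 2 U u i = u i + (if i = 0 then b (u i) else 0)"
      "\<forall>t. \<bar>b t\<bar> \<le> L * D" "\<forall>i\<le>m. \<forall>t. \<bar>t - L * p i\<bar> \<le> L * \<rho> \<longrightarrow> b t = L * (v i - p i)"
      by (elim bexE exE conjE)
    have bx: "b (L * x k) = L * (v (idx k) - p (idx k))" for k
      using b(3) idx_le[of k] \<rho>0 L by (simp add: xp)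
    have flat: "b t = b (L * x k)" if "\<bar>t - L * x k\<bar> \<le> L * \<rho>" for k t
    proof -
      have "\<bar>t - L * p (idx k)\<bar> \<le> L * \<rho>" using that by (simp only: xp)
      then show ?thesis unfolding bx using b(3)[rule_format, OF idx_le] by (simp only:)
    qed
    have rec: "\<alpha> * (L * x (Suc k) + b (L * x (Suc k))) = L * ((1 + \<beta>) * x (Suc k) - \<beta> * x k - x (Suc (Suc k)))" for k
    proof -
      define f where "f = \<phi> (Suc k)"
      have \<phi>: "\<phi> k = f - \<theta>" "\<phi> (Suc (Suc k)) = f + \<theta>" by (simp_all add: f_def \<phi>_def algebra_simps)
      have "L * x (Suc k) + b (L * x (Suc k)) = L * (A0 * cos f + B0 * sin f)"
        unfolding bx xp[symmetric] vx f_def by (simp add: algebra_simps)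
      then have "\<alpha> * (L * x (Suc k) + b (L * x (Suc k))) = L * ((\<alpha> * A0) * cos f + (\<alpha> * B0) * sin f)"
        by (simp add: algebra_simps)
      also have "\<alpha> * A0 = (1 + \<beta>) * (1 - cos \<theta>)" using \<alpha> by (simp add: A0_def)
      also have "\<alpha> * B0 = (1 - \<beta>) * sin \<theta>" using \<alpha> by (simp add: B0_def)
      also have "(1 + \<beta>) * (1 - cos \<theta>) * cos f + (1 - \<beta>) * sin \<theta> * sin f = (1 + \<beta>) * cos f - \<beta> * cos (f - \<theta>) - cos (f + \<theta>)"
        by (simp add: cos_diff cos_add algebra_simps)
      finally show ?thesis by (simp only: x_def \<phi> f_def[symmetric])
    qed
    show ?thesis
    proof (rule bexI[OF _ U], rule exI[of _ b], rule conjI[OF b(1)], rule conjI[OF b(2)], rule conjI)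
      show "\<forall>k t. \<bar>t - L * x k\<bar> \<le> L * \<rho> \<longrightarrow> b t = b (L * x k)" using flat by blast
      show "\<forall>k. \<alpha> * (L * x (Suc k) + b (L * x (Suc k))) = L * ((1 + \<beta>) * x (Suc k) - \<beta> * x k - x (Suc (Suc k)))"
        by (rule allI) (rule rec)
    qed
  qed
  show ?thesis
  proof (rule exI[of _ x], rule exI[of _ \<rho>], rule exI[of _ D], rule conjI[OF \<rho>0], rule conjI)
    show "\<forall>k. \<bar>x k\<bar> \<le> 1 \<and> 4 * \<rho> \<le> \<bar>x k - x (Suc k)\<bar>"
      using sepx abs_x by blast
  qed (rule allI, rule impI, rule main)
qed

end

section \<open>The lower bound for every tuning\<close>

text \<open>The order of quantifiers matters: potential and starting point may depend on the time \<open>n\<close>, the constants may not.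
  The starting point may be as far from equilibrium as \<open>exp (3 \<epsilon> n)\<close>: an exponential profile with a rate well above
  \<open>\<epsilon>\<close> is small at time \<open>n\<close> even when started there.\<close>

definition slow_at :: "real \<Rightarrow> real \<Rightarrow> real \<Rightarrow> real \<Rightarrow> bool" where
  "slow_at \<kappa> h \<gamma> \<epsilon> \<longleftrightarrow> (\<exists>W>0. \<exists>n0::nat. \<forall>n\<ge>n0. \<exists>U\<in>potentials 2 \<kappa>. \<exists>\<pi>. \<exists>z\<in>space (phase_space 2).
     unique_invariant_law 2 (obabo 2 U h \<gamma>) \<pi> \<and> W2 2 (dirac 2 z) \<pi> < \<infinity> \<and>
     enn2real (W2 2 (dirac 2 z) \<pi>) \<le> W * n * exp (3 * \<epsilon> * n) \<and>
     1 / 4 \<le> tv_dist 2 (kernel_pow 2 (obabo 2 U h \<gamma>) n z) \<pi>)"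

context perturbed_chain
begin

lemma q_scale: "q (t * x) (t * y) = t\<^sup>2 * q x y"
proof -
  have "t * x + t * y - s * (t * x) = t * (x + y - s * x)" by (simp add: algebra_simps)
  then show ?thesis unfolding q_def by (simp only: power_mult_distrib) (simp add: algebra_simps)
qed

text \<open>Without the nonlinear force, any trajectory of the linear recursion is followed. If it decays no faster than
  \<open>(1 - \<epsilon>) ^ n\<close>, then its two multiples by \<open>\<plusminus> exp (3 \<epsilon> n)\<close> have a squared distance of order at least
  \<open>exp (2 \<epsilon> n)\<close> at time \<open>n\<close>, beyond the variance \<open>O(n)\<close>.\<close>

lemma slow_linear_start:
  assumes b0: "b = (\<lambda>_. 0)" "Bd = 0" and \<epsilon>: "0 < \<epsilon>" "\<epsilon> \<le> 1 / 2" and n: "1 \<le> n" "32 * (noise_factor * noise_scale 0) * C / \<epsilon>\<^sup>2 \<le> n"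
    and f: "f 0 = (x, y)" "\<And>k. f (Suc k) = (fst (f k) + snd (f k), \<beta> * snd (f k) - \<alpha> * (fst (f k) + snd (f k)))"
    and xy: "x\<^sup>2 + y\<^sup>2 \<le> 2" and slow: "(1 - \<epsilon>) ^ (2 * n) \<le> (fst (f n))\<^sup>2 + (snd (f n))\<^sup>2"
  shows "\<exists>\<pi> z. unique_invariant_law 2 Q \<pi> \<and> z \<in> space M \<and> W2 2 (dirac 2 z) \<pi> < \<infinity> \<and>
      enn2real (W2 2 (dirac 2 z) \<pi>) \<le> (1 + sqrt (2 * dist_factor * (2 * C + (2 + moment_factor)))) * n * exp (3 * \<epsilon> * n) \<and> 1 / 4 \<le> tv_dist 2 (P n z) \<pi>"
proof -
  define L where "L = exp (3 * \<epsilon> * n)"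
  have L: "1 \<le> L" using \<epsilon> by (simp add: L_def)
  define c where "c t k = ((\<lambda>i::nat. if i = 0 then t * fst (f k) else 0), (\<lambda>i::nat. if i = 0 then t * snd (f k) else 0))" for t :: real and k
  have sh: "shadows (c t) R 0" for t R
    unfolding shadows_def unfolding b0(1) c_def by (auto simp: f(2) algebra_simps)
  define qn where "qn = q (fst (f n)) (snd (f n))"
  have q0: "q 0 0 = 0" by (simp add: q_def)
  have sq: "(\<Sum>i<2. q (if i = (0::nat) then a else 0) (if i = 0 then a' else 0)) = q a a'" for a a'
    by (simp add: numeral_2_eq_2 q0)
  have "exp (2 * \<epsilon> * n) \<le> L\<^sup>2 * (1 - \<epsilon>) ^ (2 * n)"
  proof -
    have "1 \<le> (1 + 2 * \<epsilon>) * (1 - \<epsilon>)"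
    proof -
      have "0 \<le> \<epsilon> * (1 - 2 * \<epsilon>)" using \<epsilon> by simp
      then show ?thesis by (simp add: algebra_simps)
    qed
    also have "\<dots> \<le> exp (2 * \<epsilon>) * (1 - \<epsilon>)" using \<epsilon> by (intro mult_right_mono exp_ge_add_one_self) auto
    finally have "1 \<le> (exp (2 * \<epsilon>) * (1 - \<epsilon>)) ^ (2 * n)" by (rule one_le_power)
    then have "exp (2 * \<epsilon> * n) * 1 \<le> exp (2 * \<epsilon> * n) * (exp (2 * \<epsilon>) * (1 - \<epsilon>)) ^ (2 * n)" by (intro mult_left_mono) auto
    also have "\<dots> = exp (2 * \<epsilon> * n) * exp (2 * \<epsilon>) ^ (2 * n) * (1 - \<epsilon>) ^ (2 * n)" by (simp add: power_mult_distrib)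
    also have "exp (2 * \<epsilon> * n) * exp (2 * \<epsilon>) ^ (2 * n) = L\<^sup>2"
      unfolding L_def by (simp add: exp_of_nat_mult[symmetric] exp_add[symmetric] power2_eq_square algebra_simps)
    finally show ?thesis by simp
  qed
  also have "\<dots> \<le> L\<^sup>2 * (C * qn)"
    using slow form_lower[of "fst (f n)" "snd (f n)"] unfolding qn_def q_def by (intro mult_left_mono) auto
  finally have big: "exp (2 * \<epsilon> * n) \<le> C * (L\<^sup>2 * qn)" by (simp add: mult_ac)
  have "0 < C * (L\<^sup>2 * qn)" using big exp_gt_zero[of "2 * \<epsilon> * n"] by linarith
  then have qpos: "0 < L\<^sup>2 * qn" using form by (simp add: zero_less_mult_iff)
  define R where "R = L\<^sup>2 * qn / 2"
  have R: "0 < R" using qpos by (simp add: R_def)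
  have double: "q (L * a - - L * a) (L * a' - - L * a') = 4 * (L\<^sup>2 * q a a')" for a a'
  proof -
    have "L * a - - L * a = (2 * L) * a" "L * a' - - L * a' = (2 * L) * a'" by simp_all
    then show ?thesis unfolding q_scale[of "2 * L", symmetric] by (simp add: q_scale)
  qed
  have "(\<Sum>i<2. q (fst (c L n) i - fst (c (- L) n) i) (snd (c L n) i - snd (c (- L) n) i))
      = q (L * fst (f n) - - L * fst (f n)) (L * snd (f n) - - L * snd (f n))"
    unfolding c_def by (simp add: numeral_2_eq_2 q0)
  then have sepeq: "(\<Sum>i<2. q (fst (c L n) i - fst (c (- L) n) i) (snd (c L n) i - snd (c (- L) n) i)) = 4 * (L\<^sup>2 * qn)"
    unfolding double qn_def .
  have sep: "4 * R < (\<Sum>i<2. q (fst (c L n) i - fst (c (- L) n) i) (snd (c L n) i - snd (c (- L) n) i))"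
    unfolding sepeq R_def using qpos by linarith
  have nR: "n * (4 * noise_factor * noise_scale 0) \<le> R / 4"
  proof -
    have "32 * (noise_factor * noise_scale 0) * C \<le> n * \<epsilon>\<^sup>2" using n(2) \<epsilon> by (simp add: pos_divide_le_eq)
    then have "n * (32 * (noise_factor * noise_scale 0) * C) \<le> n * (n * \<epsilon>\<^sup>2)" by (intro mult_left_mono) auto
    also have "\<dots> = (2 * \<epsilon> * n)\<^sup>2 / 4" by (simp add: power2_eq_square)
    also have "\<dots> \<le> exp (2 * \<epsilon> * n)"
    proof -
      define u where "u = 2 * \<epsilon> * n"
      have "0 \<le> u" using \<epsilon> by (simp add: u_def)
      then have "u / 2 \<le> exp (u / 2)" using exp_ge_add_one_self[of "u / 2"] by linarith
      then have "(u / 2)\<^sup>2 \<le> (exp (u / 2))\<^sup>2" using \<open>0 \<le> u\<close> by (intro power_mono) auto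
      also have "\<dots> = exp u" by (simp add: power2_eq_square exp_add[symmetric])
      finally have "u\<^sup>2 / 4 \<le> exp u" by (simp add: power2_eq_square)
      then show ?thesis unfolding u_def .
    qed
    also have "\<dots> \<le> C * (L\<^sup>2 * qn)" by (rule big)
    finally have "C * (n * (32 * (noise_factor * noise_scale 0))) \<le> C * (L\<^sup>2 * qn)" by (simp add: mult_ac)
    then have "n * (32 * (noise_factor * noise_scale 0)) \<le> L\<^sup>2 * qn" using form by simp
    then show ?thesis by (simp add: R_def)
  qed
  define T where "T = L\<^sup>2 * (2 * C)"
  have "q (t * x) (t * y) \<le> T" if "t\<^sup>2 = L\<^sup>2" for t
  proof -
    have "q x y \<le> C * (x\<^sup>2 + y\<^sup>2)" unfolding q_def by (rule form_upper)
    also have "\<dots> \<le> C * 2" using xy form by (intro mult_left_mono) auto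
    finally show ?thesis unfolding q_scale T_def that by (intro mult_left_mono) auto
  qed
  then have start: "(\<Sum>i<2. q (fst (c t 0) i) (snd (c t 0) i)) \<le> T" if "t\<^sup>2 = L\<^sup>2" for t
    using that unfolding c_def f(1) fst_conv snd_conv sq by simp
  have W: "sqrt (2 * dist_factor * (T + (2 + moment_factor) * (1 + Bd\<^sup>2))) \<le> (1 + sqrt (2 * dist_factor * (2 * C + (2 + moment_factor)))) * n * L"
  proof -
    have "1 * (2 + moment_factor) \<le> L\<^sup>2 * (2 + moment_factor)" using L moment_factor_nonneg by (intro mult_right_mono) (auto simp: one_le_power)
    then have "2 * dist_factor * (T + (2 + moment_factor) * (1 + Bd\<^sup>2)) \<le> 2 * dist_factor * (L\<^sup>2 * (2 * C + (2 + moment_factor)))"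
      using dist_factor_nonneg unfolding T_def b0 by (intro mult_left_mono) (auto simp: algebra_simps)
    then have "sqrt (2 * dist_factor * (T + (2 + moment_factor) * (1 + Bd\<^sup>2))) \<le> sqrt (L\<^sup>2 * (2 * dist_factor * (2 * C + (2 + moment_factor))))"
      by (intro real_sqrt_le_mono) (simp add: mult_ac)
    also have "\<dots> = L * sqrt (2 * dist_factor * (2 * C + (2 + moment_factor)))" using L by (simp add: real_sqrt_mult)
    also have "\<dots> \<le> n * L * sqrt (2 * dist_factor * (2 * C + (2 + moment_factor)))"
      using n(1) L dist_factor_nonneg moment_factor_nonneg form by (intro mult_right_mono) auto
    also have "\<dots> \<le> n * L * (1 + sqrt (2 * dist_factor * (2 * C + (2 + moment_factor))))" using L by (intro mult_left_mono) auto
    finally show ?thesis by (simp add: mult_ac)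
  qed
  obtain \<pi> z where *: "unique_invariant_law 2 Q \<pi>" "z \<in> space M" "W2 2 (dirac 2 z) \<pi> < \<infinity>"
      "enn2real (W2 2 (dirac 2 z) \<pi>) \<le> sqrt (2 * dist_factor * (T + (2 + moment_factor) * (1 + Bd\<^sup>2)))" "1 / 4 \<le> tv_dist 2 (P n z) \<pi>"
    using slow_mixing_of_separated_trajectories[OF sh sh R order_refl sep nR start[of L] start[of "- L"]] by auto
  show ?thesis
    by (rule exI[of _ \<pi>], rule exI[of _ z]) (use * order_trans[OF *(4) W] in \<open>simp add: L_def\<close>)
qed

text \<open>The cycle does not decay at all, and on the scale \<open>L = n\<close> its points have squared distances of order \<open>n\<^sup>2\<close>, beyond the
  variance \<open>O(n)\<close>. The two trajectories are the cycle and its shift by one step in time. The force is constant within \<open>L \<rho>\<close>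
  of the orbit and bounded by \<open>L D\<close>. Thus it changes only under noise of size at least \<open>L \<rho> / 2\<close>, and then by at most
  \<open>2 L D\<close>, whence the Lipschitz constant \<open>E = 4 D h \<sigma> / \<rho>\<close>, which is independent of \<open>L\<close>.\<close>

lemma slow_cycle_start:
  assumes \<rho>: "0 < \<rho>" and x: "\<And>k. \<bar>x k\<bar> \<le> 1" "\<And>k. 4 * \<rho> \<le> \<bar>x k - x (Suc k)\<bar>"
    and L: "L = real n" "1 \<le> n" and D: "\<And>t. \<bar>b t\<bar> \<le> L * D" "Bd = L * D"
    and flat: "\<forall>k t. \<bar>t - L * x k\<bar> \<le> L * \<rho> \<longrightarrow> b t = b (L * x k)"
    and rec: "\<And>k. \<alpha> * (L * x (Suc k) + b (L * x (Suc k))) = L * ((1 + \<beta>) * x (Suc k) - \<beta> * x k - x (Suc (Suc k)))"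
    and n: "128 * (noise_factor * noise_scale (4 * D * (h * \<sigma>) / \<rho>)) * C / \<rho>\<^sup>2 \<le> n"
  shows "\<exists>\<pi> z. unique_invariant_law 2 Q \<pi> \<and> z \<in> space M \<and> W2 2 (dirac 2 z) \<pi> < \<infinity> \<and>
      enn2real (W2 2 (dirac 2 z) \<pi>) \<le> (1 + sqrt (2 * dist_factor * (5 * C + (2 + moment_factor) * (1 + D\<^sup>2)))) * n \<and> 1 / 4 \<le> tv_dist 2 (P n z) \<pi>"
proof -
  have L1: "1 \<le> L" using L by simp
  define E where "E = 4 * D * (h * \<sigma>) / \<rho>"
  have D0: "0 \<le> D" using D(1)[of 0] L1 by (smt (verit) abs_ge_zero mult_nonneg_nonpos2 zero_le_mult_iff)
  have hs: "0 < h * \<sigma>" using h \<sigma>_pos by simp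
  have E0: "0 \<le> E" using D0 hs \<rho> by (simp add: E_def)
  define c where "c j k = ((\<lambda>i::nat. if i = 0 then L * x (j + k) else 0), (\<lambda>i::nat. if i = 0 then L * (x (Suc (j + k)) - x (j + k)) else 0))" for j k :: nat
  define R where "R = L\<^sup>2 * \<rho>\<^sup>2 / (8 * C)"
  have C0: "0 < C" using form by simp
  have R: "0 < R" using L1 \<rho> C0 by (simp add: R_def)
  have sh: "shadows (c j) R E" for j
    unfolding shadows_def
  proof (intro conjI allI impI)
    fix k and i :: nat assume "i < 2"
    show "fst (c j (Suc k)) i = fst (c j k) i + snd (c j k) i" by (simp add: c_def algebra_simps)
    show "snd (c j (Suc k)) i = \<beta> * snd (c j k) i - \<alpha> * (fst (c j (Suc k)) i + (if i = 0 then b (fst (c j (Suc k)) i) else 0))"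
      using rec[of "j + k"] by (simp add: c_def algebra_simps)
  next
    fix k t v assume le: "(t - (fst (c j k) 0 + snd (c j k) 0))\<^sup>2 \<le> 2 * C * R"
    define y where "y = x (Suc (j + k))"
    have fx: "fst (c j (Suc k)) 0 = L * y" by (simp add: c_def y_def)
    have "fst (c j k) 0 + snd (c j k) 0 = L * y" by (simp add: c_def y_def algebra_simps)
    then have "(t - L * y)\<^sup>2 \<le> (L * \<rho> / 2)\<^sup>2" using le C0 by (simp add: R_def power_mult_distrib power_divide)
    then have t: "\<bar>t - L * y\<bar> \<le> L * \<rho> / 2" using L1 \<rho> by (simp add: abs_le_square_iff[symmetric])
    show "\<bar>b (t + h * \<sigma> * v) - b (fst (c j (Suc k)) 0)\<bar> \<le> E * \<bar>v\<bar>"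
    proof (cases "h * \<sigma> * \<bar>v\<bar> \<le> L * \<rho> / 2")
      case True
      have "\<bar>h * \<sigma> * v\<bar> = h * \<sigma> * \<bar>v\<bar>" by (simp only: abs_mult[of "h * \<sigma>" v] abs_of_pos[OF hs])
      then have "\<bar>t + h * \<sigma> * v - L * y\<bar> \<le> L * \<rho>" using t True by linarith
      then have "b (t + h * \<sigma> * v) = b (L * y)" using flat unfolding y_def by blast
      then show ?thesis using E0 fx by simp
    next
      case False
      have "\<bar>b (t + h * \<sigma> * v) - b (fst (c j (Suc k)) 0)\<bar> \<le> 2 * (L * D)"
        using D(1)[of "t + h * \<sigma> * v"] D(1)[of "fst (c j (Suc k)) 0"] by linarith
      also have "\<dots> = (4 * D / \<rho>) * (L * \<rho> / 2)" using \<rho> by simp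
      also have "\<dots> \<le> (4 * D / \<rho>) * (h * \<sigma> * \<bar>v\<bar>)" using False D0 \<rho> by (intro mult_left_mono) auto
      also have "\<dots> = E * \<bar>v\<bar>" by (simp add: E_def)
      finally show ?thesis .
    qed
  qed
  have q0: "q 0 0 = 0" by (simp add: q_def)
  have sep: "4 * R < (\<Sum>i<2. q (fst (c 0 n) i - fst (c 1 n) i) (snd (c 0 n) i - snd (c 1 n) i))"
  proof -
    define X Y where "X = fst (c 0 n) 0 - fst (c 1 n) 0" and "Y = snd (c 0 n) 0 - snd (c 1 n) 0"
    have "\<bar>X\<bar> = L * \<bar>x n - x (Suc n)\<bar>" using L1 by (simp add: X_def c_def abs_mult right_diff_distrib[symmetric])
    then have "L * (4 * \<rho>) \<le> \<bar>X\<bar>" using x(2)[of n] L1 by simp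
    then have "(L * (4 * \<rho>))\<^sup>2 \<le> X\<^sup>2" using L1 \<rho> power_mono[of "L * (4 * \<rho>)" "\<bar>X\<bar>" 2] by simp
    also have "X\<^sup>2 \<le> X\<^sup>2 + Y\<^sup>2" by simp
    also have "\<dots> \<le> C * q X Y" unfolding q_def by (rule form_lower)
    finally have "16 * (L\<^sup>2 * \<rho>\<^sup>2) / C \<le> q X Y" using C0 by (simp add: pos_divide_le_eq mult_ac power_mult_distrib)
    moreover have "4 * R < 16 * (L\<^sup>2 * \<rho>\<^sup>2) / C"
    proof -
      define y where "y = L\<^sup>2 * \<rho>\<^sup>2 / C"
      have "0 < y" using L1 \<rho> C0 by (simp add: y_def)
      moreover have "4 * R = y / 2" "16 * (L\<^sup>2 * \<rho>\<^sup>2) / C = 16 * y" by (simp_all add: R_def y_def)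
      ultimately show ?thesis by linarith
    qed
    moreover have "(\<Sum>i<2. q (fst (c 0 n) i - fst (c 1 n) i) (snd (c 0 n) i - snd (c 1 n) i)) = q X Y"
      by (simp add: numeral_2_eq_2 X_def Y_def) (simp add: c_def q0)
    ultimately show ?thesis by linarith
  qed
  have nR: "n * (4 * noise_factor * noise_scale E) \<le> R / 4"
  proof -
    have "128 * (noise_factor * noise_scale E) * C \<le> n * \<rho>\<^sup>2" using n \<rho> by (simp add: E_def[symmetric] pos_divide_le_eq)
    then have "n * (128 * (noise_factor * noise_scale E) * C) \<le> n * (n * \<rho>\<^sup>2)" by (intro mult_left_mono) auto
    then have "n * (128 * (noise_factor * noise_scale E)) * C \<le> L\<^sup>2 * \<rho>\<^sup>2" by (simp add: L power2_eq_square mult_ac)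
    then have "n * (128 * (noise_factor * noise_scale E)) \<le> L\<^sup>2 * \<rho>\<^sup>2 / C" using C0 by (simp add: pos_le_divide_eq)
    moreover have "R / 4 = L\<^sup>2 * \<rho>\<^sup>2 / C / 32" by (simp add: R_def)
    ultimately show ?thesis by simp
  qed
  define T where "T = L\<^sup>2 * (5 * C)"
  have start: "(\<Sum>i<2. q (fst (c j 0) i) (snd (c j 0) i)) \<le> T" for j
  proof -
    define X Y where "X = x j" and "Y = x (Suc j) - x j"
    have "(\<Sum>i<2. q (fst (c j 0) i) (snd (c j 0) i)) = q (L * X) (L * Y)"
      by (simp add: numeral_2_eq_2 c_def q0 X_def Y_def)
    also have "\<dots> = L\<^sup>2 * q X Y" by (rule q_scale)
    also have "\<dots> \<le> L\<^sup>2 * (C * (X\<^sup>2 + Y\<^sup>2))" unfolding q_def by (intro mult_left_mono form_upper) simp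
    also have "\<dots> \<le> L\<^sup>2 * (C * (1\<^sup>2 + 2\<^sup>2))"
    proof (intro mult_left_mono add_mono)
      show "X\<^sup>2 \<le> 1\<^sup>2" using x(1)[of j] by (simp add: X_def abs_square_le_1)
      have "\<bar>Y\<bar> \<le> 2" using x(1)[of j] x(1)[of "Suc j"] by (simp add: Y_def)
      then show "Y\<^sup>2 \<le> 2\<^sup>2" using abs_le_square_iff[of Y 2] by simp
    qed (use C0 in auto)
    finally show ?thesis by (simp add: T_def mult_ac)
  qed
  have W: "sqrt (2 * dist_factor * (T + (2 + moment_factor) * (1 + Bd\<^sup>2))) \<le> (1 + sqrt (2 * dist_factor * (5 * C + (2 + moment_factor) * (1 + D\<^sup>2)))) * n"
  proof -
    have "1 + Bd\<^sup>2 \<le> L\<^sup>2 * (1 + D\<^sup>2)" using L1 by (simp add: D(2) power_mult_distrib distrib_left one_le_power)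
    then have "(2 + moment_factor) * (1 + Bd\<^sup>2) \<le> (2 + moment_factor) * (L\<^sup>2 * (1 + D\<^sup>2))" using moment_factor_nonneg by (intro mult_left_mono) auto
    then have "2 * dist_factor * (T + (2 + moment_factor) * (1 + Bd\<^sup>2)) \<le> 2 * dist_factor * (L\<^sup>2 * (5 * C) + (2 + moment_factor) * (L\<^sup>2 * (1 + D\<^sup>2)))"
      using dist_factor_nonneg unfolding T_def by (intro mult_left_mono) auto
    also have "\<dots> = L\<^sup>2 * (2 * dist_factor * (5 * C + (2 + moment_factor) * (1 + D\<^sup>2)))" by (simp add: algebra_simps)
    finally have "sqrt (2 * dist_factor * (T + (2 + moment_factor) * (1 + Bd\<^sup>2))) \<le> sqrt (L\<^sup>2 * (2 * dist_factor * (5 * C + (2 + moment_factor) * (1 + D\<^sup>2))))"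
      by (rule real_sqrt_le_mono)
    also have "\<dots> = L * sqrt (2 * dist_factor * (5 * C + (2 + moment_factor) * (1 + D\<^sup>2)))" using L1 by (simp add: real_sqrt_mult)
    also have "\<dots> \<le> L * (1 + sqrt (2 * dist_factor * (5 * C + (2 + moment_factor) * (1 + D\<^sup>2))))" using L1 by (intro mult_left_mono) auto
    finally show ?thesis by (simp add: L mult_ac)
  qed
  obtain \<pi> z where *: "unique_invariant_law 2 Q \<pi>" "z \<in> space M" "W2 2 (dirac 2 z) \<pi> < \<infinity>"
      "enn2real (W2 2 (dirac 2 z) \<pi>) \<le> sqrt (2 * dist_factor * (T + (2 + moment_factor) * (1 + Bd\<^sup>2)))" "1 / 4 \<le> tv_dist 2 (P n z) \<pi>"
    using slow_mixing_of_separated_trajectories[OF sh sh R E0 sep nR start start] by auto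
  show ?thesis
    by (rule exI[of _ \<pi>], rule exI[of _ z]) (use * order_trans[OF *(4) W] in simp)
qed

end

text \<open>Two reasons for slowness in a direction of curvature 1. If the friction \<open>1 - \<beta>\<close> is small, the determinant \<open>\<beta> ^ n\<close> of the
  recursion bounds one of its two basic solutions from below. Otherwise \<open>\<alpha>\<close> is small compared to the friction, the motion is overdamped,
  and the characteristic polynomial has a real root above \<open>1 - 2 N / \<kappa>\<close>.\<close>

lemma slow_linear_trajectories:
  fixes \<alpha> \<beta> \<kappa> N :: real
  assumes \<beta>: "0 < \<beta>" "\<beta> < 1" and \<alpha>: "0 < \<alpha>" and N: "1 \<le> N" and \<kappa>: "8 * N \<le> \<kappa>"
    and slow: "1 - \<beta> \<le> 4 * N / \<kappa> \<or> \<alpha> * \<kappa> \<le> N * (1 - \<beta>)"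
  shows "\<exists>f x y. f 0 = (x, y) \<and> (\<forall>k. f (Suc k) = (fst (f k) + snd (f k), \<beta> * snd (f k) - \<alpha> * (fst (f k) + snd (f k)))) \<and>
     x\<^sup>2 + y\<^sup>2 \<le> 2 \<and> (1 - 4 * N / \<kappa>) ^ (2 * n) \<le> (fst (f n))\<^sup>2 + (snd (f n :: real \<times> real))\<^sup>2"
proof -
  have \<kappa>0: "0 < \<kappa>" using \<kappa> N by linarith
  have \<epsilon>: "0 < 4 * N / \<kappa>" "4 * N / \<kappa> \<le> 1 / 2" using \<kappa> N \<kappa>0 by (auto simp: field_simps)
  define F where "F = (\<lambda>u :: real \<times> real. (fst u + snd u, \<beta> * snd u - \<alpha> * (fst u + snd u)))"
  show ?thesis
  proof (cases "1 - \<beta> \<le> 4 * N / \<kappa>")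
    case True
    define f where "f u k = (F ^^ k) u" for u k
    have f: "f u 0 = u" "f u (Suc k) = (fst (f u k) + snd (f u k), \<beta> * snd (f u k) - \<alpha> * (fst (f u k) + snd (f u k)))" for u k
      by (simp_all add: f_def F_def)
    define a b where "a = f (1, 0)" and "b = f (0, 1)"
    have det: "fst (a k) * snd (b k) - fst (b k) * snd (a k) = \<beta> ^ k" for k
    proof (induction k)
      case (Suc k)
      have "fst (a (Suc k)) * snd (b (Suc k)) - fst (b (Suc k)) * snd (a (Suc k)) = \<beta> * (fst (a k) * snd (b k) - fst (b k) * snd (a k))"
        by (simp add: a_def b_def f algebra_simps)
      then show ?case using Suc by simp
    qed (simp add: a_def b_def f)
    define na nb where "na = (fst (a n))\<^sup>2 + (snd (a n))\<^sup>2" and "nb = (fst (b n))\<^sup>2 + (snd (b n))\<^sup>2"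
    have "(\<beta> ^ n)\<^sup>2 \<le> na * nb"
    proof -
      have "na * nb = (fst (a n) * snd (b n) - fst (b n) * snd (a n))\<^sup>2 + (fst (a n) * fst (b n) + snd (a n) * snd (b n))\<^sup>2"
        by (simp add: na_def nb_def power2_eq_square algebra_simps)
      then show ?thesis unfolding det by simp
    qed
    then have "\<beta> ^ n \<le> na \<or> \<beta> ^ n \<le> nb"
    proof (rule contrapos_pp)
      assume "\<not> (\<beta> ^ n \<le> na \<or> \<beta> ^ n \<le> nb)"
      then have "na * nb < \<beta> ^ n * \<beta> ^ n" by (intro mult_strict_mono') (auto simp: na_def nb_def)
      then show "\<not> (\<beta> ^ n)\<^sup>2 \<le> na * nb" by (simp add: power2_eq_square)
    qed
    moreover have "(1 - 4 * N / \<kappa>) ^ (2 * n) \<le> \<beta> ^ n"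
    proof -
      have "(1 - 4 * N / \<kappa>) ^ (2 * n) \<le> (1 - 4 * N / \<kappa>) ^ n" using \<epsilon> by (intro power_decreasing) auto
      also have "\<dots> \<le> \<beta> ^ n" using True \<epsilon> by (intro power_mono) auto
      finally show ?thesis .
    qed
    ultimately consider "(1 - 4 * N / \<kappa>) ^ (2 * n) \<le> na" | "(1 - 4 * N / \<kappa>) ^ (2 * n) \<le> nb" by linarith
    then show ?thesis
    proof cases
      case 1
      then show ?thesis unfolding na_def a_def
        by (intro exI[of _ "f (1, 0)"] exI[of _ 1] exI[of _ 0] conjI allI f) simp_all
    next
      case 2
      then show ?thesis unfolding nb_def b_def
        by (intro exI[of _ "f (0, 1)"] exI[of _ 0] exI[of _ 1] conjI allI f) simp_all
    qed
  next
    case False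
    then have b: "4 * N / \<kappa> < 1 - \<beta>" and a: "\<alpha> * \<kappa> \<le> N * (1 - \<beta>)" using slow by auto
    define e where "e = 2 * N / \<kappa>"
    have e: "0 < e" "e \<le> 1" "2 * e = 4 * N / \<kappa>" using \<epsilon> by (auto simp: e_def)
    define p where "p l = l\<^sup>2 - (1 + \<beta> - \<alpha>) * l + \<beta>" for l
    have a': "\<alpha> \<le> e / 2 * (1 - \<beta>)" using a \<kappa>0 by (simp add: e_def field_simps)
    have "p (1 - e) = e\<^sup>2 - e * (1 - \<beta>) + \<alpha> * (1 - e)" by (simp add: p_def power2_eq_square algebra_simps)
    also have "\<dots> \<le> e / 2 * (1 - \<beta>) - e * (1 - \<beta>) + e / 2 * (1 - \<beta>)"
    proof -
      have "e * (2 * e) \<le> e * (1 - \<beta>)" using b e by (intro mult_left_mono) auto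
      then have "e\<^sup>2 \<le> e / 2 * (1 - \<beta>)" by (simp add: power2_eq_square)
      moreover have "\<alpha> * (1 - e) \<le> \<alpha> * 1" using e \<alpha> by (intro mult_left_mono) auto
      ultimately show ?thesis using a' by linarith
    qed
    also have "\<dots> = 0" by simp
    finally have p0: "p (1 - e) \<le> 0" .
    have p1: "0 \<le> p 1" using \<alpha> by (simp add: p_def)
    have "\<exists>l\<ge>1 - e. l \<le> 1 \<and> p l = 0"
      by (rule IVT'[of p "1 - e" 0 1, OF p0 p1]) (use e in \<open>auto simp: p_def intro!: continuous_intros\<close>)
    then obtain l where l: "1 - e \<le> l" "l \<le> 1" "l\<^sup>2 - (1 + \<beta> - \<alpha>) * l + \<beta> = 0" by (auto simp: p_def)
    define f where "f k = (l ^ k, l ^ k * (l - 1))" for k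
    have root: "\<beta> * (l - 1) - \<alpha> * l = l * (l - 1)" using l(3) by (simp add: power2_eq_square algebra_simps)
    have "f (Suc k) = (fst (f k) + snd (f k), \<beta> * snd (f k) - \<alpha> * (fst (f k) + snd (f k)))" for k
    proof -
      have "\<beta> * snd (f k) - \<alpha> * (fst (f k) + snd (f k)) = l ^ k * (\<beta> * (l - 1) - \<alpha> * l)"
        by (simp add: f_def algebra_simps)
      then show ?thesis unfolding root by (simp add: f_def algebra_simps)
    qed
    then have "\<forall>k. f (Suc k) = (fst (f k) + snd (f k), \<beta> * snd (f k) - \<alpha> * (fst (f k) + snd (f k)))" by (rule allI)
    moreover have "f 0 = (1, l - 1)" by (simp add: f_def)
    moreover have "1\<^sup>2 + (l - 1)\<^sup>2 \<le> 2"
    proof -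
      have "\<bar>l - 1\<bar> \<le> 1" using l e by simp
      then have "(l - 1)\<^sup>2 \<le> 1" by (simp add: abs_square_le_1)
      then show ?thesis by simp
    qed
    moreover have "(1 - 4 * N / \<kappa>) ^ (2 * n) \<le> (fst (f n))\<^sup>2 + (snd (f n))\<^sup>2"
    proof -
      have "(1 - 4 * N / \<kappa>) ^ (2 * n) \<le> l ^ (2 * n)" using l e \<epsilon> by (intro power_mono) auto
      also have "\<dots> = (fst (f n))\<^sup>2" by (simp add: f_def power_mult[symmetric] mult.commute)
      also have "\<dots> \<le> (fst (f n))\<^sup>2 + (snd (f n))\<^sup>2" by simp
      finally show ?thesis .
    qed
    ultimately show ?thesis by (intro exI[of _ f] exI[of _ 1] exI[of _ "l - 1"] conjI)
  qed
qed

context smooth_step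
begin

text \<open>The dichotomy behind the lower bound. Either friction is low or the motion overdamped, and a quadratic potential is slow
  by its curvature 1. Or \<open>\<alpha> \<kappa>\<close> is at least a large multiple of the friction \<open>1 - \<beta>\<close>, and the stiff directions leave room for
  a cycle. Numerical stability enters through \<open>\<alpha> \<kappa> < 4\<close> and the stability of the recursion with curvature 1.\<close>

lemma slow_for_every_tuning:
  fixes h \<gamma> \<kappa> :: real
  assumes \<kappa>: "16384 * B \<le> \<kappa>" and h: "0 < h" "h < 2 / sqrt \<kappa>" and \<gamma>: "0 < \<gamma>"
  shows "slow_at \<kappa> h \<gamma> (8192 * B / \<kappa>)"
proof -
  \<comment> \<open>The threshold that the construction of the cycle needs for the ratio of \<open>\<alpha> \<kappa>\<close> and \<open>1 - \<beta>\<close>.\<close>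
  define N where "N = 2048 * B"
  have N: "1 \<le> N" "8 * N \<le> \<kappa>" "4 * N = 8192 * B" using \<kappa> B_ge_1 by (auto simp: N_def)
  have \<kappa>0: "1 \<le> \<kappa>" "0 < \<kappa>" using N by linarith+
  have "\<exists>U\<in>potentials 2 \<kappa>. \<forall>x. \<forall>i<2. grad 2 U x i = x i + (if i = 0 then 0 + stair 0 (\<lambda>_. 0) (\<lambda>_. 0) (\<lambda>_. 0) (x i) else 0)"
    by (rule stair_potential) (simp_all add: \<kappa>0)
  then obtain U0 where U0: "U0 \<in> potentials 2 \<kappa>"
    "\<forall>x. \<forall>i<2. grad 2 U0 x i = x i + (if i = 0 then 0 + stair 0 (\<lambda>_. 0) (\<lambda>_. 0) (\<lambda>_. 0) (x i) else 0)"
    by (elim bexE)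
  have g0: "grad 2 U0 x i = x i + (if i = 0 then 0 else 0)" if "i < 2" for i x
    using U0(2)[rule_format, OF that] by (simp add: stair_def)
  interpret L: obabo_chain 2 U0 h \<gamma> by (rule obabo_chain_potential[OF h(1) \<gamma> U0(1)])
  have h2: "h\<^sup>2 * \<kappa> < 4"
  proof -
    have "h * sqrt \<kappa> < 2" using h \<kappa>0 by (simp add: pos_less_divide_eq)
    then have "(h * sqrt \<kappa>)\<^sup>2 < 2\<^sup>2" using h \<kappa>0 by (intro power_strict_mono) auto
    then show ?thesis using \<kappa>0 by (simp add: power_mult_distrib)
  qed
  have h4: "h\<^sup>2 < 4"
  proof -
    have "h\<^sup>2 * 1 \<le> h\<^sup>2 * \<kappa>" using \<kappa>0 by (intro mult_left_mono) auto
    then show ?thesis using h2 by linarith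
  qed
  note \<beta> = L.\<beta>_pos and \<alpha>0 = L.\<alpha>_pos
  have \<alpha>2: "L.\<alpha> < 2 * (1 + L.\<beta>)"
  proof -
    have "(1 + L.\<beta>) * h\<^sup>2 < (1 + L.\<beta>) * 4" using h4 \<beta> by (intro mult_strict_left_mono) auto
    then show ?thesis by (simp add: L.\<alpha>_def)
  qed
  have \<alpha>\<kappa>: "L.\<alpha> * \<kappa> < 4"
  proof -
    have "L.\<alpha> * \<kappa> = (1 + L.\<beta>) / 2 * (h\<^sup>2 * \<kappa>)" by (simp add: L.\<alpha>_def)
    also have "\<dots> \<le> 1 * (h\<^sup>2 * \<kappa>)" using \<beta> \<kappa>0 by (intro mult_right_mono) auto
    finally show ?thesis using h2 by simp
  qed
  obtain s p \<eta> C where form: "0 < p" "0 < \<eta>" "\<eta> < 1" "1 \<le> C" and form_xy: "\<forall>x y.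
    (x + y + (L.\<beta> * y - L.\<alpha> * (x + y)) - s * (x + y))\<^sup>2 + p * (x + y)\<^sup>2
       \<le> (1 - \<eta>) * ((x + y - s * x)\<^sup>2 + p * x\<^sup>2) \<and>
    x\<^sup>2 + y\<^sup>2 \<le> C * ((x + y - s * x)\<^sup>2 + p * x\<^sup>2) \<and>
    (x + y - s * x)\<^sup>2 + p * x\<^sup>2 \<le> C * (x\<^sup>2 + y\<^sup>2)"
    using stable_quadratic_form[OF \<beta> \<alpha>0 \<alpha>2] by (elim exE conjE)
  have chain: "perturbed_chain U h \<gamma> b Bd s p \<eta> C"
    if "U \<in> potentials 2 \<kappa>" "\<And>x i. i < 2 \<Longrightarrow> grad 2 U x i = x i + (if i = 0 then b (x i) else 0)" "\<And>t. \<bar>b t\<bar> \<le> Bd" for U b Bd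
  proof -
    interpret obabo_chain 2 U h \<gamma> by (rule obabo_chain_potential[OF h(1) \<gamma> that(1)])
    show ?thesis by unfold_locales (fact that form form_xy[rule_format, THEN conjunct1] form_xy[rule_format, THEN conjunct2, THEN conjunct1]
        form_xy[rule_format, THEN conjunct2, THEN conjunct2])+
  qed
  show ?thesis
  proof (cases "1 - L.\<beta> \<le> 4 * N / \<kappa> \<or> L.\<alpha> * \<kappa> \<le> N * (1 - L.\<beta>)")
    case True
    interpret perturbed_chain U0 h \<gamma> "\<lambda>_. 0" 0 s p \<eta> C by (rule chain) (use U0(1) g0 in auto)
    define \<epsilon> where "\<epsilon> = 8192 * B / \<kappa>"
    have \<epsilon>: "0 < \<epsilon>" "\<epsilon> \<le> 1 / 2" using \<kappa> \<kappa>0 B_ge_1 by (auto simp: \<epsilon>_def field_simps)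
    have \<epsilon>N: "4 * N / \<kappa> = \<epsilon>" by (simp add: \<epsilon>_def N_def)
    define n0 where "n0 = max 1 (nat \<lceil>32 * (noise_factor * noise_scale 0) * C / \<epsilon>\<^sup>2\<rceil>)"
    have W: "0 < 1 + sqrt (2 * dist_factor * (2 * C + (2 + moment_factor)))"
      using dist_factor_nonneg moment_factor_nonneg form(4) by (intro add_pos_nonneg real_sqrt_ge_zero mult_nonneg_nonneg) auto
    have "\<exists>U\<in>potentials 2 \<kappa>. \<exists>\<pi>. \<exists>z\<in>space (phase_space 2).
     unique_invariant_law 2 (obabo 2 U h \<gamma>) \<pi> \<and> W2 2 (dirac 2 z) \<pi> < \<infinity> \<and>
     enn2real (W2 2 (dirac 2 z) \<pi>) \<le> (1 + sqrt (2 * dist_factor * (2 * C + (2 + moment_factor)))) * n * exp (3 * \<epsilon> * n) \<and>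
     1 / 4 \<le> tv_dist 2 (kernel_pow 2 (obabo 2 U h \<gamma>) n z) \<pi>" if n: "n0 \<le> n" for n
    proof -
      have n1: "1 \<le> n" "32 * (noise_factor * noise_scale 0) * C / \<epsilon>\<^sup>2 \<le> n" using n unfolding n0_def by linarith+
      obtain f x y where f: "f 0 = (x, y)" "\<forall>k. f (Suc k) = (fst (f k) + snd (f k), L.\<beta> * snd (f k) - L.\<alpha> * (fst (f k) + snd (f k)))"
         "x\<^sup>2 + y\<^sup>2 \<le> 2" "(1 - 4 * N / \<kappa>) ^ (2 * n) \<le> (fst (f n))\<^sup>2 + (snd (f n))\<^sup>2"
        using slow_linear_trajectories[OF \<beta> \<alpha>0 N(1,2) True, of n] by (elim exE conjE)
      obtain \<pi> z where "unique_invariant_law 2 (obabo 2 U0 h \<gamma>) \<pi>" "z \<in> space (phase_space 2)" "W2 2 (dirac 2 z) \<pi> < \<infinity>"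
        "enn2real (W2 2 (dirac 2 z) \<pi>) \<le> (1 + sqrt (2 * dist_factor * (2 * C + (2 + moment_factor)))) * n * exp (3 * \<epsilon> * n)"
        "1 / 4 \<le> tv_dist 2 (kernel_pow 2 (obabo 2 U0 h \<gamma>) n z) \<pi>"
        using slow_linear_start[OF refl refl \<epsilon> n1 f(1) f(2)[rule_format] f(3) f(4)[unfolded \<epsilon>N]] by (elim exE conjE)
      then show ?thesis by (intro bexI[of _ U0] exI[of _ \<pi>] bexI[of _ z] conjI U0(1))
    qed
    then show ?thesis unfolding slow_at_def \<epsilon>_def[symmetric]
      by (intro exI[of _ "1 + sqrt (2 * dist_factor * (2 * C + (2 + moment_factor)))"] exI[of _ n0] conjI W allI impI)
  next
    case False
    then have ratio: "2048 * B * (1 - L.\<beta>) \<le> L.\<alpha> * \<kappa>" by (simp add: N_def)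
    have "256 * B \<le> \<kappa>" using \<kappa> B_ge_1 by linarith
    obtain x \<rho> D where \<rho>: "0 < \<rho>" and x: "\<forall>k. \<bar>x k\<bar> \<le> 1 \<and> 4 * \<rho> \<le> \<bar>x k - x (Suc k)\<bar>"
      and cyc: "\<forall>\<Lambda>>0. \<exists>U\<in>potentials 2 \<kappa>. \<exists>b. (\<forall>u i. i < 2 \<longrightarrow> grad 2 U u i = u i + (if i = 0 then b (u i) else 0)) \<and>
      (\<forall>t. \<bar>b t\<bar> \<le> \<Lambda> * D) \<and>
      (\<forall>k t. \<bar>t - \<Lambda> * x k\<bar> \<le> \<Lambda> * \<rho> \<longrightarrow> b t = b (\<Lambda> * x k)) \<and>
      (\<forall>k. L.\<alpha> * (\<Lambda> * x (Suc k) + b (\<Lambda> * x (Suc k))) = \<Lambda> * ((1 + L.\<beta>) * x (Suc k) - L.\<beta> * x k - x (Suc (Suc k))))"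
      using cycle_exists[OF \<beta> \<alpha>0 \<alpha>\<kappa> \<open>256 * B \<le> \<kappa>\<close> ratio] by (elim exE conjE)
    have x1: "\<bar>x k\<bar> \<le> 1" and x2: "4 * \<rho> \<le> \<bar>x k - x (Suc k)\<bar>" for k using x by auto
    define noise_factor' noise_scale' dist_factor' moment_factor' where "noise_factor' = perturbed_chain.noise_factor \<eta> C" and "noise_scale' = perturbed_chain.noise_scale h \<gamma>"
      and "dist_factor' = perturbed_chain.dist_factor h \<gamma> C" and "moment_factor' = perturbed_chain.moment_factor h \<gamma> \<eta> C"
    define n0 where "n0 = max 1 (nat \<lceil>128 * (noise_factor' * noise_scale' (4 * D * (h * L.\<sigma>) / \<rho>)) * C / \<rho>\<^sup>2\<rceil>)"
    define W where "W = 1 + sqrt (2 * dist_factor' * (5 * C + (2 + moment_factor') * (1 + D\<^sup>2)))"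
    have W: "0 < W"
    proof -
      interpret perturbed_chain U0 h \<gamma> "\<lambda>_. 0" 0 s p \<eta> C by (rule chain) (use U0(1) g0 in auto)
      show ?thesis unfolding W_def dist_factor'_def moment_factor'_def
        using dist_factor_nonneg moment_factor_nonneg form(4) by (intro add_pos_nonneg real_sqrt_ge_zero mult_nonneg_nonneg add_nonneg_nonneg) auto
    qed
    have "\<exists>U\<in>potentials 2 \<kappa>. \<exists>\<pi>. \<exists>z\<in>space (phase_space 2).
     unique_invariant_law 2 (obabo 2 U h \<gamma>) \<pi> \<and> W2 2 (dirac 2 z) \<pi> < \<infinity> \<and>
     enn2real (W2 2 (dirac 2 z) \<pi>) \<le> W * n * exp (3 * (8192 * B / \<kappa>) * n) \<and>
     1 / 4 \<le> tv_dist 2 (kernel_pow 2 (obabo 2 U h \<gamma>) n z) \<pi>" if n: "n0 \<le> n" for n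
    proof -
      have n1: "1 \<le> n" "128 * (noise_factor' * noise_scale' (4 * D * (h * L.\<sigma>) / \<rho>)) * C / \<rho>\<^sup>2 \<le> n" using n unfolding n0_def by linarith+
      have "0 < real n" using n1 by simp
      from cyc[rule_format, OF this] obtain U b where U: "U \<in> potentials 2 \<kappa>" and b:
          "\<forall>u i. i < 2 \<longrightarrow> grad 2 U u i = u i + (if i = 0 then b (u i) else 0)"
          "\<forall>t. \<bar>b t\<bar> \<le> real n * D" "\<forall>k t. \<bar>t - real n * x k\<bar> \<le> real n * \<rho> \<longrightarrow> b t = b (real n * x k)"
          "\<forall>k. L.\<alpha> * (real n * x (Suc k) + b (real n * x (Suc k))) = real n * ((1 + L.\<beta>) * x (Suc k) - L.\<beta> * x k - x (Suc (Suc k)))"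
        by (elim bexE exE conjE)
      interpret perturbed_chain U h \<gamma> b "real n * D" s p \<eta> C by (rule chain[OF U b(1,2)[rule_format]])
      obtain \<pi> z where *: "unique_invariant_law 2 Q \<pi>" "z \<in> space M" "W2 2 (dirac 2 z) \<pi> < \<infinity>"
          "enn2real (W2 2 (dirac 2 z) \<pi>) \<le> W * n" "1 / 4 \<le> tv_dist 2 (P n z) \<pi>"
        using slow_cycle_start[where x = x and \<rho> = \<rho> and D = D and n = n, OF \<rho> x1 x2 refl n1(1) b(2)[rule_format] refl b(3) b(4)[rule_format] n1(2)[unfolded noise_factor'_def noise_scale'_def]]
        unfolding W_def dist_factor'_def moment_factor'_def by (elim exE conjE)
      have "W * n * 1 \<le> W * n * exp (3 * (8192 * B / \<kappa>) * n)"
        using W \<kappa>0 B_ge_1 by (intro mult_left_mono) auto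
      then have "enn2real (W2 2 (dirac 2 z) \<pi>) \<le> W * n * exp (3 * (8192 * B / \<kappa>) * n)" using *(4) by linarith
      then show ?thesis using * by (intro bexI[of _ U] exI[of _ \<pi>] bexI[of _ z] conjI U)
    qed
    then show ?thesis unfolding slow_at_def by (intro exI[of _ W] exI[of _ n0] conjI W allI impI)
  qed
qed

end

text \<open>Along the starting points of \<open>slow_at\<close>, the factor \<open>(1 + W2) powr b\<close> grows at most like \<open>exp (4 \<epsilon> b n)\<close>, where the factor \<open>n\<close> is absorbed
  by one more \<open>exp (\<epsilon> n)\<close>. The exponential of the profile is at most \<open>exp (- 6 \<epsilon> (b + 1) n)\<close>, so the profile tends to 0
  while the distance stays above \<open>1 / 4\<close>.\<close>

lemma decay_profile_beaten:
  assumes slow: "slow_at \<kappa> h \<gamma> \<epsilon>" and \<epsilon>: "0 < \<epsilon>" and C: "0 < C" and b: "0 \<le> b" and c: "0 < c"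
    and \<tau>: "0 < \<tau> \<kappa>" "6 * \<epsilon> * (b + 1) * \<tau> \<kappa> \<le> c"
  shows "\<exists>U\<in>potentials 2 \<kappa>. \<exists>\<pi>. unique_invariant_law 2 (obabo 2 U h \<gamma>) \<pi> \<and>
    (\<exists>z\<in>space (phase_space 2). \<exists>n::nat. W2 2 (dirac 2 z) \<pi> < \<infinity> \<and>
       tv_dist 2 (kernel_pow 2 (obabo 2 U h \<gamma>) n z) \<pi> > decay_profile C c a b \<tau> \<kappa> z \<pi> n)"
proof -
  obtain W and n0 :: nat where W: "0 < W" and ex: "\<And>n. n0 \<le> n \<Longrightarrow> \<exists>U\<in>potentials 2 \<kappa>. \<exists>\<pi>. \<exists>z\<in>space (phase_space 2).
     unique_invariant_law 2 (obabo 2 U h \<gamma>) \<pi> \<and> W2 2 (dirac 2 z) \<pi> < \<infinity> \<and>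
     enn2real (W2 2 (dirac 2 z) \<pi>) \<le> W * n * exp (3 * \<epsilon> * n) \<and>
     1 / 4 \<le> tv_dist 2 (kernel_pow 2 (obabo 2 U h \<gamma>) n z) \<pi>"
    using slow unfolding slow_at_def by blast
  define K where "K = (1 + W / \<epsilon>) powr b"
  define A where "A = C * \<kappa> powr a * K"
  have K: "0 \<le> K" by (simp add: K_def)
  have A: "0 \<le> A" using C K by (simp add: A_def)
  have "exp (- \<epsilon>) < 1" "0 < exp (- \<epsilon>)" using \<epsilon> by auto
  then obtain n1 where n1: "exp (- \<epsilon>) ^ n1 < 1 / (4 * (A + 1))"
    using real_arch_pow_inv[of "1 / (4 * (A + 1))" "exp (- \<epsilon>)"] A by auto
  define n where "n = max n0 n1"
  obtain U \<pi> z where U: "U \<in> potentials 2 \<kappa>" "z \<in> space (phase_space 2)" "unique_invariant_law 2 (obabo 2 U h \<gamma>) \<pi>"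
     "W2 2 (dirac 2 z) \<pi> < \<infinity>" and W2: "enn2real (W2 2 (dirac 2 z) \<pi>) \<le> W * n * exp (3 * \<epsilon> * n)"
     and tv: "1 / 4 \<le> tv_dist 2 (kernel_pow 2 (obabo 2 U h \<gamma>) n z) \<pi>"
    using ex[of n] by (auto simp: n_def)
  have en: "exp (- \<epsilon> * n) < 1 / (4 * (A + 1))"
  proof -
    have "exp (- \<epsilon> * n) = exp (- \<epsilon>) ^ n" by (simp add: exp_of_nat_mult[symmetric] mult.commute)
    also have "\<dots> \<le> exp (- \<epsilon>) ^ n1" using \<epsilon> by (intro power_decreasing) (auto simp: n_def)
    finally show ?thesis using n1 by (rule order_le_less_trans)
  qed
  have "1 + enn2real (W2 2 (dirac 2 z) \<pi>) \<le> (1 + W / \<epsilon>) * exp (4 * \<epsilon> * n)"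
  proof -
    have "\<epsilon> * n \<le> exp (\<epsilon> * n)" using exp_ge_add_one_self[of "\<epsilon> * n"] by linarith
    then have "n \<le> exp (\<epsilon> * n) / \<epsilon>" using \<epsilon> by (simp add: pos_le_divide_eq mult.commute)
    then have "W * n * exp (3 * \<epsilon> * n) \<le> W * (exp (\<epsilon> * n) / \<epsilon>) * exp (3 * \<epsilon> * n)"
      using W by (intro mult_right_mono mult_left_mono) auto
    also have "\<dots> = W / \<epsilon> * exp (4 * \<epsilon> * n)" by (simp add: exp_add[symmetric] algebra_simps)
    finally have "enn2real (W2 2 (dirac 2 z) \<pi>) \<le> W / \<epsilon> * exp (4 * \<epsilon> * n)" using W2 by linarith
    moreover have "1 \<le> exp (4 * \<epsilon> * n)" using \<epsilon> by simp
    ultimately have "1 + enn2real (W2 2 (dirac 2 z) \<pi>) \<le> exp (4 * \<epsilon> * n) + W / \<epsilon> * exp (4 * \<epsilon> * n)" by (intro add_mono)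
    then show ?thesis by (simp only: distrib_right mult_1)
  qed
  then have "(1 + enn2real (W2 2 (dirac 2 z) \<pi>)) powr b \<le> ((1 + W / \<epsilon>) * exp (4 * \<epsilon> * n)) powr b"
    using b by (intro powr_mono2) auto
  also have "\<dots> = K * exp (4 * \<epsilon> * n * b)"
    using W \<epsilon> by (simp add: K_def powr_mult exp_powr_real)
  finally have pw: "(1 + enn2real (W2 2 (dirac 2 z) \<pi>)) powr b \<le> K * exp (4 * \<epsilon> * n * b)" .
  have "6 * \<epsilon> * (b + 1) \<le> c / \<tau> \<kappa>" using \<tau> by (simp add: pos_le_divide_eq)
  then have "6 * \<epsilon> * (b + 1) * n \<le> c / \<tau> \<kappa> * n" by (intro mult_right_mono) auto
  then have ce: "exp (- (c * n / \<tau> \<kappa>)) \<le> exp (- (6 * \<epsilon> * (b + 1) * n))" by simp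
  have "decay_profile C c a b \<tau> \<kappa> z \<pi> n \<le> C * \<kappa> powr a * (K * exp (4 * \<epsilon> * n * b)) * exp (- (6 * \<epsilon> * (b + 1) * n))"
    unfolding decay_profile_def using C K ce pw by (intro mult_mono mult_left_mono) auto
  also have "\<dots> = A * exp (4 * \<epsilon> * n * b - 6 * \<epsilon> * (b + 1) * n)" by (simp only: A_def exp_diff exp_minus divide_inverse mult_ac)
  also have "\<dots> \<le> A * exp (- \<epsilon> * n)"
  proof (intro mult_left_mono A)
    have "0 \<le> \<epsilon> * n * b" "0 \<le> \<epsilon> * n" using \<epsilon> b by auto
    then have "4 * \<epsilon> * n * b - 6 * \<epsilon> * (b + 1) * n \<le> - \<epsilon> * n" by (simp add: algebra_simps)
    then show "exp (4 * \<epsilon> * n * b - 6 * \<epsilon> * (b + 1) * n) \<le> exp (- \<epsilon> * n)" by simp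
  qed
  also have "\<dots> \<le> (A + 1) * exp (- \<epsilon> * n)" by (intro mult_right_mono) auto
  also have "\<dots> < (A + 1) * (1 / (4 * (A + 1)))" using en A by (intro mult_strict_left_mono) auto
  also have "\<dots> = 1 / 4" using A by simp
  finally show ?thesis using U tv by (meson less_le_trans)
qed

lemma slow_beyond_every_profile:
  assumes \<rho>: "tuning_rule \<rho>" "numerically_stable \<rho>" and C: "0 < C" and c: "0 < c" and b: "0 \<le> b" and \<kappa>0: "1 < \<kappa>\<^sub>0"
    and \<tau>: "\<And>\<kappa>. 1 < \<kappa> \<Longrightarrow> 0 < \<tau> \<kappa>" "\<tau> \<in> o[at_top](\<lambda>\<kappa>. \<kappa>)"
  shows "\<exists>\<kappa>\<ge>\<kappa>\<^sub>0. \<exists>U\<in>potentials 2 \<kappa>. \<exists>\<pi>. unique_invariant_law 2 (tuned_obabo \<rho> \<kappa> U) \<pi> \<and>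
    (\<exists>z\<in>space (phase_space 2). \<exists>n::nat. W2 2 (dirac 2 z) \<pi> < \<infinity> \<and>
       tv_dist 2 (kernel_pow 2 (tuned_obabo \<rho> \<kappa> U) n z) \<pi> > decay_profile C c a b \<tau> \<kappa> z \<pi> n)"
proof -
  obtain G G1 B where "smooth_step G G1 B" using smooth_step_exists by blast
  then interpret smooth_step G G1 B .
  \<comment> \<open>At rate \<open>\<epsilon> = 8192 B / \<kappa>\<close>, the condition \<open>\<tau> \<kappa> \<le> \<delta> \<kappa>\<close> says that \<open>6 \<epsilon> (b + 1) \<tau> \<kappa> \<le> c\<close>.\<close>
  define \<delta> where "\<delta> = c / (6 * (8192 * B) * (b + 1))"
  have \<delta>: "0 < \<delta>" using c b B_ge_1 by (simp add: \<delta>_def)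
  have "\<forall>\<^sub>F \<kappa> in at_top. norm (\<tau> \<kappa>) \<le> \<delta> * norm \<kappa>" by (rule landau_o.smallD[OF \<tau>(2) \<delta>])
  moreover have "\<forall>\<^sub>F \<kappa> in at_top. max \<kappa>\<^sub>0 (16384 * B) \<le> \<kappa>" by (rule eventually_ge_at_top)
  ultimately have "\<forall>\<^sub>F \<kappa> in at_top. norm (\<tau> \<kappa>) \<le> \<delta> * norm \<kappa> \<and> max \<kappa>\<^sub>0 (16384 * B) \<le> \<kappa>" by (rule eventually_conj)
  then obtain \<kappa> where \<kappa>: "\<bar>\<tau> \<kappa>\<bar> \<le> \<delta> * \<bar>\<kappa>\<bar>" "\<kappa>\<^sub>0 \<le> \<kappa>" "16384 * B \<le> \<kappa>"
    using eventually_happens[of _ "at_top :: real filter"] by (auto simp: trivial_limit_at_top_linorder)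
  have \<kappa>1: "1 < \<kappa>" using \<kappa> \<kappa>0 by linarith
  define h \<gamma> where "h = fst (\<rho> 1 \<kappa> 2)" and "\<gamma> = snd (\<rho> 1 \<kappa> 2)"
  have hg: "0 < h" "h < 2 / sqrt \<kappa>" "0 < \<gamma>"
    using \<rho> \<kappa>1 by (auto simp: tuning_rule_def numerically_stable_def h_def \<gamma>_def)
  have slow: "slow_at \<kappa> h \<gamma> (8192 * B / \<kappa>)" by (rule slow_for_every_tuning[OF \<kappa>(3) hg])
  have \<tau>1: "0 < \<tau> \<kappa>" by (rule \<tau>(1)[OF \<kappa>1])
  have "6 * (8192 * B / \<kappa>) * (b + 1) * \<tau> \<kappa> \<le> c"
  proof -
    define y where "y = 6 * (8192 * B) * (b + 1)"
    have y: "0 < y" using b B_ge_1 by (simp add: y_def)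
    have "y * \<tau> \<kappa> \<le> y * (\<delta> * \<kappa>)" using \<kappa>(1) \<kappa>1 \<tau>1 y by (intro mult_left_mono) auto
    also have "\<dots> = c * \<kappa>"
    proof -
      have "\<delta> = c / y" by (simp only: \<delta>_def y_def)
      then show ?thesis using y by simp
    qed
    finally have "y * \<tau> \<kappa> / \<kappa> \<le> c" using \<kappa>1 by (simp add: pos_divide_le_eq)
    moreover have "6 * (8192 * B / \<kappa>) * (b + 1) * \<tau> \<kappa> = y * \<tau> \<kappa> / \<kappa>" by (simp add: y_def)
    ultimately show ?thesis by (simp only:)
  qed
  moreover have "0 < 8192 * B / \<kappa>" using B_ge_1 \<kappa>1 by simp
  ultimately have "\<exists>U\<in>potentials 2 \<kappa>. \<exists>\<pi>. unique_invariant_law 2 (tuned_obabo \<rho> \<kappa> U) \<pi> \<and>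
    (\<exists>z\<in>space (phase_space 2). \<exists>n::nat. W2 2 (dirac 2 z) \<pi> < \<infinity> \<and>
       tv_dist 2 (kernel_pow 2 (tuned_obabo \<rho> \<kappa> U) n z) \<pi> > decay_profile C c a b \<tau> \<kappa> z \<pi> n)"
    unfolding tuned_obabo_def h_def[symmetric] \<gamma>_def[symmetric]
    by (intro decay_profile_beaten[where \<tau> = \<tau>, OF slow _ C b c \<tau>1])
  then show ?thesis using \<kappa>(2) by (intro exI[of _ \<kappa>] conjI)
qed

theorem corollary1p3:
  shows
  "(\<exists>C1>0. \<forall>\<kappa>>1. \<forall>d\<ge>1. \<forall>U\<in>potentials d \<kappa>.
      let Q = obabo d U (1 / (4 * sqrt \<kappa>)) (4 * sqrt \<kappa>) in
      \<exists>\<pi>. unique_invariant_law d Q \<pi> \<and>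
        (\<forall>z\<in>space (phase_space d). \<forall>\<epsilon>. 0 < \<epsilon> \<and> \<epsilon> < 1 \<longrightarrow>
           W2 d (dirac d z) \<pi> < \<infinity> \<and>
           ereal_of_enat (t_mix d z \<epsilon> Q \<pi>)
             \<le> ereal (C1 * \<kappa> * ln (C1 * \<kappa> * (1 + enn2real (W2 d (dirac d z) \<pi>)) / \<epsilon>))))
   \<and>
   (\<forall>\<rho>. tuning_rule \<rho> \<and> numerically_stable \<rho> \<longrightarrow>
      (\<forall>C c a b \<kappa>\<^sub>0 :: real. 0 < C \<and> 0 < c \<and> 0 \<le> a \<and> 0 \<le> b \<and> 1 < \<kappa>\<^sub>0 \<longrightarrow>
         (\<forall>\<tau> :: real \<Rightarrow> real. (\<forall>\<kappa>>1. 0 < \<tau> \<kappa>) \<and> \<tau> \<in> o[at_top](\<lambda>\<kappa>. \<kappa>) \<longrightarrow>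
            (\<exists>\<kappa>\<ge>\<kappa>\<^sub>0. \<exists>U\<in>potentials 2 \<kappa>. \<exists>\<pi>.
               unique_invariant_law 2 (tuned_obabo \<rho> \<kappa> U) \<pi> \<and>
               (\<exists>z\<in>space (phase_space 2). \<exists>n::nat.
                  W2 2 (dirac 2 z) \<pi> < \<infinity> \<and>
                  tv_dist 2 (kernel_pow 2 (tuned_obabo \<rho> \<kappa> U) n z) \<pi>
                    > decay_profile C c a b \<tau> \<kappa> z \<pi> n)))
         \<and>
         (\<forall>\<alpha><1.
            \<not> (\<forall>\<kappa>\<ge>\<kappa>\<^sub>0. \<forall>U\<in>potentials 2 \<kappa>. \<forall>\<pi>.
                  unique_invariant_law 2 (tuned_obabo \<rho> \<kappa> U) \<pi> \<longrightarrow>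
                  (\<forall>z\<in>space (phase_space 2). \<forall>n::nat.
                     W2 2 (dirac 2 z) \<pi> < \<infinity> \<longrightarrow>
                     tv_dist 2 (kernel_pow 2 (tuned_obabo \<rho> \<kappa> U) n z) \<pi>
                       \<le> decay_profile C c a b (\<lambda>\<kappa>. \<kappa> powr \<alpha>) \<kappa> z \<pi> n)))))"
proof (rule conjI[OF mixing_upper_bound], intro allI impI conjI)
  fix \<rho> and C c a b \<kappa>\<^sub>0 :: real and \<tau> :: "real \<Rightarrow> real"
  assume "tuning_rule \<rho> \<and> numerically_stable \<rho>" "0 < C \<and> 0 < c \<and> 0 \<le> a \<and> 0 \<le> b \<and> 1 < \<kappa>\<^sub>0"
    "(\<forall>\<kappa>>1. 0 < \<tau> \<kappa>) \<and> \<tau> \<in> o[at_top](\<lambda>\<kappa>. \<kappa>)"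
  then show "\<exists>\<kappa>\<ge>\<kappa>\<^sub>0. \<exists>U\<in>potentials 2 \<kappa>. \<exists>\<pi>.
               unique_invariant_law 2 (tuned_obabo \<rho> \<kappa> U) \<pi> \<and>
               (\<exists>z\<in>space (phase_space 2). \<exists>n::nat.
                  W2 2 (dirac 2 z) \<pi> < \<infinity> \<and>
                  tv_dist 2 (kernel_pow 2 (tuned_obabo \<rho> \<kappa> U) n z) \<pi>
                    > decay_profile C c a b \<tau> \<kappa> z \<pi> n)"
    by (intro slow_beyond_every_profile) auto
next
  fix \<rho> and C c a b \<kappa>\<^sub>0 \<alpha> :: real
  assume \<rho>: "tuning_rule \<rho> \<and> numerically_stable \<rho>" and C: "0 < C \<and> 0 < c \<and> 0 \<le> a \<and> 0 \<le> b \<and> 1 < \<kappa>\<^sub>0" and \<alpha>: "\<alpha> < 1"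
  have "(\<lambda>\<kappa>::real. \<kappa> powr \<alpha>) \<in> o[at_top](\<lambda>\<kappa>. \<kappa> powr 1)"
    using \<alpha> by (subst powr_smallo_iff) (auto intro: filterlim_ident)
  also have "(\<lambda>\<kappa>::real. \<kappa> powr 1) \<in> \<Theta>[at_top](\<lambda>\<kappa>. \<kappa>)"
    by (intro bigthetaI_cong eventually_mono[OF eventually_gt_at_top[of 0]]) auto
  finally have "(\<lambda>\<kappa>::real. \<kappa> powr \<alpha>) \<in> o[at_top](\<lambda>\<kappa>. \<kappa>)" .
  then have "\<exists>\<kappa>\<ge>\<kappa>\<^sub>0. \<exists>U\<in>potentials 2 \<kappa>. \<exists>\<pi>. unique_invariant_law 2 (tuned_obabo \<rho> \<kappa> U) \<pi> \<and>
    (\<exists>z\<in>space (phase_space 2). \<exists>n::nat. W2 2 (dirac 2 z) \<pi> < \<infinity> \<and>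
       tv_dist 2 (kernel_pow 2 (tuned_obabo \<rho> \<kappa> U) n z) \<pi> > decay_profile C c a b (\<lambda>\<kappa>. \<kappa> powr \<alpha>) \<kappa> z \<pi> n)"
    using \<rho> C by (intro slow_beyond_every_profile) auto
  then show "\<not> (\<forall>\<kappa>\<ge>\<kappa>\<^sub>0. \<forall>U\<in>potentials 2 \<kappa>. \<forall>\<pi>.
                  unique_invariant_law 2 (tuned_obabo \<rho> \<kappa> U) \<pi> \<longrightarrow>
                  (\<forall>z\<in>space (phase_space 2). \<forall>n::nat.
                     W2 2 (dirac 2 z) \<pi> < \<infinity> \<longrightarrow>
                     tv_dist 2 (kernel_pow 2 (tuned_obabo \<rho> \<kappa> U) n z) \<pi>
                       \<le> decay_profile C c a b (\<lambda>\<kappa>. \<kappa> powr \<alpha>) \<kappa> z \<pi> n))"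
    by (meson not_less)
qed

end
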